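(* If $T$ is dependent (NIP), then so is $\mathbb{T}_\alpha$.
   Context: Let $T$ be a complete theory in a countable first-order language $\mathcal{L}$, with no finite models, admitting quantifier elimination, and geometric: $T$ eliminates $\exists^{\infty}$ and in every model of $T$ the algebraic closure $\operatorname{acl}$ satisfies exchange. $\dim$ is the associated dimension ($\dim(\bar a/Y)$ = size of an $\operatorname{acl}$-basis of $\bar a$ over $Y$). Sets $Y,Z$ are free over $X$ if $\dim(\bar a/X)=\dim(\bar a/XZ)$ for all finite tuples $\bar a$ from $Y$ and $Y\cap Z=X$. $T$ is indecomposable (no finite-dimensional algebraically closed set $X$ is a finite union of sets of dimension $<\dim(X)$) and has the free-amalgamation property (for $M_0,M_1,M_2\models T^{\forall}$ and embeddings $f_i:M_0\to M_i$ with $\operatorname{acl}(f_i(M_0))=f_i(M_0)$, there are $M\models T$ and embeddings $g_i:M_i\to M$ with $g_1f_1=g_2f_2$ and $g_1(M_1),g_2(M_2)$ free over $g_1f_1(M_0)$). $\mathcal{L}_p=\mathcal{L}\cup\{p\}$, $p$ a new unary predicate ("colored" elements); $\mathcal K$ is the class of $\mathcal L_p$-structures whose $\mathcal L$-reduct models $T^\forall$. Fix real $0<\alpha\le1$. For finite $A$ and $X$ in $M\in\mathcal K$: $\delta(A)=\dim(A)-\alpha|p(A)|$, $\delta(A/X)=\dim(A/X)-\alpha|p(A/X)|$ ($p(A/X)$ the colored elements of $A\setminus X$). $\mathcal K_\alpha^+$: those $M\in\mathcal K$ with $\delta(A)\ge0$ for all finite $A$. $X\le Y$ means $X\subseteq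 Y$ and $\delta(A/X)\ge0$ for all finite $A\subseteq Y$. For finite tuples $\bar a,\bar d$ in a structure of $\mathcal K_\alpha^+$ with $\bar a\le\bar a\bar d$, $\bar d$ is transcendental over $\bar a$ if $\dim(d/\bar a)=1$ for each entry $d$ of $\bar d$ not in $\bar a$. An $\mathcal L$-formula $\varphi(\bar x,\bar y)$ is strong w.r.t. tuples $\bar d,\bar a$ (with pairwise distinct entries) if $\varphi(\bar x,\bar a)$ is in the quantifier-free $\mathcal L$-type of $\bar d$ over $\bar a$ and in a sufficiently saturated model of $T$: (i) any $\bar d'\bar a'$ satisfying $\varphi$ has pairwise distinct entries; (ii) if $\varphi(\bar d',\bar a')$ and $\dim(\bar d'/\bar a')=\dim(\bar d/\bar a)$ then for every partition $(\bar x_1,\bar x_2)$ of $\bar x$ with corresponding splittings, $\dim(\bar d_2'/\bar d_1'\bar a')\le\dim(\bar d_2/\bar d_1\bar a)$. $d_{\varphi,k}(\bar y)$ is an $\mathcal L$-formula defining the set of $\bar b$ with $\max\{\dim(\bar e/\bar b):\varphi(\bar e,\bar b)\}=k$, and $D_{\varphi,k}(\bar y)$ one defining the set of $\bar b$ such that some $\bar e$ with $\varphi(\bar e,\bar b)$ has $\dim(\bar e/\bar b)\ge k$ and no entry in $\operatorname{acl}(\bar b)$. $\mathbb T_\alpha$ is the $\mathcal L_p$-theory whose models $\mathbb M$ satisfy: $\mathbb M\models T$; $\mathbb M\in\mathcal K_\alpha^+$; and for all $\bar a,\bar d=(d_1,\dots,d_n)$ in a structure of $\mathcal K_\alpha^+$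 with $\bar a\le\bar a\bar d$, $\bar d$ transcendental over $\bar a$, $\dim(\bar d/\bar a)=k$, and every $\varphi$ strong w.r.t. $\bar d,\bar a$: $\mathbb M\models\forall\bar y[D_{\varphi,k}(\bar y)\wedge d_{\varphi,k}(\bar y)\to\exists\bar z(\varphi(\bar z,\bar y)\wedge\bigwedge_{p(d_i)}p(z_i)\wedge\bigwedge_{\neg p(d_i)}\neg p(z_i))]$. (This theory is complete.) A theory is dependent if no formula $\varphi(\bar x,\bar y)$ has the independence property, i.e., there is no model with sequences $(\bar a_i)_{i\in\omega}$, $(\bar b_J)_{J\subseteq\omega}$ such that $\varphi(\bar a_i,\bar b_J)$ holds iff $i\in J$. *)

theory Defs
  imports Complex_Main "HOL-Library.Countable_Set"
begin

section \<open>First-order syntax and semantics\<close>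

datatype 'f tm = Var nat | Fn 'f "'f tm list"

datatype ('f, 'r) fm =
    Bot
  | Eq "'f tm" "'f tm"
  | Rel 'r "'f tm list"
  | Imp "('f, 'r) fm" "('f, 'r) fm"
  | All nat "('f, 'r) fm"

definition Neg :: "('f, 'r) fm \<Rightarrow> ('f, 'r) fm" where
  "Neg \<phi> = Imp \<phi> Bot"

definition Con :: "('f, 'r) fm \<Rightarrow> ('f, 'r) fm \<Rightarrow> ('f, 'r) fm" where
  "Con \<phi> \<psi> = Neg (Imp \<phi> (Neg \<psi>))"

definition Ex :: "nat \<Rightarrow> ('f, 'r) fm \<Rightarrow> ('f, 'r) fm" where
  "Ex x \<phi> = Neg (All x (Neg \<phi>))"

record ('f, 'r) lang =
  funs :: "'f set"
  rels :: "'r set"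
  farity :: "'f \<Rightarrow> nat"
  rarity :: "'r \<Rightarrow> nat"

fun wf_tm :: "('f, 'r) lang \<Rightarrow> 'f tm \<Rightarrow> bool" where
  "wf_tm L (Var x) \<longleftrightarrow> True"
| "wf_tm L (Fn f ts) \<longleftrightarrow> f \<in> funs L \<and> length ts = farity L f \<and> (\<forall>t\<in>set ts. wf_tm L t)"

fun wf_fm :: "('f, 'r) lang \<Rightarrow> ('f, 'r) fm \<Rightarrow> bool" where
  "wf_fm L Bot \<longleftrightarrow> True"
| "wf_fm L (Eq s t) \<longleftrightarrow> wf_tm L s \<and> wf_tm L t"
| "wf_fm L (Rel r ts) \<longleftrightarrow> r \<in> rels L \<and> length ts = rarity L r \<and> (\<forall>t\<in>set ts. wf_tm L t)"
| "wf_fm L (Imp \<phi> \<psi>) \<longleftrightarrow> wf_fm L \<phi> \<and> wf_fm L \<psi>"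
| "wf_fm L (All x \<phi>) \<longleftrightarrow> wf_fm L \<phi>"

fun fv_tm :: "'f tm \<Rightarrow> nat set" where
  "fv_tm (Var x) = {x}"
| "fv_tm (Fn f ts) = (\<Union>t\<in>set ts. fv_tm t)"

fun fv :: "('f, 'r) fm \<Rightarrow> nat set" where
  "fv Bot = {}"
| "fv (Eq s t) = fv_tm s \<union> fv_tm t"
| "fv (Rel r ts) = (\<Union>t\<in>set ts. fv_tm t)"
| "fv (Imp \<phi> \<psi>) = fv \<phi> \<union> fv \<psi>"
| "fv (All x \<phi>) = fv \<phi> - {x}"

fun qf :: "('f, 'r) fm \<Rightarrow> bool" where
  "qf (Imp \<phi> \<psi>) \<longleftrightarrow> qf \<phi> \<and> qf \<psi>"
| "qf (All x \<phi>) \<longleftrightarrow> False"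
| "qf _ \<longleftrightarrow> True"

definition sentence :: "('f, 'r) lang \<Rightarrow> ('f, 'r) fm \<Rightarrow> bool" where
  "sentence L \<sigma> \<longleftrightarrow> wf_fm L \<sigma> \<and> fv \<sigma> = {}"

definition universal :: "('f, 'r) fm \<Rightarrow> bool" where
  "universal \<sigma> \<longleftrightarrow> (\<exists>xs \<psi>. qf \<psi> \<and> \<sigma> = foldr All xs \<psi>)"

record ('f, 'r, 'u) fo_struct =
  univ :: "'u set"
  fint :: "'f \<Rightarrow> 'u list \<Rightarrow> 'u"
  rint :: "'r \<Rightarrow> 'u list \<Rightarrow> bool"

definition is_struct :: "('f, 'r) lang \<Rightarrow> ('f, 'r, 'u) fo_struct \<Rightarrow> bool" where
  "is_struct L M \<longleftrightarrow> univ M \<noteq> {} \<and>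
     (\<forall>f\<in>funs L. \<forall>us\<in>lists (univ M). length us = farity L f \<longrightarrow> fint M f us \<in> univ M)"

fun val :: "('f, 'r, 'u) fo_struct \<Rightarrow> (nat \<Rightarrow> 'u) \<Rightarrow> 'f tm \<Rightarrow> 'u" where
  "val M e (Var x) = e x"
| "val M e (Fn f ts) = fint M f (map (val M e) ts)"

fun sat :: "('f, 'r, 'u) fo_struct \<Rightarrow> (nat \<Rightarrow> 'u) \<Rightarrow> ('f, 'r) fm \<Rightarrow> bool" where
  "sat M e Bot \<longleftrightarrow> False"
| "sat M e (Eq s t) \<longleftrightarrow> val M e s = val M e t"
| "sat M e (Rel r ts) \<longleftrightarrow> rint M r (map (val M e) ts)"
| "sat M e (Imp \<phi> \<psi>) \<longleftrightarrow> (sat M e \<phi> \<longrightarrow> sat M e \<psi>)"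
| "sat M e (All x \<phi>) \<longleftrightarrow> (\<forall>u\<in>univ M. sat M (e(x := u)) \<phi>)"

lemma sat_Neg [simp]: "sat M e (Neg \<phi>) \<longleftrightarrow> \<not> sat M e \<phi>"
  by (simp add: Neg_def)

lemma sat_Con [simp]: "sat M e (Con \<phi> \<psi>) \<longleftrightarrow> sat M e \<phi> \<and> sat M e \<psi>"
  by (simp add: Con_def)

lemma sat_Ex [simp]: "sat M e (Ex x \<phi>) \<longleftrightarrow> (\<exists>u\<in>univ M. sat M (e(x := u)) \<phi>)"
  by (simp add: Ex_def)

text \<open>Tuples are lists. A formula in the first \<open>k\<close> variables, \<open>fv \<phi> \<subseteq> {..<k}\<close>, is evaluated at
  a tuple of length \<open>k\<close> by using the tuple as the assignment; values beyond its length are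
  unspecified but irrelevant. In a formula with two blocks of variables, the parameter block
  (\<open>ys\<close>, of length \<open>m\<close>) always comes first: it occupies the variables \<open>0, \<dots>, m - 1\<close>, and the
  other block the variables \<open>m, \<dots>, m + n - 1\<close>.\<close>

definition holds :: "('f, 'r, 'u) fo_struct \<Rightarrow> ('f, 'r) fm \<Rightarrow> 'u list \<Rightarrow> bool" where
  "holds M \<phi> us \<longleftrightarrow> sat M (\<lambda>i. us ! i) \<phi>"

definition tuples :: "('f, 'r, 'u) fo_struct \<Rightarrow> nat \<Rightarrow> 'u list set" where
  "tuples M k = {us. length us = k \<and> set us \<subseteq> univ M}"

definition formula_in :: "('f, 'r) lang \<Rightarrow> nat \<Rightarrow> ('f, 'r) fm \<Rightarrow> bool" where
  "formula_in L k \<phi> \<longleftrightarrow> wf_fm L \<phi> \<and> fv \<phi> \<subseteq> {..<k}"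

definition true_in :: "('f, 'r, 'u) fo_struct \<Rightarrow> ('f, 'r) fm \<Rightarrow> bool" where
  "true_in M \<sigma> \<longleftrightarrow> (\<forall>e. range e \<subseteq> univ M \<longrightarrow> sat M e \<sigma>)"

definition is_model :: "('f, 'r) lang \<Rightarrow> ('f, 'r) fm set \<Rightarrow> ('f, 'r, 'u) fo_struct \<Rightarrow> bool" where
  "is_model L T M \<longleftrightarrow> is_struct L M \<and> (\<forall>\<sigma>\<in>T. true_in M \<sigma>)"

definition embedding ::
  "('f, 'r) lang \<Rightarrow> ('f, 'r, 'u) fo_struct \<Rightarrow> ('f, 'r, 'u) fo_struct \<Rightarrow> ('u \<Rightarrow> 'u) \<Rightarrow> bool" where
  "embedding L M N h \<longleftrightarrow> h ` univ M \<subseteq> univ N \<and> inj_on h (univ M) \<and>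
     (\<forall>f\<in>funs L. \<forall>us\<in>tuples M (farity L f). h (fint M f us) = fint N f (map h us)) \<and>
     (\<forall>r\<in>rels L. \<forall>us\<in>tuples M (rarity L r). rint M r us \<longleftrightarrow> rint N r (map h us))"


section \<open>Theories\<close>

text \<open>HOL cannot quantify over all types, so "every model" means every model whose universe is
  a subset of the type \<open>'u\<close>, which is passed as a type token. All notions below are meant for
  countable languages and for \<open>'u\<close> of cardinality at least the continuum. By
  Loewenheim-Skolem and compactness, they then do not depend on the choice of \<open>'u\<close>.\<close>

definition countable_lang :: "('f, 'r) lang \<Rightarrow> bool" where
  "countable_lang L \<longleftrightarrow> countable (funs L) \<and> countable (rels L)"

definition entails :: "'u itself \<Rightarrow> ('f, 'r) lang \<Rightarrow> ('f, 'r) fm set \<Rightarrow> ('f, 'r) fm \<Rightarrow> bool" where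
  "entails _ L T \<sigma> \<longleftrightarrow> (\<forall>M :: ('f, 'r, 'u) fo_struct. is_model L T M \<longrightarrow> true_in M \<sigma>)"

definition complete_theory :: "'u itself \<Rightarrow> ('f, 'r) lang \<Rightarrow> ('f, 'r) fm set \<Rightarrow> bool" where
  "complete_theory U L T \<longleftrightarrow>
     (\<forall>\<sigma>\<in>T. sentence L \<sigma>) \<and>
     (\<exists>M :: ('f, 'r, 'u) fo_struct. is_model L T M) \<and>
     (\<forall>\<sigma>. sentence L \<sigma> \<longrightarrow> entails U L T \<sigma> \<or> entails U L T (Neg \<sigma>))"

definition no_finite_models :: "'u itself \<Rightarrow> ('f, 'r) lang \<Rightarrow> ('f, 'r) fm set \<Rightarrow> bool" where
  "no_finite_models _ L T \<longleftrightarrow>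
     (\<forall>M :: ('f, 'r, 'u) fo_struct. is_model L T M \<longrightarrow> infinite (univ M))"

definition quantifier_elimination ::
  "'u itself \<Rightarrow> ('f, 'r) lang \<Rightarrow> ('f, 'r) fm set \<Rightarrow> bool" where
  "quantifier_elimination _ L T \<longleftrightarrow>
     (\<forall>\<phi>. wf_fm L \<phi> \<longrightarrow> (\<exists>\<psi>. wf_fm L \<psi> \<and> qf \<psi> \<and> fv \<psi> \<subseteq> fv \<phi> \<and>
        (\<forall>(M :: ('f, 'r, 'u) fo_struct) e. is_model L T M \<and> range e \<subseteq> univ M \<longrightarrow>
           (sat M e \<phi> \<longleftrightarrow> sat M e \<psi>))))"

definition univ_part ::
  "'u itself \<Rightarrow> ('f, 'r) lang \<Rightarrow> ('f, 'r) fm set \<Rightarrow> ('f, 'r) fm set" where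
  "univ_part U L T = {\<sigma>. sentence L \<sigma> \<and> universal \<sigma> \<and> entails U L T \<sigma>}"

text \<open>Saturation over finite parameter sets; for a countable language this is all the saturation
  that is needed to realise the types occurring in the definitions below.\<close>

definition aleph0_saturated :: "('f, 'r) lang \<Rightarrow> ('f, 'r, 'u) fo_struct \<Rightarrow> bool" where
  "aleph0_saturated L M \<longleftrightarrow>
     (\<forall>k. \<forall>bs\<in>tuples M k. \<forall>\<Sigma>. (\<forall>\<phi>\<in>\<Sigma>. formula_in L (Suc k) \<phi>) \<longrightarrow>
        (\<forall>\<Sigma>\<^sub>0\<subseteq>\<Sigma>. finite \<Sigma>\<^sub>0 \<longrightarrow> (\<exists>c\<in>univ M. \<forall>\<phi>\<in>\<Sigma>\<^sub>0. holds M \<phi> (bs @ [c]))) \<longrightarrow>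
        (\<exists>c\<in>univ M. \<forall>\<phi>\<in>\<Sigma>. holds M \<phi> (bs @ [c])))"

definition saturated_model ::
  "('f, 'r) lang \<Rightarrow> ('f, 'r) fm set \<Rightarrow> ('f, 'r, 'u) fo_struct \<Rightarrow> bool" where
  "saturated_model L T M \<longleftrightarrow> is_model L T M \<and> aleph0_saturated L M"

definition has_IP ::
  "('f, 'r, 'u) fo_struct \<Rightarrow> nat \<Rightarrow> nat \<Rightarrow> ('f, 'r) fm \<Rightarrow> bool" where
  "has_IP M m n \<phi> \<longleftrightarrow>
     (\<exists>(a :: nat \<Rightarrow> 'u list) (b :: nat set \<Rightarrow> 'u list).
        (\<forall>i. a i \<in> tuples M n) \<and> (\<forall>J. b J \<in> tuples M m) \<and>
        (\<forall>i J. holds M \<phi> (b J @ a i) \<longleftrightarrow> i \<in> J))"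

definition dependent_theory :: "'u itself \<Rightarrow> ('f, 'r) lang \<Rightarrow> ('f, 'r) fm set \<Rightarrow> bool" where
  "dependent_theory _ L T \<longleftrightarrow>
     (\<forall>m n \<phi>. formula_in L (m + n) \<phi> \<longrightarrow>
        \<not> (\<exists>M :: ('f, 'r, 'u) fo_struct. is_model L T M \<and> has_IP M m n \<phi>))"


section \<open>Algebraic closure and dimension\<close>

definition acl :: "('f, 'r) lang \<Rightarrow> ('f, 'r, 'u) fo_struct \<Rightarrow> 'u set \<Rightarrow> 'u set" where
  "acl L M X = {a \<in> univ M. \<exists>k \<phi> bs. formula_in L (Suc k) \<phi> \<and> bs \<in> tuples M k \<and> set bs \<subseteq> X \<and>
     holds M \<phi> (bs @ [a]) \<and> finite {c \<in> univ M. holds M \<phi> (bs @ [c])}}"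

text \<open>In a model of the universal part of \<open>T\<close>, algebraic closure is the trace of the algebraic
  closure in a model of \<open>T\<close> in which it embeds; if \<open>T\<close> has quantifier elimination, all such models
  give the same result, and the same as \<^const>\<open>acl\<close> if the structure is itself a model of \<open>T\<close>.\<close>

definition acl_in ::
  "('f, 'r) lang \<Rightarrow> ('f, 'r) fm set \<Rightarrow> ('f, 'r, 'u) fo_struct \<Rightarrow> 'u set \<Rightarrow> 'u set" where
  "acl_in L T M X = {a \<in> univ M. \<exists>(N :: ('f, 'r, 'u) fo_struct) h.
     is_model L T N \<and> embedding L M N h \<and> h a \<in> acl L N (h ` X)}"

definition is_basis :: "('u set \<Rightarrow> 'u set) \<Rightarrow> 'u set \<Rightarrow> 'u set \<Rightarrow> 'u set \<Rightarrow> bool" where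
  "is_basis cl A Y B \<longleftrightarrow> B \<subseteq> A \<and> (\<forall>b\<in>B. b \<notin> cl (Y \<union> (B - {b}))) \<and> A \<subseteq> cl (Y \<union> B)"

definition finite_dim :: "('u set \<Rightarrow> 'u set) \<Rightarrow> 'u set \<Rightarrow> 'u set \<Rightarrow> bool" where
  "finite_dim cl A Y \<longleftrightarrow> (\<exists>B. finite B \<and> is_basis cl A Y B)"

text \<open>\<open>dim cl A Y\<close> is the dimension of \<open>A\<close> over \<open>Y\<close>; it is only used for finite-dimensional \<open>A\<close>.\<close>

definition dim :: "('u set \<Rightarrow> 'u set) \<Rightarrow> 'u set \<Rightarrow> 'u set \<Rightarrow> nat" where
  "dim cl A Y = (THE n. \<exists>B. finite B \<and> is_basis cl A Y B \<and> card B = n)"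

definition free_over :: "('u set \<Rightarrow> 'u set) \<Rightarrow> 'u set \<Rightarrow> 'u set \<Rightarrow> 'u set \<Rightarrow> bool" where
  "free_over cl Y Z X \<longleftrightarrow>
     (\<forall>A. finite A \<and> A \<subseteq> Y \<longrightarrow> dim cl A X = dim cl A (X \<union> Z)) \<and> Y \<inter> Z = X"

definition eliminates_exists_infinity ::
  "'u itself \<Rightarrow> ('f, 'r) lang \<Rightarrow> ('f, 'r) fm set \<Rightarrow> bool" where
  "eliminates_exists_infinity _ L T \<longleftrightarrow>
     (\<forall>k \<phi>. formula_in L (Suc k) \<phi> \<longrightarrow> (\<exists>\<psi>. formula_in L k \<psi> \<and>
        (\<forall>M :: ('f, 'r, 'u) fo_struct. is_model L T M \<longrightarrow> (\<forall>bs\<in>tuples M k.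
           holds M \<psi> bs \<longleftrightarrow> infinite {c \<in> univ M. holds M \<phi> (bs @ [c])}))))"

definition acl_exchange :: "('f, 'r) lang \<Rightarrow> ('f, 'r, 'u) fo_struct \<Rightarrow> bool" where
  "acl_exchange L M \<longleftrightarrow> (\<forall>X a b. X \<subseteq> univ M \<and> a \<in> univ M \<and> b \<in> univ M \<and>
     a \<in> acl L M (insert b X) \<and> a \<notin> acl L M X \<longrightarrow> b \<in> acl L M (insert a X))"

definition geometric :: "'u itself \<Rightarrow> ('f, 'r) lang \<Rightarrow> ('f, 'r) fm set \<Rightarrow> bool" where
  "geometric U L T \<longleftrightarrow> eliminates_exists_infinity U L T \<and>
     (\<forall>M :: ('f, 'r, 'u) fo_struct. is_model L T M \<longrightarrow> acl_exchange L M)"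

text \<open>The union is over a nonempty family, so that the empty set, of dimension 0, is not
  decomposable.\<close>

definition indecomposable :: "'u itself \<Rightarrow> ('f, 'r) lang \<Rightarrow> ('f, 'r) fm set \<Rightarrow> bool" where
  "indecomposable _ L T \<longleftrightarrow>
     (\<forall>(M :: ('f, 'r, 'u) fo_struct) X.
        is_model L T M \<and> X \<subseteq> univ M \<and> acl L M X = X \<and> finite_dim (acl L M) X {} \<longrightarrow>
        \<not> (\<exists>F. finite F \<and> F \<noteq> {} \<and> \<Union>F = X \<and>
             (\<forall>Y\<in>F. finite_dim (acl L M) Y {} \<and> dim (acl L M) Y {} < dim (acl L M) X {})))"

definition free_amalgamation :: "'u itself \<Rightarrow> ('f, 'r) lang \<Rightarrow> ('f, 'r) fm set \<Rightarrow> bool" where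
  "free_amalgamation U L T \<longleftrightarrow>
     (\<forall>(M\<^sub>0 :: ('f, 'r, 'u) fo_struct) (M\<^sub>1 :: ('f, 'r, 'u) fo_struct)
        (M\<^sub>2 :: ('f, 'r, 'u) fo_struct) f\<^sub>1 f\<^sub>2.
        is_model L (univ_part U L T) M\<^sub>0 \<and>
        is_model L (univ_part U L T) M\<^sub>1 \<and>
        is_model L (univ_part U L T) M\<^sub>2 \<and>
        embedding L M\<^sub>0 M\<^sub>1 f\<^sub>1 \<and> acl_in L T M\<^sub>1 (f\<^sub>1 ` univ M\<^sub>0) = f\<^sub>1 ` univ M\<^sub>0 \<and>
        embedding L M\<^sub>0 M\<^sub>2 f\<^sub>2 \<and> acl_in L T M\<^sub>2 (f\<^sub>2 ` univ M\<^sub>0) = f\<^sub>2 ` univ M\<^sub>0 \<longrightarrow>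
        (\<exists>(M :: ('f, 'r, 'u) fo_struct) g\<^sub>1 g\<^sub>2.
           is_model L T M \<and> embedding L M\<^sub>1 M g\<^sub>1 \<and> embedding L M\<^sub>2 M g\<^sub>2 \<and>
           (\<forall>a\<in>univ M\<^sub>0. g\<^sub>1 (f\<^sub>1 a) = g\<^sub>2 (f\<^sub>2 a)) \<and>
           free_over (acl L M) (g\<^sub>1 ` univ M\<^sub>1) (g\<^sub>2 ` univ M\<^sub>2) (g\<^sub>1 ` f\<^sub>1 ` univ M\<^sub>0)))"


section \<open>Colored structures and predimension\<close>

text \<open>The color predicate is the new relation symbol \<^const>\<open>None\<close>.\<close>

definition Lp :: "('f, 'r) lang \<Rightarrow> ('f, 'r option) lang" where
  "Lp L = \<lparr>funs = funs L, rels = insert None (Some ` rels L), farity = farity L,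
           rarity = case_option 1 (rarity L)\<rparr>"

definition lift_fm :: "('f, 'r) fm \<Rightarrow> ('f, 'r option) fm" where
  "lift_fm = map_fm id Some"

definition reduct :: "('f, 'r option, 'u) fo_struct \<Rightarrow> ('f, 'r, 'u) fo_struct" where
  "reduct M = \<lparr>univ = univ M, fint = fint M, rint = (\<lambda>r. rint M (Some r))\<rparr>"

definition colored :: "('f, 'r option, 'u) fo_struct \<Rightarrow> 'u set" where
  "colored M = {a \<in> univ M. rint M None [a]}"

definition class_K ::
  "('f, 'r) lang \<Rightarrow> ('f, 'r) fm set \<Rightarrow> ('f, 'r option, 'u) fo_struct \<Rightarrow> bool" where
  "class_K L T M \<longleftrightarrow> is_struct (Lp L) M \<and> is_model L (univ_part TYPE('u) L T) (reduct M)"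

abbreviation dimT ::
  "('f, 'r) lang \<Rightarrow> ('f, 'r) fm set \<Rightarrow> ('f, 'r option, 'u) fo_struct \<Rightarrow> 'u set \<Rightarrow> 'u set \<Rightarrow> nat" where
  "dimT L T M A X \<equiv> dim (acl_in L T (reduct M)) A X"

definition delta ::
  "('f, 'r) lang \<Rightarrow> ('f, 'r) fm set \<Rightarrow> real \<Rightarrow> ('f, 'r option, 'u) fo_struct \<Rightarrow>
   'u set \<Rightarrow> 'u set \<Rightarrow> real" where
  "delta L T \<alpha> M A X = real (dimT L T M A X) - \<alpha> * real (card ((A - X) \<inter> colored M))"

definition class_K_plus ::
  "('f, 'r) lang \<Rightarrow> ('f, 'r) fm set \<Rightarrow> real \<Rightarrow> ('f, 'r option, 'u) fo_struct \<Rightarrow> bool" where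
  "class_K_plus L T \<alpha> M \<longleftrightarrow> class_K L T M \<and>
     (\<forall>A. finite A \<and> A \<subseteq> univ M \<longrightarrow> delta L T \<alpha> M A {} \<ge> 0)"

definition closed_in ::
  "('f, 'r) lang \<Rightarrow> ('f, 'r) fm set \<Rightarrow> real \<Rightarrow> ('f, 'r option, 'u) fo_struct \<Rightarrow>
   'u set \<Rightarrow> 'u set \<Rightarrow> bool" where
  "closed_in L T \<alpha> M X Y \<longleftrightarrow> X \<subseteq> Y \<and> (\<forall>A. finite A \<and> A \<subseteq> Y \<longrightarrow> delta L T \<alpha> M A X \<ge> 0)"

definition transcendental_over ::
  "('f, 'r) lang \<Rightarrow> ('f, 'r) fm set \<Rightarrow> ('f, 'r option, 'u) fo_struct \<Rightarrow>
   'u list \<Rightarrow> 'u list \<Rightarrow> bool" where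
  "transcendental_over L T N ds as \<longleftrightarrow> (\<forall>d \<in> set ds - set as. dimT L T N {d} (set as) = 1)"

abbreviation entries :: "'u list \<Rightarrow> nat set \<Rightarrow> 'u set" where
  "entries us I \<equiv> (\<lambda>i. us ! i) ` I"

text \<open>A partition of the second variable block is given by the set \<open>I\<close> of positions in its first
  part.\<close>

definition strong_formula ::
  "('f, 'r) lang \<Rightarrow> ('f, 'r) fm set \<Rightarrow> ('f, 'r option, 'u) fo_struct \<Rightarrow>
   'u list \<Rightarrow> 'u list \<Rightarrow> ('f, 'r) fm \<Rightarrow> bool" where
  "strong_formula L T N ds as \<phi> \<longleftrightarrow>
     formula_in L (length as + length ds) \<phi> \<and> qf \<phi> \<and> distinct (as @ ds) \<and>
     holds (reduct N) \<phi> (as @ ds) \<and>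
     (\<forall>M :: ('f, 'r, 'u) fo_struct. saturated_model L T M \<longrightarrow>
        (\<forall>as'\<in>tuples M (length as). \<forall>ds'\<in>tuples M (length ds). holds M \<phi> (as' @ ds') \<longrightarrow>
           distinct (as' @ ds') \<and>
           (dim (acl L M) (set ds') (set as') = dimT L T N (set ds) (set as) \<longrightarrow>
              (\<forall>I\<subseteq>{..<length ds}.
                 dim (acl L M) (entries ds' ({..<length ds} - I)) (entries ds' I \<union> set as')
                 \<le> dimT L T N (entries ds ({..<length ds} - I)) (entries ds I \<union> set as)))))"

text \<open>\<open>defines_d\<close> and \<open>defines_D\<close> say that \<open>\<psi>\<close> is a possible choice of the formula
  $d_{\varphi,k}$, respectively $D_{\varphi,k}$. As dimensions are attained only in sufficiently saturated models,
  the defined set is taken there.\<close>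

definition defines_d ::
  "'u itself \<Rightarrow> ('f, 'r) lang \<Rightarrow> ('f, 'r) fm set \<Rightarrow> nat \<Rightarrow> nat \<Rightarrow> ('f, 'r) fm \<Rightarrow> nat \<Rightarrow>
   ('f, 'r) fm \<Rightarrow> bool" where
  "defines_d _ L T m n \<phi> k \<psi> \<longleftrightarrow> formula_in L m \<psi> \<and>
     (\<forall>M :: ('f, 'r, 'u) fo_struct. saturated_model L T M \<longrightarrow> (\<forall>bs\<in>tuples M m.
        holds M \<psi> bs \<longleftrightarrow>
          (\<exists>es\<in>tuples M n. holds M \<phi> (bs @ es) \<and> dim (acl L M) (set es) (set bs) = k) \<and>
          (\<forall>es\<in>tuples M n. holds M \<phi> (bs @ es) \<longrightarrow> dim (acl L M) (set es) (set bs) \<le> k)))"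

definition defines_D ::
  "'u itself \<Rightarrow> ('f, 'r) lang \<Rightarrow> ('f, 'r) fm set \<Rightarrow> nat \<Rightarrow> nat \<Rightarrow> ('f, 'r) fm \<Rightarrow> nat \<Rightarrow>
   ('f, 'r) fm \<Rightarrow> bool" where
  "defines_D _ L T m n \<phi> k \<psi> \<longleftrightarrow> formula_in L m \<psi> \<and>
     (\<forall>M :: ('f, 'r, 'u) fo_struct. saturated_model L T M \<longrightarrow> (\<forall>bs\<in>tuples M m.
        holds M \<psi> bs \<longleftrightarrow>
          (\<exists>es\<in>tuples M n. holds M \<phi> (bs @ es) \<and> dim (acl L M) (set es) (set bs) \<ge> k \<and>
             (\<forall>e\<in>set es. e \<notin> acl L M (set bs)))))"


section \<open>The theory of rich colored structures\<close>

text \<open>\<open>C\<close> is the set of positions in the second variable block that are to be colored.\<close>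

definition color_literals :: "nat \<Rightarrow> nat \<Rightarrow> nat set \<Rightarrow> ('f, 'r option) fm list" where
  "color_literals m n C =
     map (\<lambda>i. if i \<in> C then Rel None [Var (m + i)] else Neg (Rel None [Var (m + i)])) [0..<n]"

definition extension_axiom ::
  "nat \<Rightarrow> nat \<Rightarrow> nat set \<Rightarrow> ('f, 'r) fm \<Rightarrow> ('f, 'r) fm \<Rightarrow> ('f, 'r) fm \<Rightarrow> ('f, 'r option) fm" where
  "extension_axiom m n C \<psi>D \<psi>d \<phi> =
     foldr All [0..<m]
       (Imp (Con (lift_fm \<psi>D) (lift_fm \<psi>d))
            (foldr Ex [m..<m + n] (foldr Con (color_literals m n C) (lift_fm \<phi>))))"

definition extension_axioms ::
  "'u itself \<Rightarrow> ('f, 'r) lang \<Rightarrow> ('f, 'r) fm set \<Rightarrow> real \<Rightarrow> ('f, 'r option) fm set" where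
  "extension_axioms U L T \<alpha> =
     {extension_axiom (length as) (length ds) {i. i < length ds \<and> ds ! i \<in> colored N} \<psi>D \<psi>d \<phi>
      | (N :: ('f, 'r option, 'u) fo_struct) as ds k \<phi> \<psi>D \<psi>d.
        class_K_plus L T \<alpha> N \<and> set as \<subseteq> univ N \<and> set ds \<subseteq> univ N \<and>
        closed_in L T \<alpha> N (set as) (set as \<union> set ds) \<and>
        transcendental_over L T N ds as \<and> dimT L T N (set ds) (set as) = k \<and>
        strong_formula L T N ds as \<phi> \<and>
        defines_D U L T (length as) (length ds) \<phi> k \<psi>D \<and>
        defines_d U L T (length as) (length ds) \<phi> k \<psi>d}"

definition rich_struct ::
  "('f, 'r) lang \<Rightarrow> ('f, 'r) fm set \<Rightarrow> real \<Rightarrow> ('f, 'r option, 'u) fo_struct \<Rightarrow> bool" where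
  "rich_struct L T \<alpha> M \<longleftrightarrow> is_model L T (reduct M) \<and> class_K_plus L T \<alpha> M \<and>
     (\<forall>\<sigma>\<in>extension_axioms TYPE('u) L T \<alpha>. true_in M \<sigma>)"

text \<open>The theory whose models are the structures in \<^const>\<open>rich_struct\<close>, represented by its
  deductive closure: the sentences true in all of these.\<close>

definition T_alpha ::
  "'u itself \<Rightarrow> ('f, 'r) lang \<Rightarrow> ('f, 'r) fm set \<Rightarrow> real \<Rightarrow> ('f, 'r option) fm set" where
  "T_alpha _ L T \<alpha> = {\<sigma>. sentence (Lp L) \<sigma> \<and>
     (\<forall>M :: ('f, 'r option, 'u) fo_struct. rich_struct L T \<alpha> M \<longrightarrow> true_in M \<sigma>)}"

end

theory Submission
  imports Defs "HOL-Library.Ramsey" "HOL-Library.Infinite_Set" "HOL-Library.Nat_Bijection"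
begin

text \<open>Suppose that a formula \<open>\<phi>\<close> has the independence property in a model of the expanded theory.

  In saturated rich structures, \<open>\<phi>\<close> is preserved by every elementary map in the language \<open>L\<close>
  between finite sets that respects colors and whose domain and range admit no extension of
  negative predimension by at most \<open>m\<close> colored points, for some \<open>m\<close> depending only on \<open>\<phi>\<close>. This is
  a back-and-forth argument. In the main step the extension to be copied is first enlarged by colored
  points in general position, which exist by indecomposability, until its predimension over
  the base is smaller than every possible violation of closedness. Any realization supplied by
  an extension axiom then has full dimension and is closed up to \<open>m\<close> points.

  By Ramsey's theorem and an ultrapower there are then a tuple \<open>b\<close> and tuples \<open>a\<^sub>i\<close>, with finite bounded
  closures that are jointly indiscernible, such that \<open>\<phi>(b, a\<^sub>i)\<close> holds iff \<open>i\<close> is even. Only finitely many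
  points \<open>E\<close> have to be added to make \<open>b\<close> closed over all these closures, and \<open>E\<close> is free from them
  over finitely many. As \<open>T\<close> is dependent, the \<open>L\<close>-type over \<open>E\<close> of the closure of \<open>a\<^sub>i\<close> together
  with these finitely many is eventually constant in each formula. Its limits along even and along
  odd \<open>i\<close> are related by a map as above, which contradicts the preservation of \<open>\<phi>\<close>.\<close>

section \<open>Syntactic preliminaries\<close>

text \<open>The predimension takes values n - \<alpha> m, which are not well ordered for irrational
  \<alpha>, so closing up a finite set need not stop, and closedness is a type rather than a
  formula. Testing only extensions by at most m points (\<open>mclosed\<close>) repairs both: a
  violation then costs at least \<open>gran m\<close>, so closures have bounded size, and failure is
  expressed by an existential formula. The price is a loss in m at every quantifier of the fixed
  formula. The obstacle in copying an extension is that the axioms realize single formulas. A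
  formula can bound dimensions from above only; it neither keeps them from dropping nor forbids new
  colored points near the realization. The added points in general position bring the dimension K
  and the number M of colored points to 0 \<le> K - \<alpha> M < \<open>gran m\<close> \<le> 1. Then
  closedness of the base admits no dimension below K, and a violation outside the copy would make
  the total predimension over the base negative. Such K and M come from approximating 1 / \<alpha>.
  Ultrapowers must live in the fixed type \<open>'u\<close>; hence they are taken of countable
  structures.\<close>

lemma val_cong:
  "(\<And>x. x \<in> fv_tm t \<Longrightarrow> e x = e' x) \<Longrightarrow> val M e t = val M e' t"
proof (induction t)
  case (Fn f ts)
  then have "map (val M e) ts = map (val M e') ts" by auto
  then show ?case by (simp del: map_eq_conv)
qed auto

lemma sat_cong:
  "(\<And>x. x \<in> fv \<phi> \<Longrightarrow> e x = e' x) \<Longrightarrow> sat M e \<phi> \<longleftrightarrow> sat M e' \<phi>"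
proof (induction \<phi> arbitrary: e e')
  case (Eq s t)
  then have "val M e s = val M e' s" "val M e t = val M e' t" by (auto intro!: val_cong)
  then show ?case by simp
next
  case (Rel r ts)
  then have "map (val M e) ts = map (val M e') ts" by (auto intro!: val_cong)
  then show ?case by (simp del: map_eq_conv)
next
  case (Imp \<phi> \<psi>)
  then show ?case by (metis UnCI fv.simps(4) sat.simps(4))
next
  case (All x \<phi>)
  have "sat M (e(x := u)) \<phi> \<longleftrightarrow> sat M (e'(x := u)) \<phi>" for u
    by (rule All.IH) (use All.prems in auto)
  then show ?case by simp
qed auto

lemma finite_fv_tm [simp]: "finite (fv_tm t)"
  by (induction t) auto

lemma finite_fv [simp]: "finite (fv \<phi>)"
  by (induction \<phi>) auto

lemma val_in:
  assumes "is_struct L M"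
  shows "wf_tm L t \<Longrightarrow> (\<And>x. x \<in> fv_tm t \<Longrightarrow> e x \<in> univ M) \<Longrightarrow> val M e t \<in> univ M"
proof (induction t)
  case (Fn f ts)
  then have "val M e t \<in> univ M" if "t \<in> set ts" for t using that by fastforce
  then have "map (val M e) ts \<in> lists (univ M)" by auto
  then show ?case using Fn.prems assms unfolding is_struct_def by (metis length_map val.simps(2) wf_tm.simps(2))
qed auto

fun sub_tm :: "(nat \<Rightarrow> nat) \<Rightarrow> 'f tm \<Rightarrow> 'f tm" where
  "sub_tm s (Var x) = Var (s x)"
| "sub_tm s (Fn f ts) = Fn f (map (sub_tm s) ts)"

text \<open>Renaming of variables by a map that need not be injective; it is meaningful for
  quantifier-free formulas only.\<close>

fun sub :: "(nat \<Rightarrow> nat) \<Rightarrow> ('f, 'r) fm \<Rightarrow> ('f, 'r) fm" where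
  "sub s Bot = Bot"
| "sub s (Eq t u) = Eq (sub_tm s t) (sub_tm s u)"
| "sub s (Rel r ts) = Rel r (map (sub_tm s) ts)"
| "sub s (Imp \<phi> \<psi>) = Imp (sub s \<phi>) (sub s \<psi>)"
| "sub s (All x \<phi>) = All x \<phi>"

lemma val_sub: "val M e (sub_tm s t) = val M (e \<circ> s) t"
  by (induction t) (auto simp: comp_def cong: map_cong)

lemma sat_sub: "qf \<phi> \<Longrightarrow> sat M e (sub s \<phi>) \<longleftrightarrow> sat M (e \<circ> s) \<phi>"
  by (induction \<phi>) (auto simp: val_sub comp_def)

lemma fv_sub_tm: "fv_tm (sub_tm s t) = s ` fv_tm t"
  by (induction t) auto

lemma fv_sub: "qf \<phi> \<Longrightarrow> fv (sub s \<phi>) = s ` fv \<phi>"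
  by (induction \<phi>) (auto simp: fv_sub_tm)

lemma wf_sub_tm: "wf_tm L (sub_tm s t) = wf_tm L t"
  by (induction t) auto

lemma wf_sub [simp]: "wf_fm L (sub s \<phi>) = wf_fm L \<phi>"
  by (induction \<phi>) (auto simp: wf_sub_tm)

lemma qf_sub [simp]: "qf (sub s \<phi>) = qf \<phi>"
  by (induction \<phi>) auto

lemma connective_simps [simp]:
  "wf_fm L (Neg \<phi>) = wf_fm L \<phi>" "fv (Neg \<phi>) = fv \<phi>" "qf (Neg \<phi>) = qf \<phi>"
  "wf_fm L (Con \<phi> \<psi>) = (wf_fm L \<phi> \<and> wf_fm L \<psi>)" "fv (Con \<phi> \<psi>) = fv \<phi> \<union> fv \<psi>"
  "qf (Con \<phi> \<psi>) = (qf \<phi> \<and> qf \<psi>)"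
  "wf_fm L (Ex x \<phi>) = wf_fm L \<phi>" "fv (Ex x \<phi>) = fv \<phi> - {x}"
  by (auto simp: Neg_def Con_def Ex_def)

definition Conj :: "('f, 'r) fm list \<Rightarrow> ('f, 'r) fm" where
  "Conj \<phi>s = foldr Con \<phi>s (Neg Bot)"

lemma Conj_simps [simp]:
  "sat M e (Conj \<phi>s) \<longleftrightarrow> (\<forall>\<phi>\<in>set \<phi>s. sat M e \<phi>)"
  "wf_fm L (Conj \<phi>s) \<longleftrightarrow> (\<forall>\<phi>\<in>set \<phi>s. wf_fm L \<phi>)"
  "fv (Conj \<phi>s) = (\<Union>\<phi>\<in>set \<phi>s. fv \<phi>)"
  "qf (Conj \<phi>s) \<longleftrightarrow> (\<forall>\<phi>\<in>set \<phi>s. qf \<phi>)"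
  by (induction \<phi>s) (auto simp: Conj_def)

lemma foldr_Con_simps [simp]:
  "sat M e (foldr Con \<phi>s \<psi>) \<longleftrightarrow> (\<forall>\<phi>\<in>set \<phi>s. sat M e \<phi>) \<and> sat M e \<psi>"
  "wf_fm L (foldr Con \<phi>s \<psi>) \<longleftrightarrow> (\<forall>\<phi>\<in>set \<phi>s. wf_fm L \<phi>) \<and> wf_fm L \<psi>"
  "fv (foldr Con \<phi>s \<psi>) = (\<Union>\<phi>\<in>set \<phi>s. fv \<phi>) \<union> fv \<psi>"
  by (induction \<phi>s) auto

definition fconj :: "('f, 'r) fm set \<Rightarrow> ('f, 'r) fm" where
  "fconj F = Conj (SOME l. set l = F)"

lemma fconj_simps [simp]:
  assumes "finite F"
  shows "sat M e (fconj F) \<longleftrightarrow> (\<forall>\<phi>\<in>F. sat M e \<phi>)" "fv (fconj F) = (\<Union>\<phi>\<in>F. fv \<phi>)"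
    "wf_fm L (fconj F) \<longleftrightarrow> (\<forall>\<phi>\<in>F. wf_fm L \<phi>)" "qf (fconj F) \<longleftrightarrow> (\<forall>\<phi>\<in>F. qf \<phi>)"
  using someI_ex[OF finite_list[OF assms]] by (simp_all add: fconj_def)

lemma quantifier_block_simps [simp]:
  "wf_fm L (foldr Ex xs \<phi>) = wf_fm L \<phi>" "fv (foldr Ex xs \<phi>) = fv \<phi> - set xs"
  "wf_fm L (foldr All xs \<phi>) = wf_fm L \<phi>" "fv (foldr All xs \<phi>) = fv \<phi> - set xs"
  by (induction xs) auto

lemma sat_foldr_Ex:
  "sat M e (foldr Ex xs \<phi>) \<longleftrightarrow>
     (\<exists>e'. (\<forall>x. x \<notin> set xs \<longrightarrow> e' x = e x) \<and> (\<forall>x\<in>set xs. e' x \<in> univ M) \<and> sat M e' \<phi>)"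
proof (induction xs arbitrary: e)
  case Nil
  have "e' = e" if "\<forall>x. e' x = e x" for e' using that by auto
  then show ?case by auto
next
  case (Cons y xs)
  show ?case
  proof
    assume "sat M e (foldr Ex (y # xs) \<phi>)"
    then obtain u where u: "u \<in> univ M" "sat M (e(y := u)) (foldr Ex xs \<phi>)" by auto
    then obtain e' where e': "\<forall>x. x \<notin> set xs \<longrightarrow> e' x = (e(y := u)) x" "\<forall>x\<in>set xs. e' x \<in> univ M" "sat M e' \<phi>"
      using Cons.IH[of "e(y := u)"] by auto
    have "e' y \<in> univ M" using e' u by (cases "y \<in> set xs") auto
    then show "\<exists>e'. (\<forall>x. x \<notin> set (y # xs) \<longrightarrow> e' x = e x) \<and> (\<forall>x\<in>set (y # xs). e' x \<in> univ M) \<and> sat M e' \<phi>"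
      using e' by (intro exI[of _ e']) auto
  next
    assume "\<exists>e'. (\<forall>x. x \<notin> set (y # xs) \<longrightarrow> e' x = e x) \<and> (\<forall>x\<in>set (y # xs). e' x \<in> univ M) \<and> sat M e' \<phi>"
    then obtain e' where e': "\<forall>x. x \<notin> set (y # xs) \<longrightarrow> e' x = e x" "\<forall>x\<in>set (y # xs). e' x \<in> univ M" "sat M e' \<phi>"
      by blast
    then have "sat M (e(y := e' y)) (foldr Ex xs \<phi>)"
      using Cons.IH by auto
    then show "sat M e (foldr Ex (y # xs) \<phi>)" using e' by auto
  qed
qed

lemma sat_foldr_All:
  "sat M e (foldr All xs \<phi>) \<longleftrightarrow>
     (\<forall>e'. (\<forall>x. x \<notin> set xs \<longrightarrow> e' x = e x) \<and> (\<forall>x\<in>set xs. e' x \<in> univ M) \<longrightarrow> sat M e' \<phi>)"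
proof -
  have "sat M e (foldr All xs \<phi>) \<longleftrightarrow> \<not> sat M e (foldr Ex xs (Neg \<phi>))"
    by (induction xs arbitrary: e) auto
  then show ?thesis by (simp add: sat_foldr_Ex) blast
qed

lemma holds_iff_sat:
  assumes "formula_in L k \<phi>" "\<And>i. i < k \<Longrightarrow> e i = us ! i"
  shows "holds M \<phi> us \<longleftrightarrow> sat M e \<phi>"
  unfolding holds_def using assms by (intro sat_cong) (auto simp: formula_in_def)

section \<open>Passage between \<open>L\<close> and the colored language\<close>

lemma lift_fm_simps [simp]:
  "lift_fm Bot = Bot" "lift_fm (Imp \<phi> \<psi>) = Imp (lift_fm \<phi>) (lift_fm \<psi>)"
  "lift_fm (All x \<phi>) = All x (lift_fm \<phi>)" "lift_fm (Eq s t) = Eq s t"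
  "lift_fm (Rel r ts) = Rel (Some r) ts"
  by (auto simp: lift_fm_def tm.map_id tm.map_id0)

lemma reduct_simps [simp]:
  "univ (reduct M) = univ M" "fint (reduct M) = fint M" "rint (reduct M) r = rint M (Some r)"
  by (auto simp: reduct_def)

lemma val_reduct [simp]: "val (reduct M) e t = val M e t"
  by (induction t) (auto cong: map_cong)

lemma sat_lift [simp]: "sat M e (lift_fm \<phi>) \<longleftrightarrow> sat (reduct M) e \<phi>"
  by (induction \<phi> arbitrary: e) (auto simp: val_reduct[abs_def] cong: map_cong)

lemma Lp_simps [simp]:
  "funs (Lp L) = funs L" "farity (Lp L) = farity L" "rels (Lp L) = insert None (Some ` rels L)"
  "rarity (Lp L) None = 1" "rarity (Lp L) (Some r) = rarity L r"
  by (auto simp: Lp_def)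

lemma wf_tm_Lp [simp]: "wf_tm (Lp L) t = wf_tm L t"
  by (induction t) auto

lemma wf_lift [simp]: "wf_fm (Lp L) (lift_fm \<phi>) = wf_fm L \<phi>"
  by (induction \<phi>) auto

lemma fv_lift [simp]: "fv (lift_fm \<phi>) = fv \<phi>"
  by (induction \<phi>) auto

lemma is_struct_Lp [simp]: "is_struct (Lp L) M \<longleftrightarrow> is_struct L (reduct M)"
  by (auto simp: is_struct_def)

lemma countable_lang_Lp: "countable_lang L \<Longrightarrow> countable_lang (Lp L)"
  by (auto simp: countable_lang_def)

instance tm :: (countable) countable
  by countable_datatype

instance fm :: (countable, countable) countable
  by countable_datatype

lemma wf_tm_set: "wf_tm L t \<Longrightarrow> set_tm t \<subseteq> funs L"
  by (induction t) auto

lemma wf_fm_sets: "wf_fm L \<phi> \<Longrightarrow> set1_fm \<phi> \<subseteq> funs L \<and> set2_fm \<phi> \<subseteq> rels L"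
  by (induction \<phi>) (auto dest: wf_tm_set)

text \<open>The types of symbols may be uncountable although \<open>L\<close> is countable; renaming
  the symbols of \<open>L\<close> injectively by numbers lands in a countable type of
  formulas.\<close>

lemma countable_formulas:
  assumes "countable_lang L"
  shows "countable {\<phi>. wf_fm L \<phi>}"
proof -
  obtain g :: "'a \<Rightarrow> nat" and h :: "'b \<Rightarrow> nat" where g: "inj_on g (funs L)" and h: "inj_on h (rels L)"
    using assms unfolding countable_lang_def countable_def by blast
  have "inj_on (map_fm g h) {\<phi>. wf_fm L \<phi>}"
  proof (rule inj_onI, clarify)
    fix \<phi> \<psi> assume "wf_fm L \<phi>" "wf_fm L \<psi>" and eq: "map_fm g h \<phi> = map_fm g h \<psi>"
    then have "set1_fm \<phi> \<union> set1_fm \<psi> \<subseteq> funs L" "set2_fm \<phi> \<union> set2_fm \<psi> \<subseteq> rels L"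
      using wf_fm_sets by blast+
    moreover from this have "x \<in> set1_fm \<phi> \<Longrightarrow> y \<in> set1_fm \<psi> \<Longrightarrow> g x = g y \<Longrightarrow> x = y" for x y
      using inj_onD[OF g] by blast
    moreover from calculation have "x \<in> set2_fm \<phi> \<Longrightarrow> y \<in> set2_fm \<psi> \<Longrightarrow> h x = h y \<Longrightarrow> x = y" for x y
      using inj_onD[OF h] by blast
    ultimately show "\<phi> = \<psi>"
      using eq by (intro fm.inj_map_strong[of \<phi> \<psi> g g h h]) auto
  qed
  then show ?thesis
    by (rule countable_image_inj_on[rotated]) (rule countableI_type)
qed

section \<open>Dimension in pregeometries\<close>

text \<open>The axioms are asserted inside \<open>U\<close> only, because closure in a structure is
  meaningful only for subsets of its universe.\<close>

locale pregeometry =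
  fixes U :: "'a set" and cl :: "'a set \<Rightarrow> 'a set"
  assumes cl_sub: "X \<subseteq> U \<Longrightarrow> cl X \<subseteq> U"
    and cl_ext: "X \<subseteq> U \<Longrightarrow> X \<subseteq> cl X"
    and cl_mono: "X \<subseteq> Y \<Longrightarrow> Y \<subseteq> U \<Longrightarrow> cl X \<subseteq> cl Y"
    and cl_idem: "X \<subseteq> U \<Longrightarrow> cl (cl X) \<subseteq> cl X"
    and cl_fin: "X \<subseteq> U \<Longrightarrow> a \<in> cl X \<Longrightarrow> \<exists>F. finite F \<and> F \<subseteq> X \<and> a \<in> cl F"
    and cl_exch: "X \<subseteq> U \<Longrightarrow> a \<in> U \<Longrightarrow> b \<in> U \<Longrightarrow> a \<in> cl (insert b X) \<Longrightarrow> a \<notin> cl X \<Longrightarrow> b \<in> cl (insert a X)"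
begin

lemma cl_least: "X \<subseteq> cl Y \<Longrightarrow> Y \<subseteq> U \<Longrightarrow> cl X \<subseteq> cl Y"
  using cl_mono[of X "cl Y"] cl_sub cl_idem by blast

lemma cl_finite_set:
  assumes "X \<subseteq> U" "finite A" "A \<subseteq> cl (X \<union> B)" "B \<subseteq> U"
  shows "\<exists>F. finite F \<and> F \<subseteq> X \<and> A \<subseteq> cl (F \<union> B)"
  using assms(2,3)
proof (induction A)
  case (insert a A)
  then obtain F where F: "finite F" "F \<subseteq> X" "A \<subseteq> cl (F \<union> B)" by auto
  obtain G where G: "finite G" "G \<subseteq> X \<union> B" "a \<in> cl G"
    using cl_fin[of "X \<union> B" a] insert.prems assms by auto
  have "cl G \<subseteq> cl ((F \<union> (G \<inter> X)) \<union> B)" "cl (F \<union> B) \<subseteq> cl ((F \<union> (G \<inter> X)) \<union> B)"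
    using F G assms by (intro cl_mono; blast)+
  then show ?case using F G by (intro exI[of _ "F \<union> (G \<inter> X)"]) auto
qed auto

definition indep :: "'a set \<Rightarrow> 'a set \<Rightarrow> bool" where
  "indep I Y \<longleftrightarrow> (\<forall>b\<in>I. b \<notin> cl (Y \<union> (I - {b})))"

lemma is_basis_indep: "is_basis cl A Y B \<longleftrightarrow> B \<subseteq> A \<and> indep B Y \<and> A \<subseteq> cl (Y \<union> B)"
  by (auto simp: is_basis_def indep_def)

lemma indep_subset: "indep I Y \<Longrightarrow> J \<subseteq> I \<Longrightarrow> I \<union> Y \<subseteq> U \<Longrightarrow> indep J Y"
  unfolding indep_def using cl_mono[of "Y \<union> (J - {b})" "Y \<union> (I - {b})" for b] by blast

lemma indep_antimono: "indep I Y' \<Longrightarrow> Y \<subseteq> cl Y' \<Longrightarrow> I \<union> Y' \<subseteq> U \<Longrightarrow> indep I Y"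
  unfolding indep_def
proof
  fix b assume *: "\<forall>b\<in>I. b \<notin> cl (Y' \<union> (I - {b}))" "Y \<subseteq> cl Y'" "I \<union> Y' \<subseteq> U" "b \<in> I"
  have "cl (Y \<union> (I - {b})) \<subseteq> cl (Y' \<union> (I - {b}))"
  proof (rule cl_least)
    have "I - {b} \<subseteq> U" using * by auto
    then show "Y \<union> (I - {b}) \<subseteq> cl (Y' \<union> (I - {b}))" "Y' \<union> (I - {b}) \<subseteq> U"
      using * cl_mono[of Y' "Y' \<union> (I - {b})"] cl_ext[of "Y' \<union> (I - {b})"] by auto
  qed
  then show "b \<notin> cl (Y \<union> (I - {b}))" using * by auto
qed

lemma indep_insert:
  assumes "indep I Y" "a \<notin> cl (Y \<union> I)" "insert a (I \<union> Y) \<subseteq> U"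
  shows "indep (insert a I) Y"
  unfolding indep_def
proof
  fix b assume b: "b \<in> insert a I"
  have aI: "a \<notin> I" using assms cl_ext[of "Y \<union> I"] by auto
  show "b \<notin> cl (Y \<union> (insert a I - {b}))"
  proof (cases "b = a")
    case True
    then show ?thesis using aI assms by simp
  next
    case False
    have eq: "Y \<union> (insert a I - {b}) = insert a (Y \<union> (I - {b}))" using False by auto
    have eq': "insert b (Y \<union> (I - {b})) = Y \<union> I" using False b by auto
    show ?thesis
    proof
      assume "b \<in> cl (Y \<union> (insert a I - {b}))"
      moreover have "b \<notin> cl (Y \<union> (I - {b}))" using assms False b by (auto simp: indep_def)
      ultimately have "a \<in> cl (insert b (Y \<union> (I - {b})))"
        using cl_exch[of "Y \<union> (I - {b})" b a] assms b unfolding eq by auto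
      then show False using assms eq' by simp
    qed
  qed
qed

text \<open>Exchange: some \<open>s\<close> in \<open>S\<close> lies outside the closure of
  \<open>I\<close> without \<open>b\<close>, for otherwise \<open>b\<close> itself would be spanned
  by the rest. Replacing \<open>b\<close> by \<open>s\<close> keeps the size and brings
  \<open>I\<close> closer to a subset of \<open>S\<close>.\<close>

lemma steinitz:
  assumes "Y \<subseteq> U" "finite S" "S \<subseteq> U"
  shows "finite I \<Longrightarrow> I \<subseteq> cl (Y \<union> S) \<Longrightarrow> indep I Y \<Longrightarrow> card I \<le> card S"
proof (induction "card (I - S)" arbitrary: I rule: less_induct)
  case less
  show ?case
  proof (cases "I \<subseteq> S")
    case True
    then show ?thesis using card_mono assms by auto
  next
    case False
    then obtain b where b: "b \<in> I" "b \<notin> S" by auto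
    have IU: "I \<subseteq> U" using less assms cl_sub[of "Y \<union> S"] by auto
    have "\<not> S \<subseteq> cl (Y \<union> (I - {b}))"
    proof
      assume "S \<subseteq> cl (Y \<union> (I - {b}))"
      then have "cl (Y \<union> S) \<subseteq> cl (Y \<union> (I - {b}))"
        using assms IU cl_ext[of "Y \<union> (I - {b})"] by (intro cl_least) auto
      then show False using less.prems b by (auto simp: indep_def)
    qed
    then obtain s where s: "s \<in> S" "s \<notin> cl (Y \<union> (I - {b}))" by auto
    have sI: "s \<notin> I - {b}" using s cl_ext[of "Y \<union> (I - {b})"] assms IU by auto
    let ?I = "insert s (I - {b})"
    have "indep ?I Y"
      using indep_insert[of "I - {b}" Y s] indep_subset[of I Y "I - {b}"] s less.prems assms IU by auto
    moreover have "?I - S \<subset> I - S" using b s by auto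
    then have "card (?I - S) < card (I - S)" using less.prems by (intro psubset_card_mono) auto
    moreover have "?I \<subseteq> cl (Y \<union> S)" using less.prems s assms cl_ext[of "Y \<union> S"] by auto
    ultimately have "card ?I \<le> card S" using less by auto
    moreover have "card ?I = card I"
      using sI b less.prems by (metis card_Suc_Diff1 card_insert_disjoint finite_Diff)
    ultimately show ?thesis by simp
  qed
qed

text \<open>Two bases span each other, so \<open>steinitz\<close> in both directions makes the
  description in \<open>dim\<close> unique.\<close>

lemma dim_eqI:
  assumes "Y \<subseteq> U" "A \<subseteq> U" "finite B" "is_basis cl A Y B"
  shows "dim cl A Y = card B"
  unfolding dim_def
proof (rule the_equality)
  fix n assume "\<exists>B. finite B \<and> is_basis cl A Y B \<and> card B = n"
  then obtain B' where B': "finite B'" "is_basis cl A Y B'" "card B' = n" by auto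
  have *: "B \<subseteq> A" "indep B Y" "A \<subseteq> cl (Y \<union> B)" "B' \<subseteq> A" "indep B' Y" "A \<subseteq> cl (Y \<union> B')"
    using assms(4) B'(2) by (simp_all add: is_basis_indep)
  have "card B \<le> card B'" using steinitz[of Y B' B] * assms B'(1) by auto
  moreover have "card B' \<le> card B" using steinitz[of Y B B'] * assms B'(1) by auto
  ultimately have "card B \<le> card B'" "card B' \<le> card B" by auto
  then show "n = card B" using B' by simp
qed (use assms in blast)

lemma basis_exists:
  assumes "Y \<subseteq> U"
  shows "finite A \<Longrightarrow> A \<subseteq> U \<Longrightarrow> \<exists>B. finite B \<and> is_basis cl A Y B"
proof (induction A rule: finite_induct)
  case empty
  then show ?case by (auto simp: is_basis_def)
next
  case (insert a A)
  then obtain B where B: "finite B" "B \<subseteq> A" "indep B Y" "A \<subseteq> cl (Y \<union> B)" by (auto simp: is_basis_indep)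
  show ?case
  proof (cases "a \<in> cl (Y \<union> B)")
    case True
    then show ?thesis using B by (auto simp: is_basis_indep)
  next
    case False
    have "indep (insert a B) Y" using indep_insert[of B Y a] False B insert.prems assms by auto
    moreover have "insert a A \<subseteq> cl (Y \<union> insert a B)"
      using B assms insert.prems cl_ext[of "Y \<union> insert a B"] cl_mono[of "Y \<union> B" "Y \<union> insert a B"] by blast
    ultimately show ?thesis using B unfolding is_basis_indep by (intro exI[of _ "insert a B"]) auto
  qed
qed

lemma dim_basis:
  assumes "finite A" "A \<subseteq> U" "Y \<subseteq> U"
  obtains B where "finite B" "B \<subseteq> A" "indep B Y" "A \<subseteq> cl (Y \<union> B)" "card B = dim cl A Y"
  using basis_exists[OF assms(3,1,2)] dim_eqI[OF assms(3,2)] unfolding is_basis_indep by metis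

lemma dim_le_card: "finite A \<Longrightarrow> A \<subseteq> U \<Longrightarrow> Y \<subseteq> U \<Longrightarrow> dim cl A Y \<le> card A"
  by (metis card_mono dim_basis)

lemma dim_le_span:
  assumes "finite A" "A \<subseteq> U" "Y \<subseteq> U" "finite S" "S \<subseteq> U" "A \<subseteq> cl (Y \<union> S)"
  shows "dim cl A Y \<le> card S"
proof -
  obtain B where "finite B" "B \<subseteq> A" "indep B Y" "card B = dim cl A Y"
    using dim_basis[OF assms(1-3)] .
  then show ?thesis using steinitz[of Y S B] assms by auto
qed

lemma dim_ge_indep:
  assumes "finite A" "A \<subseteq> U" "Y \<subseteq> U" "I \<subseteq> A" "indep I Y"
  shows "card I \<le> dim cl A Y"
proof -
  obtain B where "finite B" "B \<subseteq> A" "A \<subseteq> cl (Y \<union> B)" "card B = dim cl A Y"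
    using dim_basis[OF assms(1-3)] .
  then show ?thesis using steinitz[of Y B I] assms finite_subset[of I A] by auto
qed

lemma dim_antimono_cl:
  assumes "finite A" "A \<subseteq> U" "Y' \<subseteq> U" "Y \<subseteq> cl Y'" "Y \<subseteq> U"
  shows "dim cl A Y' \<le> dim cl A Y"
proof -
  obtain B where B: "finite B" "B \<subseteq> A" "indep B Y'" "card B = dim cl A Y'"
    using dim_basis[OF assms(1-3)] .
  then show ?thesis using dim_ge_indep[of A Y B] indep_antimono[of B Y' Y] assms by auto
qed

lemma dim_antimono: "finite A \<Longrightarrow> A \<subseteq> U \<Longrightarrow> Y' \<subseteq> U \<Longrightarrow> Y \<subseteq> Y' \<Longrightarrow> dim cl A Y' \<le> dim cl A Y"
  using dim_antimono_cl[of A Y' Y] cl_ext[of Y'] by auto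

text \<open>A basis of \<open>A\<close> over \<open>Y\<close> and a basis of \<open>B\<close> over
  \<open>Y\<close> and \<open>A\<close> unite to a basis. All later predimension computations rest
  on this additivity.\<close>

lemma dim_Un:
  assumes "finite A" "A \<subseteq> U" "finite B" "B \<subseteq> U" "Y \<subseteq> U"
  shows "dim cl (A \<union> B) Y = dim cl A Y + dim cl B (Y \<union> A)"
proof -
  obtain I where I: "finite I" "I \<subseteq> A" "indep I Y" "A \<subseteq> cl (Y \<union> I)" "card I = dim cl A Y"
    using dim_basis[of A Y] assms by auto
  obtain J where J: "finite J" "J \<subseteq> B" "indep J (Y \<union> A)" "B \<subseteq> cl ((Y \<union> A) \<union> J)" "card J = dim cl B (Y \<union> A)"
    using dim_basis[of B "Y \<union> A"] assms by auto
  have disj: "I \<inter> J = {}"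
  proof -
    have "b \<notin> A" if "b \<in> J" for b
      using that J(3) J(2) cl_ext[of "Y \<union> A \<union> (J - {b})"] assms unfolding indep_def by blast
    then show ?thesis using I by auto
  qed
  have sub1: "Y \<union> A \<subseteq> cl (Y \<union> I)" using I assms cl_ext[of "Y \<union> I"] by auto
  \<comment> \<open>The elements of \<open>J\<close> enter one at a time; each stays outside the
    closure of the others together with all of \<open>A\<close>, in particular with
    \<open>I\<close>.\<close>
  have "K \<subseteq> J \<Longrightarrow> indep (I \<union> K) Y" for K
  proof (induction K rule: infinite_finite_induct)
    case (infinite K)
    then show ?case using J finite_subset by blast
  next
    case (insert k K)
    have "Y \<union> (I \<union> K) \<subseteq> cl ((Y \<union> A) \<union> (J - {k}))"
    proof -
      have "(Y \<union> A) \<union> (J - {k}) \<subseteq> U" using J assms by auto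
      moreover have "Y \<union> (I \<union> K) \<subseteq> (Y \<union> A) \<union> (J - {k})" using insert.hyps insert.prems I(2) by auto
      ultimately show ?thesis using cl_ext by (meson subset_trans)
    qed
    then have "cl (Y \<union> (I \<union> K)) \<subseteq> cl ((Y \<union> A) \<union> (J - {k}))"
      using J assms by (intro cl_least) auto
    then have "k \<notin> cl (Y \<union> (I \<union> K))" using J(3) insert.prems unfolding indep_def by blast
    then have "indep (insert k (I \<union> K)) Y"
      using insert I J assms by (intro indep_insert) auto
    then show ?case by simp
  qed (use I in auto)
  then have "indep (I \<union> J) Y" by blast
  moreover have "A \<union> B \<subseteq> cl (Y \<union> (I \<union> J))"
  proof -
    have "cl (Y \<union> I) \<subseteq> cl (Y \<union> (I \<union> J))" using I J assms by (intro cl_mono) auto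
    moreover have "cl ((Y \<union> A) \<union> J) \<subseteq> cl (Y \<union> (I \<union> J))"
    proof (rule cl_least)
      show U: "Y \<union> (I \<union> J) \<subseteq> U" using I J assms by auto
      show "(Y \<union> A) \<union> J \<subseteq> cl (Y \<union> (I \<union> J))" using calculation sub1 cl_ext[OF U] by auto
    qed
    ultimately show ?thesis using I J by blast
  qed
  ultimately have "dim cl (A \<union> B) Y = card (I \<union> J)"
    using I J assms by (intro dim_eqI) (auto simp: is_basis_indep)
  then show ?thesis using disj I J by (simp add: card_Un_disjoint)
qed

lemma dim_mono:
  assumes "finite A'" "A' \<subseteq> U" "A \<subseteq> A'" "Y \<subseteq> U"
  shows "dim cl A Y \<le> dim cl A' Y"
  using dim_Un[of A A' Y] assms finite_subset[of A A'] by (simp add: Un_absorb1)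

lemma dim_eq_0_iff:
  assumes "finite A" "A \<subseteq> U" "Y \<subseteq> U"
  shows "dim cl A Y = 0 \<longleftrightarrow> A \<subseteq> cl Y"
proof
  assume "dim cl A Y = 0"
  then show "A \<subseteq> cl Y" using dim_basis[OF assms] by (metis card_0_eq sup_bot_right)
next
  assume "A \<subseteq> cl Y"
  then show "dim cl A Y = 0" using dim_le_span[of A Y "{}"] assms by auto
qed

lemma dim_singleton:
  assumes "a \<in> U" "Y \<subseteq> U"
  shows "dim cl {a} Y = (if a \<in> cl Y then 0 else 1)"
  using dim_eq_0_iff[of "{a}" Y] dim_le_card[of "{a}" Y] assms by auto

lemma dim_cl_base:
  assumes "finite A" "A \<subseteq> U" "Y' \<subseteq> U" "Y \<subseteq> cl Y'" "Y' \<subseteq> cl Y" "Y \<subseteq> U"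
  shows "dim cl A Y' = dim cl A Y"
  using dim_antimono_cl[of A Y' Y] dim_antimono_cl[of A Y Y'] assms by (intro antisym) auto

lemma dim_absorb:
  assumes "finite A" "A \<subseteq> U" "finite B" "B \<subseteq> cl (Y \<union> A)" "Y \<subseteq> U"
  shows "dim cl (A \<union> B) Y = dim cl A Y"
  using dim_Un[of A B Y] dim_eq_0_iff[of B "Y \<union> A"] assms cl_sub[of "Y \<union> A"] by auto

lemma dim_Diff_base:
  assumes "finite A" "A \<subseteq> U" "Y \<subseteq> U"
  shows "dim cl (A - Y) Y = dim cl A Y"
proof -
  have "A \<inter> Y \<subseteq> cl (Y \<union> (A - Y))" using assms cl_ext[of "Y \<union> (A - Y)"] by auto
  moreover have "A - Y \<subseteq> U" using assms by auto
  ultimately show ?thesis using dim_absorb[of "A - Y" "A \<inter> Y" Y] assms by (simp add: Un_Diff_Int)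
qed

text \<open>Spanning by a basis uses only finitely many base points. While these are kept the basis
  still spans, and shrinking the base never lowers the dimension.\<close>

lemma dim_finite_base:
  assumes "finite A" "A \<subseteq> U" "Y \<subseteq> U"
  obtains F where "finite F" "F \<subseteq> Y" "\<And>Y'. F \<subseteq> Y' \<Longrightarrow> Y' \<subseteq> Y \<Longrightarrow> dim cl A Y' = dim cl A Y"
proof -
  obtain B where B: "finite B" "B \<subseteq> A" "indep B Y" "A \<subseteq> cl (Y \<union> B)" "card B = dim cl A Y"
    using dim_basis[OF assms] .
  obtain F where F: "finite F" "F \<subseteq> Y" "A \<subseteq> cl (F \<union> B)"
    using cl_finite_set[of Y A B] B assms by auto
  have "dim cl A Y' = dim cl A Y" if Y': "F \<subseteq> Y'" "Y' \<subseteq> Y" for Y'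
  proof (rule antisym)
    have "A \<subseteq> cl (Y' \<union> B)" using F cl_mono[of "F \<union> B" "Y' \<union> B"] Y' assms B by blast
    then show "dim cl A Y' \<le> dim cl A Y"
      using dim_le_span[of A Y' B] B Y' assms by auto
    show "dim cl A Y \<le> dim cl A Y'" using dim_antimono[of A Y Y'] Y' assms by auto
  qed
  then show thesis using that F by blast
qed

text \<open>A closure may be infinite, so its dimension rests on an explicit finite basis.
  Indecomposability is stated for such closed sets.\<close>

lemma dim_cl:
  assumes "finite A" "A \<subseteq> U"
  shows "finite_dim cl (cl A) {}" "dim cl (cl A) {} = dim cl A {}"
proof -
  obtain B where B: "finite B" "B \<subseteq> A" "indep B {}" "A \<subseteq> cl B" "card B = dim cl A {}"
    using dim_basis[of A "{}"] assms by auto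
  have "cl A \<subseteq> cl B" using B assms by (intro cl_least) auto
  then have *: "is_basis cl (cl A) {} B"
    using B assms cl_ext[of A] by (auto simp: is_basis_indep)
  then show "finite_dim cl (cl A) {}" using B by (auto simp: finite_dim_def)
  show "dim cl (cl A) {} = dim cl A {}" using dim_eqI[OF _ _ _ *] B cl_sub[OF assms(2)] by auto
qed

end

text \<open>\<open>acl\<close> and \<open>acl_in\<close> are compared only on subsets of the
  universe, hence the restriction to \<open>V\<close>.\<close>

lemma is_basis_cong:
  assumes "\<And>X. X \<subseteq> V \<Longrightarrow> cl X = cl' X" "A \<subseteq> V" "Y \<subseteq> V"
  shows "is_basis cl A Y B \<longleftrightarrow> is_basis cl' A Y B"
proof (cases "B \<subseteq> A")
  case True
  have "cl (Y \<union> (B - {b})) = cl' (Y \<union> (B - {b}))" "cl (Y \<union> B) = cl' (Y \<union> B)" for b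
    using assms True by (intro assms(1); blast)+
  then show ?thesis by (simp add: is_basis_def)
qed (simp add: is_basis_def)

lemma dim_cong:
  assumes "\<And>X. X \<subseteq> V \<Longrightarrow> cl X = cl' X" "A \<subseteq> V" "Y \<subseteq> V"
  shows "dim cl A Y = dim cl' A Y"
  unfolding dim_def using is_basis_cong[OF assms] by simp

section \<open>Algebraic closure in models of a geometric theory\<close>

lemma embedding_val:
  assumes "embedding L M N h" "is_struct L M" "range e \<subseteq> univ M"
  shows "wf_tm L t \<Longrightarrow> h (val M e t) = val N (h \<circ> e) t"
proof (induction t)
  case (Fn f ts)
  have "val M e t \<in> univ M" if "t \<in> set ts" for t
    using that Fn.prems assms by (intro val_in) auto
  then have "map (val M e) ts \<in> tuples M (farity L f)" using Fn.prems by (auto simp: tuples_def)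
  then have "h (val M e (Fn f ts)) = fint N f (map h (map (val M e) ts))"
    using assms Fn.prems by (auto simp: embedding_def simp del: map_map)
  also have "map h (map (val M e) ts) = map (val N (h \<circ> e)) ts"
    using Fn by (auto simp: comp_def)
  finally show ?case by (simp add: comp_def)
qed auto

lemma embedding_sat_qf:
  assumes "embedding L M N h" "is_struct L M" "range e \<subseteq> univ M"
  shows "qf \<phi> \<Longrightarrow> wf_fm L \<phi> \<Longrightarrow> sat M e \<phi> \<longleftrightarrow> sat N (h \<circ> e) \<phi>"
proof (induction \<phi>)
  case (Eq s t)
  have "val M e s \<in> univ M" "val M e t \<in> univ M" using Eq assms by (auto intro!: val_in)
  then have "val M e s = val M e t \<longleftrightarrow> h (val M e s) = h (val M e t)"
    using assms by (auto simp: embedding_def inj_on_def)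
  then show ?case using embedding_val[OF assms] Eq by (simp add: comp_def)
next
  case (Rel r ts)
  have "val M e t \<in> univ M" if "t \<in> set ts" for t
    using that Rel.prems assms by (intro val_in) auto
  then have "map (val M e) ts \<in> tuples M (rarity L r)" using Rel.prems by (auto simp: tuples_def)
  then have "rint M r (map (val M e) ts) \<longleftrightarrow> rint N r (map h (map (val M e) ts))"
    using assms Rel.prems by (auto simp: embedding_def simp del: map_map)
  also have "map h (map (val M e) ts) = map (val N (h \<circ> e)) ts"
    using Rel embedding_val[OF assms] by auto
  finally show ?case by (simp add: comp_def)
qed auto

lemma is_model_struct: "is_model L T M \<Longrightarrow> is_struct L M"
  by (simp add: is_model_def)

text \<open>The injection \<open>c\<close> says that \<open>'u\<close> has at least continuum many
  elements, which makes room for ultrapowers of countable structures.\<close>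

locale geometric_setting =
  fixes L :: "('f, 'r) lang" and T :: "('f, 'r) fm set" and c :: "nat set \<Rightarrow> 'u"
  assumes inj_c: "inj c"
    and ctbl: "countable_lang L"
    and sentences: "\<And>\<sigma>. \<sigma> \<in> T \<Longrightarrow> sentence L \<sigma>"
    and nofin: "no_finite_models TYPE('u) L T"
    and qe: "quantifier_elimination TYPE('u) L T"
    and geom: "geometric TYPE('u) L T"
    and indec: "indecomposable TYPE('u) L T"
begin

abbreviation mdl :: "('f, 'r, 'u) fo_struct \<Rightarrow> bool" where
  "mdl M \<equiv> is_model L T M"

lemma qe_obtain:
  assumes "wf_fm L \<phi>"
  obtains \<psi> where "wf_fm L \<psi>" "qf \<psi>" "fv \<psi> \<subseteq> fv \<phi>"
    "\<And>(M :: ('f, 'r, 'u) fo_struct) e. mdl M \<Longrightarrow> range e \<subseteq> univ M \<Longrightarrow> sat M e \<phi> \<longleftrightarrow> sat M e \<psi>"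
  using qe[unfolded quantifier_elimination_def, rule_format, OF assms] that by blast

lemma acl_subset: "acl L M X \<subseteq> univ M"
  by (auto simp: acl_def)

lemma acl_mono: "X \<subseteq> Y \<Longrightarrow> acl L M X \<subseteq> acl L M Y"
  unfolding acl_def by blast

text \<open>The definition of \<open>acl\<close> wants the parameters listed in the first variables.
  Quantifier elimination comes before the reordering, since \<open>sub\<close> is a correct renaming
  only for quantifier-free formulas.\<close>

lemma acl_intro:
  assumes M: "mdl M" and wf: "wf_fm L \<phi>" and e: "range e \<subseteq> univ M" and a: "a \<in> univ M"
    and sat: "sat M (e(v := a)) \<phi>" and fin: "finite {c \<in> univ M. sat M (e(v := c)) \<phi>}"
    and X: "e ` (fv \<phi> - {v}) \<subseteq> X"
  shows "a \<in> acl L M X"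
proof -
  obtain \<psi> where \<psi>: "wf_fm L \<psi>" "qf \<psi>" "fv \<psi> \<subseteq> fv \<phi>"
    "\<And>(M :: ('f, 'r, 'u) fo_struct) e. mdl M \<Longrightarrow> range e \<subseteq> univ M \<Longrightarrow> sat M e \<phi> \<longleftrightarrow> sat M e \<psi>"
    using qe_obtain[OF wf] by blast
  obtain ws where ws: "set ws = fv \<psi> - {v}" using finite_list[of "fv \<psi> - {v}"] by auto
  let ?k = "length ws"
  have "\<exists>i. i < ?k \<and> ws ! i = x" if "x \<in> fv \<psi> - {v}" for x
    using that ws by (metis in_set_conv_nth)
  then obtain ix where ix: "\<And>x. x \<in> fv \<psi> - {v} \<Longrightarrow> ix x < ?k \<and> ws ! ix x = x" by metis
  \<comment> \<open>The distinguished variable moves to the last position, every other one to its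
    position in \<open>ws\<close>.\<close>
  define s where "s = (\<lambda>x. if x = v then ?k else ix x)"
  define bs where "bs = map e ws"
  have eq: "holds M (sub s \<psi>) (bs @ [b]) \<longleftrightarrow> sat M (e(v := b)) \<phi>" if "b \<in> univ M" for b
  proof -
    have "holds M (sub s \<psi>) (bs @ [b]) \<longleftrightarrow> sat M ((\<lambda>i. (bs @ [b]) ! i) \<circ> s) \<psi>"
      unfolding holds_def using \<psi> by (intro sat_sub) auto
    also have "\<dots> \<longleftrightarrow> sat M (e(v := b)) \<psi>"
      by (rule sat_cong) (use ix in \<open>auto simp: s_def bs_def nth_append\<close>)
    also have "\<dots> \<longleftrightarrow> sat M (e(v := b)) \<phi>" using \<psi>(4)[OF M, of "e(v := b)"] that e by auto
    finally show ?thesis .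
  qed
  have "formula_in L (Suc ?k) (sub s \<psi>)"
    using \<psi> ix by (auto simp: formula_in_def fv_sub s_def less_Suc_eq)
  moreover have "bs \<in> tuples M ?k" using e by (auto simp: bs_def tuples_def)
  moreover have "set bs \<subseteq> X" using X ws \<psi> by (auto simp: bs_def)
  moreover have "{d \<in> univ M. holds M (sub s \<psi>) (bs @ [d])} = {c \<in> univ M. sat M (e(v := c)) \<phi>}"
    using eq by auto
  ultimately show ?thesis using eq[OF a] sat fin a unfolding acl_def
    by (intro CollectI conjI exI[of _ ?k] exI[of _ "sub s \<psi>"] exI[of _ bs]) auto
qed

lemma acl_elim:
  assumes M: "mdl M" and "a \<in> acl L M X"
  obtains \<phi> e v where "wf_fm L \<phi>" "qf \<phi>" "range e \<subseteq> univ M" "sat M (e(v := a)) \<phi>"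
    "finite {c \<in> univ M. sat M (e(v := c)) \<phi>}" "e ` (fv \<phi> - {v}) \<subseteq> X"
proof -
  obtain k \<phi> bs where *: "formula_in L (Suc k) \<phi>" "bs \<in> tuples M k" "set bs \<subseteq> X"
     "holds M \<phi> (bs @ [a])" "finite {c \<in> univ M. holds M \<phi> (bs @ [c])}" and a: "a \<in> univ M"
    using assms(2) unfolding acl_def by blast
  define e where "e = (\<lambda>i. if i < k then bs ! i else a)"
  have e: "range e \<subseteq> univ M" using * a by (auto simp: e_def tuples_def)
  have wf: "wf_fm L \<phi>" using * by (auto simp: formula_in_def)
  obtain \<psi> where \<psi>: "wf_fm L \<psi>" "qf \<psi>" "fv \<psi> \<subseteq> fv \<phi>"
    "\<And>(M :: ('f, 'r, 'u) fo_struct) e. mdl M \<Longrightarrow> range e \<subseteq> univ M \<Longrightarrow> sat M e \<phi> \<longleftrightarrow> sat M e \<psi>"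
    using qe_obtain[OF wf] by blast
  have eq: "holds M \<phi> (bs @ [d]) \<longleftrightarrow> sat M (e(k := d)) \<psi>" if "d \<in> univ M" for d
  proof -
    have "holds M \<phi> (bs @ [d]) \<longleftrightarrow> sat M (e(k := d)) \<phi>"
      by (rule holds_iff_sat[OF *(1)]) (use *(2) in \<open>auto simp: e_def tuples_def nth_append\<close>)
    also have "\<dots> \<longleftrightarrow> sat M (e(k := d)) \<psi>" using \<psi>(4)[OF M, of "e(k := d)"] that e by auto
    finally show ?thesis .
  qed
  have "{d \<in> univ M. sat M (e(k := d)) \<psi>} = {c \<in> univ M. holds M \<phi> (bs @ [c])}"
    using eq by auto
  moreover have "e ` (fv \<psi> - {k}) \<subseteq> X"
  proof (rule image_subsetI)
    fix x assume "x \<in> fv \<psi> - {k}"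
    then have "x < k" using \<psi>(3) *(1) by (force simp: formula_in_def less_Suc_eq)
    then show "e x \<in> X" using *(2,3) by (auto simp: e_def tuples_def)
  qed
  ultimately show thesis using that[OF \<psi>(1,2) e, of k] eq[OF a] * by simp
qed

lemma acl_ext:
  assumes "mdl M" "X \<subseteq> univ M"
  shows "X \<subseteq> acl L M X"
proof
  fix a assume a: "a \<in> X"
  show "a \<in> acl L M X"
  proof (rule acl_intro[of _ "Eq (Var 0) (Var 1)" "\<lambda>_. a" a 0])
    show "finite {b \<in> univ M. sat M ((\<lambda>_. a)(0 := b)) (Eq (Var 0) (Var 1))}"
      by (rule finite_subset[of _ "{a}"]) auto
  qed (use a assms in auto)
qed

text \<open>Elimination of the infinity quantifier, freed from the fixed order of variables: the
  formula is renamed into that order and the result renamed back, each time after eliminating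
  quantifiers.\<close>

lemma fin_formula:
  assumes "wf_fm L \<phi>"
  obtains \<psi> where "wf_fm L \<psi>" "qf \<psi>" "fv \<psi> \<subseteq> fv \<phi> - {v}"
    "\<And>(M :: ('f, 'r, 'u) fo_struct) e. mdl M \<Longrightarrow> range e \<subseteq> univ M \<Longrightarrow>
       sat M e \<psi> \<longleftrightarrow> finite {c \<in> univ M. sat M (e(v := c)) \<phi>}"
proof -
  obtain \<phi>' where \<phi>': "wf_fm L \<phi>'" "qf \<phi>'" "fv \<phi>' \<subseteq> fv \<phi>"
    "\<And>(M :: ('f, 'r, 'u) fo_struct) e. mdl M \<Longrightarrow> range e \<subseteq> univ M \<Longrightarrow> sat M e \<phi> \<longleftrightarrow> sat M e \<phi>'"
    using qe_obtain[OF assms] by blast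
  obtain ws where ws: "set ws = fv \<phi>' - {v}" using finite_list[of "fv \<phi>' - {v}"] by auto
  let ?k = "length ws"
  have "\<exists>i. i < ?k \<and> ws ! i = x" if "x \<in> fv \<phi>' - {v}" for x
    using that ws by (metis in_set_conv_nth)
  then obtain ix where ix: "\<And>x. x \<in> fv \<phi>' - {v} \<Longrightarrow> ix x < ?k \<and> ws ! ix x = x" by metis
  define s where "s = (\<lambda>x. if x = v then ?k else ix x)"
  have form: "formula_in L (Suc ?k) (sub s \<phi>')"
    using \<phi>' ix by (auto simp: formula_in_def fv_sub s_def less_Suc_eq)
  have elim: "eliminates_exists_infinity TYPE('u) L T" using geom by (simp add: geometric_def)
  obtain \<psi> where \<psi>: "formula_in L ?k \<psi>"
    "\<And>(M :: ('f, 'r, 'u) fo_struct) bs. mdl M \<Longrightarrow> bs \<in> tuples M ?k \<Longrightarrow>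
       holds M \<psi> bs \<longleftrightarrow> infinite {c \<in> univ M. holds M (sub s \<phi>') (bs @ [c])}"
    using elim[unfolded eliminates_exists_infinity_def, rule_format, OF form] by blast
  then have wf\<psi>: "wf_fm L \<psi>" by (simp add: formula_in_def)
  obtain \<psi>' where \<psi>': "wf_fm L \<psi>'" "qf \<psi>'" "fv \<psi>' \<subseteq> fv \<psi>"
    "\<And>(M :: ('f, 'r, 'u) fo_struct) e. mdl M \<Longrightarrow> range e \<subseteq> univ M \<Longrightarrow> sat M e \<psi> \<longleftrightarrow> sat M e \<psi>'"
    using qe_obtain[OF wf\<psi>] by blast
  have fv\<psi>': "fv \<psi>' \<subseteq> {..<?k}" using \<psi>' \<psi>(1) by (auto simp: formula_in_def)
  let ?r = "\<lambda>i. if i < ?k then ws ! i else v"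
  show thesis
  proof (rule that[of "Neg (sub ?r \<psi>')"])
    show "fv (Neg (sub ?r \<psi>')) \<subseteq> fv \<phi> - {v}"
      using \<psi>' \<phi>' ws fv\<psi>' by (auto simp: fv_sub)
    fix M :: "('f, 'r, 'u) fo_struct" and e :: "nat \<Rightarrow> 'u" assume M: "mdl M" and e: "range e \<subseteq> univ M"
    define bs where "bs = map e ws"
    have bs: "bs \<in> tuples M ?k" using e by (auto simp: bs_def tuples_def)
    have eq: "holds M (sub s \<phi>') (bs @ [b]) \<longleftrightarrow> sat M (e(v := b)) \<phi>" if "b \<in> univ M" for b
    proof -
      have "holds M (sub s \<phi>') (bs @ [b]) \<longleftrightarrow> sat M ((\<lambda>i. (bs @ [b]) ! i) \<circ> s) \<phi>'"
        unfolding holds_def using \<phi>' by (intro sat_sub) auto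
      also have "\<dots> \<longleftrightarrow> sat M (e(v := b)) \<phi>'"
        by (rule sat_cong) (use ix in \<open>auto simp: s_def bs_def nth_append\<close>)
      also have "\<dots> \<longleftrightarrow> sat M (e(v := b)) \<phi>" using \<phi>'(4)[OF M, of "e(v := b)"] that e by auto
      finally show ?thesis .
    qed
    have "sat M e (sub ?r \<psi>') \<longleftrightarrow> sat M (e \<circ> ?r) \<psi>'" using \<psi>' by (intro sat_sub)
    also have "\<dots> \<longleftrightarrow> sat M (e \<circ> ?r) \<psi>" using \<psi>'(4)[OF M, of "e \<circ> ?r"] e by auto
    also have "\<dots> \<longleftrightarrow> holds M \<psi> bs"
      by (rule holds_iff_sat[OF \<psi>(1), symmetric]) (auto simp: bs_def)
    also have "\<dots> \<longleftrightarrow> infinite {c \<in> univ M. sat M (e(v := c)) \<phi>}"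
      using \<psi>(2)[OF M bs] eq by (simp cong: conj_cong)
    finally show "sat M e (Neg (sub ?r \<psi>')) \<longleftrightarrow> finite {c \<in> univ M. sat M (e(v := c)) \<phi>}"
      by simp
  qed (use \<psi>' in auto)
qed

text \<open>If \<open>\<phi>\<close> makes \<open>a\<close> algebraic over \<open>X\<close> and
  \<open>b\<close>, and \<open>\<phi>'\<close> makes \<open>b\<close> algebraic over
  \<open>X\<close>, then \<open>b\<close> is quantified out. Another solution of
  \<open>\<phi>'\<close> could leave \<open>\<phi>\<close> with infinitely many solutions; the
  conjunct \<open>\<zeta>\<close> excludes this, so a finite union of finite sets remains.\<close>

lemma acl_insert:
  assumes M: "mdl M" and b: "b \<in> acl L M X" and a: "a \<in> acl L M (insert b X)"
  shows "a \<in> acl L M X"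
proof -
  obtain \<phi> e v where \<phi>: "wf_fm L \<phi>" "qf \<phi>" "range e \<subseteq> univ M" "sat M (e(v := a)) \<phi>"
    "finite {c \<in> univ M. sat M (e(v := c)) \<phi>}" "e ` (fv \<phi> - {v}) \<subseteq> insert b X"
    using acl_elim[OF M a] by blast
  obtain \<phi>' e' v' where \<phi>': "wf_fm L \<phi>'" "qf \<phi>'" "range e' \<subseteq> univ M" "sat M (e'(v' := b)) \<phi>'"
    "finite {c \<in> univ M. sat M (e'(v' := c)) \<phi>'}" "e' ` (fv \<phi>' - {v'}) \<subseteq> X"
    using acl_elim[OF M b] by blast
  \<comment> \<open>Variable 0 stands for \<open>a\<close> and 1 for \<open>b\<close>; parameters of
    \<open>\<phi>\<close> get even variables from 2 on, those of \<open>\<phi>'\<close> odd ones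
    from 3 on, and \<open>E\<close> decodes them.\<close>
  define s where "s = (\<lambda>x. if x = v then 0 else if e x \<in> X then 2 * x + 2 else (1::nat))"
  define s' where "s' = (\<lambda>x. if x = v' then 1 else 2 * x + (3::nat))"
  define E where "E = (\<lambda>x. if even x then e ((x - 2) div 2) else e' ((x - 3) div 2))"
  have E: "E (2 * x + 2) = e x" "E (2 * x + 3) = e' x" "E (Suc (Suc (2 * x))) = e x" for x by (auto simp: E_def)
  have rE: "range E \<subseteq> univ M" using \<phi>(3) \<phi>'(3) by (auto simp: E_def)
  have aU: "a \<in> univ M" and bU: "b \<in> univ M" using subsetD[OF acl_subset a] subsetD[OF acl_subset b] by auto
  have wfs: "wf_fm L (sub s \<phi>)" using \<phi>(1) by simp
  obtain \<zeta> where \<zeta>': "wf_fm L \<zeta>" "qf \<zeta>" "fv \<zeta> \<subseteq> fv (sub s \<phi>) - {0}"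
    "\<And>(M :: ('f, 'r, 'u) fo_struct) e. mdl M \<Longrightarrow> range e \<subseteq> univ M \<Longrightarrow>
       sat M e \<zeta> \<longleftrightarrow> finite {c \<in> univ M. sat M (e(0 := c)) (sub s \<phi>)}"
    by (rule fin_formula[OF wfs, of 0], rule that)
  note \<zeta> = \<zeta>'(1,3,4)
  have s1: "sat M (E(1 := b, 0 := d)) (sub s \<phi>) \<longleftrightarrow> sat M (e(v := d)) \<phi>" for d
    unfolding sat_sub[OF \<phi>(2)]
    by (rule sat_cong) (use \<phi>(6) in \<open>auto simp: s_def E\<close>)
  have s2: "sat M (E(0 := d, 1 := d')) (sub s' \<phi>') \<longleftrightarrow> sat M (e'(v' := d')) \<phi>'" for d d'
    unfolding sat_sub[OF \<phi>'(2)]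
    by (rule sat_cong) (auto simp: s'_def E)
  let ?Phi = "Ex 1 (Con (sub s \<phi>) (Con (sub s' \<phi>') \<zeta>))"
  have sat: "sat M (E(0 := d)) ?Phi \<longleftrightarrow> (\<exists>u\<in>univ M. sat M (e'(v' := u)) \<phi>' \<and>
      finite {c \<in> univ M. sat M (E(1 := u, 0 := c)) (sub s \<phi>)} \<and> sat M (E(1 := u, 0 := d)) (sub s \<phi>))"
    if d: "d \<in> univ M" for d
  proof -
    have "sat M (E(0 := d, 1 := u)) \<zeta> \<longleftrightarrow> finite {c \<in> univ M. sat M (E(1 := u, 0 := c)) (sub s \<phi>)}"
      if "u \<in> univ M" for u
      using \<zeta>(3)[OF M, of "E(0 := d, 1 := u)"] rE d that by (auto simp: fun_upd_twist)
    moreover have "E(0 := d, 1 := u) = E(1 := u, 0 := d)" for u by (simp add: fun_upd_twist)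
    ultimately show ?thesis using s2 by (auto simp: fun_upd_twist)
  qed
  show ?thesis
  proof (rule acl_intro[OF M, of ?Phi E a 0])
    have "sat M (E(1 := b, 0 := a)) (sub s \<phi>)" using s1 \<phi>(4) by simp
    moreover have "finite {c \<in> univ M. sat M (E(1 := b, 0 := c)) (sub s \<phi>)}"
      using s1 \<phi>(5) by simp
    ultimately show "sat M (E(0 := a)) ?Phi"
      unfolding sat[OF aU] using \<phi>'(4) bU by blast
    have "{c \<in> univ M. sat M (E(0 := c)) ?Phi} \<subseteq>
      (\<Union>u\<in>{u\<in>univ M. sat M (e'(v' := u)) \<phi>' \<and> finite {c \<in> univ M. sat M (E(1 := u, 0 := c)) (sub s \<phi>)}}.
          {c \<in> univ M. sat M (E(1 := u, 0 := c)) (sub s \<phi>)})"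
    proof
      fix d assume "d \<in> {c \<in> univ M. sat M (E(0 := c)) ?Phi}"
      then show "d \<in> (\<Union>u\<in>{u\<in>univ M. sat M (e'(v' := u)) \<phi>' \<and> finite {c \<in> univ M. sat M (E(1 := u, 0 := c)) (sub s \<phi>)}}.
          {c \<in> univ M. sat M (E(1 := u, 0 := c)) (sub s \<phi>)})"
        using sat[of d] by blast
    qed
    moreover have "finite \<dots>"
      using \<phi>'(5) by (intro finite_UN_I) (auto intro: finite_subset[OF _ \<phi>'(5)])
    ultimately show "finite {c \<in> univ M. sat M (E(0 := c)) ?Phi}" by (rule finite_subset)
    have "E x \<in> X" if "x \<in> fv ?Phi - {0}" for x
    proof -
      have "x \<in> s ` fv \<phi> \<or> x \<in> s' ` fv \<phi>'" "x \<noteq> 0" "x \<noteq> 1"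
        using that \<zeta>(2) by (auto simp: fv_sub \<phi>(2) \<phi>'(2))
      then show ?thesis
        using \<phi>(6) \<phi>'(6) by (auto simp: s_def s'_def E split: if_splits)
    qed
    then show "E ` (fv ?Phi - {0}) \<subseteq> X" by blast
  qed (use \<phi> \<phi>' \<zeta> rE aU in auto)
qed

lemma acl_finite:
  assumes M: "mdl M" and a: "a \<in> acl L M X"
  shows "\<exists>F. finite F \<and> F \<subseteq> X \<and> a \<in> acl L M F"
proof -
  obtain \<phi> e v where \<phi>: "wf_fm L \<phi>" "qf \<phi>" "range e \<subseteq> univ M" "sat M (e(v := a)) \<phi>"
    "finite {c \<in> univ M. sat M (e(v := c)) \<phi>}" "e ` (fv \<phi> - {v}) \<subseteq> X"
    using acl_elim[OF M a] by blast
  have "a \<in> acl L M (e ` (fv \<phi> - {v}))"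
    by (rule acl_intro[OF M \<phi>(1,3) subsetD[OF acl_subset a] \<phi>(4,5)]) simp
  then show ?thesis using \<phi>(6) by (intro exI[of _ "e ` (fv \<phi> - {v})"]) auto
qed

lemma acl_pregeometry:
  assumes M: "mdl M"
  shows "pregeometry (univ M) (acl L M)"
proof
  fix X assume X: "X \<subseteq> univ M"
  show "acl L M (acl L M X) \<subseteq> acl L M X"
  proof
    fix a assume "a \<in> acl L M (acl L M X)"
    then obtain F where F: "finite F" "F \<subseteq> acl L M X" "a \<in> acl L M F" using acl_finite[OF M] by blast
    have "finite F \<Longrightarrow> F \<subseteq> acl L M X \<Longrightarrow> a \<in> acl L M (F \<union> X) \<Longrightarrow> a \<in> acl L M X"
    proof (induction F rule: finite_induct)
      case (insert b F)
      have "b \<in> acl L M (F \<union> X)" using insert.prems acl_mono[of X "F \<union> X"] by auto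
      then show ?case using acl_insert[OF M, of b "F \<union> X" a] insert by auto
    qed simp
    then show "a \<in> acl L M X" using F acl_mono[of F "F \<union> X"] by auto
  qed
  show "\<exists>F. finite F \<and> F \<subseteq> X \<and> a \<in> acl L M F" if "a \<in> acl L M X" for a
    using acl_finite[OF M that] .
  fix a b assume "a \<in> univ M" "b \<in> univ M" "a \<in> acl L M (insert b X)" "a \<notin> acl L M X"
  then show "b \<in> acl L M (insert a X)"
    using geom M X unfolding geometric_def acl_exchange_def by blast
qed (use acl_subset[of M] acl_ext[OF M] acl_mono[of _ _ M] in blast)+

text \<open>The conjunct \<open>\<zeta>\<close> carries the finiteness of the solution set along, so
  the formula forces algebraicity under every assignment in every model and not only under
  \<open>H\<close>.\<close>

lemma alg_witness:
  assumes M: "mdl M" and H: "range H \<subseteq> univ M" and v: "H v \<in> acl L M (H ` W)"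
  obtains \<chi> where "wf_fm L \<chi>" "qf \<chi>" "fv \<chi> \<subseteq> insert v W" "sat M H \<chi>"
    "\<And>M' H'. mdl M' \<Longrightarrow> range H' \<subseteq> univ M' \<Longrightarrow> sat M' H' \<chi> \<Longrightarrow> H' v \<in> acl L M' (H' ` W)"
proof (cases "v \<in> W")
  case True
  show ?thesis
  proof (rule that[of "Eq (Var v) (Var v)"])
    fix M' :: "('f, 'r, 'u) fo_struct" and H' :: "nat \<Rightarrow> 'u" assume "mdl M'" "range H' \<subseteq> univ M'"
    then show "H' v \<in> acl L M' (H' ` W)" using True acl_ext[of M' "H' ` W"] by auto
  qed auto
next
  case False
  obtain \<phi> e v0 where \<phi>: "wf_fm L \<phi>" "qf \<phi>" "range e \<subseteq> univ M" "sat M (e(v0 := H v)) \<phi>"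
    "finite {c \<in> univ M. sat M (e(v0 := c)) \<phi>}" "e ` (fv \<phi> - {v0}) \<subseteq> H ` W"
    using acl_elim[OF M v] by blast
  have "\<exists>w. w \<in> W \<and> H w = e x" if "x \<in> fv \<phi> - {v0}" for x
  proof -
    have "e x \<in> H ` W" using that \<phi>(6) by blast
    then show ?thesis by auto
  qed
  then obtain w where w: "\<And>x. x \<in> fv \<phi> - {v0} \<Longrightarrow> w x \<in> W \<and> H (w x) = e x" by metis
  define s where "s = (\<lambda>x. if x = v0 then v else w x)"
  have eq: "sat M (H(v := d)) (sub s \<phi>) \<longleftrightarrow> sat M (e(v0 := d)) \<phi>" for d
    unfolding sat_sub[OF \<phi>(2)] by (rule sat_cong) (use w False in \<open>auto simp: s_def\<close>)
  have wfs: "wf_fm L (sub s \<phi>)" using \<phi>(1) by simp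
  obtain \<zeta> where \<zeta>: "wf_fm L \<zeta>" "qf \<zeta>" "fv \<zeta> \<subseteq> fv (sub s \<phi>) - {v}"
    "\<And>(M :: ('f, 'r, 'u) fo_struct) e. mdl M \<Longrightarrow> range e \<subseteq> univ M \<Longrightarrow>
       sat M e \<zeta> \<longleftrightarrow> finite {c \<in> univ M. sat M (e(v := c)) (sub s \<phi>)}"
    using fin_formula[OF wfs, of v] by blast
  have fvs: "fv (sub s \<phi>) \<subseteq> insert v W" using w by (auto simp: fv_sub[OF \<phi>(2)] s_def)
  show ?thesis
  proof (rule that[of "Con (sub s \<phi>) \<zeta>"])
    have "sat M H (sub s \<phi>)" using eq[of "H v"] \<phi>(4) by simp
    moreover have "sat M H \<zeta>" using \<zeta>(4)[OF M H] eq \<phi>(5) by simp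
    ultimately show "sat M H (Con (sub s \<phi>) \<zeta>)" by simp
    fix M' :: "('f, 'r, 'u) fo_struct" and H' assume M': "mdl M'" "range H' \<subseteq> univ M'" "sat M' H' (Con (sub s \<phi>) \<zeta>)"
    then show "H' v \<in> acl L M' (H' ` W)"
      using \<zeta>(4)[OF M'(1,2)] fvs \<phi>(1)
      by (intro acl_intro[of _ "sub s \<phi>" H' _ v]) auto
  qed (use \<phi> \<zeta> fvs in auto)
qed

abbreviation mdim :: "('f, 'r, 'u) fo_struct \<Rightarrow> 'u set \<Rightarrow> 'u set \<Rightarrow> nat" where
  "mdim M \<equiv> dim (acl L M)"

text \<open>To bound a dimension from above it suffices to state that each variable of
  \<open>S\<close> is algebraic over \<open>W\<close> and the variables of one basis. As
  \<open>H\<close> may identify variables, one variable is selected for each basis element.\<close>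

lemma dim_witness:
  assumes M: "mdl M" and H: "range H \<subseteq> univ M" and fin: "finite S" "finite W"
    and d: "mdim M (H ` S) (H ` W) \<le> i"
  obtains \<chi> where "wf_fm L \<chi>" "qf \<chi>" "fv \<chi> \<subseteq> S \<union> W" "sat M H \<chi>"
    "\<And>M' H'. mdl M' \<Longrightarrow> range H' \<subseteq> univ M' \<Longrightarrow> sat M' H' \<chi> \<Longrightarrow> mdim M' (H' ` S) (H' ` W) \<le> i"
proof -
  interpret pregeometry "univ M" "acl L M" by (rule acl_pregeometry[OF M])
  have HU: "H ` S \<subseteq> univ M" "H ` W \<subseteq> univ M" using H by auto
  obtain B where B': "finite B" "B \<subseteq> H ` S" "indep B (H ` W)" "H ` S \<subseteq> acl L M (H ` W \<union> B)"
     "card B = mdim M (H ` S) (H ` W)"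
    by (rule dim_basis[OF finite_imageI[OF fin(1)] HU], rule that)
  note B = B'(1,2,4,5)
  obtain S' where S': "S' \<subseteq> S" "inj_on H S'" "B = H ` S'"
    using subset_image_inj[of B H S] B(2) by auto
  have "\<exists>\<chi>. wf_fm L \<chi> \<and> qf \<chi> \<and> fv \<chi> \<subseteq> insert s (W \<union> S') \<and> sat M H \<chi> \<and>
    (\<forall>M' H'. mdl M' \<longrightarrow> range H' \<subseteq> univ M' \<longrightarrow> sat M' H' \<chi> \<longrightarrow> H' s \<in> acl L M' (H' ` (W \<union> S')))"
    if "s \<in> S" for s
  proof -
    have "H s \<in> acl L M (H ` (W \<union> S'))" using that B(3) S' by (auto simp: image_Un)
    then show ?thesis using alg_witness[OF M H] by metis
  qed
  then obtain X where X: "\<And>s. s \<in> S \<Longrightarrow> wf_fm L (X s) \<and> qf (X s) \<and> fv (X s) \<subseteq> insert s (W \<union> S') \<and> sat M H (X s)"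
    "\<And>s M' H'. s \<in> S \<Longrightarrow> mdl M' \<Longrightarrow> range H' \<subseteq> univ M' \<Longrightarrow> sat M' H' (X s) \<Longrightarrow> H' s \<in> acl L M' (H' ` (W \<union> S'))"
    by metis
  obtain l where l: "set l = X ` S" using finite_list[of "X ` S"] fin by auto
  show thesis
  proof (rule that[of "Conj l"])
    show "fv (Conj l) \<subseteq> S \<union> W" using X(1) S'(1) by (fastforce simp: l)
    fix M' :: "('f, 'r, 'u) fo_struct" and H' assume M': "mdl M'" "range H' \<subseteq> univ M'" "sat M' H' (Conj l)"
    interpret M': pregeometry "univ M'" "acl L M'" by (rule acl_pregeometry[OF M'(1)])
    have "H' ` S \<subseteq> acl L M' (H' ` W \<union> H' ` S')" using X(2) M' by (auto simp: l image_Un)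
    then have "mdim M' (H' ` S) (H' ` W) \<le> card (H' ` S')"
      using M' fin S' finite_subset[of S' S] by (intro M'.dim_le_span) auto
    also have "\<dots> \<le> card S'" using fin S' finite_subset card_image_le by blast
    also have "\<dots> = card B" using S' by (simp add: card_image)
    finally show "mdim M' (H' ` S) (H' ` W) \<le> i" using d B by simp
  qed (use X l in auto)
qed

text \<open>Algebraicity is witnessed by quantifier-free formulas. Embeddings preserve these and are
  injective, so finiteness of the solution set pulls back.\<close>

lemma acl_in_eq:
  assumes M: "mdl M" and X: "X \<subseteq> univ M"
  shows "acl_in L T M X = acl L M X"
proof
  have "embedding L M M id"
    by (simp add: embedding_def)
  then show "acl L M X \<subseteq> acl_in L T M X"
    using M acl_subset unfolding acl_in_def by (fastforce intro: exI[of _ M] exI[of _ id])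
next
  show "acl_in L T M X \<subseteq> acl L M X"
  proof
    fix a assume "a \<in> acl_in L T M X"
    then obtain N h where a: "a \<in> univ M" and N: "mdl N" "embedding L M N h" "h a \<in> acl L N (h ` X)"
      unfolding acl_in_def by blast
    have hU: "h x \<in> univ N" if "x \<in> univ M" for x using N(2) that by (auto simp: embedding_def)
    obtain \<phi> e v where \<phi>: "wf_fm L \<phi>" "qf \<phi>" "range e \<subseteq> univ N" "sat N (e(v := h a)) \<phi>"
      "finite {c \<in> univ N. sat N (e(v := c)) \<phi>}" "e ` (fv \<phi> - {v}) \<subseteq> h ` X"
      using acl_elim[OF N(1,3)] by blast
    have "\<exists>y\<in>X. e x = h y" if "x \<in> fv \<phi> - {v}" for x using \<phi>(6) that by blast
    then obtain g where g: "\<And>x. x \<in> fv \<phi> - {v} \<Longrightarrow> g x \<in> X \<and> e x = h (g x)" by metis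
    define e' where "e' = (\<lambda>x. if x \<in> fv \<phi> - {v} then g x else a)"
    have e': "range e' \<subseteq> univ M" using g a X by (auto simp: e'_def)
    have eq: "sat M (e'(v := d)) \<phi> \<longleftrightarrow> sat N (e(v := h d)) \<phi>" if "d \<in> univ M" for d
    proof -
      have "sat M (e'(v := d)) \<phi> \<longleftrightarrow> sat N (h \<circ> e'(v := d)) \<phi>"
        using e' that by (intro embedding_sat_qf[OF N(2) is_model_struct[OF M] _ \<phi>(2,1)]) auto
      also have "\<dots> \<longleftrightarrow> sat N (e(v := h d)) \<phi>"
        by (rule sat_cong) (use g in \<open>auto simp: e'_def\<close>)
      finally show ?thesis .
    qed
    have "h ` {d \<in> univ M. sat M (e'(v := d)) \<phi>} \<subseteq> {c \<in> univ N. sat N (e(v := c)) \<phi>}"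
      using eq hU by auto
    then have "finite (h ` {d \<in> univ M. sat M (e'(v := d)) \<phi>})" using \<phi>(5) finite_subset by blast
    moreover have "inj_on h {d \<in> univ M. sat M (e'(v := d)) \<phi>}"
      using N(2) unfolding embedding_def inj_on_def by blast
    ultimately have "finite {d \<in> univ M. sat M (e'(v := d)) \<phi>}" using finite_imageD by blast
    moreover have "e' ` (fv \<phi> - {v}) \<subseteq> X" using g by (auto simp: e'_def)
    ultimately show "a \<in> acl L M X"
      using eq[OF a] \<phi>(4) by (intro acl_intro[OF M \<phi>(1) e' a, of v]) auto
  qed
qed

lemma dim_acl_in_eq:
  assumes "mdl M" "A \<subseteq> univ M" "Y \<subseteq> univ M"
  shows "dim (acl_in L T M) A Y = mdim M A Y"
  by (rule dim_cong[of "univ M"]) (use assms acl_in_eq in auto)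

end

section \<open>Countable elementary substructures and saturated ultrapowers\<close>

text \<open>Countability is the point: sequences in a countable universe can be coded by sets of
  numbers, as \<open>ultrapower_exists\<close> requires.\<close>

lemma loewenheim_skolem:
  fixes M :: "('f, 'r, 'u) fo_struct"
  assumes L: "countable_lang L" and M: "is_struct L M" and X: "countable X" "X \<subseteq> univ M"
  obtains M0 :: "('f, 'r, 'u) fo_struct" where "is_struct L M0" "countable (univ M0)" "X \<subseteq> univ M0"
    "univ M0 \<subseteq> univ M" "\<And>e \<phi>. range e \<subseteq> univ M0 \<Longrightarrow> wf_fm L \<phi> \<Longrightarrow> sat M0 e \<phi> \<longleftrightarrow> sat M e \<phi>"
proof -
  obtain m0 where m0: "m0 \<in> univ M" using M by (auto simp: is_struct_def)
  define wit where "wit = (\<lambda>(\<psi> :: ('f, 'r) fm, x, us).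
    if \<exists>u\<in>univ M. sat M ((\<lambda>i. us ! i)(x := u)) \<psi>
    then SOME u. u \<in> univ M \<and> sat M ((\<lambda>i. us ! i)(x := u)) \<psi> else m0)"
  have wit: "wit (\<psi>, x, us) \<in> univ M \<and> (\<forall>u\<in>univ M. sat M ((\<lambda>i. us ! i)(x := u)) \<psi> \<longrightarrow>
      sat M ((\<lambda>i. us ! i)(x := wit (\<psi>, x, us))) \<psi>)" for \<psi> x us
  proof (cases "\<exists>u\<in>univ M. sat M ((\<lambda>i. us ! i)(x := u)) \<psi>")
    case True
    then have "\<exists>u. u \<in> univ M \<and> sat M ((\<lambda>i. us ! i)(x := u)) \<psi>" by blast
    then show ?thesis using someI_ex[of "\<lambda>u. u \<in> univ M \<and> sat M ((\<lambda>i. us ! i)(x := u)) \<psi>"] True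
      by (simp add: wit_def)
  qed (use m0 in \<open>auto simp: wit_def\<close>)
  \<comment> \<open>One round adds witnesses for all formulas with parameters in the set and values
    of all functions; the union of the rounds passes the Tarski-Vaught test.\<close>
  define step where "step = (\<lambda>A. A \<union> wit ` ({\<psi>. wf_fm L \<psi>} \<times> (UNIV :: nat set) \<times> lists A) \<union>
    (\<lambda>(f, us). fint M f us) ` {(f, us). f \<in> funs L \<and> us \<in> lists A \<and> length us = farity L f})"
  define S where "S = (\<Union>n. (step ^^ n) (insert m0 X))"
  have mono: "(step ^^ n) A \<subseteq> (step ^^ (n + k)) A" for n k A
    by (induction k) (auto simp: step_def)
  have cstep: "countable A \<Longrightarrow> countable (step A)" for A
  proof -
    assume A: "countable A"
    have "countable (wit ` ({\<psi>. wf_fm L \<psi>} \<times> (UNIV :: nat set) \<times> lists A))"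
      using countable_formulas[OF L] A by (intro countable_image countable_SIGMA countable_lists) auto
    moreover have "countable ((\<lambda>(f, us). fint M f us) ` {(f, us). f \<in> funs L \<and> us \<in> lists A \<and> length us = farity L f})"
    proof (rule countable_subset)
      show "countable ((\<lambda>(f, us). fint M f us) ` (funs L \<times> lists A))"
        using L A by (intro countable_image countable_SIGMA countable_lists) (auto simp: countable_lang_def)
    qed auto
    ultimately show "countable (step A)" using A by (simp add: step_def)
  qed
  have "countable ((step ^^ n) (insert m0 X))" for n
    by (induction n) (use X cstep in auto)
  then have cS: "countable S" by (simp add: S_def)
  have sstep: "A \<subseteq> univ M \<Longrightarrow> step A \<subseteq> univ M" for A
  proof -
    assume A: "A \<subseteq> univ M"
    have "wit x \<in> univ M" for x using wit by (cases x) auto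
    moreover have "fint M f us \<in> univ M" if "f \<in> funs L" "\<forall>x\<in>set us. x \<in> A" "length us = farity L f" for f us
    proof -
      have "us \<in> lists (univ M)" using that(2) A by auto
      then show ?thesis using that M by (auto simp: is_struct_def)
    qed
    ultimately show "step A \<subseteq> univ M" using A by (auto simp: step_def)
  qed
  have "(step ^^ n) (insert m0 X) \<subseteq> univ M" for n
    by (induction n) (use X m0 sstep in auto)
  then have SM: "S \<subseteq> univ M" by (auto simp: S_def)
  have stage: "us \<in> lists S \<Longrightarrow> \<exists>n. us \<in> lists ((step ^^ n) (insert m0 X))" for us
  proof (induction us)
    case (Cons u us)
    then obtain n n' where n: "u \<in> (step ^^ n) (insert m0 X)" "us \<in> lists ((step ^^ n') (insert m0 X))"
      by (auto simp: S_def)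
    have "u \<in> (step ^^ (n + n')) (insert m0 X)" "us \<in> lists ((step ^^ (n + n')) (insert m0 X))"
      using n(1) mono[of n "insert m0 X" n'] subsetD[OF lists_mono[OF mono[of n' "insert m0 X" n]] n(2)]
      by (auto simp: add.commute)
    then show ?case by (intro exI[of _ "n + n'"]) auto
  qed auto
  have sub: "step ((step ^^ n) (insert m0 X)) \<subseteq> S" for n
    unfolding S_def by (rule subset_trans[OF _ UN_upper[of "Suc n"]]) auto
  have witS: "wit (\<psi>, x, us) \<in> S" if that': "wf_fm L \<psi>" "us \<in> lists S" for \<psi> x us
  proof -
    obtain n where "us \<in> lists ((step ^^ n) (insert m0 X))" using stage[OF that'(2)] by blast
    then have "wit (\<psi>, x, us) \<in> step ((step ^^ n) (insert m0 X))" using that' by (auto simp: step_def)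
    then show ?thesis using sub by blast
  qed
  have funS: "fint M f us \<in> S" if that': "f \<in> funs L" "us \<in> lists S" "length us = farity L f" for f us
  proof -
    obtain n where "us \<in> lists ((step ^^ n) (insert m0 X))" using stage[OF that'(2)] by blast
    then have "fint M f us \<in> step ((step ^^ n) (insert m0 X))" using that' by (force simp: step_def)
    then show ?thesis using sub by blast
  qed
  have X_S: "insert m0 X \<subseteq> S" unfolding S_def by (rule subset_trans[OF _ UN_upper[of 0]]) auto
  define M0 where "M0 = M\<lparr>univ := S\<rparr>"
  have val: "val M0 e t = val M e t" for e t
    by (induction t) (auto simp: M0_def cong: map_cong)
  have elem: "range e \<subseteq> S \<Longrightarrow> wf_fm L \<phi> \<Longrightarrow> sat M0 e \<phi> \<longleftrightarrow> sat M e \<phi>" for e \<phi>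
  proof (induction \<phi> arbitrary: e)
    case (Rel r ts)
    then show ?case by (simp add: M0_def val[unfolded M0_def] cong: map_cong)
  next
    case (All x \<phi>)
    have IH: "sat M0 (e(x := u)) \<phi> \<longleftrightarrow> sat M (e(x := u)) \<phi>" if "u \<in> S" for u
      using All that by (intro All.IH) auto
    have "sat M (e(x := u)) \<phi>" if *: "\<forall>u\<in>S. sat M (e(x := u)) \<phi>" and u: "u \<in> univ M" for u
    proof (rule ccontr)
      assume neg: "\<not> sat M (e(x := u)) \<phi>"
      obtain k where k: "fv \<phi> \<subseteq> {..<k}" using finite_fv[of \<phi>] finite_nat_iff_bounded by blast
      define us where "us = map e [0..<k]"
      have eq: "sat M ((\<lambda>i. us ! i)(x := w)) \<phi> \<longleftrightarrow> sat M (e(x := w)) \<phi>" for w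
        by (rule sat_cong) (use k in \<open>auto simp: us_def\<close>)
      have usS: "us \<in> lists S" using range_subsetD[OF All.prems(1)] by (auto simp: us_def)
      have "sat M ((\<lambda>i. us ! i)(x := u)) (Neg \<phi>)" using neg eq[of u] by simp
      then have "sat M ((\<lambda>i. us ! i)(x := wit (Neg \<phi>, x, us))) (Neg \<phi>)" using wit u by blast
      then have "\<not> sat M (e(x := wit (Neg \<phi>, x, us))) \<phi>" using eq by simp
      moreover have "wit (Neg \<phi>, x, us) \<in> S" using witS usS All.prems by simp
      ultimately show False using * by blast
    qed
    then show ?case using IH SM by (auto simp: M0_def)
  qed (auto simp: val)
  show thesis
  proof (rule that[of M0])
    show "is_struct L M0" using X_S funS by (auto simp: is_struct_def M0_def)
  qed (use cS X_S SM elem in \<open>auto simp: M0_def\<close>)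
qed

section \<open>Nonprincipal ultrafilters on the natural numbers\<close>

locale nonprincipal_ultrafilter =
  fixes U :: "nat set set"
  assumes U_Int: "A \<in> U \<Longrightarrow> B \<in> U \<Longrightarrow> A \<inter> B \<in> U"
    and U_up: "A \<in> U \<Longrightarrow> A \<subseteq> B \<Longrightarrow> B \<in> U"
    and U_compl: "- A \<in> U \<longleftrightarrow> A \<notin> U"
    and U_cofinite: "finite (- A) \<Longrightarrow> A \<in> U"
begin

lemma U_UNIV: "UNIV \<in> U"
  using U_cofinite by simp

lemma U_not_empty: "{} \<notin> U"
  using U_compl[of UNIV] U_UNIV by simp

lemma U_finite_Inter: "finite I \<Longrightarrow> (\<And>i. i \<in> I \<Longrightarrow> {n. P i n} \<in> U) \<Longrightarrow> {n. \<forall>i\<in>I. P i n} \<in> U"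
proof (induction I rule: finite_induct)
  case (insert i I)
  then have "{n. P i n} \<inter> {n. \<forall>i\<in>I. P i n} \<in> U" by (intro U_Int) auto
  moreover have "{n. P i n} \<inter> {n. \<forall>i\<in>I. P i n} = {n. \<forall>i\<in>insert i I. P i n}" by auto
  ultimately show ?case by simp
qed (simp add: U_UNIV)

lemma U_iff:
  assumes "{n. P n \<longleftrightarrow> Q n} \<in> U"
  shows "{n. P n} \<in> U \<longleftrightarrow> {n. Q n} \<in> U"
proof -
  have "{n. P n \<longleftrightarrow> Q n} \<inter> {n. P n} \<subseteq> {n. Q n}" "{n. P n \<longleftrightarrow> Q n} \<inter> {n. Q n} \<subseteq> {n. P n}" by auto
  then show ?thesis using U_Int[OF assms] U_up by meson
qed

lemma U_Collect_not: "{n. \<not> P n} \<in> U \<longleftrightarrow> {n. P n} \<notin> U"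
  using U_compl[of "{n. P n}"] by (simp add: Collect_neg_eq)

lemma U_Collect_imp: "{n. P n \<longrightarrow> Q n} \<in> U \<longleftrightarrow> ({n. P n} \<in> U \<longrightarrow> {n. Q n} \<in> U)"
proof -
  have 1: "{n. P n \<longrightarrow> Q n} \<inter> {n. P n} \<subseteq> {n. Q n}" and 2: "{n. Q n} \<subseteq> {n. P n \<longrightarrow> Q n}"
    and 3: "{n. \<not> P n} \<subseteq> {n. P n \<longrightarrow> Q n}" by auto
  show ?thesis using U_up[OF _ 1] U_up[OF _ 2] U_up[OF _ 3] U_Int U_Collect_not[of P] by blast
qed

end

text \<open>Zorn's lemma for the proper filters that contain all cofinite sets.\<close>

lemma nonprincipal_ultrafilter_exists: "\<exists>U. nonprincipal_ultrafilter U"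
proof -
  let ?A = "{U :: nat set set. (\<forall>A. finite (- A) \<longrightarrow> A \<in> U) \<and> (\<forall>A\<in>U. \<forall>B\<in>U. A \<inter> B \<in> U) \<and>
     (\<forall>A\<in>U. \<forall>B. A \<subseteq> B \<longrightarrow> B \<in> U) \<and> {} \<notin> U}"
  have "\<exists>M\<in>?A. \<forall>X\<in>?A. M \<subseteq> X \<longrightarrow> X = M"
  proof (rule subset_Zorn_nonempty)
    have "{A :: nat set. finite (- A)} \<in> ?A"
      by (auto intro: finite_subset)
    then show "?A \<noteq> {}" by blast
  next
    fix C assume C: "C \<noteq> {}" "subset.chain ?A C"
    then have sub: "C \<subseteq> ?A" and chain: "\<And>X Y. X \<in> C \<Longrightarrow> Y \<in> C \<Longrightarrow> X \<subseteq> Y \<or> Y \<subseteq> X"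
      by (auto simp: subset_chain_def)
    have "A \<inter> B \<in> \<Union>C" if AB: "A \<in> \<Union>C" "B \<in> \<Union>C" for A B
    proof -
      obtain X Y where XY: "X \<in> C" "Y \<in> C" "A \<in> X" "B \<in> Y" using AB by auto
      then have "\<exists>Z\<in>C. A \<in> Z \<and> B \<in> Z" using chain[of X Y] by blast
      then obtain Z where Z: "Z \<in> C" "A \<in> Z" "B \<in> Z" by blast
      then have "A \<inter> B \<in> Z" using sub by blast
      then show ?thesis using Z by blast
    qed
    moreover have "A \<in> \<Union>C" if "finite (- A)" for A
    proof -
      obtain X where X: "X \<in> C" using C(1) by auto
      then have "A \<in> X" using sub that by blast
      then show ?thesis using X by blast
    qed
    moreover have "B \<in> \<Union>C" if AB: "A \<in> \<Union>C" "A \<subseteq> B" for A B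
    proof -
      obtain X where X: "X \<in> C" "A \<in> X" using AB by auto
      then have "B \<in> X" using sub AB(2) by blast
      then show ?thesis using X by blast
    qed
    moreover have "{} \<notin> \<Union>C" using sub by blast
    ultimately show "\<Union>C \<in> ?A" by blast
  qed
  then obtain U where U: "U \<in> ?A" and max: "\<forall>X\<in>?A. U \<subseteq> X \<longrightarrow> X = U" by (rule bexE)
  have int: "\<And>A B. A \<in> U \<Longrightarrow> B \<in> U \<Longrightarrow> A \<inter> B \<in> U" and up: "\<And>A B. A \<in> U \<Longrightarrow> A \<subseteq> B \<Longrightarrow> B \<in> U"
    and cof: "\<And>A. finite (- A) \<Longrightarrow> A \<in> U" and ne: "{} \<notin> U" using U by blast+
  have compl: "- A \<in> U" if A: "A \<notin> U" for A
  proof (rule ccontr)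
    assume nA: "- A \<notin> U"
    \<comment> \<open>The filter generated by \<open>U\<close> and \<open>A\<close>; it is proper
      because \<open>- A\<close> is not in \<open>U\<close>, and so it contradicts
      maximality.\<close>
    let ?X = "{X. \<exists>B\<in>U. B \<inter> A \<subseteq> X}"
    have x1: "{} \<notin> ?X"
    proof
      assume "{} \<in> ?X"
      then obtain B where "B \<in> U" "B \<subseteq> - A" by auto
      then show False using up nA by blast
    qed
    have x2: "X \<inter> Y \<in> ?X" if XY: "X \<in> ?X" "Y \<in> ?X" for X Y
    proof -
      obtain B B' where "B \<in> U" "B' \<in> U" "B \<inter> A \<subseteq> X" "B' \<inter> A \<subseteq> Y" using XY by blast
      then show ?thesis using int[of B B'] by blast
    qed
    have sub: "U \<subseteq> ?X" by blast
    have x3: "Y \<in> ?X" if "X \<in> ?X" "X \<subseteq> Y" for X Y using that by blast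
    have x4: "X \<in> ?X" if "finite (- X)" for X using cof[OF that] sub by blast
    have "V \<in> ?A" if "\<forall>A. finite (- A) \<longrightarrow> A \<in> V" "\<forall>A\<in>V. \<forall>B\<in>V. A \<inter> B \<in> V"
      "\<forall>A\<in>V. \<forall>B. A \<subseteq> B \<longrightarrow> B \<in> V" "{} \<notin> V" for V
      using that by simp
    then have "?X \<in> ?A"
    proof this
      show "\<forall>A\<in>?X. \<forall>B\<in>?X. A \<inter> B \<in> ?X" by (intro ballI) (rule x2)
      show "\<forall>A\<in>?X. \<forall>B. A \<subseteq> B \<longrightarrow> B \<in> ?X" by (intro ballI allI impI) (rule x3)
      show "\<forall>A. finite (- A) \<longrightarrow> A \<in> ?X" by (intro allI impI) (rule x4)
    qed (rule x1)
    then have "?X = U" using bspec[OF max] sub by simp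
    moreover have "A \<in> ?X" using cof[of UNIV] by auto
    ultimately show False using A by blast
  qed
  have "nonprincipal_ultrafilter U"
  proof
    show "- A \<in> U \<longleftrightarrow> A \<notin> U" for A using compl[of A] int[of A "- A"] ne by auto
  qed (use int up cof in auto)
  then show ?thesis by blast
qed

text \<open>Classes of sequences have to be elements of \<open>'u\<close> again. Of the injection
  \<open>code\<close> that achieves this, only its kernel is prescribed.\<close>

locale ultrapower = nonprincipal_ultrafilter U for U +
  fixes L :: "('f, 'r) lang" and M :: "('f, 'r, 'u) fo_struct" and code :: "(nat \<Rightarrow> 'u) \<Rightarrow> 'u"
  assumes struct: "is_struct L M"
    and code_eq: "range f \<subseteq> univ M \<Longrightarrow> range g \<subseteq> univ M \<Longrightarrow> code f = code g \<longleftrightarrow> {n. f n = g n} \<in> U"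
begin

definition rep :: "'u \<Rightarrow> nat \<Rightarrow> 'u" where
  "rep x = (SOME f. range f \<subseteq> univ M \<and> code f = x)"

definition N :: "('f, 'r, 'u) fo_struct" where
  "N = \<lparr>univ = code ` {f. range f \<subseteq> univ M},
        fint = (\<lambda>f us. code (\<lambda>n. fint M f (map (\<lambda>x. rep x n) us))),
        rint = (\<lambda>r us. {n. rint M r (map (\<lambda>x. rep x n) us)} \<in> U)\<rparr>"

lemma rep: "x \<in> univ N \<Longrightarrow> range (rep x) \<subseteq> univ M \<and> code (rep x) = x"
proof -
  assume "x \<in> univ N"
  then obtain f where "range f \<subseteq> univ M \<and> code f = x" unfolding N_def by auto
  then show "range (rep x) \<subseteq> univ M \<and> code (rep x) = x" unfolding rep_def by (rule someI[of "\<lambda>f. range f \<subseteq> univ M \<and> code f = x"])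
qed

lemma rep_in: "x \<in> univ N \<Longrightarrow> rep x n \<in> univ M"
  using rep by blast

lemma code_in: "range f \<subseteq> univ M \<Longrightarrow> code f \<in> univ N"
  by (auto simp: N_def)

lemma rep_code: "range f \<subseteq> univ M \<Longrightarrow> {n. rep (code f) n = f n} \<in> U"
  using rep[OF code_in] code_eq by metis

lemma struct_N: "is_struct L N"
  unfolding is_struct_def
proof (intro conjI ballI impI)
  obtain m where "m \<in> univ M" using struct by (auto simp: is_struct_def)
  then show "univ N \<noteq> {}" using code_in[of "\<lambda>_. m"] by auto
  fix f us assume f: "f \<in> funs L" and us: "us \<in> lists (univ N)" "length us = farity L f"
  have "fint M f (map (\<lambda>x. rep x n) us) \<in> univ M" for n
    using struct f us rep_in unfolding is_struct_def by (auto simp: in_lists_conv_set)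
  then show "fint N f us \<in> univ N" by (auto simp: N_def)
qed

lemma los_val:
  assumes e: "range e \<subseteq> univ N"
  shows "wf_tm L t \<Longrightarrow> {n. rep (val N e t) n = val M (\<lambda>v. rep (e v) n) t} \<in> U"
proof (induction t)
  case (Var x)
  then show ?case by (simp add: U_UNIV)
next
  case (Fn f ts)
  have eN: "e v \<in> univ N" for v using e by auto
  have "val N e t \<in> univ N" if "t \<in> set ts" for t
    using that Fn.prems eN by (intro val_in[OF struct_N]) auto
  then have vM: "rep (val N e t) n \<in> univ M" if "t \<in> set ts" for t n using that rep_in by auto
  have "fint M f (map (\<lambda>x. rep x n) (map (val N e) ts)) \<in> univ M" for n
    using struct Fn.prems vM unfolding is_struct_def by (auto simp: in_lists_conv_set)
  then have "{n. rep (val N e (Fn f ts)) n = fint M f (map (\<lambda>x. rep x n) (map (val N e) ts))} \<in> U"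
    using rep_code[of "\<lambda>n. fint M f (map (\<lambda>x. rep x n) (map (val N e) ts))"] by (auto simp: N_def)
  moreover have "{n. \<forall>t\<in>set ts. rep (val N e t) n = val M (\<lambda>v. rep (e v) n) t} \<in> U"
    using Fn by (intro U_finite_Inter) auto
  ultimately have "{n. rep (val N e (Fn f ts)) n = fint M f (map (\<lambda>x. rep x n) (map (val N e) ts))} \<inter>
    {n. \<forall>t\<in>set ts. rep (val N e t) n = val M (\<lambda>v. rep (e v) n) t} \<in> U" by (rule U_Int)
  then show ?case
  proof (rule U_up, safe)
    fix n assume *: "rep (val N e (Fn f ts)) n = fint M f (map (\<lambda>x. rep x n) (map (val N e) ts))"
      "\<forall>t\<in>set ts. rep (val N e t) n = val M (\<lambda>v. rep (e v) n) t"
    have eq: "map (\<lambda>x. rep x n) (map (val N e) ts) = map (val M (\<lambda>v. rep (e v) n)) ts" using *(2) by simp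
    show "rep (val N e (Fn f ts)) n = val M (\<lambda>v. rep (e v) n) (Fn f ts)"
      unfolding *(1) eq by simp
  qed
qed

lemma los_rep:
  "range e \<subseteq> univ N \<Longrightarrow> wf_fm L \<phi> \<Longrightarrow> sat N e \<phi> \<longleftrightarrow> {n. sat M (\<lambda>v. rep (e v) n) \<phi>} \<in> U"
proof (induction \<phi> arbitrary: e)
  case Bot
  then show ?case by (simp add: U_not_empty)
next
  case (Eq s t)
  then have wf: "wf_tm L s" "wf_tm L t" by auto
  have eN: "e v \<in> univ N" for v using Eq by auto
  have vN: "val N e s \<in> univ N" "val N e t \<in> univ N" using eN wf by (auto intro!: val_in[OF struct_N])
  have "sat N e (Eq s t) \<longleftrightarrow> code (rep (val N e s)) = code (rep (val N e t))"
    using rep vN by simp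
  also have "\<dots> \<longleftrightarrow> {n. rep (val N e s) n = rep (val N e t) n} \<in> U"
    using rep vN by (intro code_eq) auto
  also have "\<dots> \<longleftrightarrow> {n. sat M (\<lambda>v. rep (e v) n) (Eq s t)} \<in> U"
    by (rule U_iff, rule U_up[OF U_Int[OF los_val[OF Eq.prems(1) wf(1)] los_val[OF Eq.prems(1) wf(2)]]]) auto
  finally show ?case .
next
  case (Rel r ts)
  have "{n. \<forall>t\<in>set ts. rep (val N e t) n = val M (\<lambda>v. rep (e v) n) t} \<in> U"
    using Rel los_val by (intro U_finite_Inter) auto
  then have "{n. rint M r (map (\<lambda>x. rep x n) (map (val N e) ts)) \<longleftrightarrow> sat M (\<lambda>v. rep (e v) n) (Rel r ts)} \<in> U"
  proof (rule U_up, safe)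
    fix n assume *: "\<forall>t\<in>set ts. rep (val N e t) n = val M (\<lambda>v. rep (e v) n) t"
    have eq: "map (\<lambda>x. rep x n) (map (val N e) ts) = map (val M (\<lambda>v. rep (e v) n)) ts" using * by simp
    show "rint M r (map (\<lambda>x. rep x n) (map (val N e) ts)) \<Longrightarrow> sat M (\<lambda>v. rep (e v) n) (Rel r ts)"
      "sat M (\<lambda>v. rep (e v) n) (Rel r ts) \<Longrightarrow> rint M r (map (\<lambda>x. rep x n) (map (val N e) ts))"
      unfolding eq by simp_all
  qed
  then show ?case using U_iff by (simp add: N_def)
next
  case (Imp \<phi> \<psi>)
  then show ?case by (simp add: U_Collect_imp)
next
  case (All x \<phi>)
  have IH: "sat N (e(x := u)) \<phi> \<longleftrightarrow> {n. sat M ((\<lambda>v. rep (e v) n)(x := rep u n)) \<phi>} \<in> U" if "u \<in> univ N" for u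
  proof -
    have "sat N (e(x := u)) \<phi> \<longleftrightarrow> {n. sat M (\<lambda>v. rep ((e(x := u)) v) n) \<phi>} \<in> U"
      using All that by (intro All.IH) auto
    moreover have "(\<lambda>v. rep ((e(x := u)) v) n) = (\<lambda>v. rep (e v) n)(x := rep u n)" for n by auto
    ultimately show ?thesis by simp
  qed
  show ?case
  proof
    assume *: "sat N e (All x \<phi>)"
    show "{n. sat M (\<lambda>v. rep (e v) n) (All x \<phi>)} \<in> U"
    proof (rule ccontr)
      assume "{n. sat M (\<lambda>v. rep (e v) n) (All x \<phi>)} \<notin> U"
      then have bad: "{n. \<not> sat M (\<lambda>v. rep (e v) n) (All x \<phi>)} \<in> U" by (simp only: U_Collect_not not_False_eq_True)
      obtain m where m: "m \<in> univ M" using struct by (auto simp: is_struct_def)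
      have "\<exists>w. w \<in> univ M \<and> (\<not> sat M (\<lambda>v. rep (e v) n) (All x \<phi>) \<longrightarrow> \<not> sat M ((\<lambda>v. rep (e v) n)(x := w)) \<phi>)" for n
        using m by auto
      then obtain w where w: "\<And>n. w n \<in> univ M"
        "\<And>n. \<not> sat M (\<lambda>v. rep (e v) n) (All x \<phi>) \<Longrightarrow> \<not> sat M ((\<lambda>v. rep (e v) n)(x := w n)) \<phi>" by metis
      have rw: "range w \<subseteq> univ M" using w(1) by auto
      have "{n. sat M ((\<lambda>v. rep (e v) n)(x := rep (code w) n)) \<phi>} \<in> U"
        using * IH[OF code_in[OF rw]] code_in[OF rw] by simp
      then have "{n. sat M ((\<lambda>v. rep (e v) n)(x := rep (code w) n)) \<phi>} \<inter> {n. rep (code w) n = w n} \<inter>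
        {n. \<not> sat M (\<lambda>v. rep (e v) n) (All x \<phi>)} \<in> U" using rep_code[OF rw] bad by (intro U_Int)
      moreover have "{n. sat M ((\<lambda>v. rep (e v) n)(x := rep (code w) n)) \<phi>} \<inter> {n. rep (code w) n = w n} \<inter>
        {n. \<not> sat M (\<lambda>v. rep (e v) n) (All x \<phi>)} = {}" using w(2) by (auto simp del: sat.simps)
      ultimately show False using U_not_empty by simp
    qed
  next
    assume *: "{n. sat M (\<lambda>v. rep (e v) n) (All x \<phi>)} \<in> U"
    have "sat N (e(x := u)) \<phi>" if u: "u \<in> univ N" for u
      unfolding IH[OF u] by (rule U_up[OF *]) (use rep_in[OF u] in auto)
    then show "sat N e (All x \<phi>)" by simp
  qed
qed

text \<open>Arbitrary sequences may replace the chosen representatives, since both agree almost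
  everywhere on the finitely many free variables.\<close>

lemma los:
  assumes E: "\<And>n v. E n v \<in> univ M" and \<phi>: "wf_fm L \<phi>"
  shows "sat N (\<lambda>v. code (\<lambda>n. E n v)) \<phi> \<longleftrightarrow> {n. sat M (E n) \<phi>} \<in> U"
proof -
  have in_M: "range (\<lambda>n. E n v) \<subseteq> univ M" for v using E by auto
  have "sat N (\<lambda>v. code (\<lambda>n. E n v)) \<phi> \<longleftrightarrow> {n. sat M (\<lambda>v. rep (code (\<lambda>n. E n v)) n) \<phi>} \<in> U"
    using code_in[OF in_M] \<phi> by (intro los_rep) auto
  also have "\<dots> \<longleftrightarrow> {n. sat M (E n) \<phi>} \<in> U"
  proof (rule U_iff)
    have "{n. \<forall>v\<in>fv \<phi>. rep (code (\<lambda>n. E n v)) n = E n v} \<in> U"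
      using rep_code[OF in_M] by (intro U_finite_Inter) auto
    then show "{n. sat M (\<lambda>v. rep (code (\<lambda>n. E n v)) n) \<phi> \<longleftrightarrow> sat M (E n) \<phi>} \<in> U"
    proof (rule U_up, clarify)
      fix n assume "\<forall>v\<in>fv \<phi>. rep (code (\<lambda>n. E n v)) n = E n v"
      then show "sat M (\<lambda>v. rep (code (\<lambda>n. E n v)) n) \<phi> \<longleftrightarrow> sat M (E n) \<phi>" by (intro sat_cong) auto
    qed
  qed
  finally show ?thesis .
qed

text \<open>A realization is built coordinatewise: at coordinate n it satisfies as long an initial
  part of an enumeration as possible. Whole assignments are realized instead of single elements, so
  \<open>V\<close> may be infinite.\<close>

lemma saturation:
  assumes \<Sigma>: "countable \<Sigma>" "\<And>\<phi>. \<phi> \<in> \<Sigma> \<Longrightarrow> wf_fm L \<phi>" and e: "range e \<subseteq> univ N"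
    and fin: "\<And>\<Sigma>0. finite \<Sigma>0 \<Longrightarrow> \<Sigma>0 \<subseteq> \<Sigma> \<Longrightarrow>
      \<exists>e'. range e' \<subseteq> univ N \<and> (\<forall>v. v \<notin> V \<longrightarrow> e' v = e v) \<and> (\<forall>\<phi>\<in>\<Sigma>0. sat N e' \<phi>)"
  shows "\<exists>e'. range e' \<subseteq> univ N \<and> (\<forall>v. v \<notin> V \<longrightarrow> e' v = e v) \<and> (\<forall>\<phi>\<in>\<Sigma>. sat N e' \<phi>)"
proof (cases "\<Sigma> = {}")
  case True
  then show ?thesis using e by auto
next
  case False
  define \<sigma> where "\<sigma> = from_nat_into \<Sigma>"
  have \<sigma>: "range \<sigma> = \<Sigma>" using range_from_nat_into[OF False \<Sigma>(1)] by (simp add: \<sigma>_def)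
  then have \<sigma>wf: "wf_fm L (\<sigma> j)" for j using \<Sigma>(2) by auto
  define E where "E = (\<lambda>n v. rep (e v) n)"
  have E: "E n v \<in> univ M" for n v using rep_in[OF range_subsetD[OF e]] by (simp add: E_def)
  define ok where "ok = (\<lambda>k n E'. range E' \<subseteq> univ M \<and> (\<forall>v. v \<notin> V \<longrightarrow> E' v = E n v) \<and> (\<forall>j<k. sat M E' (\<sigma> j)))"
  \<comment> \<open>The clause \<open>k \<le> n\<close> bounds the number of formulas tried at
    coordinate n, so the maximum \<open>K\<close> exists; each \<open>S k\<close> still belongs to
    the ultrafilter.\<close>
  define S where "S = (\<lambda>k. {n. k \<le> n \<and> (\<exists>E'. ok k n E')})"
  have SU: "S k \<in> U" for k
  proof -
    have "finite (\<sigma> ` {..<k})" "\<sigma> ` {..<k} \<subseteq> \<Sigma>" using \<sigma> by auto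
    then obtain e' where e': "range e' \<subseteq> univ N" "\<forall>v. v \<notin> V \<longrightarrow> e' v = e v" "\<forall>\<phi>\<in>\<sigma> ` {..<k}. sat N e' \<phi>"
      using fin by meson
    have "{n. sat M (\<lambda>v. rep (e' v) n) (\<sigma> j)} \<in> U" if "j \<in> {..<k}" for j
      using los_rep[OF e'(1) \<sigma>wf] e'(3) that by auto
    then have "{n. \<forall>j\<in>{..<k}. sat M (\<lambda>v. rep (e' v) n) (\<sigma> j)} \<in> U" by (intro U_finite_Inter) auto
    moreover have "{n. k \<le> n} \<in> U" by (rule U_cofinite) (simp add: Compl_eq not_le)
    ultimately have "{n. \<forall>j\<in>{..<k}. sat M (\<lambda>v. rep (e' v) n) (\<sigma> j)} \<inter> {n. k \<le> n} \<in> U" by (rule U_Int)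
    then show ?thesis
    proof (rule U_up, safe)
      fix n assume n: "k \<le> n" "\<forall>j\<in>{..<k}. sat M (\<lambda>v. rep (e' v) n) (\<sigma> j)"
      have "range (\<lambda>v. rep (e' v) n) \<subseteq> univ M" using rep_in e'(1) by auto
      then have "ok k n (\<lambda>v. rep (e' v) n)" using n e' by (auto simp: ok_def E_def)
      then show "n \<in> S k" using n by (auto simp: S_def)
    qed
  qed
  have ok_mono: "ok k n E' \<Longrightarrow> j \<le> k \<Longrightarrow> ok j n E'" for j k n E' by (auto simp: ok_def)
  have S0: "n \<in> S 0" for n using E by (auto simp: S_def ok_def)
  define K where "K = (\<lambda>n. Max {k. n \<in> S k})"
  have finK: "finite {k. n \<in> S k}" for n by (rule finite_subset[of _ "{..n}"]) (auto simp: S_def)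
  have "n \<in> S (K n)" for n using Max_in[OF finK[of n]] S0[of n] by (auto simp: K_def)
  then have "\<exists>E'. ok (K n) n E'" for n by (auto simp: S_def)
  then obtain E' where E': "\<And>n. ok (K n) n (E' n)" by metis
  have E'M: "E' n v \<in> univ M" for n v using E'[of n] by (auto simp: ok_def)
  define e' where "e' = (\<lambda>v. code (\<lambda>n. E' n v))"
  have "e' v \<in> univ N" for v unfolding e'_def by (rule code_in) (use E'M in auto)
  moreover have "e' v = e v" if "v \<notin> V" for v
  proof -
    have "(\<lambda>n. E' n v) = rep (e v)" using E' that by (auto simp: ok_def E_def)
    then show ?thesis using rep[of "e v"] e by (auto simp: e'_def)
  qed
  moreover have "sat N e' (\<sigma> j)" for j
    unfolding e'_def los[OF E'M \<sigma>wf]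
  proof (rule U_up[OF SU[of "Suc j"]], safe)
    fix n assume "n \<in> S (Suc j)"
    then have "Suc j \<le> K n" using Max_ge[OF finK[of n]] by (auto simp: K_def)
    then show "sat M (E' n) (\<sigma> j)" using E'[of n] by (auto simp: ok_def)
  qed
  ultimately show ?thesis using \<sigma> by (intro exI[of _ e']) auto
qed

end

lemma ultrapower_exists:
  fixes M :: "('f, 'r, 'u) fo_struct" and c :: "nat set \<Rightarrow> 'u"
  assumes c: "inj c" and M: "is_struct L M" "countable (univ M)"
  obtains U code where "ultrapower U L M code"
proof -
  obtain U where U: "nonprincipal_ultrafilter U" using nonprincipal_ultrafilter_exists by blast
  interpret nonprincipal_ultrafilter U by (rule U)
  let ?D = "{f :: nat \<Rightarrow> 'u. range f \<subseteq> univ M}"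
  define g where "g = to_nat_on (univ M)"
  have g: "inj_on g (univ M)" unfolding g_def using M(2) by (rule inj_on_to_nat_on)
  \<comment> \<open>A sequence becomes its graph, coded as a set of numbers, which \<open>c\<close>
    sends into \<open>'u\<close>.\<close>
  define J where "J = (\<lambda>f. c (range (\<lambda>n. prod_encode (n, g (f n)))))"
  have J: "f = h" if fh: "f \<in> ?D" "h \<in> ?D" and eq: "J f = J h" for f h
  proof
    fix n
    have "range (\<lambda>n. prod_encode (n, g (f n))) = range (\<lambda>n. prod_encode (n, g (h n)))"
      using c eq by (auto simp: J_def inj_def)
    then have "prod_encode (n, g (f n)) \<in> range (\<lambda>n. prod_encode (n, g (h n)))" by blast
    then have "g (f n) = g (h n)" by auto
    moreover have "f n \<in> univ M" "h n \<in> univ M" using fh by (auto dest: range_subsetD)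
    ultimately show "f n = h n" using g by (auto simp: inj_on_def)
  qed
  \<comment> \<open>The predicate under \<open>SOME\<close> depends only on the class of
    \<open>f\<close>, so equivalent sequences get the same representative.\<close>
  define cl where "cl = (\<lambda>f. SOME h. h \<in> ?D \<and> {n. f n = h n} \<in> U)"
  have cl: "cl f \<in> ?D \<and> {n. f n = cl f n} \<in> U" if "f \<in> ?D" for f
    unfolding cl_def by (rule someI[of _ f]) (use that U_UNIV in auto)
  have trans: "{n. f n = k n} \<in> U" if "{n. f n = h n} \<in> U" "{n. h n = k n} \<in> U" for f h k :: "nat \<Rightarrow> 'u"
    by (rule U_up[OF U_Int[OF that]]) auto
  have sym: "{n. f n = h n} \<in> U \<longleftrightarrow> {n. h n = f n} \<in> U" for f h :: "nat \<Rightarrow> 'u"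
    by (simp add: eq_commute)
  have cl_eq: "cl f = cl h \<longleftrightarrow> {n. f n = h n} \<in> U" if fh: "f \<in> ?D" "h \<in> ?D" for f h
  proof
    assume "cl f = cl h"
    then have "{n. cl f n = h n} \<in> U" using cl[OF fh(2)] sym[of h] by auto
    then show "{n. f n = h n} \<in> U" using cl[OF fh(1)] trans by blast
  next
    assume eq: "{n. f n = h n} \<in> U"
    have "{n. f n = k n} \<in> U \<longleftrightarrow> {n. h n = k n} \<in> U" for k using eq trans sym[of f h] by blast
    then show "cl f = cl h" by (simp add: cl_def)
  qed
  have "ultrapower U L M (\<lambda>f. J (cl f))"
  proof
    fix f h :: "nat \<Rightarrow> 'u" assume "range f \<subseteq> univ M" "range h \<subseteq> univ M"
    then have fh: "f \<in> ?D" "h \<in> ?D" by auto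
    have "J (cl f) = J (cl h) \<longleftrightarrow> cl f = cl h" 
      using J[OF conjunct1[OF cl[OF fh(1)]] conjunct1[OF cl[OF fh(2)]]] by metis
    then show "J (cl f) = J (cl h) \<longleftrightarrow> {n. f n = h n} \<in> U" using cl_eq[OF fh] by simp
  qed (rule M)
  then show thesis by (rule that)
qed

section \<open>Closed sets in colored structures\<close>

locale colored_setting = geometric_setting L T c
  for L :: "('f, 'r) lang" and T :: "('f, 'r) fm set" and c :: "nat set \<Rightarrow> 'u" +
  fixes \<alpha> :: real
  assumes alpha_pos: "0 < \<alpha>" and alpha_le: "\<alpha> \<le> 1"
begin

abbreviation cmdl :: "('f, 'r option, 'u) fo_struct \<Rightarrow> bool" where
  "cmdl M \<equiv> mdl (reduct M)"

abbreviation cdim :: "('f, 'r option, 'u) fo_struct \<Rightarrow> 'u set \<Rightarrow> 'u set \<Rightarrow> nat" where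
  "cdim M \<equiv> mdim (reduct M)"

abbreviation cacl :: "('f, 'r option, 'u) fo_struct \<Rightarrow> 'u set \<Rightarrow> 'u set" where
  "cacl M \<equiv> acl L (reduct M)"

text \<open>Closedness with respect to extensions by at most \<open>m\<close> points. Uncolored points can only
  increase the predimension, so only colored extensions are considered.\<close>

definition mclosed :: "nat \<Rightarrow> ('f, 'r option, 'u) fo_struct \<Rightarrow> 'u set \<Rightarrow> bool" where
  "mclosed m M X \<longleftrightarrow> (\<forall>Z. finite Z \<and> Z \<subseteq> colored M \<and> Z \<inter> X = {} \<and> card Z \<le> m \<longrightarrow>
     \<alpha> * card Z \<le> cdim M Z X)"

lemma mclosed_mono: "mclosed m M X \<Longrightarrow> m' \<le> m \<Longrightarrow> mclosed m' M X"
  by (auto simp: mclosed_def)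

lemma colored_subset: "colored M \<subseteq> univ M"
  by (auto simp: colored_def)

lemma cpregeometry: "cmdl M \<Longrightarrow> pregeometry (univ M) (cacl M)"
  using acl_pregeometry[of "reduct M"] by simp

lemma class_K_cmdl: "cmdl M \<Longrightarrow> class_K L T M"
  by (auto simp: class_K_def is_model_def univ_part_def entails_def)

lemma delta_eq:
  assumes "cmdl M" "A \<subseteq> univ M" "X \<subseteq> univ M"
  shows "delta L T \<alpha> M A X = cdim M A X - \<alpha> * card ((A - X) \<inter> colored M)"
  using dim_acl_in_eq[OF assms(1)] assms by (simp add: delta_def)

text \<open>Uncolored points only raise the dimension, so colored sets decide; over the empty base,
  all bounds m together cover every finite set.\<close>

lemma class_K_plus_iff:
  assumes M: "cmdl M"
  shows "class_K_plus L T \<alpha> M \<longleftrightarrow> (\<forall>m. mclosed m M {})"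
proof -
  interpret pregeometry "univ M" "cacl M" by (rule cpregeometry[OF M])
  show ?thesis
  proof
    assume K: "class_K_plus L T \<alpha> M"
    show "\<forall>m. mclosed m M {}"
      unfolding mclosed_def
    proof (intro allI impI, elim conjE)
      fix m Z assume Z: "finite Z" "Z \<subseteq> colored M"
      have ZU: "Z \<subseteq> univ M" using Z(2) colored_subset by (rule subset_trans)
      have "0 \<le> delta L T \<alpha> M Z {}" using K Z ZU unfolding class_K_plus_def by blast
      then show "\<alpha> * card Z \<le> cdim M Z {}"
        using Z delta_eq[OF M ZU, of "{}"] by (simp add: Int_absorb2)
    qed
  next
    assume m: "\<forall>m. mclosed m M {}"
    have "0 \<le> delta L T \<alpha> M A {}" if A: "finite A" "A \<subseteq> univ M" for A
    proof -
      have "\<alpha> * card (A \<inter> colored M) \<le> cdim M (A \<inter> colored M) {}"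
        using m[rule_format, of "card (A \<inter> colored M)"] A unfolding mclosed_def by auto
      also have "\<dots> \<le> cdim M A {}" using A dim_mono[of A "A \<inter> colored M" "{}"] by auto
      finally show ?thesis using delta_eq[OF M A(2), of "{}"] by simp
    qed
    then show "class_K_plus L T \<alpha> M" using class_K_cmdl[OF M] by (auto simp: class_K_plus_def)
  qed
qed

text \<open>Failure is existential: there are at most m distinct new colored points whose dimension
  over \<open>W\<close> is small, and \<open>dim_witness\<close> enforces that by a formula. The
  negations of such formulas carry \<open>mclosed\<close> through theories, ultrapowers and
  types.\<close>

lemma not_mclosed_witness:
  assumes M: "cmdl M" and H: "range H \<subseteq> univ M" and W: "finite W" and n: "\<not> mclosed m M (H ` W)"
  obtains \<psi> where "wf_fm (Lp L) \<psi>" "fv \<psi> \<subseteq> W" "sat M H \<psi>"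
    "\<And>M' H'. cmdl M' \<Longrightarrow> range H' \<subseteq> univ M' \<Longrightarrow> sat M' H' \<psi> \<Longrightarrow> \<not> mclosed m M' (H' ` W)"
proof -
  obtain Z where Z: "finite Z" "Z \<subseteq> colored M" "Z \<inter> H ` W = {}" "card Z \<le> m"
    "cdim M Z (H ` W) < \<alpha> * card Z" using n by (auto simp: mclosed_def not_le)
  obtain zl where zl: "set zl = Z" "distinct zl" using finite_distinct_list[OF Z(1)] by auto
  let ?j = "length zl"
  have j: "?j = card Z" using zl distinct_card by fastforce
  obtain k where k: "W \<subseteq> {..<k}" using W finite_nat_iff_bounded by blast
  \<comment> \<open>The points of \<open>Z\<close> are named by variables beyond all those in
    \<open>W\<close>.\<close>
  let ?xs = "[k..<k + ?j]"
  have fresh: "x \<notin> W" if "x \<in> set ?xs" for x using that k by auto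
  define H1 where "H1 = (\<lambda>v. if v \<in> set ?xs then zl ! (v - k) else H v)"
  have ZU: "Z \<subseteq> univ M" using Z(2) colored_subset by (rule subset_trans)
  have H1: "range H1 \<subseteq> univ M" using H ZU zl by (auto simp: H1_def)
  have H1W: "H1 ` W = H ` W" using fresh by (auto simp: H1_def image_iff)
  have H1xs: "H1 ` set ?xs = Z"
  proof
    show "H1 ` set ?xs \<subseteq> Z" using zl by (auto simp: H1_def)
    show "Z \<subseteq> H1 ` set ?xs"
    proof
      fix z assume "z \<in> Z"
      then obtain i where i: "i < ?j" "z = zl ! i" using zl by (metis in_set_conv_nth)
      then have "z = H1 (k + i)" by (auto simp: H1_def)
      then show "z \<in> H1 ` set ?xs" using i by auto
    qed
  qed
  have H1inj: "inj_on H1 (set ?xs)" using zl by (auto simp: inj_on_def H1_def nth_eq_iff_index_eq)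
  have "mdim (reduct M) (H1 ` set ?xs) (H1 ` W) \<le> cdim M Z (H ` W)" by (simp only: H1xs H1W)
  then obtain \<chi> where \<chi>: "wf_fm L \<chi>" "qf \<chi>" "fv \<chi> \<subseteq> set ?xs \<union> W" "sat (reduct M) H1 \<chi>"
    "\<And>M' H'. mdl M' \<Longrightarrow> range H' \<subseteq> univ M' \<Longrightarrow> sat M' H' \<chi> \<Longrightarrow>
      mdim M' (H' ` set ?xs) (H' ` W) \<le> cdim M Z (H ` W)"
    using dim_witness[OF M, of H1 "set ?xs" W] H1 W by (metis List.finite_set reduct_simps(1))
  let ?F = "{lift_fm \<chi>} \<union> (\<lambda>x. Rel None [Var x]) ` set ?xs \<union>
     (\<lambda>(x, y). Neg (Eq (Var x) (Var y))) ` {(x, y) \<in> set ?xs \<times> (set ?xs \<union> W). x \<noteq> y}"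
  have finF: "finite ?F" using W by (intro finite_UnI finite_imageI) (auto intro: finite_subset[of _ "set ?xs \<times> (set ?xs \<union> W)"])
  define \<psi>0 where "\<psi>0 = fconj ?F"
  note \<psi>0 = fconj_simps[OF finF, folded \<psi>0_def]
  have F: "sat M' e \<psi>0 \<longleftrightarrow> sat (reduct M') e \<chi> \<and> (\<forall>x\<in>set ?xs. rint M' None [e x]) \<and>
     (\<forall>x\<in>set ?xs. \<forall>y\<in>set ?xs \<union> W. x \<noteq> y \<longrightarrow> e x \<noteq> e y)" for M' :: "('f, 'r option, 'u) fo_struct" and e
    unfolding \<psi>0(1) ball_Un ball_simps(9) by auto
  show thesis
  proof (rule that[of "foldr Ex ?xs \<psi>0"])
    show "wf_fm (Lp L) (foldr Ex ?xs \<psi>0)" using \<psi>0(3) \<chi>(1) by auto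
    have "fv \<psi>0 \<subseteq> set ?xs \<union> W" unfolding \<psi>0(2) using \<chi>(3) by auto
    then show "fv (foldr Ex ?xs \<psi>0) \<subseteq> W" by auto
    have "H1 x \<noteq> H1 y" if "x \<in> set ?xs" "y \<in> set ?xs \<union> W" "x \<noteq> y" for x y
    proof (cases "y \<in> set ?xs")
      case True
      then show ?thesis using that H1inj by (auto simp: inj_on_def)
    next
      case False
      then have "H1 y \<in> H ` W" "H1 x \<in> Z" using that H1W H1xs by blast+
      then show ?thesis using Z(3) by auto
    qed
    moreover have "rint M None [H1 x]" if "x \<in> set ?xs" for x
    proof -
      have "H1 x \<in> colored M" using that H1xs Z(2) by blast
      then show ?thesis by (simp add: colored_def)
    qed
    ultimately have "sat M H1 \<psi>0" using \<chi>(4) F by blast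
    then show "sat M H (foldr Ex ?xs \<psi>0)"
      unfolding sat_foldr_Ex using H1 by (intro exI[of _ H1]) (auto simp: H1_def)
  next
    fix M' :: "('f, 'r option, 'u) fo_struct" and H' :: "nat \<Rightarrow> 'u"
    assume M': "cmdl M'" "range H' \<subseteq> univ M'" "sat M' H' (foldr Ex ?xs \<psi>0)"
    then obtain e where e: "\<forall>x. x \<notin> set ?xs \<longrightarrow> e x = H' x" "\<forall>x\<in>set ?xs. e x \<in> univ M'" "sat M' e \<psi>0"
      unfolding sat_foldr_Ex by blast
    have eU: "range e \<subseteq> univ M'"
    proof clarify
      fix x show "e x \<in> univ M'" using e(1,2) M'(2) by (cases "x \<in> set ?xs") auto
    qed
    have eW: "e ` W = H' ` W" by (rule image_cong) (use e(1) fresh in blast)+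
    note e3 = e(3)[unfolded F]
    have inj: "inj_on e (set ?xs)" using e3 unfolding inj_on_def by blast
    let ?Z = "e ` set ?xs"
    have cardZ: "card ?Z = card Z" using inj j by (simp add: card_image)
    have "?Z \<subseteq> colored M'" using e3 e(2) unfolding colored_def by blast
    moreover have "e x \<noteq> e y" if "x \<in> set ?xs" "y \<in> W" for x y
    proof -
      have "x \<noteq> y" using fresh[OF that(1)] that(2) by auto
      then show ?thesis using e3[THEN conjunct2, THEN conjunct2, rule_format, of x y] that by simp
    qed
    then have "?Z \<inter> e ` W = {}" by blast
    then have "?Z \<inter> H' ` W = {}" by (simp only: eW)
    moreover have "cdim M' ?Z (H' ` W) \<le> cdim M Z (H ` W)"
      using \<chi>(5)[of "reduct M'" e] M'(1) eU e3 eW by simp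
    then have "cdim M' ?Z (H' ` W) < \<alpha> * card ?Z" using Z(5) cardZ by simp
    ultimately show "\<not> mclosed m M' (H' ` W)"
      unfolding mclosed_def using cardZ Z(4) by (metis List.finite_set finite_imageI not_le)
  qed
qed

section \<open>Rich structures as models of the theory\<close>

abbreviation rich :: "('f, 'r option, 'u) fo_struct \<Rightarrow> bool" where
  "rich M \<equiv> rich_struct L T \<alpha> M"

lemma rich_cmdl: "rich M \<Longrightarrow> cmdl M"
  by (simp add: rich_struct_def)

lemma rich_mclosed: "rich M \<Longrightarrow> mclosed m M {}"
  using class_K_plus_iff by (auto simp: rich_struct_def)

lemma true_in_lift [simp]: "true_in M (lift_fm \<sigma>) \<longleftrightarrow> true_in (reduct M) \<sigma>"
  by (simp add: true_in_def)

lemma extension_axiom_sentence: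
  assumes "formula_in L m \<psi>D" "formula_in L m \<psi>d" "formula_in L (m + n) \<phi>"
  shows "sentence (Lp L) (extension_axiom m n C \<psi>D \<psi>d \<phi>)"
proof -
  have "fv (foldr Con (color_literals m n C) (lift_fm \<phi>)) \<subseteq> {..<m + n}"
    using assms by (auto simp: color_literals_def formula_in_def)
  then show ?thesis
    using assms by (auto simp: sentence_def extension_axiom_def formula_in_def color_literals_def)
qed

text \<open>The theory is given as the set of consequences of richness, so each clause of richness
  has to be recovered from sentences. For nonnegative predimension these are the negated witnesses
  of failing closedness over the empty set.\<close>

lemma model_T_alpha_rich:
  assumes M: "is_model (Lp L) (T_alpha TYPE('u) L T \<alpha>) M"
  shows "rich M"
proof -
  have *: "true_in M \<sigma>" if "sentence (Lp L) \<sigma>" "\<And>M' :: ('f, 'r option, 'u) fo_struct. rich M' \<Longrightarrow> true_in M' \<sigma>" for \<sigma>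
    using M that by (auto simp: is_model_def T_alpha_def)
  have struct: "is_struct (Lp L) M" using M by (simp add: is_model_def)
  have "true_in (reduct M) \<sigma>" if "\<sigma> \<in> T" for \<sigma>
  proof -
    have "true_in M (lift_fm \<sigma>)"
    proof (rule *)
      show "sentence (Lp L) (lift_fm \<sigma>)" using sentences[OF that] by (simp add: sentence_def)
      show "true_in M' (lift_fm \<sigma>)" if "rich M'" for M' :: "('f, 'r option, 'u) fo_struct"
        using rich_cmdl[OF that] \<open>\<sigma> \<in> T\<close> by (simp add: is_model_def)
    qed
    then show ?thesis by simp
  qed
  then have cM: "cmdl M" using struct by (simp add: is_model_def)
  have "mclosed m M {}" for m
  proof (rule ccontr)
    assume n: "\<not> mclosed m M {}"
    obtain u where u: "u \<in> univ M" using struct by (auto simp: is_struct_def)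
    then have r: "range (\<lambda>_. u) \<subseteq> univ M" by auto
    obtain \<psi> where \<psi>: "wf_fm (Lp L) \<psi>" "fv \<psi> \<subseteq> {}" "sat M (\<lambda>_. u) \<psi>"
      "\<And>M' H'. cmdl M' \<Longrightarrow> range H' \<subseteq> univ M' \<Longrightarrow> sat M' H' \<psi> \<Longrightarrow> \<not> mclosed m M' (H' ` {})"
      using not_mclosed_witness[OF cM r, of "{}" m] n by auto
    have "true_in M (Neg \<psi>)"
    proof (rule *)
      show "sentence (Lp L) (Neg \<psi>)" using \<psi> by (simp add: sentence_def)
      show "true_in M' (Neg \<psi>)" if "rich M'" for M' :: "('f, 'r option, 'u) fo_struct"
        using \<psi>(4)[OF rich_cmdl[OF that]] rich_mclosed[OF that] by (auto simp: true_in_def)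
    qed
    then show False using \<psi>(3) r by (simp add: true_in_def)
  qed
  moreover have "true_in M \<sigma>" if "\<sigma> \<in> extension_axioms TYPE('u) L T \<alpha>" for \<sigma>
  proof (rule *)
    show "sentence (Lp L) \<sigma>" using that
      by (auto simp: extension_axioms_def defines_D_def defines_d_def strong_formula_def
          intro!: extension_axiom_sentence)
    show "true_in M' \<sigma>" if "rich M'" for M' :: "('f, 'r option, 'u) fo_struct"
      using that \<open>\<sigma> \<in> _\<close> by (simp add: rich_struct_def)
  qed
  ultimately show ?thesis using cM class_K_plus_iff[OF cM] by (simp add: rich_struct_def)
qed

end

section \<open>Rational approximation of the weight\<close>

text \<open>Dirichlet's pigeonhole argument gives a small residue of unknown sign; a negative one is
  added up almost to -1, which leaves a small positive residue.\<close>

lemma small_positive_residue: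
  fixes \<beta> \<delta> :: real
  assumes "\<delta> > 0"
  shows "\<exists>K\<ge>l. \<exists>z::int. z \<le> real K * \<beta> \<and> real K * \<beta> - z < \<delta>"
proof -
  obtain m :: nat where m: "m > 0" "1 / real m < \<delta>"
    using reals_Archimedean[OF assms] by (metis inverse_eq_divide zero_less_Suc)
  \<comment> \<open>Only multiples of \<open>Suc l\<close> are compared, so any difference of two of
    them exceeds l.\<close>
  let ?l = "Suc l"
  define f where "f = (\<lambda>j::nat. frac (real (j * ?l) * \<beta>))"
  define box where "box = (\<lambda>j. nat \<lfloor>real m * f j\<rfloor>)"
  have f01: "0 \<le> f j" "f j < 1" for j by (auto simp: f_def frac_lt_1)
  have "box j < m" for j
  proof -
    have "real m * f j < m" using f01[of j] m by simp
    then show ?thesis using f01[of j] by (simp add: box_def nat_less_iff floor_less_iff)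
  qed
  then have "box ` {..m} \<subseteq> {..<m}" by auto
  then have "card (box ` {..m}) \<le> m" using card_mono[of "{..<m}" "box ` {..m}"] by simp
  then have "card (box ` {..m}) < card {..m}" by simp
  then have "\<not> inj_on box {..m}" by (rule pigeonhole)
  then obtain i j where ij: "i < j" "box i = box j"
    unfolding inj_on_def by (metis linorder_neqE_nat)
  have fl: "\<lfloor>real m * f i\<rfloor> = \<lfloor>real m * f j\<rfloor>"
    using ij(2) f01[of i] f01[of j] by (simp add: box_def nat_eq_iff split: if_splits)
  have "\<bar>real m * f j - real m * f i\<bar> < 1" using fl by linarith
  then have "real m * \<bar>f j - f i\<bar> < 1" by (simp add: abs_mult flip: right_diff_distrib)
  then have d: "\<bar>f j - f i\<bar> < \<delta>" using m by (simp add: field_simps) (smt (verit) m(2) pos_less_divide_eq of_nat_0_less_iff mult.commute)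
  define D where "D = (j - i) * ?l"
  have "1 * ?l \<le> (j - i) * ?l" using ij by (intro mult_right_mono) auto
  then have Dl: "D \<ge> ?l" by (simp only: D_def mult_1)
  have rD: "real D = (real j - real i) * real ?l"
    using ij by (simp add: D_def of_nat_diff del: mult_Suc_right of_nat_Suc)
  obtain z :: int where z: "real D * \<beta> = z + (f j - f i)"
  proof -
    have "real D * \<beta> = (\<lfloor>real (j * ?l) * \<beta>\<rfloor> - \<lfloor>real (i * ?l) * \<beta>\<rfloor>) + (f j - f i)"
      unfolding rD f_def frac_def by (simp add: algebra_simps del: of_nat_Suc mult_Suc_right)
    then show thesis using that[of "\<lfloor>real (j * ?l) * \<beta>\<rfloor> - \<lfloor>real (i * ?l) * \<beta>\<rfloor>"] by simp
  qed
  show ?thesis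
  proof (cases "f j - f i \<ge> 0")
    case True
    then show ?thesis using z d Dl by (intro exI[of _ D]) (auto intro!: exI[of _ z])
  next
    case False
    \<comment> \<open>The residue is \<open>- y\<close>. With t the integer part of 1 / y, t copies
      add up to a value in [-1, y - 1), which exceeds -1 by less than y.\<close>
    define y where "y = f i - f j"
    have y: "0 < y" "y < \<delta>" "y < 1" using False d f01[of i] f01[of j] by (auto simp: y_def)
    define t where "t = nat \<lfloor>1 / y\<rfloor>"
    have fl1: "1 \<le> \<lfloor>1 / y\<rfloor>" using y by (simp add: le_floor_iff)
    have rt: "real t = of_int \<lfloor>1 / y\<rfloor>" unfolding t_def using fl1 by (intro of_nat_nat) linarith
    have t: "real t \<le> 1 / y" "1 / y < real t + 1" unfolding rt by linarith+
    have t1: "t \<ge> 1" unfolding t_def using fl1 by linarith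
    have ty: "real t * y \<le> 1" "1 < real t * y + y" using t y by (auto simp: field_simps)
    have eq: "real (t * D) * \<beta> = of_int (int t * z) - real t * y"
    proof -
      have "real (t * D) * \<beta> = real t * (real D * \<beta>)" by simp
      also have "\<dots> = real t * (of_int z - y)" unfolding z y_def by simp
      finally show ?thesis by (simp add: algebra_simps)
    qed
    have "t * D \<ge> l"
    proof -
      have "D \<le> t * D" using t1 by simp
      then show ?thesis using Dl by linarith
    qed
    then show ?thesis
      using eq ty y by (intro exI[of _ "t * D"] conjI exI[of _ "int t * z - 1"]) auto
  qed
qed

text \<open>M is K / \<alpha> rounded down, for a K of small residue. K and M will be the dimension
  and the number of colored points of an enlarged extension, r and b those before enlarging; the
  last clause makes the number of added points at least the added dimension.\<close>

lemma weight_approximation: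
  fixes \<alpha> \<epsilon> :: real
  assumes \<alpha>: "0 < \<alpha>" "\<alpha> \<le> 1" and \<epsilon>: "\<epsilon> > 0"
  obtains K M :: nat where "l \<le> K" "0 \<le> K - \<alpha> * M" "K - \<alpha> * M < \<epsilon>"
    "\<And>r b. b \<le> l \<Longrightarrow> \<alpha> * b \<le> real r \<Longrightarrow> K + b \<le> M + r"
proof (cases "\<alpha> = 1")
  case True
  \<comment> \<open>For \<alpha> = 1 equal weights have difference 0, and the last clause becomes b
    \<le> r.\<close>
  then show thesis using that[of l l] \<epsilon> by auto
next
  case False
  then have a1: "\<alpha> < 1" using \<alpha> by simp
  \<comment> \<open>Above this threshold K / \<alpha> exceeds K by at least l + 1, so M is at least
    K + l and the last clause holds for every r.\<close>
  define L' where "L' = max l (nat \<lceil>(real l + 1) / (1 / \<alpha> - 1)\<rceil>)"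
  obtain K z where K: "L' \<le> K" "real_of_int z \<le> real K * (1 / \<alpha>)" "real K * (1 / \<alpha>) - z < \<epsilon> / \<alpha>"
    using small_positive_residue[of "\<epsilon> / \<alpha>" L' "1 / \<alpha>"] \<alpha> \<epsilon> by (auto simp del: times_divide_eq_right)
  define M where "M = nat \<lfloor>real K * (1 / \<alpha>)\<rfloor>"
  have rM: "real M = of_int \<lfloor>real K * (1 / \<alpha>)\<rfloor>" using \<alpha> by (simp add: M_def)
  have M: "real M \<le> real K * (1 / \<alpha>)" "real K * (1 / \<alpha>) < real M + 1" unfolding rM by linarith+
  have zM: "real_of_int z \<le> real M" unfolding rM using K(2) by (simp add: le_floor_iff)
  show thesis
  proof (rule that[of K M])
    show "l \<le> K" using K by (simp add: L'_def)
    have "\<alpha> * M \<le> \<alpha> * (real K * (1 / \<alpha>))" using M(1) \<alpha> by (intro mult_left_mono) auto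
    then show "0 \<le> K - \<alpha> * M" using \<alpha> by simp
    have "real K * (1 / \<alpha>) - M < \<epsilon> / \<alpha>" using K(3) zM by linarith
    then have "\<alpha> * (real K * (1 / \<alpha>) - M) < \<alpha> * (\<epsilon> / \<alpha>)" using \<alpha> by (intro mult_strict_left_mono) auto
    then show "K - \<alpha> * M < \<epsilon>" using \<alpha> by (simp add: right_diff_distrib)
    fix r b assume b: "b \<le> l"
    have pos: "0 < 1 / \<alpha> - 1" using a1 \<alpha> by simp
    have "(real l + 1) / (1 / \<alpha> - 1) \<le> real L'" unfolding L'_def by linarith
    then have "(real l + 1) / (1 / \<alpha> - 1) \<le> real K" using K(1) by linarith
    then have "real l + 1 \<le> real K * (1 / \<alpha> - 1)" using pos by (simp add: pos_divide_le_eq)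
    then have "real l + real K \<le> real M" using M(2) by (simp add: algebra_simps)
    then show "K + b \<le> M + r" using b by linarith
  qed
qed

section \<open>Definability of generic extensions\<close>

context geometric_setting begin

abbreviation satm :: "('f, 'r, 'u) fo_struct \<Rightarrow> bool" where
  "satm M \<equiv> saturated_model L T M"

lemma satm_mdl: "satm M \<Longrightarrow> mdl M"
  by (simp add: saturated_model_def)

lemma tuples_append: "bs \<in> tuples M k \<Longrightarrow> cs \<in> tuples M n \<Longrightarrow> bs @ cs \<in> tuples M (k + n)"
  by (auto simp: tuples_def)

lemma formula_in_sub:
  assumes "wf_fm L \<phi>" "qf \<phi>" "\<And>x. x \<in> fv \<phi> \<Longrightarrow> s x < k"
  shows "formula_in L k (sub s \<phi>)"
  using assms by (auto simp: formula_in_def fv_sub)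

lemma acl_list_elim:
  assumes M: "mdl M" and bs: "bs \<in> tuples M k" and a: "a \<in> acl L M (set bs)"
  obtains \<theta> where "formula_in L (Suc k) \<theta>" "holds M \<theta> (bs @ [a])" "finite {c \<in> univ M. holds M \<theta> (bs @ [c])}"
proof -
  obtain \<phi> e v where \<phi>: "wf_fm L \<phi>" "qf \<phi>" "range e \<subseteq> univ M" "sat M (e(v := a)) \<phi>"
    "finite {c \<in> univ M. sat M (e(v := c)) \<phi>}" "e ` (fv \<phi> - {v}) \<subseteq> set bs"
    using acl_elim[OF M a] by blast
  have "\<exists>i<k. bs ! i = e x" if "x \<in> fv \<phi> - {v}" for x
  proof -
    have "e x \<in> set bs" using that \<phi>(6) by blast
    then show ?thesis using bs by (auto simp: in_set_conv_nth tuples_def)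
  qed
  then obtain ix where ix: "\<And>x. x \<in> fv \<phi> - {v} \<Longrightarrow> ix x < k \<and> bs ! ix x = e x" by metis
  define s where "s = (\<lambda>x. if x = v then k else ix x)"
  have eq: "holds M (sub s \<phi>) (bs @ [d]) \<longleftrightarrow> sat M (e(v := d)) \<phi>" for d
    unfolding holds_def sat_sub[OF \<phi>(2)]
    by (rule sat_cong) (use ix bs in \<open>auto simp: s_def nth_append tuples_def\<close>)
  show thesis
    by (rule that[of "sub s \<phi>"]) (use ix \<phi> eq in \<open>auto simp: s_def less_SucI intro!: formula_in_sub\<close>)
qed

text \<open>An infinite set is not covered by finitely many finite ones, so the type of a solution
  outside all finite sets definable over \<open>bs\<close> is finitely satisfiable.\<close>

lemma generic_point:
  assumes M: "satm M" and bs: "bs \<in> tuples M k" and \<chi>: "formula_in L (Suc k) \<chi>"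
    and inf: "infinite {c \<in> univ M. holds M \<chi> (bs @ [c])}"
  obtains a where "a \<in> univ M" "holds M \<chi> (bs @ [a])" "a \<notin> acl L M (set bs)"
proof -
  define A where "A = (\<lambda>\<theta>. {c \<in> univ M. holds M \<theta> (bs @ [c])})"
  define \<Sigma> where "\<Sigma> = insert \<chi> (Neg ` {\<theta>. formula_in L (Suc k) \<theta> \<and> finite (A \<theta>)})"
  have "\<exists>a\<in>univ M. \<forall>\<phi>\<in>\<Sigma>. holds M \<phi> (bs @ [a])"
  proof -
    have "\<exists>a\<in>univ M. \<forall>\<phi>\<in>\<Sigma>0. holds M \<phi> (bs @ [a])" if S: "\<Sigma>0 \<subseteq> \<Sigma>" "finite \<Sigma>0" for \<Sigma>0
    proof -
      have "inj (Neg :: ('f, 'r) fm \<Rightarrow> _)" by (auto simp: inj_def Neg_def)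
      then have "finite {\<theta>. Neg \<theta> \<in> \<Sigma>0}" using finite_vimageI[OF S(2)] by (simp add: vimage_def)
      then have "finite (\<Union>\<theta>\<in>{\<theta>. Neg \<theta> \<in> \<Sigma>0 \<and> finite (A \<theta>)}. A \<theta>)" by auto
      moreover have "infinite (A \<chi>)" using inf by (simp add: A_def)
      ultimately have "\<not> A \<chi> \<subseteq> (\<Union>\<theta>\<in>{\<theta>. Neg \<theta> \<in> \<Sigma>0 \<and> finite (A \<theta>)}. A \<theta>)" using finite_subset by blast
      then obtain a where a: "a \<in> A \<chi>" "a \<notin> (\<Union>\<theta>\<in>{\<theta>. Neg \<theta> \<in> \<Sigma>0 \<and> finite (A \<theta>)}. A \<theta>)"
        by blast
      have "holds M \<phi> (bs @ [a])" if \<phi>: "\<phi> \<in> \<Sigma>0" for \<phi>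
      proof (cases "\<phi> = \<chi>")
        case True
        then show ?thesis using a(1) by (simp add: A_def)
      next
        case False
        then obtain \<theta> where "\<phi> = Neg \<theta>" "finite (A \<theta>)" using subsetD[OF S(1) \<phi>] by (auto simp: \<Sigma>_def)
        then show ?thesis using a \<phi> by (auto simp: A_def holds_def)
      qed
      then show ?thesis using a(1) by (auto simp: A_def)
    qed
    moreover have "\<forall>\<phi>\<in>\<Sigma>. formula_in L (Suc k) \<phi>" using \<chi> by (auto simp: \<Sigma>_def formula_in_def)
    ultimately show ?thesis using M bs unfolding saturated_model_def aleph0_saturated_def by blast
  qed
  then obtain a where a: "a \<in> univ M" "\<And>\<phi>. \<phi> \<in> \<Sigma> \<Longrightarrow> holds M \<phi> (bs @ [a])" by blast
  have "a \<notin> acl L M (set bs)"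
  proof
    assume "a \<in> acl L M (set bs)"
    then obtain \<theta> where "formula_in L (Suc k) \<theta>" "holds M \<theta> (bs @ [a])" "finite {c \<in> univ M. holds M \<theta> (bs @ [c])}"
      using acl_list_elim[OF satm_mdl[OF M] bs] by blast
    then have "Neg \<theta> \<in> \<Sigma>" by (auto simp: \<Sigma>_def A_def)
    then show False using a(2)[OF \<open>Neg \<theta> \<in> \<Sigma>\<close>] \<open>holds M \<theta> (bs @ [a])\<close> by (auto simp: holds_def)
  qed
  then show thesis using that a by (simp add: \<Sigma>_def)
qed

lemma exists_transcendental:
  assumes M: "satm M" and A: "finite A" "A \<subseteq> univ M"
  obtains a where "a \<in> univ M" "a \<notin> acl L M A"
proof -
  obtain bs where bs: "set bs = A" using finite_list[OF A(1)] by auto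
  have "infinite (univ M)" using nofin satm_mdl[OF M] by (auto simp: no_finite_models_def)
  then have "infinite {c \<in> univ M. holds M (Neg Bot) (bs @ [c])}" by (simp add: holds_def)
  moreover have "bs \<in> tuples M (length bs)" "formula_in L (Suc (length bs)) (Neg Bot)"
    using A bs by (auto simp: tuples_def formula_in_def)
  ultimately show thesis using generic_point[OF M] that bs by blast
qed

text \<open>A tuple is independent if every entry is generic over the parameters and the earlier
  entries, and in a saturated model a generic solution exists iff there are infinitely many. So n
  nested eliminations of the infinity quantifier suffice.\<close>

lemma generic_extension_formula:
  assumes "formula_in L (k + n) \<chi>"
  shows "\<exists>\<psi>. formula_in L k \<psi> \<and> (\<forall>M. satm M \<longrightarrow> (\<forall>bs\<in>tuples M k.
     holds M \<psi> bs \<longleftrightarrow> (\<exists>cs\<in>tuples M n. holds M \<chi> (bs @ cs) \<and> mdim M (set cs) (set bs) = n)))"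
  using assms
proof (induction n arbitrary: k)
  case 0
  have "mdim M {} (set bs) = 0" if "satm M" "bs \<in> tuples M k" for M bs
  proof -
    interpret pregeometry "univ M" "acl L M" using acl_pregeometry satm_mdl that by blast
    show ?thesis using that dim_eq_0_iff[of "{}" "set bs"] by (auto simp: tuples_def)
  qed
  then show ?case using 0 by (intro exI[of _ \<chi>]) (auto simp: tuples_def)
next
  case (Suc n)
  obtain \<psi>1 where \<psi>1: "formula_in L (Suc k) \<psi>1"
    "\<And>M bs. satm M \<Longrightarrow> bs \<in> tuples M (Suc k) \<Longrightarrow>
     holds M \<psi>1 bs \<longleftrightarrow> (\<exists>cs\<in>tuples M n. holds M \<chi> (bs @ cs) \<and> mdim M (set cs) (set bs) = n)"
    using Suc.IH[of "Suc k"] Suc.prems by auto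
  have elim: "eliminates_exists_infinity TYPE('u) L T" using geom by (simp add: geometric_def)
  obtain \<psi> where \<psi>: "formula_in L k \<psi>"
    "\<forall>M :: ('f, 'r, 'u) fo_struct. mdl M \<longrightarrow> (\<forall>bs\<in>tuples M k.
       holds M \<psi> bs \<longleftrightarrow> infinite {c \<in> univ M. holds M \<psi>1 (bs @ [c])})"
    using elim[unfolded eliminates_exists_infinity_def, rule_format, OF \<psi>1(1)] by blast
  have "holds M \<psi> bs \<longleftrightarrow> (\<exists>cs\<in>tuples M (Suc n). holds M \<chi> (bs @ cs) \<and> mdim M (set cs) (set bs) = Suc n)"
    if M: "satm M" and bs: "bs \<in> tuples M k" for M bs
  proof -
    have mM: "mdl M" using satm_mdl[OF M] .
    interpret pregeometry "univ M" "acl L M" by (rule acl_pregeometry[OF mM])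
    have bsU: "set bs \<subseteq> univ M" using bs by (auto simp: tuples_def)
    have bsc: "bs @ [a] \<in> tuples M (Suc k)" if "a \<in> univ M" for a using bs that by (auto simp: tuples_def)
    have split: "mdim M (set (a # cs)) (set bs) = mdim M {a} (set bs) + mdim M (set cs) (set (bs @ [a]))"
      if "a \<in> univ M" "cs \<in> tuples M n" for a cs
      using dim_Un[of "{a}" "set cs" "set bs"] that bsU by (auto simp: tuples_def)
    show ?thesis
    proof
      assume "holds M \<psi> bs"
      then have "infinite {c \<in> univ M. holds M \<psi>1 (bs @ [c])}" using \<psi>(2) mM bs by blast
      then obtain a where a: "a \<in> univ M" "holds M \<psi>1 (bs @ [a])" "a \<notin> acl L M (set bs)"
        by (rule generic_point[OF M bs \<psi>1(1)])
      then obtain cs where cs: "cs \<in> tuples M n" "holds M \<chi> ((bs @ [a]) @ cs)" "mdim M (set cs) (set (bs @ [a])) = n"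
        using \<psi>1(2)[OF M bsc[OF a(1)]] by blast
      have "mdim M (set (a # cs)) (set bs) = Suc n" using split[OF a(1) cs(1)] cs(3) a dim_singleton[of a "set bs"] bsU by simp
      moreover have "a # cs \<in> tuples M (Suc n)" using a(1) cs(1) by (auto simp: tuples_def)
      ultimately show "\<exists>cs\<in>tuples M (Suc n). holds M \<chi> (bs @ cs) \<and> mdim M (set cs) (set bs) = Suc n"
        using cs(2) by (intro bexI[of _ "a # cs"]) auto
    next
      assume "\<exists>cs\<in>tuples M (Suc n). holds M \<chi> (bs @ cs) \<and> mdim M (set cs) (set bs) = Suc n"
      then obtain cs' where cs': "cs' \<in> tuples M (Suc n)" "holds M \<chi> (bs @ cs')" "mdim M (set cs') (set bs) = Suc n" by blast
      then obtain a cs where acs: "cs' = a # cs" "a \<in> univ M" "cs \<in> tuples M n"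
        by (cases cs') (auto simp: tuples_def)
      have "card (set cs) \<le> n" "set cs \<subseteq> univ M" using acs(3) card_length[of cs] by (auto simp: tuples_def)
      then have "mdim M (set cs) (set (bs @ [a])) \<le> n"
        using dim_le_card[of "set cs" "set (bs @ [a])"] bsU acs by auto
      then have *: "a \<notin> acl L M (set bs)" "mdim M (set cs) (set (bs @ [a])) = n"
        using split[OF acs(2,3)] cs'(3) dim_singleton[of a "set bs"] bsU acs by (auto split: if_splits)
      have h1: "holds M \<psi>1 (bs @ [a])"
        using \<psi>1(2)[OF M bsc[OF acs(2)]] * acs cs'(2) by auto
      have "infinite {c \<in> univ M. holds M \<psi>1 (bs @ [c])}"
      proof
        assume "finite {c \<in> univ M. holds M \<psi>1 (bs @ [c])}"
        then have "a \<in> acl L M (set bs)" using h1 \<psi>1(1) bs acs(2) unfolding acl_def by blast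
        then show False using * by simp
      qed
      then show "holds M \<psi> bs" using \<psi>(2) mM bs by blast
    qed
  qed
  then show ?case using \<psi>(1) by blast
qed

lemma holds_foldr_Ex:
  assumes "formula_in L (k + n) \<chi>" "bs \<in> tuples M k" "is_struct L M"
  shows "holds M (foldr Ex [k..<k + n] \<chi>) bs \<longleftrightarrow> (\<exists>es\<in>tuples M n. holds M \<chi> (bs @ es))"
proof
  assume "holds M (foldr Ex [k..<k + n] \<chi>) bs"
  then obtain e where e: "\<forall>x. x \<notin> set [k..<k + n] \<longrightarrow> e x = bs ! x" "\<forall>x\<in>set [k..<k + n]. e x \<in> univ M" "sat M e \<chi>"
    unfolding holds_def sat_foldr_Ex by blast
  have "map e [k..<k + n] \<in> tuples M n" using e(2) by (auto simp: tuples_def)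
  moreover have "holds M \<chi> (bs @ map e [k..<k + n]) \<longleftrightarrow> sat M e \<chi>"
    by (rule holds_iff_sat[OF assms(1)]) (use e(1) assms(2) in \<open>auto simp: tuples_def nth_append\<close>)
  ultimately show "\<exists>es\<in>tuples M n. holds M \<chi> (bs @ es)" using e(3) by blast
next
  assume "\<exists>es\<in>tuples M n. holds M \<chi> (bs @ es)"
  then obtain es where es: "es \<in> tuples M n" "holds M \<chi> (bs @ es)" by blast
  define e where "e = (\<lambda>x. if x \<in> set [k..<k + n] then (bs @ es) ! x else bs ! x)"
  have "holds M \<chi> (bs @ es) \<longleftrightarrow> sat M e \<chi>"
    by (rule holds_iff_sat[OF assms(1)]) (use assms(2) es in \<open>auto simp: e_def tuples_def nth_append\<close>)
  moreover have "e x \<in> univ M" if "x \<in> set [k..<k + n]" for x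
    using that es(1) assms(2) by (auto simp: e_def tuples_def nth_append)
  ultimately show "holds M (foldr Ex [k..<k + n] \<chi>) bs"
    unfolding holds_def sat_foldr_Ex using es(2) by (intro exI[of _ e]) (auto simp: e_def holds_def)
qed

text \<open>Finitely many conjuncts from \<open>dim_witness\<close>, one for each pair of position
  sets, impose all upper bounds on relative dimensions. They hold for realizations in every model,
  without assuming full dimension, which is more than a strong formula promises.\<close>

lemma strong_formula_exists:
  assumes M: "mdl M" and tup: "as \<in> tuples M m" "ds \<in> tuples M n" and ne: "as \<noteq> []"
    and dist: "distinct (as @ ds)" and \<theta>: "formula_in L (m + n) \<theta>" "qf \<theta>" "holds M \<theta> (as @ ds)"
  obtains \<phi> where "formula_in L (m + n) \<phi>" "qf \<phi>" "holds M \<phi> (as @ ds)"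
    "\<And>M' bs es. mdl M' \<Longrightarrow> bs \<in> tuples M' m \<Longrightarrow> es \<in> tuples M' n \<Longrightarrow> holds M' \<phi> (bs @ es) \<Longrightarrow>
       holds M' \<theta> (bs @ es) \<and> distinct (bs @ es) \<and>
       (\<forall>I J. I \<subseteq> {..<n} \<longrightarrow> J \<subseteq> {..<n} \<longrightarrow>
          mdim M' (entries es I) (entries es J \<union> set bs) \<le> mdim M (entries ds I) (entries ds J \<union> set as))"
proof -
  have len: "length as = m" "length ds = n" using tup by (auto simp: tuples_def)
  \<comment> \<open>The first entry serves as default value and keeps the assignment in the
    universe; this is why \<open>as\<close> is taken nonempty.\<close>
  define asg where "asg = (\<lambda>us i. if i < m + n then us ! i else us ! (0::nat) :: 'u)"
  have asg: "holds M' \<psi> us \<longleftrightarrow> sat M' (asg us) \<psi>" if "formula_in L (m + n) \<psi>"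
    for M' :: "('f, 'r, 'u) fo_struct" and \<psi> us
    by (rule holds_iff_sat[OF that]) (simp add: asg_def)
  have m0: "m > 0" using ne len by auto
  have asg_range: "range (asg (bs @ es)) \<subseteq> univ M'" if "bs \<in> tuples M' m" "es \<in> tuples M' n"
    for M' :: "('f, 'r, 'u) fo_struct" and bs es
    using that m0 by (auto simp: asg_def tuples_def nth_append)
  have imgI: "asg (bs @ es) ` ((\<lambda>j. m + j) ` I) = entries es I"
    if "length bs = m" "I \<subseteq> {..<n}" for bs es I
    unfolding image_image by (rule image_cong) (use that in \<open>auto simp: asg_def\<close>)
  have imgB: "asg (bs @ es) ` {..<m} = set bs" if "length bs = m" for bs es
    unfolding set_conv_nth using that by (auto simp: asg_def nth_append)
  have "\<exists>\<chi>. wf_fm L \<chi> \<and> qf \<chi> \<and> fv \<chi> \<subseteq> {..<m + n} \<and> sat M (asg (as @ ds)) \<chi> \<and>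
      (\<forall>M' bs es. mdl M' \<longrightarrow> bs \<in> tuples M' m \<longrightarrow> es \<in> tuples M' n \<longrightarrow> sat M' (asg (bs @ es)) \<chi> \<longrightarrow>
          mdim M' (entries es I) (entries es J \<union> set bs) \<le> mdim M (entries ds I) (entries ds J \<union> set as))"
    if IJ: "I \<subseteq> {..<n}" "J \<subseteq> {..<n}" for I J
  proof -
    let ?S = "(\<lambda>j. m + j) ` I" and ?W = "(\<lambda>j. m + j) ` J \<union> {..<m}"
    have fin: "finite ?S" "finite ?W" using finite_subset[OF IJ(1)] finite_subset[OF IJ(2)] by auto
    have le: "mdim M (asg (as @ ds) ` ?S) (asg (as @ ds) ` ?W) \<le> mdim M (entries ds I) (entries ds J \<union> set as)"
      unfolding image_Un[of _ "(\<lambda>j. m + j) ` J"] imgI[OF len(1) IJ(1)] imgI[OF len(1) IJ(2)] imgB[OF len(1)] by simp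
    obtain \<chi> where \<chi>: "wf_fm L \<chi>" "qf \<chi>" "fv \<chi> \<subseteq> ?S \<union> ?W" "sat M (asg (as @ ds)) \<chi>"
      "\<And>M' H'. mdl M' \<Longrightarrow> range H' \<subseteq> univ M' \<Longrightarrow> sat M' H' \<chi> \<Longrightarrow>
         mdim M' (H' ` ?S) (H' ` ?W) \<le> mdim M (entries ds I) (entries ds J \<union> set as)"
      by (rule dim_witness[OF M asg_range[OF tup] fin le], rule that)
    have "mdim M' (entries es I) (entries es J \<union> set bs) \<le> mdim M (entries ds I) (entries ds J \<union> set as)"
      if "mdl M'" "bs \<in> tuples M' m" "es \<in> tuples M' n" "sat M' (asg (bs @ es)) \<chi>" for M' bs es
    proof -
      have lb: "length bs = m" using that by (simp add: tuples_def)
      show ?thesis using \<chi>(5)[OF that(1) asg_range[OF that(2,3)] that(4)]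
        unfolding image_Un[of _ "(\<lambda>j. m + j) ` J"] imgI[OF lb IJ(1)] imgI[OF lb IJ(2)] imgB[OF lb] .
    qed
    moreover have "fv \<chi> \<subseteq> {..<m + n}" using \<chi>(3) IJ by fastforce
    ultimately show ?thesis using \<chi>(1,2,4) by blast
  qed
  then obtain X where X: "\<And>I J. I \<subseteq> {..<n} \<Longrightarrow> J \<subseteq> {..<n} \<Longrightarrow> wf_fm L (X I J) \<and> qf (X I J) \<and>
      fv (X I J) \<subseteq> {..<m + n} \<and> sat M (asg (as @ ds)) (X I J) \<and>
      (\<forall>M' bs es. mdl M' \<longrightarrow> bs \<in> tuples M' m \<longrightarrow> es \<in> tuples M' n \<longrightarrow> sat M' (asg (bs @ es)) (X I J) \<longrightarrow>
          mdim M' (entries es I) (entries es J \<union> set bs) \<le> mdim M (entries ds I) (entries ds J \<union> set as))"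
    by metis
  define F where "F = insert \<theta> ((\<lambda>(I, J). X I J) ` (Pow {..<n} \<times> Pow {..<n}) \<union>
     (\<lambda>(x, y). Neg (Eq (Var x) (Var y))) ` {(x, y) \<in> {..<m + n} \<times> {..<m + n}. x \<noteq> y})"
  have finF: "finite F" unfolding F_def
    by (intro finite.insertI finite_UnI finite_imageI) (auto intro: finite_subset[of _ "{..<m + n} \<times> {..<m + n}"])
  have dne: "(as @ ds) ! x \<noteq> (as @ ds) ! y" if "x < m + n" "y < m + n" "x \<noteq> y" for x y
    using dist that len by (metis length_append nth_eq_iff_index_eq)
  have FF: "wf_fm L \<phi> \<and> qf \<phi> \<and> fv \<phi> \<subseteq> {..<m + n} \<and> sat M (asg (as @ ds)) \<phi>" if "\<phi> \<in> F" for \<phi>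
  proof -
    have "\<phi> = \<theta> \<or> (\<exists>I J. I \<subseteq> {..<n} \<and> J \<subseteq> {..<n} \<and> \<phi> = X I J) \<or>
      (\<exists>x y. x < m + n \<and> y < m + n \<and> x \<noteq> y \<and> \<phi> = Neg (Eq (Var x) (Var y)))"
      using that unfolding F_def by auto
    then consider "\<phi> = \<theta>" | I J where "I \<subseteq> {..<n}" "J \<subseteq> {..<n}" "\<phi> = X I J"
      | x y where "x < m + n" "y < m + n" "x \<noteq> y" "\<phi> = Neg (Eq (Var x) (Var y))"
      by (elim disjE exE conjE)
    then show ?thesis
    proof cases
      case 1
      then show ?thesis using \<theta> asg[OF \<theta>(1)] by (simp add: formula_in_def)
    next
      case 2
      then show ?thesis using X by simp
    next
      case 3
      then show ?thesis using dne by (auto simp: asg_def)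
    qed
  qed
  have form: "formula_in L (m + n) (fconj F)"
    unfolding formula_in_def fconj_simps[OF finF] using FF by blast
  show thesis
  proof (rule that[OF form])
    show "qf (fconj F)" unfolding fconj_simps[OF finF] using FF by blast
    show "holds M (fconj F) (as @ ds)" unfolding asg[OF form] fconj_simps[OF finF] using FF by blast
    fix M' bs es assume h: "mdl M'" "bs \<in> tuples M' m" "es \<in> tuples M' n" "holds M' (fconj F) (bs @ es)"
    then have sF: "sat M' (asg (bs @ es)) \<phi>" if "\<phi> \<in> F" for \<phi>
      using that unfolding asg[OF form] fconj_simps[OF finF] by blast
    have "\<theta> \<in> F" by (simp add: F_def)
    then have 1: "holds M' \<theta> (bs @ es)" using sF asg[OF \<theta>(1)] by blast
    have lbe: "length (bs @ es) = m + n" using h by (simp add: tuples_def)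
    have 2: "distinct (bs @ es)"
      unfolding distinct_conv_nth lbe
    proof (intro allI impI)
      fix x y assume xy: "x < m + n" "y < m + n" "x \<noteq> y"
      then have "Neg (Eq (Var x) (Var y)) \<in> F" unfolding F_def by (auto intro!: image_eqI[of _ _ "(x, y)"])
      then show "(bs @ es) ! x \<noteq> (bs @ es) ! y" using sF xy by (fastforce simp: asg_def)
    qed
    have "mdim M' (entries es I) (entries es J \<union> set bs) \<le> mdim M (entries ds I) (entries ds J \<union> set as)"
      if "I \<subseteq> {..<n}" "J \<subseteq> {..<n}" for I J
    proof -
      have "X I J \<in> F" unfolding F_def using that by auto
      then show ?thesis using X[OF that] sF h by blast
    qed
    then show "holds M' \<theta> (bs @ es) \<and> distinct (bs @ es) \<and>
       (\<forall>I J. I \<subseteq> {..<n} \<longrightarrow> J \<subseteq> {..<n} \<longrightarrow>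
          mdim M' (entries es I) (entries es J \<union> set bs) \<le> mdim M (entries ds I) (entries ds J \<union> set as))"
      using 1 2 by blast
  qed
qed

end

context colored_setting begin

lemma tuples_reduct [simp]: "tuples (reduct N) k = tuples N k"
  by (simp add: tuples_def)

text \<open>The extension axioms are applied to a recoloring of the model itself in which only the
  parameters and the prescribed entries of the extension are colored.\<close>

lemma extension_axiom_realization:
  fixes N :: "('f, 'r option, 'u) fo_struct"
  assumes N: "rich N" and sat: "satm (reduct N)"
    and as: "as \<in> tuples N m" "as \<noteq> []" and ds: "ds \<in> tuples N n" "ds = ds1 @ ds2" "length ds1 = k"
    and dist: "distinct (as @ ds)"
    and basis: "cdim N (set ds1) (set as) = k" "cdim N (set ds) (set as) = k"
    and C: "C \<subseteq> set ds" and closed: "\<And>A. A \<subseteq> set ds \<Longrightarrow> \<alpha> * card (A \<inter> C) \<le> cdim N A (set as)"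
    and transc: "\<And>d. d \<in> set ds \<Longrightarrow> d \<notin> cacl N (set as)"
    and \<theta>: "formula_in L (m + n) \<theta>" "qf \<theta>" "holds (reduct N) \<theta> (as @ ds)"
    and bs: "bs \<in> tuples N m" "\<And>\<psi>. formula_in L m \<psi> \<Longrightarrow> holds (reduct N) \<psi> as \<longleftrightarrow> holds (reduct N) \<psi> bs"
  obtains es where "es \<in> tuples N n" "holds (reduct N) \<theta> (bs @ es)" "distinct (bs @ es)"
    "\<And>i. i < n \<Longrightarrow> es ! i \<in> colored N \<longleftrightarrow> ds ! i \<in> C"
    "\<And>I J. I \<subseteq> {..<n} \<Longrightarrow> J \<subseteq> {..<n} \<Longrightarrow>
       cdim N (entries es I) (entries es J \<union> set bs) \<le> cdim N (entries ds I) (entries ds J \<union> set as)"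
proof -
  have M: "cmdl N" using N by (rule rich_cmdl)
  interpret pregeometry "univ N" "cacl N" by (rule cpregeometry[OF M])
  have len: "length as = m" "length ds = n" and asU: "set as \<subseteq> univ N" and dsU: "set ds \<subseteq> univ N"
    using as ds by (auto simp: tuples_def)
  have kn: "k \<le> n" using ds len by auto
  have disj: "set as \<inter> set ds = {}" using dist by auto
  obtain \<phi> where \<phi>: "formula_in L (m + n) \<phi>" "qf \<phi>" "holds (reduct N) \<phi> (as @ ds)"
    "\<And>M' bs es. mdl M' \<Longrightarrow> bs \<in> tuples M' m \<Longrightarrow> es \<in> tuples M' n \<Longrightarrow> holds M' \<phi> (bs @ es) \<Longrightarrow>
       holds M' \<theta> (bs @ es) \<and> distinct (bs @ es) \<and>
       (\<forall>I J. I \<subseteq> {..<n} \<longrightarrow> J \<subseteq> {..<n} \<longrightarrow>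
          mdim M' (entries es I) (entries es J \<union> set bs) \<le> cdim N (entries ds I) (entries ds J \<union> set as))"
    by (rule strong_formula_exists[OF M _ _ as(2) dist \<theta>, unfolded tuples_reduct, OF as(1) ds(1)], rule that)
  have \<phi>dim: "mdim M' (entries es I) (entries es J \<union> set bs) \<le> cdim N (entries ds I) (entries ds J \<union> set as)"
    if "mdl M'" "bs \<in> tuples M' m" "es \<in> tuples M' n" "holds M' \<phi> (bs @ es)" "I \<subseteq> {..<n}" "J \<subseteq> {..<n}"
    for M' bs es I J
    using \<phi>(4)[OF that(1-4)] that(5,6) by blast
  have all: "entries us {..<length us} = set us" for us :: "'u list"
    by (auto simp: set_conv_nth)

  define N' where "N' = N\<lparr>rint := (\<lambda>r us. case r of
     None \<Rightarrow> (\<exists>x. us = [x] \<and> x \<in> (colored N \<inter> set as) \<union> C) | Some r' \<Rightarrow> rint N (Some r') us)\<rparr>"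
  have red: "reduct N' = reduct N" by (simp add: reduct_def N'_def)
  have uN': "univ N' = univ N" by (simp add: N'_def)
  have col: "colored N' = (colored N \<inter> set as) \<union> C"
    using C dsU asU by (auto simp: colored_def N'_def)
  have "mclosed j N' {}" for j
    unfolding mclosed_def red col
  proof (intro allI impI, elim conjE)
    fix Z assume Z: "finite Z" "Z \<subseteq> (colored N \<inter> set as) \<union> C"
    \<comment> \<open>The parameters are controlled by richness of \<open>N\<close>, the new points
      over them by \<open>closed\<close>; additivity combines the two.\<close>
    let ?Z1 = "Z \<inter> set as" and ?Z2 = "Z - set as"
    have Z2: "?Z2 \<subseteq> C" "?Z2 \<inter> C = ?Z2" "?Z2 \<subseteq> set ds" using Z C by auto
    have "\<alpha> * card ?Z1 \<le> cdim N ?Z1 {}"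
      using rich_mclosed[OF N, of "card ?Z1"] Z C disj unfolding mclosed_def by auto
    moreover have "\<alpha> * card ?Z2 \<le> cdim N ?Z2 (set as)" using closed[OF Z2(3)] Z2(2) by simp
    moreover have "cdim N ?Z2 (set as) \<le> cdim N ?Z2 ({} \<union> ?Z1)"
      using Z Z2 asU dsU by (intro dim_antimono) auto
    moreover have "cdim N (?Z1 \<union> ?Z2) {} = cdim N ?Z1 {} + cdim N ?Z2 ({} \<union> ?Z1)"
      using Z Z2 asU dsU by (intro dim_Un) auto
    moreover have "?Z1 \<union> ?Z2 = Z" by auto
    moreover have "card Z = card ?Z1 + card ?Z2"
      using Z(1) card_Un_disjoint[of ?Z1 ?Z2] by (simp add: Int_Diff_Un Int_Diff_disjoint)
    ultimately show "\<alpha> * card Z \<le> cdim N Z {}" by (simp add: distrib_left)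
  qed
  then have K': "class_K_plus L T \<alpha> N'" using class_K_plus_iff[of N'] M red by simp
  have "delta L T \<alpha> N' A (set as) \<ge> 0" if A: "finite A" "A \<subseteq> set as \<union> set ds" for A
  proof -
    have AU: "A \<subseteq> univ N" "A - set as \<subseteq> set ds" using A asU dsU by auto
    have "(A - set as) \<inter> colored N' = (A - set as) \<inter> C" unfolding col by auto
    then show ?thesis
      using delta_eq[of N' A "set as"] closed[OF AU(2)] dim_Diff_base[OF A(1) AU(1) asU] M AU asU
      by (simp add: red uN')
  qed
  then have cl': "closed_in L T \<alpha> N' (set as) (set as \<union> set ds)" by (auto simp: closed_in_def)
  have dimT: "dim (acl_in L T (reduct N')) A Y = cdim N A Y" if "A \<subseteq> univ N" "Y \<subseteq> univ N" for A Y
    using dim_acl_in_eq[OF M] that by (simp add: red)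
  have dimT1: "dim (acl_in L T (reduct N')) {d} (set as) = 1" if "d \<in> set ds - set as" for d
    using dimT[of "{d}" "set as"] dim_singleton[of d "set as"] transc that dsU asU by auto
  have dimTk: "dim (acl_in L T (reduct N')) (set ds) (set as) = k"
    using dimT[OF dsU asU] basis by simp
  have entU: "entries ds I \<subseteq> univ N" if "I \<subseteq> {..<n}" for I
    using that dsU len by (auto intro!: nth_mem)
  have strong: "strong_formula L T N' ds as \<phi>"
    unfolding strong_formula_def
  proof (intro conjI allI impI ballI)
    show "formula_in L (length as + length ds) \<phi>" using \<phi>(1) len by simp
    show "holds (reduct N') \<phi> (as @ ds)" using \<phi>(3) red by simp
    fix M' :: "('f, 'r, 'u) fo_struct" and bs' es' I
    assume h: "satm M'" "bs' \<in> tuples M' (length as)" "es' \<in> tuples M' (length ds)" "holds M' \<phi> (bs' @ es')"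
    then have h': "mdl M'" "bs' \<in> tuples M' m" "es' \<in> tuples M' n" using satm_mdl len by auto
    show "distinct (bs' @ es')" using \<phi>(4)[OF h' h(4)] by blast
    show "mdim M' (entries es' ({..<length ds} - I)) (entries es' I \<union> set bs')
        \<le> dim (acl_in L T (reduct N')) (entries ds ({..<length ds} - I)) (entries ds I \<union> set as)"
      if "I \<subseteq> {..<length ds}"
      using \<phi>dim[OF h' h(4), of "{..<n} - I" I] dimT[of "entries ds ({..<n} - I)" "entries ds I \<union> set as"]
        that len entU asU by simp
  qed (use \<phi>(2) dist in auto)

  \<comment> \<open>The entries after the basis are quantified out, and
    \<open>generic_extension_formula\<close> asks for an independent choice of the first k. The
    resulting \<open>\<psi>\<close> serves both as D and as d.\<close>
  let ?\<chi> = "foldr Ex [m + k..<(m + k) + (n - k)] \<phi>"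
  have fin_\<phi>: "formula_in L ((m + k) + (n - k)) \<phi>" using \<phi>(1) kn by simp
  have "formula_in L (m + k) ?\<chi>" using \<phi>(1) kn by (fastforce simp: formula_in_def)
  then obtain \<psi> where \<psi>: "formula_in L m \<psi>" "\<forall>M. satm M \<longrightarrow> (\<forall>bs\<in>tuples M m.
     holds M \<psi> bs \<longleftrightarrow> (\<exists>cs\<in>tuples M k. holds M ?\<chi> (bs @ cs) \<and> mdim M (set cs) (set bs) = k))"
    using generic_extension_formula by blast
  \<comment> \<open>As \<phi> bounds the dimension of the remaining entries over any part, total
    dimension k leaves each part at least the dimension it has in \<open>ds\<close>. Hence the first
    k entries are independent and no entry is algebraic.\<close>
  have low: "k \<le> mdim M' (set (take k es')) (set bs') \<and> (\<forall>e\<in>set es'. e \<notin> acl L M' (set bs'))"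
    if h: "satm M'" "bs' \<in> tuples M' m" "es' \<in> tuples M' n" "holds M' \<phi> (bs' @ es')"
      "k \<le> mdim M' (set es') (set bs')" for M' bs' es'
  proof -
    have M': "mdl M'" using satm_mdl[OF h(1)] .
    interpret M': pregeometry "univ M'" "acl L M'" by (rule acl_pregeometry[OF M'])
    have U: "set bs' \<subseteq> univ M'" "set es' \<subseteq> univ M'" and len': "length es' = n" using h by (auto simp: tuples_def)
    have split: "mdim M' (set es') (set bs') \<le> mdim M' (entries es' I) (set bs') + (k - cdim N (entries ds I) (set as))"
      if I: "I \<subseteq> {..<n}" for I
    proof -
      have un: "entries us I \<union> entries us ({..<n} - I) = set us" if "length us = n" for us :: "'u list"
      proof -
        have "I \<union> ({..<n} - I) = {..<n}" using I by auto
        then show ?thesis using all[of us] that by (metis image_Un)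
      qed
      have fin: "finite (entries us J)" if "J \<subseteq> {..<n}" for us :: "'u list" and J
        using finite_subset[OF that] by simp
      have U1: "entries es' J \<subseteq> univ M'" if "J \<subseteq> {..<n}" for J
        using that U(2) len' by (auto intro!: nth_mem)
      have "mdim M' (set es') (set bs') = mdim M' (entries es' I) (set bs') +
          mdim M' (entries es' ({..<n} - I)) (set bs' \<union> entries es' I)"
        unfolding un[OF len', symmetric] using I U U1 fin by (intro M'.dim_Un) auto
      moreover have "cdim N (set ds) (set as) = cdim N (entries ds I) (set as) +
          cdim N (entries ds ({..<n} - I)) (set as \<union> entries ds I)"
        unfolding un[OF len(2), symmetric] using I asU entU fin by (intro dim_Un) auto
      moreover have "mdim M' (entries es' ({..<n} - I)) (set bs' \<union> entries es' I) \<le>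
          cdim N (entries ds ({..<n} - I)) (set as \<union> entries ds I)"
        using \<phi>dim[OF M' h(2-4), of "{..<n} - I" I] I by (simp add: Un_commute)
      ultimately show ?thesis using basis by simp
    qed
    have tk: "entries us {..<k} = set (take k us)" if "length us = n" for us :: "'u list"
      using nth_image[of k us] kn that by (simp add: atLeast0LessThan)
    have "take k ds = ds1" using ds by simp
    then have "k \<le> mdim M' (set (take k es')) (set bs')"
      using split[of "{..<k}"] h(5) kn basis by (simp add: tk len' len)
    moreover have "e \<notin> acl L M' (set bs')" if "e \<in> set es'" for e
    proof -
      obtain i where i: "i < n" "e = es' ! i" using \<open>e \<in> set es'\<close> len' by (metis in_set_conv_nth)
      have dsi: "ds ! i \<in> set ds" using i(1) len by simp
      then have "cdim N {ds ! i} (set as) = 1" using dim_singleton[of "ds ! i" "set as"] transc dsU asU by auto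
      moreover have "cdim N {ds ! i} (set as) \<le> k"
        using dim_mono[of "set ds" "{ds ! i}" "set as"] basis dsi dsU asU by simp
      ultimately have "mdim M' {e} (set bs') \<ge> 1"
        using split[of "{i}"] h(5) i by simp
      then show ?thesis using M'.dim_singleton[of e "set bs'"] U \<open>e \<in> set es'\<close> by (auto split: if_splits)
    qed
    ultimately show ?thesis by blast
  qed
  have up: "mdim M' (set es') (set bs') \<le> k"
    if h: "satm M'" "bs' \<in> tuples M' m" "es' \<in> tuples M' n" "holds M' \<phi> (bs' @ es')" for M' bs' es'
    using \<phi>dim[OF satm_mdl[OF h(1)] h(2-4), of "{..<n}" "{}"] all[of es'] all[of ds] h(3) len basis
    by (simp add: tuples_def)
  have \<psi>_iff: "holds M' \<psi> bs' \<longleftrightarrow> (\<exists>es'\<in>tuples M' n. holds M' \<phi> (bs' @ es') \<and> k \<le> mdim M' (set es') (set bs'))"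
    if h: "satm M'" "bs' \<in> tuples M' m" for M' bs'
  proof -
    have M': "mdl M'" using satm_mdl[OF h(1)] .
    interpret M': pregeometry "univ M'" "acl L M'" by (rule acl_pregeometry[OF M'])
    have ex: "holds M' ?\<chi> (bs' @ cs) \<longleftrightarrow> (\<exists>es\<in>tuples M' (n - k). holds M' \<phi> ((bs' @ cs) @ es))" if "cs \<in> tuples M' k" for cs
      by (rule holds_foldr_Ex[OF fin_\<phi> tuples_append[OF h(2) that] is_model_struct[OF M']])
    show ?thesis
    proof
      assume "holds M' \<psi> bs'"
      then obtain cs where cs: "cs \<in> tuples M' k" "holds M' ?\<chi> (bs' @ cs)" "mdim M' (set cs) (set bs') = k"
        using \<psi>(2) h by blast
      then obtain es where es: "es \<in> tuples M' (n - k)" "holds M' \<phi> ((bs' @ cs) @ es)" using ex by blast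
      have t: "cs @ es \<in> tuples M' n" using tuples_append[OF cs(1) es(1)] kn by simp
      have "mdim M' (set cs) (set bs') \<le> mdim M' (set (cs @ es)) (set bs')"
        using t h(2) by (intro M'.dim_mono) (auto simp: tuples_def)
      then show "\<exists>es'\<in>tuples M' n. holds M' \<phi> (bs' @ es') \<and> k \<le> mdim M' (set es') (set bs')"
        using t es(2) cs(3) by (intro bexI[of _ "cs @ es"]) auto
    next
      assume "\<exists>es'\<in>tuples M' n. holds M' \<phi> (bs' @ es') \<and> k \<le> mdim M' (set es') (set bs')"
      then obtain es' where es': "es' \<in> tuples M' n" "holds M' \<phi> (bs' @ es')" "k \<le> mdim M' (set es') (set bs')" by blast
      have t: "take k es' \<in> tuples M' k" "drop k es' \<in> tuples M' (n - k)"
        using es'(1) kn set_take_subset[of k es'] set_drop_subset[of k es'] by (auto simp: tuples_def)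
      have "mdim M' (set (take k es')) (set bs') \<le> card (set (take k es'))"
        using t h(2) by (intro M'.dim_le_card) (auto simp: tuples_def)
      also have "\<dots> \<le> k" using card_length[of "take k es'"] by simp
      finally have "mdim M' (set (take k es')) (set bs') = k" using low[OF h es'] by simp
      moreover have "holds M' ?\<chi> (bs' @ take k es')" 
      proof -
        have "holds M' \<phi> ((bs' @ take k es') @ drop k es')" using es'(2) by simp
        then show ?thesis using ex[OF t(1)] t(2) by blast
      qed
      ultimately show "holds M' \<psi> bs'" using \<psi>(2) h t(1) by blast
    qed
  qed
  have "defines_D TYPE('u) L T (length as) (length ds) \<phi> k \<psi>"
    unfolding defines_D_def len using \<psi>(1) \<psi>_iff low by blast
  moreover have "defines_d TYPE('u) L T (length as) (length ds) \<phi> k \<psi>"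
    unfolding defines_d_def len using \<psi>(1) \<psi>_iff up by (metis le_antisym order_refl)
  ultimately have "extension_axiom (length as) (length ds) {i. i < length ds \<and> ds ! i \<in> colored N'} \<psi> \<psi> \<phi>
      \<in> extension_axioms TYPE('u) L T \<alpha>"
    unfolding extension_axioms_def
    using K' cl' dimT1 dimTk strong asU dsU uN'
    by (intro CollectI exI[of _ N'] exI[of _ as] exI[of _ ds] exI[of _ k] exI[of _ \<phi>] exI[of _ \<psi>])
      (auto simp: transcendental_over_def)
  then have ax: "true_in N (extension_axiom m n {i. i < n \<and> ds ! i \<in> colored N'} \<psi> \<psi> \<phi>)"
    using N by (simp add: rich_struct_def len)
  have m0: "0 < m" using as(2) len by auto
  define e0 where "e0 = (\<lambda>i. if i < m then bs ! i else bs ! 0)"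
  have e0: "range e0 \<subseteq> univ N" using bs(1) m0 by (auto simp: e0_def tuples_def)
  \<comment> \<open>The premise of the axiom holds at \<open>as\<close> with witness
    \<open>ds\<close>, and it passes to \<open>bs\<close>, which has the same type.\<close>
  have "holds (reduct N) \<psi> as" using \<psi>_iff[OF sat, of as] as(1) ds(1) \<phi>(3) basis by auto
  then have "holds (reduct N) \<psi> bs" using bs(2)[OF \<psi>(1)] by simp
  moreover have "holds (reduct N) \<psi> bs \<longleftrightarrow> sat (reduct N) e0 \<psi>"
    by (rule holds_iff_sat[OF \<psi>(1)]) (simp add: e0_def)
  ultimately have se0: "sat (reduct N) e0 \<psi>" by simp
  have "sat N e0 (extension_axiom m n {i. i < n \<and> ds ! i \<in> colored N'} \<psi> \<psi> \<phi>)"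
    using ax e0 by (simp add: true_in_def)
  note ax0 = this[unfolded extension_axiom_def sat_foldr_All, THEN spec, of e0, THEN mp]
  have "sat N e0 (Imp (Con (lift_fm \<psi>) (lift_fm \<psi>))
      (foldr Ex [m..<m + n] (foldr Con (color_literals m n {i. i < n \<and> ds ! i \<in> colored N'}) (lift_fm \<phi>))))"
    by (rule ax0) (use range_subsetD[OF e0] in auto)
  then have "sat N e0 (foldr Ex [m..<m + n] (foldr Con (color_literals m n {i. i < n \<and> ds ! i \<in> colored N'}) (lift_fm \<phi>)))"
    using se0 by simp
  then obtain e1 where e1: "\<forall>x. x \<notin> set [m..<m + n] \<longrightarrow> e1 x = e0 x" "\<forall>x\<in>set [m..<m + n]. e1 x \<in> univ N"
    "sat N e1 (foldr Con (color_literals m n {i. i < n \<and> ds ! i \<in> colored N'}) (lift_fm \<phi>))"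
    unfolding sat_foldr_Ex by blast
  define es where "es = map e1 [m..<m + n]"
  have es: "es \<in> tuples N n" using e1(2) by (auto simp: es_def tuples_def)
  have "holds (reduct N) \<phi> (bs @ es) \<longleftrightarrow> sat (reduct N) e1 \<phi>"
    by (rule holds_iff_sat[OF \<phi>(1)]) (use e1(1) bs(1) in \<open>auto simp: es_def e0_def tuples_def nth_append\<close>)
  then have h\<phi>: "holds (reduct N) \<phi> (bs @ es)" using e1(3) by simp
  have strong': "holds (reduct N) \<theta> (bs @ es) \<and> distinct (bs @ es) \<and>
       (\<forall>I J. I \<subseteq> {..<n} \<longrightarrow> J \<subseteq> {..<n} \<longrightarrow>
          cdim N (entries es I) (entries es J \<union> set bs) \<le> cdim N (entries ds I) (entries ds J \<union> set as))"
    using \<phi>(4)[OF M _ _ h\<phi>] bs(1) es by simp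
  have "es ! i \<in> colored N \<longleftrightarrow> ds ! i \<in> C" if i: "i < n" for i
  proof -
    have "\<forall>\<phi>\<in>set (color_literals m n {i. i < n \<and> ds ! i \<in> colored N'}). sat N e1 \<phi>" using e1(3) by simp
    moreover have "(if i \<in> {i. i < n \<and> ds ! i \<in> colored N'} then Rel None [Var (m + i)] else Neg (Rel None [Var (m + i)]))
        \<in> set (color_literals m n {i. i < n \<and> ds ! i \<in> colored N'})"
      unfolding color_literals_def set_map by (rule image_eqI[of _ _ i]) (use i in auto)
    ultimately have "sat N e1 (if i \<in> {i. i < n \<and> ds ! i \<in> colored N'} then Rel None [Var (m + i)] else Neg (Rel None [Var (m + i)]))"
      by (rule bspec)
    then have "rint N None [e1 (m + i)] \<longleftrightarrow> ds ! i \<in> colored N'" using i by (auto split: if_splits)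
    moreover have "ds ! i \<in> colored N' \<longleftrightarrow> ds ! i \<in> C"
      unfolding col using disj nth_mem[of i ds] i len by auto
    moreover have "es ! i = e1 (m + i)" "e1 (m + i) \<in> univ N" using i e1(2) by (auto simp: es_def)
    ultimately show ?thesis by (simp add: colored_def)
  qed
  then show thesis using that es strong' by blast
qed

end

section \<open>Points in general position\<close>

context geometric_setting begin

lemma independent_points:
  assumes M: "satm M" and B: "finite B" "B \<subseteq> univ M"
  shows "\<exists>K. finite K \<and> K \<subseteq> univ M \<and> mdim M K B = k"
proof -
  interpret pregeometry "univ M" "acl L M" by (rule acl_pregeometry[OF satm_mdl[OF M]])
  show ?thesis
  proof (induction k)
    case 0
    show ?case using dim_eq_0_iff[of "{}" B] B by (intro exI[of _ "{}"]) auto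
  next
    case (Suc k)
    then obtain K where K: "finite K" "K \<subseteq> univ M" "mdim M K B = k" by blast
    have KB: "finite (B \<union> K)" "B \<union> K \<subseteq> univ M" using K B by auto
    obtain a where a: "a \<in> univ M" "a \<notin> acl L M (B \<union> K)" by (rule exists_transcendental[OF M KB])
    have "mdim M (K \<union> {a}) B = Suc k"
      using dim_Un[of K "{a}" B] dim_singleton[of a "B \<union> K"] K a KB B by simp
    then show ?case using K a by (intro exI[of _ "K \<union> {a}"]) auto
  qed
qed

text \<open>Indecomposability supplies a point outside finitely many proper closed subspaces.\<close>

lemma avoiding_point:
  assumes M: "mdl M" and V: "finite V" "V \<subseteq> univ M" and Gs: "finite Gs" "Gs \<noteq> {}"
    and G: "\<And>G. G \<in> Gs \<Longrightarrow> finite G \<and> G \<subseteq> acl L M V \<and> mdim M G {} < mdim M V {}"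
  obtains e where "e \<in> acl L M V" "\<And>G. G \<in> Gs \<Longrightarrow> e \<notin> acl L M G"
proof -
  interpret pregeometry "univ M" "acl L M" by (rule acl_pregeometry[OF M])
  have VU: "acl L M V \<subseteq> univ M" using V cl_sub by blast
  have "acl L M (acl L M V) = acl L M V" using cl_idem[OF V(2)] cl_ext[OF VU] by blast
  moreover have "finite_dim (acl L M) (acl L M V) {}" using dim_cl(1)[OF V] .
  ultimately have nd: "\<not> (\<exists>F. finite F \<and> F \<noteq> {} \<and> \<Union>F = acl L M V \<and>
      (\<forall>Y\<in>F. finite_dim (acl L M) Y {} \<and> mdim M Y {} < mdim M (acl L M V) {}))"
    using indec M VU unfolding indecomposable_def by blast
  let ?F = "acl L M ` Gs"
  have "finite_dim (acl L M) Y {} \<and> mdim M Y {} < mdim M (acl L M V) {}" if Y: "Y \<in> ?F" for Y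
  proof -
    obtain H where H: "H \<in> Gs" "Y = acl L M H" using Y by auto
    have "finite H" "H \<subseteq> univ M" using G[OF H(1)] VU by auto
    then show ?thesis using dim_cl[of H] dim_cl(2)[OF V] G[OF H(1)] H(2) by simp
  qed
  then have "\<Union>?F \<noteq> acl L M V"
  proof (intro notI)
    assume *: "\<And>Y. Y \<in> ?F \<Longrightarrow> finite_dim (acl L M) Y {} \<and> mdim M Y {} < mdim M (acl L M V) {}" "\<Union>?F = acl L M V"
    have "finite ?F \<and> ?F \<noteq> {} \<and> \<Union>?F = acl L M V \<and>
      (\<forall>Y\<in>?F. finite_dim (acl L M) Y {} \<and> mdim M Y {} < mdim M (acl L M V) {})"
      using Gs * by (intro conjI ballI) auto
    then show False using nd by blast
  qed
  moreover have "acl L M H \<subseteq> acl L M V" if "H \<in> Gs" for H using G[OF that] V(2) by (intro cl_least) auto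
  then have "\<Union>?F \<subseteq> acl L M V" by blast
  ultimately obtain e where "e \<in> acl L M V" "e \<notin> \<Union>?F" by blast
  then show thesis using that by blast
qed

text \<open>All points lie in the closure of \<open>B\<close> and k further independent points, of
  dimension r + k over \<open>X\<close>. Each new point avoids the closure over \<open>X\<close> of
  every subset of smaller dimension of the points present, so it adds one dimension until r + k is
  reached.\<close>

lemma general_position:
  assumes M: "satm M" and B: "finite B" "B \<subseteq> univ M" and X: "X \<subseteq> B" and r: "mdim M B X = r" "r \<ge> 1" and k: "k \<ge> 1"
  shows "\<exists>E. finite E \<and> card E = n \<and> E \<subseteq> univ M \<and> E \<inter> B = {} \<and> mdim M (B \<union> E) X \<le> r + k \<and>
    (\<forall>B0 S. B0 \<subseteq> B \<longrightarrow> S \<subseteq> E \<longrightarrow> min (mdim M B0 X + card S) (r + k) \<le> mdim M (B0 \<union> S) X)"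
proof -
  interpret pregeometry "univ M" "acl L M" by (rule acl_pregeometry[OF satm_mdl[OF M]])
  obtain K where K: "finite K" "K \<subseteq> univ M" "mdim M K B = k" using independent_points[OF M B] by blast
  let ?V = "B \<union> K"
  have V: "finite ?V" "?V \<subseteq> univ M" using B K by auto
  have XU: "X \<subseteq> univ M" and finX: "finite X" using X B finite_subset by auto
  have XB: "X \<union> B = B" using X by auto
  have dV: "mdim M ?V X = r + k" using dim_Un[of B K X] B K XU r XB by simp
  have VU: "acl L M ?V \<subseteq> univ M" using V cl_sub by blast
  have absorb: "mdim M A X \<le> r + k" if A: "finite A" "A \<subseteq> acl L M ?V" for A
  proof -
    have AU: "A \<subseteq> univ M" using A VU by auto
    have "mdim M A X \<le> mdim M (?V \<union> A) X" using A AU V XU by (intro dim_mono) auto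
    also have "X \<union> ?V = ?V" using X by auto
    then have "mdim M (?V \<union> A) X = mdim M ?V X" using A AU V XU by (intro dim_absorb) auto
    finally show ?thesis using dV by simp
  qed
  have "\<exists>E. finite E \<and> card E = n \<and> E \<subseteq> acl L M ?V \<and> E \<inter> B = {} \<and>
    (\<forall>B0 S. B0 \<subseteq> B \<longrightarrow> S \<subseteq> E \<longrightarrow> min (mdim M B0 X + card S) (r + k) \<le> mdim M (B0 \<union> S) X)"
  proof (induction n)
    case 0
    show ?case by (intro exI[of _ "{}"]) auto
  next
    case (Suc n)
    then obtain E where E: "finite E" "card E = n" "E \<subseteq> acl L M ?V" "E \<inter> B = {}"
      "\<And>B0 S. B0 \<subseteq> B \<Longrightarrow> S \<subseteq> E \<Longrightarrow> min (mdim M B0 X + card S) (r + k) \<le> mdim M (B0 \<union> S) X" by blast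
    have BV: "B \<subseteq> acl L M ?V" using cl_ext[OF V(2)] by auto
    \<comment> \<open>\<open>X\<close> is added to every set because indecomposability speaks of
      dimension over the empty set.\<close>
    define Gs where "Gs = {X \<union> A | A. A \<subseteq> B \<union> E \<and> mdim M A X < r + k}"
    have "Gs \<subseteq> (\<lambda>A. X \<union> A) ` Pow (B \<union> E)" by (auto simp: Gs_def)
    then have finGs: "finite Gs" by (rule finite_subset) (use B E in auto)
    have "mdim M {} X < r + k" using dim_eq_0_iff[of "{}" X] XU k by simp
    then have neGs: "Gs \<noteq> {}" by (auto simp: Gs_def)
    have G: "finite G \<and> G \<subseteq> acl L M ?V \<and> mdim M G {} < mdim M ?V {}" if Gin: "G \<in> Gs" for G
    proof -
      obtain A where A: "G = X \<union> A" "A \<subseteq> B \<union> E" "mdim M A X < r + k" using Gin by (auto simp: Gs_def)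
      have finA: "finite A" and AV: "A \<subseteq> acl L M ?V" using A(2) B E BV finite_subset[OF A(2)] by auto
      have "mdim M G {} = mdim M X {} + mdim M A X" using dim_Un[of X A "{}"] A(1) finA finX XU AV VU by auto
      moreover have "mdim M (X \<union> ?V) {} = mdim M X {} + mdim M ?V X" using dim_Un[of X ?V "{}"] V finX XU by auto
      moreover have "X \<union> ?V = ?V" using X by auto
      ultimately have "mdim M G {} < mdim M ?V {}" using A(3) dV by simp
      then show ?thesis using A(1) finA finX AV X BV by auto
    qed
    obtain e where e: "e \<in> acl L M ?V" "\<And>G. G \<in> Gs \<Longrightarrow> e \<notin> acl L M G"
      by (rule avoiding_point[OF satm_mdl[OF M] V finGs neGs G], assumption, rule that)
    have eU: "e \<in> univ M" using e(1) VU by auto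
    have EU: "E \<subseteq> univ M" using E(3) VU by auto
    have avoid: "e \<notin> acl L M (X \<union> A)" if "A \<subseteq> B \<union> E" "mdim M A X < r + k" for A
      using e(2) that by (auto simp: Gs_def)
    \<comment> \<open>Single points have dimension at most 1 < r + k, so the points already present
      are among the avoided sets.\<close>
    have new: "e \<notin> B \<union> E"
    proof
      assume eBE: "e \<in> B \<union> E"
      have "mdim M {e} X \<le> 1" using dim_singleton[OF eU XU] by simp
      then have "e \<notin> acl L M (X \<union> {e})" using eBE r k by (intro avoid) auto
      then show False using cl_ext[of "X \<union> {e}"] XU eU by auto
    qed
    show ?case
    proof (intro exI[of _ "insert e E"] conjI allI impI)
      show "finite (insert e E)" "card (insert e E) = Suc n" "insert e E \<subseteq> acl L M ?V" "insert e E \<inter> B = {}"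
        using E e(1) new by auto
      fix B0 S assume S: "B0 \<subseteq> B" "S \<subseteq> insert e E"
      have finB0: "finite B0" "finite S" using finite_subset[OF S(1)] finite_subset[OF S(2)] B E by auto
      show "min (mdim M B0 X + card S) (r + k) \<le> mdim M (B0 \<union> S) X"
      proof (cases "e \<in> S")
        case False
        then show ?thesis using E(5)[OF S(1), of S] S(2) by auto
      next
        case True
        let ?S = "S - {e}"
        have S': "?S \<subseteq> E" using S(2) by auto
        have cS: "card S = Suc (card ?S)" using True finB0 by (metis card_Suc_Diff1)
        have BS: "B0 \<union> S = (B0 \<union> ?S) \<union> {e}" using True by auto
        have U: "B0 \<union> ?S \<subseteq> univ M" using S S' B EU by auto
        have eq: "mdim M (B0 \<union> S) X = mdim M (B0 \<union> ?S) X + mdim M {e} (X \<union> (B0 \<union> ?S))"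
          unfolding BS using finB0 U eU XU by (intro dim_Un) auto
        show ?thesis
        proof (cases "mdim M (B0 \<union> ?S) X < r + k")
          case True
          have "e \<notin> acl L M (X \<union> (B0 \<union> ?S))" using S S' True by (intro avoid) auto
          then have "mdim M {e} (X \<union> (B0 \<union> ?S)) = 1" using dim_singleton[of e] eU U XU by simp
          then show ?thesis using eq E(5)[OF S(1) S'] cS by linarith
        next
          case False
          then show ?thesis using eq by linarith
        qed
      qed
    qed
  qed
  then obtain E where E: "finite E" "card E = n" "E \<subseteq> acl L M ?V" "E \<inter> B = {}"
    "\<forall>B0 S. B0 \<subseteq> B \<longrightarrow> S \<subseteq> E \<longrightarrow> min (mdim M B0 X + card S) (r + k) \<le> mdim M (B0 \<union> S) X" by blast
  moreover have "mdim M (B \<union> E) X \<le> r + k" using E B cl_ext[OF V(2)] by (intro absorb) auto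
  moreover have "E \<subseteq> univ M" using E(3) VU by (rule subset_trans)
  ultimately show ?thesis by (intro exI[of _ E] conjI) assumption+
qed

end

section \<open>Bounded closures\<close>

context colored_setting begin

text \<open>As \<alpha> \<le> 1, only i \<le> m can occur, so \<epsilon> is the least of finitely
  many positive gaps, cut off at 1.\<close>

lemma granularity_exists:
  "\<exists>\<epsilon>>0. \<epsilon> \<le> 1 \<and> (\<forall>i j. j \<le> m \<longrightarrow> real i < \<alpha> * real j \<longrightarrow> real i \<le> \<alpha> * real j - \<epsilon>)"
proof -
  let ?S = "insert 1 ((\<lambda>(i, j). \<alpha> * real j - real i) ` {(i, j). i \<le> m \<and> j \<le> m \<and> real i < \<alpha> * real j})"
  have fin: "finite ?S"
    by (intro finite.insertI finite_imageI finite_subset[of "{(i, j). i \<le> m \<and> j \<le> m \<and> real i < \<alpha> * real j}" "{..m} \<times> {..m}"]) auto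
  have "Min ?S > 0" using fin by (subst Min_gr_iff) auto
  moreover have "Min ?S \<le> 1" using fin by (intro Min_le) auto
  moreover have "real i \<le> \<alpha> * real j - Min ?S" if ij: "j \<le> m" "real i < \<alpha> * real j" for i j
  proof -
    have "\<alpha> * real j \<le> 1 * real j" using alpha_le by (intro mult_right_mono) auto
    then have "i \<le> m" using ij by linarith
    then have "\<alpha> * real j - real i \<in> ?S" using ij by (intro insertI2 image_eqI[of _ _ "(i, j)"]) auto
    then have "Min ?S \<le> \<alpha> * real j - real i" using fin by (intro Min_le)
    then show ?thesis by simp
  qed
  ultimately show ?thesis by blast
qed

definition gran :: "nat \<Rightarrow> real" where
  "gran m = (SOME \<epsilon>. \<epsilon> > 0 \<and> \<epsilon> \<le> 1 \<and> (\<forall>i j. j \<le> m \<longrightarrow> real i < \<alpha> * real j \<longrightarrow> real i \<le> \<alpha> * real j - \<epsilon>))"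

lemma gran:
  "gran m > 0" "gran m \<le> 1" "j \<le> m \<Longrightarrow> real i < \<alpha> * real j \<Longrightarrow> real i \<le> \<alpha> * real j - gran m"
  using someI_ex[OF granularity_exists[of m]] unfolding gran_def by blast+

text \<open>How many points can be added if each uses up \<open>gran m / Suc m\<close> of a budget
  q, the largest possible dimension of q points.\<close>

definition closure_bound :: "nat \<Rightarrow> nat \<Rightarrow> nat" where
  "closure_bound q m = nat \<lfloor>real q * real (Suc m) / gran m\<rfloor>"

text \<open>Every violation of closedness lowers the predimension by at least \<open>gran m\<close>, so only
  boundedly many points have to be added.\<close>

lemma mclosed_extension:
  assumes N: "cmdl N" and X: "X \<subseteq> univ N" "mclosed (closure_bound q m + m) N X"
    and A: "finite A" "A \<subseteq> univ N" "card A \<le> q"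
  obtains W where "finite W" "W \<subseteq> colored N" "W \<inter> (X \<union> A) = {}" "card W \<le> closure_bound q m"
    "mclosed m N (X \<union> A \<union> W)"
proof -
  interpret pregeometry "univ N" "cacl N" by (rule cpregeometry[OF N])
  let ?s = "closure_bound q m + m"
  \<comment> \<open>A violation by at most m points costs \<open>gran m\<close>, hence at least
    \<epsilon> per point; \<open>Suc m\<close> avoids division by 0.\<close>
  define \<epsilon> where "\<epsilon> = gran m / real (Suc m)"
  have \<epsilon>: "\<epsilon> > 0" using gran(1) by (simp add: \<epsilon>_def)
  have \<epsilon>m: "\<epsilon> * real j \<le> gran m" if "j \<le> m" for j
  proof -
    have "\<epsilon> * real j \<le> \<epsilon> * real (Suc m)" using that \<epsilon> by (intro mult_left_mono) auto
    then show ?thesis by (simp add: \<epsilon>_def)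
  qed
  \<comment> \<open>The size bound \<open>?s\<close> is generous: closedness of \<open>X\<close>
    still applies to such \<open>W\<close> and improves the bound to
    \<open>closure_bound q m\<close>, which leaves room for m more points.\<close>
  define P where "P = (\<lambda>W. finite W \<and> W \<subseteq> colored N \<and> W \<inter> (X \<union> A) = {} \<and> card W \<le> ?s \<and>
    cdim N W (X \<union> A) \<le> \<alpha> * card W - \<epsilon> * card W)"
  have bound: "card W \<le> closure_bound q m" if W: "P W" for W
  proof -
    have WU: "W \<subseteq> univ N" "finite W" using W colored_subset[of N] by (auto simp: P_def)
    have "\<alpha> * card W \<le> cdim N W X" using W X(2) unfolding P_def mclosed_def by blast
    also have "cdim N W X \<le> cdim N (A \<union> W) X" using WU A X by (intro dim_mono) auto
    then have "real (cdim N W X) \<le> cdim N (A \<union> W) X" by simp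
    also have "cdim N (A \<union> W) X = cdim N A X + cdim N W (X \<union> A)" using WU A X by (intro dim_Un) auto
    also have "real (cdim N A X + cdim N W (X \<union> A)) \<le> q + (\<alpha> * card W - \<epsilon> * card W)"
      using W dim_le_card[of A X] A X unfolding P_def by simp
    finally have "\<epsilon> * card W \<le> q" by simp
    then have "real (card W) \<le> real q * real (Suc m) / gran m"
      using gran(1)[of m] by (simp add: \<epsilon>_def field_simps)
    then show ?thesis unfolding closure_bound_def by linarith
  qed
  have "P {}" using dim_eq_0_iff[of "{}" "X \<union> A"] X A by (simp add: P_def)
  then obtain W where W: "P W" "\<And>W'. P W' \<Longrightarrow> card W' \<le> card W"
    using ex_has_greatest_nat[of P "{}" card "Suc (closure_bound q m)"] bound by (metis le_imp_less_Suc)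
  have "mclosed m N (X \<union> A \<union> W)"
  proof (rule ccontr)
    assume "\<not> mclosed m N (X \<union> A \<union> W)"
    then obtain Z where Z: "finite Z" "Z \<subseteq> colored N" "Z \<inter> (X \<union> A \<union> W) = {}" "card Z \<le> m"
      "real (cdim N Z (X \<union> A \<union> W)) < \<alpha> * card Z" by (auto simp: mclosed_def not_le)
    have U: "Z \<subseteq> univ N" "W \<subseteq> univ N" "finite W"
      using Z(2) W(1) colored_subset[of N] unfolding P_def by auto
    have dz: "real (cdim N Z (X \<union> A \<union> W)) \<le> \<alpha> * card Z - \<epsilon> * card Z"
      using gran(3)[OF Z(4,5)] \<epsilon>m[OF Z(4)] by linarith
    have cWZ: "card (W \<union> Z) = card W + card Z" using Z U by (intro card_Un_disjoint) auto
    have "cdim N (W \<union> Z) (X \<union> A) = cdim N W (X \<union> A) + cdim N Z (X \<union> A \<union> W)"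
      using U Z X A by (intro dim_Un) auto
    then have "cdim N (W \<union> Z) (X \<union> A) \<le> \<alpha> * card (W \<union> Z) - \<epsilon> * card (W \<union> Z)"
      using dz W(1) unfolding P_def cWZ by (simp add: algebra_simps)
    then have "P (W \<union> Z)" using W(1) Z bound[OF W(1)] cWZ unfolding P_def by auto
    then have "card Z = 0" using W(2)[of "W \<union> Z"] cWZ by simp
    then show False using Z(5) by simp
  qed
  then show thesis using that[of W] W(1) bound[OF W(1)] unfolding P_def by blast
qed

section \<open>Extending elementary maps between closed sets\<close>

definition qf_elementary :: "('f, 'r option, 'u) fo_struct \<Rightarrow> 'u set \<Rightarrow> ('u \<Rightarrow> 'u) \<Rightarrow> bool" where
  "qf_elementary N X f \<longleftrightarrow> f ` X \<subseteq> univ N \<and>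
     (\<forall>\<phi> \<eta>. wf_fm L \<phi> \<longrightarrow> qf \<phi> \<longrightarrow> range \<eta> \<subseteq> X \<longrightarrow> sat (reduct N) \<eta> \<phi> \<longleftrightarrow> sat (reduct N) (f \<circ> \<eta>) \<phi>)"

text \<open>The maps of the back-and-forth argument. Closedness is demanded on both sides, so the
  notion passes to inverses.\<close>

definition good :: "nat \<Rightarrow> ('f, 'r option, 'u) fo_struct \<Rightarrow> 'u set \<Rightarrow> ('u \<Rightarrow> 'u) \<Rightarrow> bool" where
  "good m N X f \<longleftrightarrow> finite X \<and> X \<subseteq> univ N \<and> qf_elementary N X f \<and>
     (\<forall>x\<in>X. x \<in> colored N \<longleftrightarrow> f x \<in> colored N) \<and> mclosed m N X \<and> mclosed m N (f ` X)"

lemma qf_elementary_sat: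
  assumes N: "cmdl N" and X: "X \<subseteq> univ N" and f: "qf_elementary N X f" and \<phi>: "wf_fm L \<phi>" and \<eta>: "range \<eta> \<subseteq> X"
  shows "sat (reduct N) \<eta> \<phi> \<longleftrightarrow> sat (reduct N) (f \<circ> \<eta>) \<phi>"
proof -
  obtain \<psi> where \<psi>: "wf_fm L \<psi>" "qf \<psi>" "fv \<psi> \<subseteq> fv \<phi>"
    "\<And>(M :: ('f, 'r, 'u) fo_struct) e. mdl M \<Longrightarrow> range e \<subseteq> univ M \<Longrightarrow> sat M e \<phi> \<longleftrightarrow> sat M e \<psi>"
    using qe_obtain[OF \<phi>] by blast
  have "range (f \<circ> \<eta>) \<subseteq> univ N" using f \<eta> unfolding qf_elementary_def by auto
  then show ?thesis
    using \<psi>(4)[OF N, of \<eta>] \<psi>(4)[OF N, of "f \<circ> \<eta>"] f \<psi>(1,2) \<eta> X unfolding qf_elementary_def by (metis reduct_simps(1) subset_trans)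
qed

lemma qf_elementary_inj:
  assumes f: "qf_elementary N X f"
  shows "inj_on f X"
proof (rule inj_onI)
  fix x y assume xy: "x \<in> X" "y \<in> X" "f x = f y"
  let ?\<eta> = "\<lambda>i. if i = 0 then x else y"
  have "range ?\<eta> \<subseteq> X" using xy by auto
  then have "sat (reduct N) ?\<eta> (Eq (Var 0) (Var 1)) \<longleftrightarrow> sat (reduct N) (f \<circ> ?\<eta>) (Eq (Var 0) (Var 1))"
    using f unfolding qf_elementary_def by (metis qf.simps(4) wf_fm.simps(2) wf_tm.simps(1))
  then show "x = y" using xy(3) by simp
qed

lemma good_mono: "good m N X f \<Longrightarrow> m' \<le> m \<Longrightarrow> good m' N X f"
  using mclosed_mono unfolding good_def by blast

lemma good_inverse:
  assumes "good m N X f"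
  shows "good m N (f ` X) (inv_into X f)" "\<And>x. x \<in> X \<Longrightarrow> inv_into X f (f x) = x"
proof -
  have f: "qf_elementary N X f" and X: "X \<subseteq> univ N" using assms by (auto simp: good_def)
  have inj: "inj_on f X" by (rule qf_elementary_inj[OF f])
  then show inv: "\<And>x. x \<in> X \<Longrightarrow> inv_into X f (f x) = x" by simp
  have img: "inv_into X f ` f ` X = X" using inj by (simp add: inv_into_image_cancel)
  have "sat (reduct N) \<eta> \<phi> \<longleftrightarrow> sat (reduct N) (inv_into X f \<circ> \<eta>) \<phi>"
    if "wf_fm L \<phi>" "qf \<phi>" "range \<eta> \<subseteq> f ` X" for \<phi> \<eta>
  proof -
    have "range (inv_into X f \<circ> \<eta>) \<subseteq> X" using that(3) img by (auto simp: image_comp[symmetric] simp del: image_comp)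
    moreover have "f \<circ> (inv_into X f \<circ> \<eta>) = \<eta>" using that(3) by (auto simp: fun_eq_iff f_inv_into_f range_subsetD)
    ultimately show ?thesis using f that unfolding qf_elementary_def by metis
  qed
  then have "qf_elementary N (f ` X) (inv_into X f)"
    using img X unfolding qf_elementary_def by auto
  then show "good m N (f ` X) (inv_into X f)"
    using assms inv img unfolding good_def qf_elementary_def by auto
qed

text \<open>Types may use all variables: those in \<open>V\<close> are realized simultaneously, the
  others carry parameters. Thus whole maps and infinite configurations are obtained in one
  step.\<close>

definition saturated_struct :: "('f, 'r option, 'u) fo_struct \<Rightarrow> bool" where
  "saturated_struct N \<longleftrightarrow> (\<forall>\<Sigma> V e. (\<forall>\<phi>\<in>\<Sigma>. wf_fm (Lp L) \<phi>) \<longrightarrow> range e \<subseteq> univ N \<longrightarrow>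
     (\<forall>\<Sigma>0. finite \<Sigma>0 \<longrightarrow> \<Sigma>0 \<subseteq> \<Sigma> \<longrightarrow>
        (\<exists>e'. range e' \<subseteq> univ N \<and> (\<forall>v. v \<notin> V \<longrightarrow> e' v = e v) \<and> (\<forall>\<phi>\<in>\<Sigma>0. sat N e' \<phi>))) \<longrightarrow>
     (\<exists>e'. range e' \<subseteq> univ N \<and> (\<forall>v. v \<notin> V \<longrightarrow> e' v = e v) \<and> (\<forall>\<phi>\<in>\<Sigma>. sat N e' \<phi>)))"

lemma saturated_struct_realize:
  assumes "saturated_struct N" "\<And>\<phi>. \<phi> \<in> \<Sigma> \<Longrightarrow> wf_fm (Lp L) \<phi>" "range e \<subseteq> univ N"
    "\<And>\<Sigma>0. finite \<Sigma>0 \<Longrightarrow> \<Sigma>0 \<subseteq> \<Sigma> \<Longrightarrow>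
        \<exists>e'. range e' \<subseteq> univ N \<and> (\<forall>v. v \<notin> V \<longrightarrow> e' v = e v) \<and> (\<forall>\<phi>\<in>\<Sigma>0. sat N e' \<phi>)"
  obtains e' where "range e' \<subseteq> univ N" "\<And>v. v \<notin> V \<Longrightarrow> e' v = e v" "\<And>\<phi>. \<phi> \<in> \<Sigma> \<Longrightarrow> sat N e' \<phi>"
proof -
  have "\<exists>e'. range e' \<subseteq> univ N \<and> (\<forall>v. v \<notin> V \<longrightarrow> e' v = e v) \<and> (\<forall>\<phi>\<in>\<Sigma>. sat N e' \<phi>)"
    using assms(1)[unfolded saturated_struct_def, rule_format, of \<Sigma> e V] assms(2-4) by blast
  then show thesis using that by blast
qed

lemma saturated_struct_satm:
  assumes "saturated_struct N" "cmdl N"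
  shows "satm (reduct N)"
  unfolding saturated_model_def aleph0_saturated_def
proof (intro conjI allI ballI impI assms(2))
  fix k bs and \<Sigma> :: "('f, 'r) fm set"
  assume bs: "bs \<in> tuples (reduct N) k" and \<Sigma>: "\<forall>\<phi>\<in>\<Sigma>. formula_in L (Suc k) \<phi>"
    and fin: "\<forall>\<Sigma>0\<subseteq>\<Sigma>. finite \<Sigma>0 \<longrightarrow> (\<exists>a\<in>univ (reduct N). \<forall>\<phi>\<in>\<Sigma>0. holds (reduct N) \<phi> (bs @ [a]))"
  obtain u where u: "u \<in> univ N" using is_model_struct[OF assms(2)] by (auto simp: is_struct_def)
  define e where "e = (\<lambda>i. if i < k then bs ! i else u)"
  have e: "range e \<subseteq> univ N" using bs u by (auto simp: e_def tuples_def)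
  have eq: "holds (reduct N) \<phi> (bs @ [a]) \<longleftrightarrow> sat N (e(k := a)) (lift_fm \<phi>)" if "\<phi> \<in> \<Sigma>" for \<phi> a
    unfolding sat_lift by (rule holds_iff_sat) (use \<Sigma> that bs in \<open>auto simp: e_def tuples_def nth_append\<close>)
  obtain e' where e': "range e' \<subseteq> univ N" "\<And>v. v \<notin> {k} \<Longrightarrow> e' v = e v" "\<And>\<phi>. \<phi> \<in> lift_fm ` \<Sigma> \<Longrightarrow> sat N e' \<phi>"
  proof (rule saturated_struct_realize[OF assms(1), of "lift_fm ` \<Sigma>" e "{k}"])
    show "wf_fm (Lp L) \<phi>" if "\<phi> \<in> lift_fm ` \<Sigma>" for \<phi> using that \<Sigma> by (auto simp: formula_in_def)
    fix \<Sigma>0 :: "('f, 'r option) fm set" assume "finite \<Sigma>0" "\<Sigma>0 \<subseteq> lift_fm ` \<Sigma>"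
    then obtain \<Theta> where \<Theta>: "\<Theta> \<subseteq> \<Sigma>" "finite \<Theta>" "\<Sigma>0 = lift_fm ` \<Theta>" by (meson finite_subset_image)
    then obtain a where a: "a \<in> univ N" "\<forall>\<phi>\<in>\<Theta>. holds (reduct N) \<phi> (bs @ [a])" using fin by auto
    then show "\<exists>e'. range e' \<subseteq> univ N \<and> (\<forall>v. v \<notin> {k} \<longrightarrow> e' v = e v) \<and> (\<forall>\<phi>\<in>\<Sigma>0. sat N e' \<phi>)"
    proof (intro exI[of _ "e(k := a)"] conjI ballI allI impI)
      fix \<phi> assume "\<phi> \<in> \<Sigma>0"
      then obtain \<theta> where "\<theta> \<in> \<Theta>" "\<phi> = lift_fm \<theta>" using \<Theta>(3) by auto
      then show "sat N (e(k := a)) \<phi>" using eq[of \<theta> a] \<Theta>(1) a(2) by auto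
    qed (use e a(1) in auto)
  qed (use e in auto)
  have "e' = e(k := e' k)" using e'(2) by auto
  then have "holds (reduct N) \<phi> (bs @ [e' k])" if "\<phi> \<in> \<Sigma>" for \<phi> using eq[OF that] e'(3) that by (metis imageI)
  then show "\<exists>a\<in>univ (reduct N). \<forall>\<phi>\<in>\<Sigma>. holds (reduct N) \<phi> (bs @ [a])"
    using e'(1) by (intro bexI[of _ "e' k"]) auto
qed

text \<open>Reduces the extension of a map to the realization of one formula at a time. The flag \<open>b\<close>
  tells whether colors and closedness are part of the type to be realized.\<close>

lemma extend_by_saturation:
  assumes N: "cmdl N" "saturated_struct N" and B: "finite B" "X \<subseteq> B" "B \<subseteq> univ N" "X \<noteq> {}"
    and f: "f ` X \<subseteq> univ N"
    and step: "\<And>\<theta> H. wf_fm L \<theta> \<Longrightarrow> qf \<theta> \<Longrightarrow> range H = B \<Longrightarrow> sat (reduct N) H \<theta> \<Longrightarrow>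
      \<exists>g. (\<forall>x\<in>X. g x = f x) \<and> g ` B \<subseteq> univ N \<and> sat (reduct N) (g \<circ> H) \<theta> \<and>
        (b \<longrightarrow> (\<forall>x\<in>B. x \<in> colored N \<longleftrightarrow> g x \<in> colored N) \<and> mclosed m N (g ` B))"
  obtains g where "\<And>x. x \<in> X \<Longrightarrow> g x = f x" "qf_elementary N B g"
    "b \<Longrightarrow> (\<forall>x\<in>B. x \<in> colored N \<longleftrightarrow> g x \<in> colored N) \<and> mclosed m N (g ` B)"
proof -
  have ne: "B \<noteq> {}" using B by auto
  \<comment> \<open>\<open>H\<close> names the elements of \<open>B\<close> by variables. Names of
    elements of \<open>X\<close> keep the value given by \<open>f\<close>; the others form the block
    to be realized.\<close>
  define H where "H = from_nat_into B"
  have H: "range H = B" unfolding H_def by (rule range_from_nat_into[OF ne countable_finite[OF B(1)]])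
  have "B \<subseteq> H ` UNIV" using H by simp
  then obtain W where W: "finite W" "H ` W = B" using finite_subset_image[OF B(1)] by metis
  obtain x0 where x0: "x0 \<in> X" using B by auto
  define e where "e = (\<lambda>v. if H v \<in> X then f (H v) else f x0)"
  have e: "range e \<subseteq> univ N" using f x0 by (auto simp: e_def)
  let ?V = "{v. H v \<notin> X}"
  define \<Sigma>1 where "\<Sigma>1 = {\<theta>. wf_fm L \<theta> \<and> qf \<theta> \<and> sat (reduct N) H \<theta>}"
  \<comment> \<open>All formulas common to the images of \<open>B\<close> with the right colors and
    closed range. Among them are the color literals and the negated witnesses of failing closedness,
    from which both properties are read off again.\<close>
  define \<Sigma>2 where "\<Sigma>2 = {\<psi>. wf_fm (Lp L) \<psi> \<and> b \<and> (\<forall>g. g ` B \<subseteq> univ N \<longrightarrow> (\<forall>x\<in>B. x \<in> colored N \<longleftrightarrow> g x \<in> colored N) \<longrightarrow>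
     mclosed m N (g ` B) \<longrightarrow> sat N (g \<circ> H) \<psi>)}"
  obtain e' where e': "range e' \<subseteq> univ N" "\<And>v. v \<notin> ?V \<Longrightarrow> e' v = e v" "\<And>\<phi>. \<phi> \<in> lift_fm ` \<Sigma>1 \<union> \<Sigma>2 \<Longrightarrow> sat N e' \<phi>"
  proof (rule saturated_struct_realize[OF N(2), of "lift_fm ` \<Sigma>1 \<union> \<Sigma>2" e ?V])
    show "wf_fm (Lp L) \<phi>" if "\<phi> \<in> lift_fm ` \<Sigma>1 \<union> \<Sigma>2" for \<phi> using that by (auto simp: \<Sigma>1_def \<Sigma>2_def)
    fix \<Sigma>0 assume S: "finite \<Sigma>0" "\<Sigma>0 \<subseteq> lift_fm ` \<Sigma>1 \<union> \<Sigma>2"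
    have "finite (\<Sigma>0 - \<Sigma>2)" "\<Sigma>0 - \<Sigma>2 \<subseteq> lift_fm ` \<Sigma>1" using S by auto
    then obtain \<Theta> where \<Theta>: "\<Theta> \<subseteq> \<Sigma>1" "finite \<Theta>" "\<Sigma>0 - \<Sigma>2 = lift_fm ` \<Theta>" by (meson finite_subset_image)
    have "wf_fm L (fconj \<Theta>)" "qf (fconj \<Theta>)" "sat (reduct N) H (fconj \<Theta>)"
      using \<Theta>(1) by (auto simp: fconj_simps[OF \<Theta>(2)] \<Sigma>1_def)
    then obtain g where g: "\<forall>x\<in>X. g x = f x" "g ` B \<subseteq> univ N" "sat (reduct N) (g \<circ> H) (fconj \<Theta>)"
      "b \<longrightarrow> (\<forall>x\<in>B. x \<in> colored N \<longleftrightarrow> g x \<in> colored N) \<and> mclosed m N (g ` B)" using step[OF _ _ H] by blast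
    have "sat N (g \<circ> H) \<phi>" if \<phi>: "\<phi> \<in> \<Sigma>0" for \<phi>
    proof (cases "\<phi> \<in> \<Sigma>2")
      case True
      then show ?thesis using g(2,4) by (auto simp: \<Sigma>2_def)
    next
      case False
      then obtain \<theta> where "\<theta> \<in> \<Theta>" "\<phi> = lift_fm \<theta>" using \<phi> \<Theta>(3) by auto
      then show ?thesis using g(3) by (simp add: fconj_simps[OF \<Theta>(2)])
    qed
    moreover have "range (g \<circ> H) \<subseteq> univ N" using g(2) H by auto
    moreover have "(g \<circ> H) v = e v" if "v \<notin> ?V" for v using that g(1) by (simp add: e_def)
    ultimately show "\<exists>e'. range e' \<subseteq> univ N \<and> (\<forall>v. v \<notin> ?V \<longrightarrow> e' v = e v) \<and> (\<forall>\<phi>\<in>\<Sigma>0. sat N e' \<phi>)" by blast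
  qed (use e in auto)
  have sat1: "sat (reduct N) e' \<theta> \<longleftrightarrow> sat (reduct N) H \<theta>" if "wf_fm L \<theta>" "qf \<theta>" for \<theta>
  proof -
    have st: "sat (reduct N) e' \<theta>'" if "\<theta>' \<in> \<Sigma>1" for \<theta>' using e'(3)[of "lift_fm \<theta>'"] that by simp
    have "sat (reduct N) H \<theta> \<Longrightarrow> sat (reduct N) e' \<theta>" "sat (reduct N) H (Neg \<theta>) \<Longrightarrow> sat (reduct N) e' (Neg \<theta>)"
      using st[of \<theta>] st[of "Neg \<theta>"] that by (simp_all add: \<Sigma>1_def)
    then show ?thesis by auto
  qed
  define g where "g = (\<lambda>x. e' (SOME v. H v = x))"
  have gH: "g (H v) = e' v" for v
  proof -
    have "H (SOME w. H w = H v) = H v" by (rule someI[of _ v]) simp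
    then show ?thesis using sat1[of "Eq (Var (SOME w. H w = H v)) (Var v)"] by (simp add: g_def)
  qed
  then have gH': "g \<circ> H = e'" by auto
  have gB: "g ` B \<subseteq> univ N" using e'(1) gH' by (metis H image_comp)
  show thesis
  proof (rule that)
    fix x assume x: "x \<in> X"
    then obtain v where "x = H v" using B(2) H by auto
    then show "g x = f x" using gH[of v] e'(2)[of v] x by (simp add: e_def)
  next
    show "qf_elementary N B g"
      unfolding qf_elementary_def
    proof (intro conjI allI impI gB)
      fix \<phi> and \<eta> :: "nat \<Rightarrow> 'u" assume \<phi>: "wf_fm L \<phi>" "qf \<phi>" and \<eta>: "range \<eta> \<subseteq> B"
      have "\<exists>v. H v = \<eta> x" for x using range_subsetD[OF \<eta>] H by (metis imageE)
      then obtain p where p: "\<And>x. H (p x) = \<eta> x" by metis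
      have "\<eta> = H \<circ> p" using p by auto
      then show "sat (reduct N) \<eta> \<phi> \<longleftrightarrow> sat (reduct N) (g \<circ> \<eta>) \<phi>"
        using sat1[of "sub p \<phi>"] \<phi> gH' by (simp add: sat_sub[OF \<phi>(2)] comp_assoc[symmetric])
    qed
  next
    assume b: b
    have lit: "H v \<in> colored N \<Longrightarrow> Rel None [Var v] \<in> \<Sigma>2" "H v \<notin> colored N \<Longrightarrow> Neg (Rel None [Var v]) \<in> \<Sigma>2" for v
    proof -
      have "H v \<in> B" using H by auto
      then show "H v \<in> colored N \<Longrightarrow> Rel None [Var v] \<in> \<Sigma>2" "H v \<notin> colored N \<Longrightarrow> Neg (Rel None [Var v]) \<in> \<Sigma>2"
        using b unfolding \<Sigma>2_def colored_def by auto
    qed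
    have "x \<in> colored N \<longleftrightarrow> g x \<in> colored N" if x: "x \<in> B" for x
    proof -
      obtain v where v: "x = H v" using x H by auto
      have "e' v \<in> univ N" using e'(1) by auto
      then show ?thesis
        using lit[of v] e'(3)[of "Rel None [Var v]"] e'(3)[of "Neg (Rel None [Var v])"] v gH[of v]
        by (cases "x \<in> colored N") (auto simp: colored_def)
    qed
    moreover have "mclosed m N (g ` B)"
    proof (rule ccontr)
      assume n: "\<not> mclosed m N (g ` B)"
      have eW: "e' ` W = g ` B" using W(2) gH by (force simp: image_iff)
      obtain \<psi> where \<psi>: "wf_fm (Lp L) \<psi>" "fv \<psi> \<subseteq> W" "sat N e' \<psi>"
        "\<And>M' H'. cmdl M' \<Longrightarrow> range H' \<subseteq> univ M' \<Longrightarrow> sat M' H' \<psi> \<Longrightarrow> \<not> mclosed m M' (H' ` W)"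
        by (rule not_mclosed_witness[OF N(1) e'(1) W(1), of m], use n eW in simp) (rule that)
      have "Neg \<psi> \<in> \<Sigma>2"
        unfolding \<Sigma>2_def
      proof (intro CollectI conjI allI impI)
        fix g' assume g': "g' ` B \<subseteq> univ N" "mclosed m N (g' ` B)"
        have "range (g' \<circ> H) \<subseteq> univ N" using g' H by auto
        moreover have "(g' \<circ> H) ` W = g' ` B" using W(2) by (metis image_comp)
        ultimately show "sat N (g' \<circ> H) (Neg \<psi>)" using \<psi>(4)[OF N(1), of "g' \<circ> H"] g'(2) by auto
      qed (use \<psi> b in auto)
      then show False using e'(3)[of "Neg \<psi>"] \<psi>(3) by simp
    qed
    ultimately show "(\<forall>x\<in>B. x \<in> colored N \<longleftrightarrow> g x \<in> colored N) \<and> mclosed m N (g ` B)" by blast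
  qed
qed

text \<open>The pair \<open>weights m\<close> consists of the dimension and the number of colored points of an
  extension whose predimension over the base is below the granularity \<open>gran m\<close>.\<close>

definition admissible_weights :: "nat \<Rightarrow> nat \<Rightarrow> nat \<Rightarrow> bool" where
  "admissible_weights m K M \<longleftrightarrow> closure_bound 1 m + m + 2 \<le> K \<and> 0 \<le> real K - \<alpha> * real M \<and>
     real K - \<alpha> * real M < gran m \<and>
     (\<forall>r b. b \<le> closure_bound 1 m + m + 2 \<longrightarrow> \<alpha> * real b \<le> real r \<longrightarrow> K + b \<le> M + r)"

definition weights :: "nat \<Rightarrow> nat \<times> nat" where
  "weights m = (SOME p. admissible_weights m (fst p) (snd p))"

lemma weights:
  assumes "weights m = (K, M)"
  shows "closure_bound 1 m + m + 2 \<le> K" "0 \<le> real K - \<alpha> * real M" "real K - \<alpha> * real M < gran m"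
    "b \<le> closure_bound 1 m + m + 2 \<Longrightarrow> \<alpha> * real b \<le> real r \<Longrightarrow> K + b \<le> M + r"
proof -
  obtain K' M' :: nat where KM: "closure_bound 1 m + m + 2 \<le> K'" "0 \<le> real K' - \<alpha> * real M'" "real K' - \<alpha> * real M' < gran m"
    "\<And>r b. b \<le> closure_bound 1 m + m + 2 \<Longrightarrow> \<alpha> * real b \<le> real r \<Longrightarrow> K' + b \<le> M' + r"
    by (rule weight_approximation[OF alpha_pos alpha_le gran(1), of "closure_bound 1 m + m + 2" m], rule that)
  then have "admissible_weights m K' M'" by (simp add: admissible_weights_def)
  then have "admissible_weights m (fst (weights m)) (snd (weights m))"
    unfolding weights_def by (intro someI[of "\<lambda>p. admissible_weights m (fst p) (snd p)" "(K', M')"]) simp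
  then have "admissible_weights m K M" by (simp add: assms)
  then show "closure_bound 1 m + m + 2 \<le> K" "0 \<le> real K - \<alpha> * real M" "real K - \<alpha> * real M < gran m"
    "b \<le> closure_bound 1 m + m + 2 \<Longrightarrow> \<alpha> * real b \<le> real r \<Longrightarrow> K + b \<le> M + r"
    by (auto simp: admissible_weights_def)
qed

lemma mclosedD:
  "mclosed m M X \<Longrightarrow> finite Z \<Longrightarrow> Z \<subseteq> colored M \<Longrightarrow> Z \<inter> X = {} \<Longrightarrow> card Z \<le> m \<Longrightarrow>
     \<alpha> * real (card Z) \<le> real (cdim M Z X)"
  by (auto simp: mclosed_def)

text \<open>Dominates every size that one extension step tests against closedness:
  \<open>closure_bound 1 m + m\<close> when closing up, and the colored points of the copied
  extension together with a violation of m points.\<close>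

definition extension_bound :: "nat \<Rightarrow> nat" where
  "extension_bound m = closure_bound 1 m + 2 * m + 2 + snd (weights m)"

text \<open>Closedness of the image of \<open>X\<close> is used twice. It forces the copy of
  \<open>D\<close> to have full dimension K, as K - 1 < \<alpha> Mn; and it excludes violations
  outside the copy, since their loss of \<open>gran m\<close> exceeds the predimension of the copy.
  Among the points copied from \<open>E\<close>, independence excludes violations.\<close>

lemma transcendental_extension_step:
  assumes N: "rich N" "satm (reduct N)" and f: "good m' N X f" and m': "extension_bound m \<le> m'"
    and X0: "X \<noteq> {}" and u: "u \<in> univ N" "u \<notin> cacl N X"
    and W: "finite W" "W \<subseteq> colored N" "W \<inter> (X \<union> {u}) = {}" "card W \<le> closure_bound 1 m"
    and \<theta>: "wf_fm L \<theta>" "qf \<theta>" and H: "range H = X \<union> {u} \<union> W" "sat (reduct N) H \<theta>"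
  shows "\<exists>g. (\<forall>x\<in>X. g x = f x) \<and> g ` (X \<union> {u} \<union> W) \<subseteq> univ N \<and> sat (reduct N) (g \<circ> H) \<theta> \<and>
    (\<forall>x\<in>X \<union> {u} \<union> W. x \<in> colored N \<longleftrightarrow> g x \<in> colored N) \<and> mclosed m N (g ` (X \<union> {u} \<union> W))"
proof -
  have M: "cmdl N" using N(1) by (rule rich_cmdl)
  interpret pregeometry "univ N" "cacl N" by (rule cpregeometry[OF M])
  have X: "finite X" "X \<subseteq> univ N" and fe: "qf_elementary N X f"
    and fcol: "\<And>x. x \<in> X \<Longrightarrow> x \<in> colored N \<longleftrightarrow> f x \<in> colored N"
    and mX: "mclosed m' N X" and mY: "mclosed m' N (f ` X)"
    using f by (auto simp: good_def)
  have WU: "W \<subseteq> univ N" using W(2) colored_subset by (rule subset_trans)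
  have uX: "u \<notin> X" using u(2) cl_ext[OF X(2)] by auto
  define D0 where "D0 = insert u W"
  define B where "B = X \<union> D0"
  have B_eq: "X \<union> {u} \<union> W = B" by (auto simp: B_def D0_def)
  have D0: "finite D0" "D0 \<subseteq> univ N" "D0 \<inter> X = {}" using W u WU uX by (auto simp: D0_def)
  have B: "finite B" "B \<subseteq> univ N" "X \<subseteq> B" using D0 X by (auto simp: B_def)
  have cD0: "card D0 \<le> closure_bound 1 m + 1" using W(1,4) card_insert_le_m1 by (auto simp: D0_def card_insert_if)
  define r where "r = cdim N D0 X"
  define b where "b = card (D0 \<inter> colored N)"
  obtain K Mn where KM: "weights m = (K, Mn)" by (cases "weights m")
  note w = weights[OF KM]
  have m'_ge: "closure_bound 1 m + 2 * m + 2 + Mn \<le> m'" using m' KM by (simp add: extension_bound_def)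
  have D0dim: "\<alpha> * card (A \<inter> colored N) \<le> cdim N A X" if A: "A \<subseteq> D0" for A
  proof -
    have finA: "finite A" using A D0(1) finite_subset by blast
    have "card (A \<inter> colored N) \<le> card D0" using A D0(1) by (intro card_mono) auto
    then have "card (A \<inter> colored N) \<le> m'" using cD0 m'_ge by linarith
    then have "\<alpha> * card (A \<inter> colored N) \<le> cdim N (A \<inter> colored N) X"
      using mX A D0(3) finA unfolding mclosed_def by blast
    also have "cdim N (A \<inter> colored N) X \<le> cdim N A X" using finA A D0 X by (intro dim_mono) auto
    finally show ?thesis by simp
  qed
  have b_le: "b \<le> closure_bound 1 m + m + 2"
    using card_mono[OF D0(1), of "D0 \<inter> colored N"] cD0 by (simp add: b_def)
  have br: "\<alpha> * b \<le> r" using D0dim[of D0] by (simp add: b_def r_def)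
  have "cdim N {u} X \<le> r" unfolding r_def using D0 X by (intro dim_mono) (auto simp: D0_def)
  then have r1: "1 \<le> r" using dim_singleton[OF u(1) X(2)] u(2) by simp
  have "r \<le> card D0" unfolding r_def using D0 X by (intro dim_le_card)
  then have r_le: "r \<le> closure_bound 1 m + 1" using cD0 by simp
  have Kb: "K + b \<le> Mn + r" using w(4)[OF b_le] br by simp
  \<comment> \<open>The points of \<open>E\<close> are to raise the dimension from r to K and the
    number of colored points from b to \<open>Mn\<close>.\<close>
  define k where "k = K - r"
  define n where "n = Mn - b"
  \<comment> \<open>k exceeds m, so any m points of \<open>E\<close> will be independent over
    \<open>D0\<close> and \<open>X\<close>.\<close>
  have k: "m + 1 \<le> k" "r + k = K" using r_le w(1) by (auto simp: k_def)
  have n: "k \<le> n" "b + n = Mn" using Kb r_le w(1) by (auto simp: k_def n_def)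
  have Bdim: "cdim N B X = r"
  proof -
    have "B - X = D0" using D0(3) by (auto simp: B_def)
    then show ?thesis using dim_Diff_base[OF B(1,2) X(2)] by (simp add: r_def)
  qed
  have "\<exists>E. finite E \<and> card E = n \<and> E \<subseteq> univ N \<and> E \<inter> B = {} \<and> cdim N (B \<union> E) X \<le> r + k \<and>
    (\<forall>B0 S. B0 \<subseteq> B \<longrightarrow> S \<subseteq> E \<longrightarrow> min (cdim N B0 X + card S) (r + k) \<le> cdim N (B0 \<union> S) X)"
    using general_position[OF N(2), of B X r k n] B Bdim r1 k by simp
  then obtain E where E: "finite E" "card E = n" "E \<subseteq> univ N" "E \<inter> B = {}" "cdim N (B \<union> E) X \<le> K"
    "\<And>B0 S. B0 \<subseteq> B \<Longrightarrow> S \<subseteq> E \<Longrightarrow> min (cdim N B0 X + card S) K \<le> cdim N (B0 \<union> S) X"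
    unfolding k(2) by blast
  define D where "D = D0 \<union> E"
  have D: "finite D" "D \<subseteq> univ N" "D \<inter> X = {}" using D0 E by (auto simp: D_def B_def)
  have D0B: "D0 \<subseteq> B" by (simp add: B_def)
  \<comment> \<open>The points of \<open>E\<close> are declared colored, whatever their color in
    \<open>N\<close>; their copies will really be colored.\<close>
  define C where "C = (D0 \<inter> colored N) \<union> E"
  have CD: "C \<subseteq> D" by (auto simp: C_def D_def)
  have D0E: "D0 \<inter> E = {}" using E(4) by (auto simp: B_def)
  have cardC: "card C = Mn"
  proof -
    have "(D0 \<inter> colored N) \<inter> E = {}" using D0E by auto
    then show ?thesis using card_Un_disjoint[of "D0 \<inter> colored N" E] D0(1) E(1,2) n(2) unfolding C_def b_def by simp
  qed
  have dimD: "cdim N D X = K"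
  proof (rule antisym)
    have "cdim N D X \<le> cdim N (B \<union> E) X" using D B E X by (intro dim_mono) (auto simp: D_def B_def)
    then show "cdim N D X \<le> K" using E(5) by simp
    have "min (cdim N D0 X + card E) K \<le> cdim N (D0 \<union> E) X" using E(6)[OF D0B] by simp
    then show "K \<le> cdim N D X" using n(1) k(2) E(2) by (simp add: D_def r_def)
  qed
  \<comment> \<open>Below dimension K each point of \<open>E\<close> adds 1, at least its weight
    \<alpha>. Once K is reached, even all \<open>Mn\<close> colored points together weigh at most
    K.\<close>
  have Cdim: "\<alpha> * card (A \<inter> C) \<le> cdim N A X" if A: "A \<subseteq> D" for A
  proof -
    let ?A0 = "A \<inter> D0" and ?S = "A \<inter> E"
    have un: "?A0 \<union> ?S = A" using A by (auto simp: D_def)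
    have finA: "finite A" using A D finite_subset by blast
    have "A \<inter> C = (?A0 \<inter> colored N) \<union> ?S" using A by (auto simp: C_def D_def)
    then have c: "card (A \<inter> C) = card (?A0 \<inter> colored N) + card ?S"
      using card_Un_disjoint[of "?A0 \<inter> colored N" ?S] finA D0E by auto
    have le: "min (cdim N ?A0 X + card ?S) K \<le> cdim N A X"
      using E(6)[of ?A0 ?S] D0B by (auto simp: un)
    show ?thesis
    proof (cases "cdim N ?A0 X + card ?S \<le> K")
      case True
      have "\<alpha> * real (card ?S) \<le> 1 * real (card ?S)" using alpha_le by (intro mult_right_mono) auto
      then have "\<alpha> * card (A \<inter> C) \<le> cdim N ?A0 X + card ?S"
        using D0dim[of ?A0] unfolding c by (simp add: distrib_left)
      then show ?thesis using le True by simp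
    next
      case False
      have "card (A \<inter> C) \<le> Mn" unfolding cardC[symmetric] using CD D(1) finite_subset by (intro card_mono) auto
      then have "\<alpha> * card (A \<inter> C) \<le> \<alpha> * Mn" using alpha_pos by (intro mult_left_mono) auto
      then show ?thesis using le False w(2) by simp
    qed
  qed
  \<comment> \<open>A point of \<open>C\<close> has dimension at least \<alpha> > 0; the only point
    of \<open>D\<close> that can lie outside \<open>C\<close> is \<open>u\<close>.\<close>
  have Dtr: "d \<notin> cacl N X" if d: "d \<in> D" for d
  proof (cases "d \<in> C")
    case True
    then have "\<alpha> \<le> cdim N {d} X" using Cdim[of "{d}"] d by simp
    then show ?thesis using dim_singleton[of d X] d D X alpha_pos by (auto split: if_splits)
  next
    case False
    then have "d = u" using d W(2) by (auto simp: C_def D_def D0_def)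
    then show ?thesis using u(2) by simp
  qed
  obtain D1 where D1: "finite D1" "D1 \<subseteq> D" "indep D1 X" "D \<subseteq> cacl N (X \<union> D1)" "card D1 = cdim N D X"
    by (rule dim_basis[OF D(1,2) X(2)], rule that)
  have D1dim: "cdim N D1 X = K"
    using dim_ge_indep[of D1 X D1] dim_le_card[of D1 X] D1 subset_trans[OF D1(2) D(2)] X dimD by auto
  obtain ds1 where ds1: "set ds1 = D1" "distinct ds1" using finite_distinct_list[OF D1(1)] by auto
  have "finite (D - D1)" using D(1) by simp
  then obtain ds2 where ds2: "set ds2 = D - D1" "distinct ds2" using finite_distinct_list by blast
  obtain as where as: "set as = X" "distinct as" using finite_distinct_list[OF X(1)] by auto
  define ds where "ds = ds1 @ ds2"
  define m0 where "m0 = length as"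
  define n0 where "n0 = length ds"
  have ds: "set ds = D" "distinct ds" using ds1 ds2 D1(2) by (auto simp: ds_def)
  have lds1: "length ds1 = K" using ds1 D1(5) dimD distinct_card by fastforce
  have dist: "distinct (as @ ds)" using as ds D(3) by auto
  have as_t: "as \<in> tuples N m0" and ds_t: "ds \<in> tuples N n0" using as ds X D by (auto simp: tuples_def m0_def n0_def)
  have "\<exists>i<m0. as ! i = x" if "x \<in> X" for x using that as by (metis in_set_conv_nth m0_def)
  then obtain ia where ia: "\<And>x. x \<in> X \<Longrightarrow> ia x < m0 \<and> as ! ia x = x" by metis
  have "\<exists>i<n0. ds ! i = x" if "x \<in> D" for x using that ds by (metis in_set_conv_nth n0_def)
  then obtain id where id: "\<And>x. x \<in> D \<Longrightarrow> id x < n0 \<and> ds ! id x = x" by metis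
  define s where "s = (\<lambda>v. if H v \<in> X then ia (H v) else m0 + id (H v))"
  have HD: "H v \<in> D" if "H v \<notin> X" for v
  proof -
    have "H v \<in> X \<union> {u} \<union> W" using H(1) by blast
    then show ?thesis using that by (auto simp: D_def D0_def)
  qed
  have \<theta>': "formula_in L (m0 + n0) (sub s \<theta>)"
    using \<theta> ia id HD by (intro formula_in_sub) (force simp: s_def)+
  have \<theta>H: "holds (reduct N) (sub s \<theta>) (as @ ds)"
  proof -
    have "(\<lambda>i. (as @ ds) ! i) \<circ> s = H"
      using ia id HD by (auto simp: s_def nth_append m0_def fun_eq_iff)
    then show ?thesis unfolding holds_def sat_sub[OF \<theta>(2)] using H(2) by simp
  qed
  define bs where "bs = map f as"
  have fU: "f ` X \<subseteq> univ N" using fe by (simp add: qf_elementary_def)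
  have bs_t: "bs \<in> tuples N m0" using fU as by (auto simp: bs_def tuples_def m0_def)
  have setbs: "set bs = f ` X" using as by (simp add: bs_def)
  have m0_pos: "0 < m0" using X0 as by (auto simp: m0_def)
  have bs_type: "holds (reduct N) \<psi> as \<longleftrightarrow> holds (reduct N) \<psi> bs" if \<psi>: "formula_in L m0 \<psi>" for \<psi>
  proof -
    define \<eta> where "\<eta> = (\<lambda>i. if i < m0 then as ! i else as ! 0)"
    have \<eta>: "range \<eta> \<subseteq> X" using m0_pos as by (auto simp: \<eta>_def m0_def)
    have "holds (reduct N) \<psi> as \<longleftrightarrow> sat (reduct N) \<eta> \<psi>" by (rule holds_iff_sat[OF \<psi>]) (simp add: \<eta>_def)
    moreover have "holds (reduct N) \<psi> bs \<longleftrightarrow> sat (reduct N) (f \<circ> \<eta>) \<psi>"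
      by (rule holds_iff_sat[OF \<psi>]) (simp add: \<eta>_def bs_def m0_def)
    moreover have "wf_fm L \<psi>" using \<psi> by (simp add: formula_in_def)
    ultimately show ?thesis using qf_elementary_sat[OF M X(2) fe _ \<eta>] by simp
  qed
  have closed: "\<alpha> * card (A \<inter> C) \<le> cdim N A (set as)" if "A \<subseteq> set ds" for A
    using Cdim that ds as by simp
  have transc: "d \<notin> cacl N (set as)" if "d \<in> set ds" for d using Dtr that ds as by simp
  have ne: "as \<noteq> []" using m0_pos m0_def by auto
  have basis: "cdim N (set ds1) (set as) = K" "cdim N (set ds) (set as) = K"
    using D1dim dimD ds1 ds as by simp_all
  have Cds: "C \<subseteq> set ds" using CD ds by simp
  obtain es where es: "es \<in> tuples N n0" "holds (reduct N) (sub s \<theta>) (bs @ es)" "distinct (bs @ es)"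
    "\<And>i. i < n0 \<Longrightarrow> es ! i \<in> colored N \<longleftrightarrow> ds ! i \<in> C"
    "\<And>I J. I \<subseteq> {..<n0} \<Longrightarrow> J \<subseteq> {..<n0} \<Longrightarrow>
       cdim N (entries es I) (entries es J \<union> set bs) \<le> cdim N (entries ds I) (entries ds J \<union> set as)"
    using extension_axiom_realization[OF N as_t ne ds_t ds_def lds1 dist basis Cds closed transc \<theta>' _ \<theta>H bs_t bs_type] \<theta>(2)
    by (metis qf_sub)
  define g where "g = (\<lambda>x. if x \<in> X then f x else es ! id x)"
  define Y where "Y = f ` X"
  have les: "length es = n0" and esU: "set es \<subseteq> univ N" using es(1) by (auto simp: tuples_def)
  have gD: "g x = es ! id x" if "x \<in> D" for x using that D(3) by (auto simp: g_def)
  have gX: "g x = f x" if "x \<in> X" for x using that by (simp add: g_def)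
  have gDes: "g x \<in> set es" if "x \<in> D" for x using gD[OF that] id[OF that] les by (metis nth_mem)
  have gDU: "g ` A \<subseteq> univ N" if "A \<subseteq> D" for A using gDes that esU by blast
  have gDY: "g ` D \<inter> Y = {}" using gDes es(3) setbs by (force simp: Y_def)
  have YU: "Y \<subseteq> univ N" using fU by (simp add: Y_def)
  have g_inj: "inj_on g D"
  proof (rule inj_onI)
    fix x y assume xy: "x \<in> D" "y \<in> D" "g x = g y"
    then have "id x = id y" using gD id es(3) les by (metis distinct_append nth_eq_iff_index_eq)
    then show "x = y" using id xy by metis
  qed
  have gcol: "g x \<in> colored N \<longleftrightarrow> x \<in> C" if "x \<in> D" for x using es(4)[of "id x"] id[OF that] gD[OF that] by simp
  have gdim: "cdim N (g ` A) (g ` A' \<union> Y) \<le> cdim N A (A' \<union> X)" if A: "A \<subseteq> D" "A' \<subseteq> D" for A A'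
  proof -
    have e1: "entries ds (id ` A) = A" if "A \<subseteq> D" for A
    proof -
      have "(\<lambda>i. ds ! i) ` id ` A = (\<lambda>x. x) ` A" unfolding image_image by (rule image_cong) (use id that in auto)
      then show ?thesis by simp
    qed
    have e2: "entries es (id ` A) = g ` A" if "A \<subseteq> D" for A
      unfolding image_image by (rule image_cong) (use gD that in auto)
    have e3: "id ` A \<subseteq> {..<n0}" if "A \<subseteq> D" for A using id that by auto
    show ?thesis using es(5)[OF e3[OF A(1)] e3[OF A(2)]] e1[OF A(1)] e1[OF A(2)] e2[OF A(1)] e2[OF A(2)] setbs as(1)
      by (simp add: Y_def)
  qed
  have finD: "finite A" if "A \<subseteq> D" for A using that D(1) finite_subset by blast
  have C_t: "card (g ` C) = Mn" "g ` C \<subseteq> colored N" "finite (g ` C)" "g ` C \<inter> Y = {}"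
    using card_image[OF inj_on_subset[OF g_inj CD]] cardC gcol CD finD[OF CD] gDY by auto
  \<comment> \<open>The \<open>Mn\<close> colored points over a closed set force dimension at least
    \<alpha> Mn > K - 1, while the realized formula allows at most K.\<close>
  have dimD': "cdim N (g ` D) Y = K"
  proof -
    have "Mn \<le> m'" using m'_ge by simp
    then have "\<alpha> * Mn \<le> cdim N (g ` C) Y" using mY C_t unfolding mclosed_def Y_def by metis
    also have "cdim N (g ` C) Y \<le> cdim N (g ` D) Y" using CD D gDU[of D] YU by (intro dim_mono) auto
    finally have "\<alpha> * Mn \<le> cdim N (g ` D) Y" by simp
    moreover have "cdim N (g ` D) Y \<le> K" using gdim[of D "{}"] dimD by simp
    ultimately show ?thesis using w(3) gran(2)[of m] by linarith
  qed
  \<comment> \<open>The total is K on both sides and the rest over a part has not grown, so no part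
    has lost dimension.\<close>
  have gdim_ge: "cdim N A X \<le> cdim N (g ` A) Y" if A: "A \<subseteq> D" for A
  proof -
    have AD: "A \<union> D = D" using A by auto
    have "cdim N (g ` A \<union> g ` D) Y = cdim N (g ` A) Y + cdim N (g ` D) (Y \<union> g ` A)"
      using finD[OF A] D gDU[OF A] gDU[of D] YU by (intro dim_Un) auto
    moreover have "cdim N (A \<union> D) X = cdim N A X + cdim N D (X \<union> A)"
      using finD[OF A] D A X by (intro dim_Un) auto
    moreover have "cdim N (g ` D) (Y \<union> g ` A) \<le> cdim N D (X \<union> A)" using gdim[of D A] A by (simp add: Un_commute)
    moreover have "g ` A \<union> g ` D = g ` D" using A by auto
    ultimately show ?thesis using dimD dimD' AD by simp
  qed
  have gB: "g ` B = Y \<union> g ` D0" unfolding B_def image_Un using gX by (auto simp: Y_def)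
  have D0D: "D0 \<subseteq> D" by (simp add: D_def)
  have "mclosed m N (g ` B)"
    unfolding mclosed_def gB
  proof (intro allI impI, elim conjE)
    fix Z assume Z: "finite Z" "Z \<subseteq> colored N" "Z \<inter> (Y \<union> g ` D0) = {}" "card Z \<le> m"
    have ZU: "Z \<subseteq> univ N" using Z(2) colored_subset by (rule subset_trans)
    \<comment> \<open>\<open>Z\<close> is split into copies of points of \<open>E\<close> and points
      outside the copy of \<open>C\<close>.\<close>
    define S where "S = {x \<in> E. g x \<in> Z}"
    have S: "S \<subseteq> E" "S \<subseteq> D" by (auto simp: S_def D_def)
    let ?Z1 = "g ` S" and ?Z2 = "Z - g ` S"
    have Z1: "?Z1 \<subseteq> Z" by (auto simp: S_def)
    have cS: "card ?Z1 = card S" using card_image[OF inj_on_subset[OF g_inj S(2)]] .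
    have cSm: "card S \<le> m" using card_mono[OF Z(1) Z1] cS Z(4) by simp
    have cZ: "card Z = card ?Z1 + card ?Z2"
      using card_Un_disjoint[of ?Z1 ?Z2] Z1 Z(1) finite_subset[OF Z1 Z(1)] by (simp add: Un_absorb1)
    \<comment> \<open>As \<open>card S\<close> is at most m < k, the minimum in the general position
      is r plus \<open>card S\<close>; thus \<open>S\<close> is independent over \<open>D0\<close>,
      and so is its copy.\<close>
    have "real (card S) \<le> cdim N ?Z1 (Y \<union> g ` D0)"
    proof -
      have "min (cdim N D0 X + card S) K \<le> cdim N (D0 \<union> S) X" using E(6)[OF D0B S(1)] .
      then have "r + card S \<le> cdim N (D0 \<union> S) X" using cSm k by (simp add: r_def)
      also have "\<dots> \<le> cdim N (g ` (D0 \<union> S)) Y" using gdim_ge[of "D0 \<union> S"] D0D S by simp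
      also have "\<dots> = cdim N (g ` D0) Y + cdim N ?Z1 (Y \<union> g ` D0)"
        unfolding image_Un using finD[OF D0D] finD[OF S(2)] gDU[OF D0D] gDU[OF S(2)] YU by (intro dim_Un) auto
      also have "cdim N (g ` D0) Y \<le> r" using gdim[of D0 "{}"] D0D by (simp add: r_def)
      finally show ?thesis by simp
    qed
    moreover have "\<alpha> * real (card ?Z1) \<le> 1 * real (card ?Z1)" using alpha_le by (intro mult_right_mono) auto
    ultimately have part1: "\<alpha> * card ?Z1 \<le> cdim N ?Z1 (Y \<union> g ` D0)" using cS by simp
    \<comment> \<open>A failure costs \<open>gran m\<close>, but the copy of \<open>D\<close> has
      predimension below \<open>gran m\<close>; together they would be negative over the closed set
      \<open>Y\<close>.\<close>
    have part2: "\<alpha> * card ?Z2 \<le> cdim N ?Z2 (Y \<union> g ` D)"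
    proof (rule ccontr)
      assume neg: "\<not> \<alpha> * card ?Z2 \<le> cdim N ?Z2 (Y \<union> g ` D)"
      have cZ2: "card ?Z2 \<le> m" using card_mono[of Z ?Z2] Z(1,4) by auto
      have gr: "cdim N ?Z2 (Y \<union> g ` D) \<le> \<alpha> * card ?Z2 - gran m" using gran(3)[OF cZ2] neg by simp
      have disj: "g ` C \<inter> ?Z2 = {}"
      proof -
        have "g x \<notin> ?Z2" if x: "x \<in> C" for x
        proof (cases "x \<in> E")
          case True
          then show ?thesis by (auto simp: S_def)
        next
          case False
          then have "x \<in> D0" using x by (simp add: C_def)
          then have "g x \<in> Y \<union> g ` D0" by simp
          then show ?thesis using Z(3) by blast
        qed
        then show ?thesis by blast
      qed
      have fin2: "finite ?Z2" using Z(1) by simp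
      have c: "card (g ` C \<union> ?Z2) = Mn + card ?Z2" using card_Un_disjoint[OF C_t(3) fin2 disj] C_t(1) by simp
      have cm: "card (g ` C \<union> ?Z2) \<le> m'" using c cZ2 m'_ge by simp
      have f3: "finite (g ` C \<union> ?Z2)" "g ` C \<union> ?Z2 \<subseteq> colored N" "(g ` C \<union> ?Z2) \<inter> Y = {}"
        using C_t Z fin2 by auto
      have "\<alpha> * card (g ` C \<union> ?Z2) \<le> cdim N (g ` C \<union> ?Z2) Y"
        by (rule mclosedD[OF mY[folded Y_def] f3 cm])
      also have "cdim N (g ` C \<union> ?Z2) Y \<le> cdim N (g ` D \<union> ?Z2) Y"
        using CD D Z(1) ZU gDU[of D] YU by (intro dim_mono) auto
      also have "cdim N (g ` D \<union> ?Z2) Y = K + cdim N ?Z2 (Y \<union> g ` D)"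
        unfolding dimD'[symmetric] using D Z(1) ZU gDU[of D] YU by (intro dim_Un) auto
      finally have "\<alpha> * Mn + \<alpha> * card ?Z2 \<le> K + cdim N ?Z2 (Y \<union> g ` D)"
        unfolding c by (simp add: distrib_left)
      then show False using gr w(3) by linarith
    qed
    have "cdim N ?Z2 (Y \<union> g ` D) \<le> cdim N ?Z2 ((Y \<union> g ` D0) \<union> ?Z1)"
      using Z(1) ZU gDU[of D] YU D0D S(2) by (intro dim_antimono) auto
    moreover have "cdim N (?Z1 \<union> ?Z2) (Y \<union> g ` D0) = cdim N ?Z1 (Y \<union> g ` D0) + cdim N ?Z2 ((Y \<union> g ` D0) \<union> ?Z1)"
      using finD[OF S(2)] Z(1) ZU gDU[OF S(2)] gDU[OF D0D] YU by (intro dim_Un) auto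
    moreover have "?Z1 \<union> ?Z2 = Z" using Z1 by auto
    ultimately show "\<alpha> * card Z \<le> cdim N Z (Y \<union> g ` D0)"
      using part1 part2 unfolding cZ by (simp add: distrib_left)
  qed
  moreover have "sat (reduct N) (g \<circ> H) \<theta>"
  proof -
    have "(\<lambda>i. (bs @ es) ! i) \<circ> s = g \<circ> H"
      using ia id HD gD gX by (auto simp: s_def nth_append m0_def bs_def fun_eq_iff)
    then show ?thesis using es(2) unfolding holds_def sat_sub[OF \<theta>(2)] by simp
  qed
  moreover have "x \<in> colored N \<longleftrightarrow> g x \<in> colored N" if x: "x \<in> B" for x
  proof (cases "x \<in> X")
    case True
    then show ?thesis using fcol gX by simp
  next
    case False
    then have "x \<in> D0" using x by (simp add: B_def)
    then show ?thesis using gcol[of x] D0D D0E by (auto simp: C_def)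
  qed
  moreover have "g ` B \<subseteq> univ N" using gB YU gDU[OF D0D] by auto
  ultimately show ?thesis unfolding B_eq using gX by (intro exI[of _ g]) auto
qed

lemma algebraic_extension_step:
  assumes N: "cmdl N" and X: "X \<subseteq> univ N" "X \<noteq> {}" and f: "qf_elementary N X f"
    and u: "u \<in> univ N" "u \<notin> X" and \<theta>: "wf_fm L \<theta>" "qf \<theta>" and H: "range H = insert u X" "sat (reduct N) H \<theta>"
  shows "\<exists>g. (\<forall>x\<in>X. g x = f x) \<and> g ` insert u X \<subseteq> univ N \<and> sat (reduct N) (g \<circ> H) \<theta>"
proof -
  obtain x0 where x0: "x0 \<in> X" using X by auto
  define s where "s = (\<lambda>v. if H v = u then 0 else Suc v)"
  define \<eta> where "\<eta> = (\<lambda>i. if i = 0 \<or> H (i - 1) = u then x0 else H (i - 1))"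
  have Hv: "H v = u \<or> H v \<in> X" for v using H(1) by blast
  have \<eta>: "range \<eta> \<subseteq> X" using x0 Hv by (auto simp: \<eta>_def)
  have "\<eta>(0 := u) \<circ> s = H" by (auto simp: s_def \<eta>_def fun_eq_iff)
  then have "sat (reduct N) (\<eta>(0 := u)) (sub s \<theta>)" using H(2) by (simp add: sat_sub[OF \<theta>(2)])
  then have "sat (reduct N) \<eta> (Ex 0 (sub s \<theta>))" using u(1) by auto
  moreover have "wf_fm L (Ex 0 (sub s \<theta>))" using \<theta>(1) by simp
  ultimately have "sat (reduct N) (f \<circ> \<eta>) (Ex 0 (sub s \<theta>))" using qf_elementary_sat[OF N X(1) f _ \<eta>] by blast
  then obtain w where w: "w \<in> univ N" "sat (reduct N) ((f \<circ> \<eta>)(0 := w)) (sub s \<theta>)" by auto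
  define g where "g = f(u := w)"
  have "(f \<circ> \<eta>)(0 := w) \<circ> s = g \<circ> H" by (auto simp: s_def \<eta>_def g_def fun_eq_iff)
  then have "sat (reduct N) (g \<circ> H) \<theta>" using w(2) by (simp add: sat_sub[OF \<theta>(2)])
  moreover have "g ` insert u X \<subseteq> univ N" using w(1) f by (auto simp: g_def qf_elementary_def)
  ultimately show ?thesis using u(2) by (intro exI[of _ g]) (auto simp: g_def)
qed

text \<open>The formula of \<open>alg_witness\<close> is preserved by \<open>g\<close> and forces
  algebraicity of the image as well.\<close>

lemma acl_image:
  assumes N: "cmdl N" and B: "B \<subseteq> univ N" and g: "qf_elementary N B g" and X: "X \<subseteq> B"
    and u: "u \<in> B" "u \<in> cacl N X"
  shows "g u \<in> cacl N (g ` X)"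
proof -
  obtain F where F: "finite F" "F \<subseteq> X" "u \<in> cacl N F" using acl_finite[OF N u(2)] by blast
  obtain l where l: "set l = F" using finite_list[OF F(1)] by auto
  define H where "H = (\<lambda>i. if i < length l then l ! i else u)"
  have "H i \<in> B" for i
  proof (cases "i < length l")
    case True
    then have "H i \<in> F" using nth_mem[of i l] l by (simp add: H_def)
    then show ?thesis using F(2) X by blast
  qed (use u in \<open>simp add: H_def\<close>)
  then have H: "range H \<subseteq> B" by blast
  have HF: "H ` {..<length l} = F" using l by (auto simp: H_def set_conv_nth)
  have Hu: "H (length l) = u" by (simp add: H_def)
  have HU: "range H \<subseteq> univ (reduct N)" using H B by auto
  have Hacl: "H (length l) \<in> acl L (reduct N) (H ` {..<length l})" using F(3) HF Hu by simp
  obtain \<chi> where \<chi>: "wf_fm L \<chi>" "qf \<chi>" "fv \<chi> \<subseteq> insert (length l) {..<length l}" "sat (reduct N) H \<chi>"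
    "\<And>M' H'. mdl M' \<Longrightarrow> range H' \<subseteq> univ M' \<Longrightarrow> sat M' H' \<chi> \<Longrightarrow> H' (length l) \<in> acl L M' (H' ` {..<length l})"
    by (rule alg_witness[OF N HU Hacl], rule that)
  have "sat (reduct N) (g \<circ> H) \<chi>" using g \<chi> H unfolding qf_elementary_def by blast
  moreover have "range (g \<circ> H) \<subseteq> univ N" using g H unfolding qf_elementary_def by auto
  ultimately have "(g \<circ> H) (length l) \<in> cacl N ((g \<circ> H) ` {..<length l})" using \<chi>(5)[OF N, of "g \<circ> H"] by simp
  then have "g u \<in> cacl N (g ` F)" using HF Hu by (metis comp_apply image_comp)
  then show ?thesis using acl_mono[of "g ` F" "g ` X" "reduct N"] F(2) by blast
qed

text \<open>A colored algebraic point would have predimension - \<alpha> over \<open>X\<close>.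
  Adding an algebraic point to the base changes no dimension.\<close>

lemma mclosed_insert_algebraic:
  assumes N: "cmdl N" and X: "X \<subseteq> univ N" "mclosed m N X" "m \<ge> 1" and u: "u \<in> cacl N X" "u \<notin> X"
  shows "u \<notin> colored N" "mclosed m N (insert u X)"
proof -
  interpret pregeometry "univ N" "cacl N" by (rule cpregeometry[OF N])
  have uU: "u \<in> univ N" using u cl_sub[OF X(1)] by auto
  show "u \<notin> colored N"
  proof
    assume "u \<in> colored N"
    then have "\<alpha> * card {u} \<le> cdim N {u} X" using X(3) u(2) by (intro mclosedD[OF X(2)]) auto
    then show False using dim_singleton[OF uU X(1)] u(1) alpha_pos by simp
  qed
  have eq: "cdim N Z (insert u X) = cdim N Z X" if "finite Z" "Z \<subseteq> univ N" for Z
    using that X u cl_ext[of "insert u X"] cl_ext[OF X(1)] uU by (intro dim_cl_base) auto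
  show "mclosed m N (insert u X)"
    unfolding mclosed_def
  proof (intro allI impI, elim conjE)
    fix Z assume Z: "finite Z" "Z \<subseteq> colored N" "Z \<inter> insert u X = {}" "card Z \<le> m"
    have "\<alpha> * card Z \<le> cdim N Z X" using Z by (intro mclosedD[OF X(2)]) auto
    then show "\<alpha> * card Z \<le> cdim N Z (insert u X)" using eq[OF Z(1) subset_trans[OF Z(2) colored_subset]] by simp
  qed
qed

text \<open>An algebraic \<open>u\<close> can be added alone. A transcendental one may create
  violations, so the domain is first closed up by the set \<open>W\<close> and then copied as a
  whole.\<close>

lemma good_extension:
  assumes N: "rich N" "saturated_struct N" and f: "good m' N X f" and m': "extension_bound m \<le> m'"
    and X0: "X \<noteq> {}" and u: "u \<in> univ N"
  obtains B g where "u \<in> B" "X \<subseteq> B" "\<And>x. x \<in> X \<Longrightarrow> g x = f x" "good m N B g"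
proof -
  have M: "cmdl N" using N(1) by (rule rich_cmdl)
  interpret pregeometry "univ N" "cacl N" by (rule cpregeometry[OF M])
  have X: "finite X" "X \<subseteq> univ N" and fe: "qf_elementary N X f" and mX: "mclosed m' N X" "mclosed m' N (f ` X)"
    using f by (auto simp: good_def)
  have fU: "f ` X \<subseteq> univ N" using fe by (simp add: qf_elementary_def)
  have mm': "m \<le> m'" "1 \<le> m'" "closure_bound 1 m + m \<le> m'" using m' by (auto simp: extension_bound_def)
  consider "u \<in> X" | "u \<notin> X" "u \<in> cacl N X" | "u \<notin> cacl N X" by blast
  then show thesis
  proof cases
    case 1
    then show ?thesis using that[of X f] good_mono[OF f mm'(1)] by blast
  next
    case 2
    have B: "finite (insert u X)" "X \<subseteq> insert u X" "insert u X \<subseteq> univ N" using X u by auto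
    \<comment> \<open>The flag is \<open>False\<close>: at an algebraic point colors and closedness
      are automatic on both sides and are derived afterwards.\<close>
    obtain g where g: "\<And>x. x \<in> X \<Longrightarrow> g x = f x" "qf_elementary N (insert u X) g"
    proof (rule extend_by_saturation[OF M N(2) B X0 fU, of False m])
      fix \<theta> H assume "wf_fm L \<theta>" "qf \<theta>" "range H = insert u X" "sat (reduct N) H \<theta>"
      then show "\<exists>g. (\<forall>x\<in>X. g x = f x) \<and> g ` insert u X \<subseteq> univ N \<and> sat (reduct N) (g \<circ> H) \<theta> \<and>
        (False \<longrightarrow> (\<forall>x\<in>insert u X. x \<in> colored N \<longleftrightarrow> g x \<in> colored N) \<and> mclosed m N (g ` insert u X))"
        using algebraic_extension_step[OF M X(2) X0 fe u 2(1)] by blast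
    qed blast
    have gX: "g ` X = f ` X" using g(1) by auto
    have gu: "g u \<in> cacl N (f ` X)" using acl_image[OF M B(3) g(2) B(2) _ 2(2)] gX by simp
    have guX: "g u \<notin> f ` X"
    proof
      assume "g u \<in> f ` X"
      then obtain x where "x \<in> X" "g u = g x" using g(1) by auto
      then show False using qf_elementary_inj[OF g(2)] 2(1) by (auto simp: inj_on_def)
    qed
    note a = mclosed_insert_algebraic[OF M X(2) mX(1) mm'(2) 2(2,1)]
    note b = mclosed_insert_algebraic[OF M fU mX(2) mm'(2) gu guX]
    have "g ` insert u X = insert (g u) (f ` X)" using gX by simp
    then have "good m N (insert u X) g"
      using B g a b f mclosed_mono[OF _ mm'(1)] unfolding good_def by auto
    then show ?thesis using that[of "insert u X" g] g(1) by auto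
  next
    case 3
    have "mclosed (closure_bound 1 m + m) N X" using mclosed_mono[OF mX(1) mm'(3)] .
    then obtain W where W: "finite W" "W \<subseteq> colored N" "W \<inter> (X \<union> {u}) = {}" "card W \<le> closure_bound 1 m"
      "mclosed m N (X \<union> {u} \<union> W)"
      using mclosed_extension[OF M X(2), of 1 m "{u}"] u by auto
    let ?B = "X \<union> {u} \<union> W"
    have B: "finite ?B" "X \<subseteq> ?B" "?B \<subseteq> univ N" using X u W(1,2) colored_subset[of N] by auto
    have "\<exists>g. (\<forall>x\<in>X. g x = f x) \<and> qf_elementary N ?B g \<and> (\<forall>x\<in>?B. x \<in> colored N \<longleftrightarrow> g x \<in> colored N) \<and> mclosed m N (g ` ?B)"
    proof (rule extend_by_saturation[OF M N(2) B X0 fU, of True m])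
      fix \<theta> and H :: "nat \<Rightarrow> 'u" assume th: "wf_fm L \<theta>" "qf \<theta>" "range H = ?B" "sat (reduct N) H \<theta>"
      then show "\<exists>g. (\<forall>x\<in>X. g x = f x) \<and> g ` ?B \<subseteq> univ N \<and> sat (reduct N) (g \<circ> H) \<theta> \<and>
        (True \<longrightarrow> (\<forall>x\<in>?B. x \<in> colored N \<longleftrightarrow> g x \<in> colored N) \<and> mclosed m N (g ` ?B))"
        using transcendental_extension_step[OF N(1) saturated_struct_satm[OF N(2) M] f m' X0 u 3 W(1-4) th] by simp
    next
      fix g assume 1: "\<And>x. x \<in> X \<Longrightarrow> g x = f x" and 2: "qf_elementary N ?B g" and 3: "True \<Longrightarrow> (\<forall>x\<in>?B. x \<in> colored N \<longleftrightarrow> g x \<in> colored N) \<and> mclosed m N (g ` ?B)"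
      show "\<exists>g. (\<forall>x\<in>X. g x = f x) \<and> qf_elementary N ?B g \<and> (\<forall>x\<in>?B. x \<in> colored N \<longleftrightarrow> g x \<in> colored N) \<and> mclosed m N (g ` ?B)"
      proof (rule exI[of _ g], rule conjI)
        show "\<forall>x\<in>X. g x = f x" using 1 by simp
        show "qf_elementary N ?B g \<and> (\<forall>x\<in>?B. x \<in> colored N \<longleftrightarrow> g x \<in> colored N) \<and> mclosed m N (g ` ?B)" by (rule conjI[OF 2 3[OF TrueI]])
      qed
    qed
    then obtain g where g: "\<And>x. x \<in> X \<Longrightarrow> g x = f x" "qf_elementary N ?B g" "(\<forall>x\<in>?B. x \<in> colored N \<longleftrightarrow> g x \<in> colored N) \<and> mclosed m N (g ` ?B)" by (elim exE conjE) (rule that, auto)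
    have "good m N ?B g" using B g(2,3) W(5) unfolding good_def by blast
    then show ?thesis using that[of ?B g] g(1) by auto
  qed
qed

section \<open>Good maps preserve formulas\<close>

text \<open>The value of a term may lie outside \<open>X\<close>, but it is algebraic over
  \<open>X\<close>; if colored, it belongs to \<open>X\<close> by closedness.\<close>

lemma good_preserves_colored_term:
  assumes N: "rich N" and f: "good m N X f" "m \<ge> 1" and t: "wf_tm L t" and \<eta>: "range \<eta> \<subseteq> X"
    and col: "val N \<eta> t \<in> colored N"
  shows "val N (f \<circ> \<eta>) t \<in> colored N"
proof -
  have M: "cmdl N" using N by (rule rich_cmdl)
  have X: "X \<subseteq> univ N" and fe: "qf_elementary N X f" and mX: "mclosed m N X" using f by (auto simp: good_def)
  obtain v where v: "v \<notin> fv_tm t" using ex_new_if_finite[OF infinite_UNIV_nat finite_fv_tm] by blast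
  have vt: "val N (\<eta>'(v := a)) t = val N \<eta>' t" for \<eta>' a by (rule val_cong) (use v in auto)
  let ?x = "val N \<eta> t"
  have xU: "?x \<in> univ N" by (rule subsetD[OF colored_subset col])
  have "?x \<in> cacl N X"
  proof (rule acl_intro[OF M, of "Eq (Var v) t" \<eta> ?x v])
    show "finite {a \<in> univ (reduct N). sat (reduct N) (\<eta>(v := a)) (Eq (Var v) t)}"
      by (rule finite_subset[of _ "{?x}"]) (auto simp: vt)
    show "\<eta> ` (fv (Eq (Var v) t) - {v}) \<subseteq> X" using \<eta> by auto
  qed (use t \<eta> X xU vt in auto)
  then have xX: "?x \<in> X" using mclosed_insert_algebraic(1)[OF M X mX f(2)] col by blast
  have "range (\<eta>(v := ?x)) \<subseteq> X" using \<eta> xX by auto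
  then have "sat (reduct N) (f \<circ> \<eta>(v := ?x)) (Eq (Var v) t)"
    using fe[unfolded qf_elementary_def, THEN conjunct2, rule_format, of "Eq (Var v) t" "\<eta>(v := ?x)"] t vt by simp
  moreover have "f \<circ> \<eta>(v := ?x) = (f \<circ> \<eta>)(v := f ?x)" by auto
  ultimately have "f ?x = val N (f \<circ> \<eta>) t" using vt by simp
  then show ?thesis using f xX col unfolding good_def by metis
qed

text \<open>A quantifier raises m by \<open>extension_bound\<close> and is handled by one extension
  step; the inverse map gives the other direction. An atom speaking of color requires m = 1.\<close>

theorem good_preserves_formulas:
  "wf_fm (Lp L) \<phi> \<Longrightarrow> \<exists>m. \<forall>N X f \<eta>. rich N \<longrightarrow> saturated_struct N \<longrightarrow> good m N X f \<longrightarrow> range \<eta> \<subseteq> X \<longrightarrow>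
     (sat N \<eta> \<phi> \<longleftrightarrow> sat N (f \<circ> \<eta>) \<phi>)"
proof (induction \<phi>)
  case Bot
  then show ?case by simp
next
  case (Eq s t)
  show ?case
  proof (intro exI allI impI)
    fix N :: "('f, 'r option, 'u) fo_struct" and X f and \<eta> :: "nat \<Rightarrow> 'u" assume "good 0 N X f" "range \<eta> \<subseteq> X"
    then have "sat (reduct N) \<eta> (Eq s t) \<longleftrightarrow> sat (reduct N) (f \<circ> \<eta>) (Eq s t)"
      using Eq unfolding good_def qf_elementary_def by (metis qf.simps(4) wf_fm.simps(2) wf_tm_Lp)
    then show "sat N \<eta> (Eq s t) \<longleftrightarrow> sat N (f \<circ> \<eta>) (Eq s t)" by simp
  qed
next
  case (Rel q ts)
  show ?case
  proof (cases q)
    case (Some r)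
    show ?thesis
    proof (intro exI allI impI)
      fix N :: "('f, 'r option, 'u) fo_struct" and X f and \<eta> :: "nat \<Rightarrow> 'u" assume gd: "good 0 N X f" "range \<eta> \<subseteq> X"
      have "wf_fm L (Rel r ts)" using Rel Some by auto
      then have "sat (reduct N) \<eta> (Rel r ts) \<longleftrightarrow> sat (reduct N) (f \<circ> \<eta>) (Rel r ts)"
        using gd unfolding good_def qf_elementary_def by (metis qf.simps(5))
      then show "sat N \<eta> (Rel q ts) \<longleftrightarrow> sat N (f \<circ> \<eta>) (Rel q ts)" using Some sat_lift[of N _ "Rel r ts"] by simp
    qed
  next
    case None
    then obtain t where t: "ts = [t]" "wf_tm L t" using Rel by (cases ts) auto
    show ?thesis
    proof (intro exI allI impI)
      fix N :: "('f, 'r option, 'u) fo_struct" and X f and \<eta> :: "nat \<Rightarrow> 'u"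
      assume N: "rich N" and gd: "good 1 N X f" and \<eta>: "range \<eta> \<subseteq> X"
      have X: "X \<subseteq> univ N" and fU: "f ` X \<subseteq> univ N" using gd by (auto simp: good_def qf_elementary_def)
      have str: "is_struct L (reduct N)" using is_model_struct[OF rich_cmdl[OF N]] .
      have "val (reduct N) \<eta> t \<in> univ (reduct N)" using \<eta> X by (intro val_in[OF str t(2)]) auto
      moreover have "val (reduct N) (f \<circ> \<eta>) t \<in> univ (reduct N)" using \<eta> fU by (intro val_in[OF str t(2)]) auto
      ultimately have vU: "val N \<eta> t \<in> univ N" "val N (f \<circ> \<eta>) t \<in> univ N" by simp_all
      note inv = good_inverse[OF gd]
      have eq: "inv_into X f \<circ> (f \<circ> \<eta>) = \<eta>" using inv(2) \<eta> by (auto simp: fun_eq_iff range_subsetD)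
      have r': "range (f \<circ> \<eta>) \<subseteq> f ` X" using \<eta> by auto
      have "val N \<eta> t \<in> colored N \<longleftrightarrow> val N (f \<circ> \<eta>) t \<in> colored N"
        using good_preserves_colored_term[OF N gd _ t(2) \<eta>] good_preserves_colored_term[OF N inv(1) _ t(2) r'] eq by auto
      then show "sat N \<eta> (Rel q ts) \<longleftrightarrow> sat N (f \<circ> \<eta>) (Rel q ts)" using None t vU by (simp add: colored_def)
    qed
  qed
next
  case (Imp \<phi> \<psi>)
  then obtain m1 m2 where m: "\<And>N X f \<eta>. rich N \<Longrightarrow> saturated_struct N \<Longrightarrow> good m1 N X f \<Longrightarrow> range \<eta> \<subseteq> X \<Longrightarrow>
     (sat N \<eta> \<phi> \<longleftrightarrow> sat N (f \<circ> \<eta>) \<phi>)" "\<And>N X f \<eta>. rich N \<Longrightarrow> saturated_struct N \<Longrightarrow> good m2 N X f \<Longrightarrow> range \<eta> \<subseteq> X \<Longrightarrow>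
     (sat N \<eta> \<psi> \<longleftrightarrow> sat N (f \<circ> \<eta>) \<psi>)" by (auto; blast)
  show ?case
  proof (intro exI[of _ "max m1 m2"] allI impI)
    fix N :: "('f, 'r option, 'u) fo_struct" and X f and \<eta> :: "nat \<Rightarrow> 'u" assume h: "rich N" "saturated_struct N" "good (max m1 m2) N X f" "range \<eta> \<subseteq> X"
    then have "good m1 N X f" "good m2 N X f" using good_mono by auto
    then show "sat N \<eta> (Imp \<phi> \<psi>) \<longleftrightarrow> sat N (f \<circ> \<eta>) (Imp \<phi> \<psi>)" using m(1)[OF h(1,2) _ h(4)] m(2)[OF h(1,2) _ h(4)] by simp
  qed
next
  case (All x \<phi>)
  then obtain m where m: "\<And>N X f \<eta>. rich N \<Longrightarrow> saturated_struct N \<Longrightarrow> good m N X f \<Longrightarrow> range \<eta> \<subseteq> X \<Longrightarrow>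
     (sat N \<eta> \<phi> \<longleftrightarrow> sat N (f \<circ> \<eta>) \<phi>)" by (auto; blast)
  have one: "sat N \<eta> (All x \<phi>)"
    if h: "rich N" "saturated_struct N" "good (extension_bound m) N X f" "range \<eta> \<subseteq> X" "sat N (f \<circ> \<eta>) (All x \<phi>)"
    for N X f \<eta>
    unfolding sat.simps
  proof
    fix u assume u: "u \<in> univ N"
    have "X \<noteq> {}" using h(4) by auto
    then obtain B g where B: "u \<in> B" "X \<subseteq> B" "\<And>x. x \<in> X \<Longrightarrow> g x = f x" "good m N B g"
      using good_extension[OF h(1-3) order_refl _ u] by metis
    have r: "range (\<eta>(x := u)) \<subseteq> B" using h(4) B by auto
    have "g u \<in> univ N" using B by (auto simp: good_def qf_elementary_def)
    moreover have "g \<circ> \<eta>(x := u) = (f \<circ> \<eta>)(x := g u)" using B(3) h(4) by (auto simp: fun_eq_iff range_subsetD)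
    ultimately show "sat N (\<eta>(x := u)) \<phi>" using m[OF h(1,2) B(4) r] h(5) by simp
  qed
  show ?case
  proof (intro exI[of _ "extension_bound m"] allI impI)
    fix N :: "('f, 'r option, 'u) fo_struct" and X f and \<eta> :: "nat \<Rightarrow> 'u" assume h: "rich N" "saturated_struct N" "good (extension_bound m) N X f" "range \<eta> \<subseteq> X"
    note inv = good_inverse[OF h(3)]
    have eq: "inv_into X f \<circ> (f \<circ> \<eta>) = \<eta>" using inv(2) h(4) by (auto simp: fun_eq_iff range_subsetD)
    have r': "range (f \<circ> \<eta>) \<subseteq> f ` X" using h(4) by auto
    show "sat N \<eta> (All x \<phi>) \<longleftrightarrow> sat N (f \<circ> \<eta>) (All x \<phi>)"
      using one[OF h] one[OF h(1,2) inv(1) r'] unfolding eq by blast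
  qed
qed

end

section \<open>Minimal bounded closures\<close>

context colored_setting begin

text \<open>\<open>Z\<close> is split at \<open>X\<close>: the part in \<open>X\<close> avoids
  \<open>Y\<close>, the rest avoids \<open>X\<close>, so each part is controlled by one of the two
  closed sets.\<close>

lemma mclosed_Int:
  assumes N: "cmdl N" and X: "X \<subseteq> univ N" "mclosed m N X" and Y: "Y \<subseteq> univ N" "mclosed m N Y"
  shows "mclosed m N (X \<inter> Y)"
  unfolding mclosed_def
proof (intro allI impI, elim conjE)
  interpret pregeometry "univ N" "cacl N" by (rule cpregeometry[OF N])
  fix Z assume Z: "finite Z" "Z \<subseteq> colored N" "Z \<inter> (X \<inter> Y) = {}" "card Z \<le> m"
  have ZU: "Z \<subseteq> univ N" using Z(2) colored_subset by (rule subset_trans)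
  let ?Z1 = "Z \<inter> X" and ?Z2 = "Z - X"
  have c: "card ?Z1 \<le> m" "card ?Z2 \<le> m" using card_mono[OF Z(1), of ?Z1] card_mono[OF Z(1), of ?Z2] Z(4) by auto
  have "\<alpha> * card ?Z1 \<le> cdim N ?Z1 Y" using Y(2) Z c(1) unfolding mclosed_def by (auto simp: Int_assoc)
  also have "cdim N ?Z1 Y \<le> cdim N ?Z1 (X \<inter> Y)" using Z(1) ZU Y(1) by (intro dim_antimono) auto
  finally have 1: "\<alpha> * card ?Z1 \<le> cdim N ?Z1 (X \<inter> Y)" by simp
  have "\<alpha> * card ?Z2 \<le> cdim N ?Z2 X" using X(2) Z c(2) unfolding mclosed_def by auto
  also have "cdim N ?Z2 X \<le> cdim N ?Z2 ((X \<inter> Y) \<union> ?Z1)" using Z(1) ZU X(1) by (intro dim_antimono) auto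
  finally have 2: "\<alpha> * card ?Z2 \<le> cdim N ?Z2 ((X \<inter> Y) \<union> ?Z1)" by simp
  have "cdim N (?Z1 \<union> ?Z2) (X \<inter> Y) = cdim N ?Z1 (X \<inter> Y) + cdim N ?Z2 ((X \<inter> Y) \<union> ?Z1)"
    using Z(1) ZU X(1) by (intro dim_Un) auto
  moreover have "?Z1 \<union> ?Z2 = Z" by auto
  moreover have "card Z = card ?Z1 + card ?Z2"
    using Z(1) card_Un_disjoint[of ?Z1 ?Z2] by (simp add: Int_Diff_Un Int_Diff_disjoint)
  ultimately show "\<alpha> * card Z \<le> cdim N Z (X \<inter> Y)" using 1 2 by (simp add: distrib_left)
qed

text \<open>By \<open>mclosed_Int\<close> a closed superset of least size lies in every other one.
  Being least makes these closures monotone in \<open>A\<close>, which later yields a directed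
  system.\<close>

lemma minimal_closure_exists:
  assumes N: "rich N" and A: "finite A" "A \<subseteq> univ N" "card A \<le> q"
  shows "\<exists>C. finite C \<and> A \<subseteq> C \<and> C \<subseteq> univ N \<and> mclosed m N C \<and> card C \<le> q + closure_bound q m \<and>
    (\<forall>C'. finite C' \<and> A \<subseteq> C' \<and> C' \<subseteq> univ N \<and> mclosed m N C' \<longrightarrow> C \<subseteq> C')"
proof -
  have M: "cmdl N" using N by (rule rich_cmdl)
  define P where "P = (\<lambda>C. finite C \<and> A \<subseteq> C \<and> C \<subseteq> univ N \<and> mclosed m N C)"
  obtain W where W: "finite W" "W \<subseteq> colored N" "card W \<le> closure_bound q m" "mclosed m N ({} \<union> A \<union> W)"
    using mclosed_extension[OF M _ rich_mclosed[OF N] A, of m] by (metis empty_subsetI)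
  have PW: "P (A \<union> W)" using A W colored_subset[of N] by (auto simp: P_def)
  then obtain C where C: "P C" "\<And>C'. P C' \<Longrightarrow> card C \<le> card C'"
    using ex_has_least_nat[of P _ card] by blast
  have "C \<subseteq> C'" if C': "P C'" for C'
  proof -
    have "P (C \<inter> C')" using C(1) C' mclosed_Int[OF M] unfolding P_def by auto
    then have "card C \<le> card (C \<inter> C')" by (rule C(2))
    then have "C \<inter> C' = C" using C(1) unfolding P_def by (intro card_seteq) auto
    then show ?thesis by blast
  qed
  moreover have "card C \<le> q + closure_bound q m"
    using C(2)[OF PW] card_Un_le[of A W] A(3) W(3) by linarith
  ultimately show ?thesis using C(1) unfolding P_def by blast
qed

text \<open>\<open>Z\<close> is split at \<open>Y\<close>. Outside \<open>Y\<close>, closedness of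
  \<open>Y\<close> with \<open>A\<close> applies. Inside \<open>Y\<close>, freeness is symmetric by
  additivity, so adding \<open>A\<close> to the base \<open>X\<close> loses no dimension.\<close>

lemma mclosed_Un_free:
  assumes N: "cmdl N" and Y: "Y \<subseteq> univ N" and X: "X \<subseteq> Y" "mclosed m N X"
    and A: "finite A" "A \<subseteq> univ N" "mclosed m N (Y \<union> A)" and free: "cdim N A X = cdim N A Y"
  shows "mclosed m N (X \<union> A)"
  unfolding mclosed_def
proof (intro allI impI, elim conjE)
  interpret pregeometry "univ N" "cacl N" by (rule cpregeometry[OF N])
  fix Z assume Z: "finite Z" "Z \<subseteq> colored N" "Z \<inter> (X \<union> A) = {}" "card Z \<le> m"
  have ZU: "Z \<subseteq> univ N" using Z(2) colored_subset by (rule subset_trans)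
  have XU: "X \<subseteq> univ N" using X Y by auto
  let ?Z2 = "Z \<inter> Y" and ?Z1 = "Z - Y"
  have c: "card ?Z1 \<le> m" "card ?Z2 \<le> m" using card_mono[OF Z(1), of ?Z1] card_mono[OF Z(1), of ?Z2] Z(4) by auto
  have "\<alpha> * card ?Z1 \<le> cdim N ?Z1 (Y \<union> A)" using A(3) Z c(1) unfolding mclosed_def by auto
  also have "cdim N ?Z1 (Y \<union> A) \<le> cdim N ?Z1 ((X \<union> A) \<union> ?Z2)"
    using Z(1) ZU Y A X by (intro dim_antimono) auto
  finally have 1: "\<alpha> * card ?Z1 \<le> cdim N ?Z1 ((X \<union> A) \<union> ?Z2)" by simp
  have "\<alpha> * card ?Z2 \<le> cdim N ?Z2 X" using X(2) Z c(2) unfolding mclosed_def by (auto simp: Int_assoc)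
  moreover have "cdim N ?Z2 X \<le> cdim N ?Z2 (X \<union> A)"
  proof -
    have "cdim N (?Z2 \<union> A) X = cdim N ?Z2 X + cdim N A (X \<union> ?Z2)" using Z(1) ZU A XU by (intro dim_Un) auto
    moreover have "cdim N (A \<union> ?Z2) X = cdim N A X + cdim N ?Z2 (X \<union> A)" using Z(1) ZU A XU by (intro dim_Un) auto
    moreover have "cdim N A Y \<le> cdim N A (X \<union> ?Z2)" using A Y X by (intro dim_antimono) auto
    ultimately show ?thesis using free by (simp add: Un_commute)
  qed
  ultimately have 2: "\<alpha> * card ?Z2 \<le> cdim N ?Z2 (X \<union> A)" by linarith
  have "cdim N (?Z2 \<union> ?Z1) (X \<union> A) = cdim N ?Z2 (X \<union> A) + cdim N ?Z1 ((X \<union> A) \<union> ?Z2)"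
    using Z(1) ZU XU A by (intro dim_Un) auto
  moreover have "?Z2 \<union> ?Z1 = Z" by auto
  moreover have "card Z = card ?Z2 + card ?Z1"
    using Z(1) card_Un_disjoint[of ?Z2 ?Z1] by (simp add: Int_Diff_Un Int_Diff_disjoint)
  ultimately show "\<alpha> * card Z \<le> cdim N Z (X \<union> A)" using 1 2 by (simp add: distrib_left)
qed

end

section \<open>Indiscernible sequences of closed sets\<close>

text \<open>Addressing by position in increasing order makes the subsets of any two index sets of
  equal size correspond; positions beyond the size are dropped.\<close>

definition pick :: "nat set \<Rightarrow> nat set \<Rightarrow> nat set" where
  "pick \<sigma> p = (\<lambda>i. sorted_list_of_set \<sigma> ! i) ` (p \<inter> {..<card \<sigma>})"

lemma pick_image:
  assumes s: "strict_mono s" and \<sigma>: "finite \<sigma>"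
  shows "pick (s ` \<sigma>) p = s ` pick \<sigma> p"
proof -
  have inj: "inj_on s \<sigma>" using s by (simp add: strict_mono_imp_inj_on inj_on_subset)
  have "sorted_list_of_set (s ` \<sigma>) = map s (sorted_list_of_set \<sigma>)"
  proof (rule sorted_distinct_set_unique)
    show "sorted (map s (sorted_list_of_set \<sigma>))"
      using s by (auto simp: sorted_map strict_mono_less_eq)
    show "distinct (map s (sorted_list_of_set \<sigma>))" using inj \<sigma> by (simp add: distinct_map)
  qed (use \<sigma> in auto)
  moreover have "card (s ` \<sigma>) = card \<sigma>" by (rule card_image[OF inj])
  ultimately show ?thesis unfolding pick_def by (auto simp: image_image)
qed

lemma finite_pick [simp]: "finite (pick \<sigma> p)"
  by (simp add: pick_def)

text \<open>Variables with even code address the elements of the sets attached to the subsets of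
  \<open>\<sigma>\<close>, by position, so that the same formula can be evaluated at index sets of equal size.\<close>

definition address :: "nat set \<Rightarrow> nat \<Rightarrow> nat" where
  "address p k = 2 * prod_encode (set_encode p, k)"

text \<open>Odd variables carry no address and remain available as bound variables of later
  formulas.\<close>

definition family_asg :: "(nat set \<Rightarrow> nat \<Rightarrow> 'u) \<Rightarrow> nat set \<Rightarrow> nat \<Rightarrow> 'u" where
  "family_asg F \<sigma> v = (if even v then (case prod_decode (v div 2) of (c, k) \<Rightarrow> F (pick \<sigma> (set_decode c)) k) else F {} 0)"

lemma family_asg_address [simp]: "finite p \<Longrightarrow> family_asg F \<sigma> (address p k) = F (pick \<sigma> p) k"
  by (simp add: family_asg_def address_def set_encode_inverse)

lemma even_address [simp]: "even (address p k)"
  by (simp add: address_def)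

text \<open>Ramsey's theorem is applied once per relation, inside the previous infinite set. The
  n-th sequence serves the relations below n; for a fixed relation the finitely many exceptions
  disappear in an ultrapower over n.\<close>

lemma homogeneous_sequence:
  fixes R :: "nat \<Rightarrow> nat set \<Rightarrow> bool" and r :: "nat \<Rightarrow> nat"
  shows "\<exists>s :: nat \<Rightarrow> nat \<Rightarrow> nat. (\<forall>n. strict_mono (s n)) \<and>
    (\<forall>j n \<sigma> \<tau>. j < n \<longrightarrow> finite \<sigma> \<longrightarrow> finite \<tau> \<longrightarrow> card \<sigma> = r j \<longrightarrow> card \<tau> = r j \<longrightarrow>
       (R j (s n ` \<sigma>) \<longleftrightarrow> R j (s n ` \<tau>)))"
proof -
  define hom where "hom = (\<lambda>j S. \<forall>\<sigma> \<tau>. finite \<sigma> \<and> finite \<tau> \<and> \<sigma> \<subseteq> S \<and> \<tau> \<subseteq> S \<and> card \<sigma> = r j \<and> card \<tau> = r j \<longrightarrow>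
     R j \<sigma> \<longleftrightarrow> R j \<tau>)"
  have step: "\<exists>S'. infinite S' \<and> S' \<subseteq> S \<and> hom j S'" if inf: "infinite S" for S j
  proof -
    have col: "\<forall>X. X \<subseteq> S \<and> finite X \<and> card X = r j \<longrightarrow> (if R j X then 1 else 0) < (2::nat)" by simp
    obtain Y t where Y: "Y \<subseteq> S" "infinite Y"
      "\<forall>X. X \<subseteq> Y \<and> finite X \<and> card X = r j \<longrightarrow> (if R j X then 1 else 0) = (t :: nat)"
      using Ramsey[OF inf col] by auto
    have "hom j Y" unfolding hom_def
    proof (intro allI impI, elim conjE)
      fix \<sigma> \<tau> assume "finite \<sigma>" "finite \<tau>" "\<sigma> \<subseteq> Y" "\<tau> \<subseteq> Y" "card \<sigma> = r j" "card \<tau> = r j"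
      then have "(if R j \<sigma> then 1 else 0) = t" "(if R j \<tau> then 1 else 0) = t" using Y(3) by blast+
      then show "R j \<sigma> \<longleftrightarrow> R j \<tau>" by (auto split: if_splits)
    qed
    then show ?thesis using Y by blast
  qed
  have "\<exists>S. \<forall>n. infinite (S n) \<and> (S (Suc n) \<subseteq> S n \<and> hom n (S (Suc n)))"
    by (rule dependent_nat_choice) (use step infinite_UNIV_nat in blast)+
  then obtain S :: "nat \<Rightarrow> nat set" where S: "\<And>n. infinite (S n)" "\<And>n. S (Suc n) \<subseteq> S n" "\<And>n. hom n (S (Suc n))"
    by blast
  have dec: "S n \<subseteq> S j" if "j \<le> n" for j n
    using that by (induction n rule: dec_induct) (use S(2) in blast)+
  have sm: "strict_mono (enumerate (S n))" for n using S(1) by (rule strict_mono_enumerate)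
  show ?thesis
  proof (intro exI[of _ "\<lambda>n. enumerate (S n)"] conjI allI impI sm)
    fix j n :: nat and \<sigma> \<tau> :: "nat set" assume h: "j < n" "finite \<sigma>" "finite \<tau>" "card \<sigma> = r j" "card \<tau> = r j"
    have inj: "inj_on (enumerate (S n)) A" for A using sm by (simp add: strict_mono_imp_inj_on inj_on_subset)
    have "enumerate (S n) ` A \<subseteq> S (Suc j)" for A
      using enumerate_in_set[OF S(1), of n] dec[OF Suc_leI[OF h(1)]] by auto
    then show "R j (enumerate (S n) ` \<sigma>) \<longleftrightarrow> R j (enumerate (S n) ` \<tau>)"
      using S(3)[of j] h inj unfolding hom_def by (simp add: card_image)
  qed
qed

context colored_setting begin

text \<open>Indiscernibility is joint: through \<open>family_asg\<close> one formula sees the closed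
  sets of all subsets of \<sigma> at once. The length of a list depends only on the size of the
  index set.\<close>

definition indiscernible_family ::
  "nat \<Rightarrow> ('f, 'r option, 'u) fo_struct \<Rightarrow> (nat set \<Rightarrow> nat \<Rightarrow> 'u) \<Rightarrow> (nat \<Rightarrow> nat) \<Rightarrow> bool" where
  "indiscernible_family m N F l \<longleftrightarrow> (\<forall>\<sigma> k. F \<sigma> k \<in> univ N) \<and>
     (\<forall>\<sigma>. finite \<sigma> \<longrightarrow> mclosed m N (F \<sigma> ` {..<l (card \<sigma>)})) \<and>
     (\<forall>\<sigma> \<tau>. finite \<tau> \<longrightarrow> \<sigma> \<subseteq> \<tau> \<longrightarrow> F \<sigma> ` {..<l (card \<sigma>)} \<subseteq> F \<tau> ` {..<l (card \<tau>)}) \<and>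
     (\<forall>\<sigma> \<tau> \<psi>. finite \<sigma> \<longrightarrow> finite \<tau> \<longrightarrow> card \<sigma> = card \<tau> \<longrightarrow> wf_fm (Lp L) \<psi> \<longrightarrow>
        (sat N (family_asg F \<sigma>) \<psi> \<longleftrightarrow> sat N (family_asg F \<tau>) \<psi>))"

lemma indiscernible_familyD:
  assumes "indiscernible_family m N F l"
  shows "F \<sigma> k \<in> univ N" "finite \<sigma> \<Longrightarrow> mclosed m N (F \<sigma> ` {..<l (card \<sigma>)})"
    "finite \<tau> \<Longrightarrow> \<sigma> \<subseteq> \<tau> \<Longrightarrow> F \<sigma> ` {..<l (card \<sigma>)} \<subseteq> F \<tau> ` {..<l (card \<tau>)}"
    "finite \<sigma> \<Longrightarrow> finite \<tau> \<Longrightarrow> card \<sigma> = card \<tau> \<Longrightarrow> wf_fm (Lp L) \<psi> \<Longrightarrow>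
       sat N (family_asg F \<sigma>) \<psi> \<longleftrightarrow> sat N (family_asg F \<tau>) \<psi>"
proof -
  note d = assms[unfolded indiscernible_family_def]
  show "F \<sigma> k \<in> univ N" using d[THEN conjunct1] by blast
  show "finite \<sigma> \<Longrightarrow> mclosed m N (F \<sigma> ` {..<l (card \<sigma>)})" using d[THEN conjunct2, THEN conjunct1] by blast
  show "finite \<tau> \<Longrightarrow> \<sigma> \<subseteq> \<tau> \<Longrightarrow> F \<sigma> ` {..<l (card \<sigma>)} \<subseteq> F \<tau> ` {..<l (card \<tau>)}"
    using d[THEN conjunct2, THEN conjunct2, THEN conjunct1] by blast
  show "finite \<sigma> \<Longrightarrow> finite \<tau> \<Longrightarrow> card \<sigma> = card \<tau> \<Longrightarrow> wf_fm (Lp L) \<psi> \<Longrightarrow>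
       sat N (family_asg F \<sigma>) \<psi> \<longleftrightarrow> sat N (family_asg F \<tau>) \<psi>"
    using d[THEN conjunct2, THEN conjunct2, THEN conjunct2] by blast
qed

text \<open>At coordinate n of the ultrapower the indices are thinned out by \<open>s n\<close>, and
  the parameter is the one that the independence property supplies for the image \<open>J n\<close>
  of the even numbers.\<close>

lemma indiscernible_family_exists:
  fixes M :: "('f, 'r option, 'u) fo_struct"
  assumes M: "is_model (Lp L) (T_alpha TYPE('u) L T \<alpha>) M" and \<phi>: "formula_in (Lp L) (p + q) \<phi>"
    and ip: "has_IP M p q \<phi>"
  shows "\<exists>(N :: ('f, 'r option, 'u) fo_struct) F l bs. rich N \<and> saturated_struct N \<and>
    indiscernible_family m N F l \<and> bs \<in> tuples N p \<and>
    (\<forall>i. holds N \<phi> (bs @ map (F {i}) [0..<q]) \<longleftrightarrow> even i) \<and> q \<le> l 1"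
proof -
  have rM: "rich M" using model_T_alpha_rich[OF M] .
  have sM: "is_struct (Lp L) M" using M by (simp add: is_model_def)
  obtain u where u: "u \<in> univ M" using sM by (auto simp: is_struct_def)
  obtain a :: "nat \<Rightarrow> 'u list" and b :: "nat set \<Rightarrow> 'u list" where ab: "\<And>i. a i \<in> tuples M q" "\<And>J. b J \<in> tuples M p" "\<And>i J. holds M \<phi> (b J @ a i) \<longleftrightarrow> i \<in> J"
    using ip[unfolded has_IP_def] by (elim exE conjE) (rule that, auto)
  \<comment> \<open>The point \<open>u\<close> keeps every closure nonempty and fills up the
    lists.\<close>
  define A where "A = (\<lambda>\<sigma> :: nat set. insert u (\<Union>i\<in>\<sigma>. set (a i)))"
  define c where "c = (\<lambda>r. 1 + r * q)"
  have A: "finite (A \<sigma>)" "A \<sigma> \<subseteq> univ M" "card (A \<sigma>) \<le> c (card \<sigma>)" if "finite \<sigma>" for \<sigma>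
  proof -
    show "finite (A \<sigma>)" using that by (simp add: A_def)
    show "A \<sigma> \<subseteq> univ M" using u ab(1) by (auto simp: A_def tuples_def)
    have aq: "card (set (a i)) \<le> q" for i using ab(1)[of i] card_length[of "a i"] by (simp add: tuples_def)
    have "card (\<Union>i\<in>\<sigma>. set (a i)) \<le> (\<Sum>i\<in>\<sigma>. card (set (a i)))" using that by (rule card_UN_le)
    also have "\<dots> \<le> (\<Sum>i\<in>\<sigma>. q)" using aq by (rule sum_mono)
    also have "\<dots> = card \<sigma> * q" by simp
    finally have "card (\<Union>i\<in>\<sigma>. set (a i)) \<le> card \<sigma> * q" .
    then show "card (A \<sigma>) \<le> c (card \<sigma>)" using that by (simp add: A_def c_def card_insert_if)
  qed
  have "\<exists>C. finite C \<and> A \<sigma> \<subseteq> C \<and> C \<subseteq> univ M \<and> mclosed m M C \<and> card C \<le> c (card \<sigma>) + closure_bound (c (card \<sigma>)) m \<and>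
    (\<forall>C'. finite C' \<and> A \<sigma> \<subseteq> C' \<and> C' \<subseteq> univ M \<and> mclosed m M C' \<longrightarrow> C \<subseteq> C')" if "finite \<sigma>" for \<sigma>
    using minimal_closure_exists[OF rM A[OF that]] .
  then obtain C where C: "\<And>\<sigma>. finite \<sigma> \<Longrightarrow> finite (C \<sigma>) \<and> A \<sigma> \<subseteq> C \<sigma> \<and> C \<sigma> \<subseteq> univ M \<and> mclosed m M (C \<sigma>) \<and>
     card (C \<sigma>) \<le> c (card \<sigma>) + closure_bound (c (card \<sigma>)) m \<and>
    (\<forall>C'. finite C' \<and> A \<sigma> \<subseteq> C' \<and> C' \<subseteq> univ M \<and> mclosed m M C' \<longrightarrow> C \<sigma> \<subseteq> C')" by metis
  \<comment> \<open>Room for q leading entries, which hold the tuple itself for a singleton,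
    followed by an enumeration of the closure.\<close>
  define l where "l = (\<lambda>r. q + c r + closure_bound (c r) m)"
  have "\<exists>xs. length xs = l (card \<sigma>) \<and> set xs = C \<sigma> \<and> (\<forall>i. \<sigma> = {i} \<longrightarrow> take q xs = a i)" if \<sigma>: "finite \<sigma>" for \<sigma>
  proof -
    have finC: "finite (C \<sigma>)" using C[OF \<sigma>] by simp
    obtain ys where ys: "set ys = C \<sigma>" "distinct ys" using finite_distinct_list[OF finC] by blast
    have lys: "length ys \<le> c (card \<sigma>) + closure_bound (c (card \<sigma>)) m"
      using C[OF \<sigma>] ys distinct_card by metis
    define zs where "zs = (if \<exists>i. \<sigma> = {i} then a (THE i. \<sigma> = {i}) else replicate q u)"
    have lzs: "length zs = q" using ab(1) by (auto simp: zs_def tuples_def)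
    have uC: "u \<in> C \<sigma>" using C[OF \<sigma>] by (auto simp: A_def)
    have zsC: "set zs \<subseteq> C \<sigma>" using C[OF \<sigma>] uC by (auto simp: zs_def A_def)
    define xs where "xs = zs @ ys @ replicate (l (card \<sigma>) - q - length ys) u"
    have "length xs = l (card \<sigma>)" using lys lzs by (simp add: xs_def l_def)
    moreover have "set xs = C \<sigma>" using ys zsC uC by (auto simp: xs_def)
    moreover have "take q xs = a i" if "\<sigma> = {i}" for i using that lzs by (simp add: xs_def zs_def)
    ultimately show ?thesis by blast
  qed
  then obtain xs where xs: "\<And>\<sigma>. finite \<sigma> \<Longrightarrow> length (xs \<sigma>) = l (card \<sigma>) \<and> set (xs \<sigma>) = C \<sigma> \<and> (\<forall>i. \<sigma> = {i} \<longrightarrow> take q (xs \<sigma>) = a i)"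
    by metis
  define F0 where "F0 = (\<lambda>\<sigma> k. if finite \<sigma> \<and> k < l (card \<sigma>) then xs \<sigma> ! k else u)"
  have F0_img: "F0 \<sigma> ` {..<l (card \<sigma>)} = C \<sigma>" if "finite \<sigma>" for \<sigma>
    using xs[OF that] that by (force simp: F0_def set_conv_nth)
  have F0_in: "F0 \<sigma> k \<in> univ M" for \<sigma> k
  proof (cases "finite \<sigma> \<and> k < l (card \<sigma>)")
    case True
    then have "F0 \<sigma> k \<in> C \<sigma>" using F0_img[of \<sigma>] by blast
    then show ?thesis using C[of \<sigma>] True by blast
  qed (use u in \<open>auto simp: F0_def\<close>)
  have F0_single: "F0 {i} k = a i ! k" if "k < q" for i k
  proof -
    have "take q (xs {i}) = a i" "length (xs {i}) = l 1" using xs[of "{i}"] by auto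
    then show ?thesis using that by (auto simp: F0_def l_def) (metis nth_take)
  qed
  have Cmono: "C \<sigma> \<subseteq> C \<tau>" if "finite \<tau>" "\<sigma> \<subseteq> \<tau>" for \<sigma> \<tau>
  proof -
    have fin: "finite \<sigma>" using that finite_subset by blast
    have "A \<sigma> \<subseteq> A \<tau>" using that by (auto simp: A_def)
    then show ?thesis using C[OF fin] C[OF that(1)] by (meson subset_trans)
  qed
  define X where "X = {\<psi>. wf_fm (Lp L) \<psi>} \<times> (UNIV :: nat set)"
  have cX: "countable X" unfolding X_def using countable_formulas[OF countable_lang_Lp[OF ctbl]] by (intro countable_SIGMA) auto
  have "(Bot, 0) \<in> X" by (simp add: X_def)
  then have "X \<noteq> {}" by blast
  define en where "en = from_nat_into X"
  have en: "range en = X" unfolding en_def by (rule range_from_nat_into[OF \<open>X \<noteq> {}\<close> cX])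
  have "\<exists>s :: nat \<Rightarrow> nat \<Rightarrow> nat. (\<forall>n. strict_mono (s n)) \<and>
    (\<forall>j n \<sigma> \<tau>. j < n \<longrightarrow> finite \<sigma> \<longrightarrow> finite \<tau> \<longrightarrow> card \<sigma> = snd (en j) \<longrightarrow> card \<tau> = snd (en j) \<longrightarrow>
       (sat M (family_asg F0 (s n ` \<sigma>)) (fst (en j)) \<longleftrightarrow> sat M (family_asg F0 (s n ` \<tau>)) (fst (en j))))"
    by (rule homogeneous_sequence)
  then obtain s :: "nat \<Rightarrow> nat \<Rightarrow> nat" where s: "\<And>n. strict_mono (s n)"
    "\<And>j n \<sigma> \<tau>. j < n \<Longrightarrow> finite \<sigma> \<Longrightarrow> finite \<tau> \<Longrightarrow> card \<sigma> = snd (en j) \<Longrightarrow> card \<tau> = snd (en j) \<Longrightarrow>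
       sat M (family_asg F0 (s n ` \<sigma>)) (fst (en j)) \<longleftrightarrow> sat M (family_asg F0 (s n ` \<tau>)) (fst (en j))"
    by (elim exE conjE) (rule that, blast+)
  have s_inj: "inj_on (s n) B" for n B
    using strict_mono_imp_inj_on[OF s(1)] inj_on_subset by blast
  have s_card: "card (s n ` \<sigma>) = card \<sigma>" for n \<sigma> using s_inj by (rule card_image)
  define J where "J = (\<lambda>n. s n ` {i. even i})"
  \<comment> \<open>Only countably many elements matter: all listed closures and, of all the
    parameters, one tuple for each n.\<close>
  define Y where "Y = (\<Union>\<sigma>\<in>{\<sigma>. finite \<sigma>}. range (F0 \<sigma>)) \<union> (\<Union>n. set (b (J n))) \<union> {u}"
  have cY: "countable Y" unfolding Y_def
    by (intro countable_Un countable_UN countable_Collect_finite) (auto intro: countable_finite)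
  have YM: "Y \<subseteq> univ M" using F0_in ab(2) u by (auto simp: Y_def tuples_def)
  obtain M0 :: "('f, 'r option, 'u) fo_struct" where M0: "is_struct (Lp L) M0" "countable (univ M0)" "Y \<subseteq> univ M0"
    "univ M0 \<subseteq> univ M" "\<And>e \<phi>. range e \<subseteq> univ M0 \<Longrightarrow> wf_fm (Lp L) \<phi> \<Longrightarrow> sat M0 e \<phi> \<longleftrightarrow> sat M e \<phi>"
    by (rule loewenheim_skolem[OF countable_lang_Lp[OF ctbl] sM cY YM], rule that)
  obtain U code where "ultrapower U (Lp L) M0 code" by (rule ultrapower_exists[OF inj_c M0(1,2)])
  then interpret up: ultrapower U "Lp L" M0 code .
  let ?N = "up.N"
  have F0Y: "F0 \<sigma> k \<in> univ M0" for \<sigma> k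
    using M0(3) by (cases "finite \<sigma>") (auto simp: Y_def F0_def)
  have uM0: "u \<in> univ M0" using M0(3) by (auto simp: Y_def)
  have losM: "sat ?N (\<lambda>v. code (\<lambda>n. E n v)) \<psi> \<longleftrightarrow> {n. sat M (E n) \<psi>} \<in> U"
    if "\<And>n v. E n v \<in> univ M0" "wf_fm (Lp L) \<psi>" for E \<psi>
    using up.los[of E \<psi>] M0(5)[OF _ that(2)] that by (simp add: image_subset_iff)
  have "is_model (Lp L) (T_alpha TYPE('u) L T \<alpha>) ?N"
    unfolding is_model_def
  proof (intro conjI ballI up.struct_N)
    fix \<sigma> assume \<sigma>: "\<sigma> \<in> T_alpha TYPE('u) L T \<alpha>"
    then have wf: "wf_fm (Lp L) \<sigma>" and fv: "fv \<sigma> = {}" by (auto simp: T_alpha_def sentence_def)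
    have "true_in M \<sigma>" using M \<sigma> by (simp add: is_model_def)
    then have "sat M (\<lambda>_. u) \<sigma>" using u by (auto simp: true_in_def)
    then have "sat ?N (\<lambda>v. code (\<lambda>n. u)) \<sigma>" using losM[of "\<lambda>n v. u" \<sigma>] uM0 wf up.U_UNIV by simp
    moreover have "sat ?N e \<sigma> \<longleftrightarrow> sat ?N (\<lambda>v. code (\<lambda>n. u)) \<sigma>" for e by (rule sat_cong) (simp add: fv)
    ultimately show "true_in ?N \<sigma>" by (simp add: true_in_def)
  qed
  then have rN: "rich ?N" by (rule model_T_alpha_rich)
  have satN: "saturated_struct ?N"
    unfolding saturated_struct_def
  proof (intro allI impI)
    fix \<Sigma> V e assume h: "\<forall>\<phi>\<in>\<Sigma>. wf_fm (Lp L) \<phi>" "range e \<subseteq> univ ?N"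
     "\<forall>\<Sigma>0. finite \<Sigma>0 \<longrightarrow> \<Sigma>0 \<subseteq> \<Sigma> \<longrightarrow>
        (\<exists>e'. range e' \<subseteq> univ ?N \<and> (\<forall>v. v \<notin> V \<longrightarrow> e' v = e v) \<and> (\<forall>\<phi>\<in>\<Sigma>0. sat ?N e' \<phi>))"
    have "countable \<Sigma>" by (rule countable_subset[OF _ countable_formulas[OF countable_lang_Lp[OF ctbl]]]) (use h in auto)
    then show "\<exists>e'. range e' \<subseteq> univ ?N \<and> (\<forall>v. v \<notin> V \<longrightarrow> e' v = e v) \<and> (\<forall>\<phi>\<in>\<Sigma>. sat ?N e' \<phi>)"
    proof (rule up.saturation)
      show "wf_fm (Lp L) \<phi>" if "\<phi> \<in> \<Sigma>" for \<phi> using h(1) that by blast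
      show "\<exists>e'. range e' \<subseteq> univ ?N \<and> (\<forall>v. v \<notin> V \<longrightarrow> e' v = e v) \<and> (\<forall>\<phi>\<in>\<Sigma>0. sat ?N e' \<phi>)"
        if "finite \<Sigma>0" "\<Sigma>0 \<subseteq> \<Sigma>" for \<Sigma>0 using h(3)[rule_format, OF that] by blast
    qed (rule h(2))
  qed
  define F where "F = (\<lambda>\<sigma> k. code (\<lambda>n. F0 (s n ` \<sigma>) k))"
  have F_in: "F \<sigma> k \<in> univ ?N" for \<sigma> k unfolding F_def by (rule up.code_in) (use F0Y in auto)
  have F_asg: "family_asg F \<sigma> = (\<lambda>v. code (\<lambda>n. family_asg F0 (s n ` \<sigma>) v))" if "finite \<sigma>" for \<sigma>
    using pick_image[OF s(1) that] by (auto simp: family_asg_def F_def fun_eq_iff split: prod.split)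
  have asg_in: "family_asg F0 \<sigma> v \<in> univ M0" for \<sigma> v using F0Y by (auto simp: family_asg_def split: prod.split)
  have uniq: "F0 (s n ` \<sigma>) ` {..<l (card \<sigma>)} = C (s n ` \<sigma>)" if "finite \<sigma>" for n \<sigma>
    using F0_img[of "s n ` \<sigma>"] that s_card by simp
  have closed: "mclosed m ?N (F \<sigma> ` {..<l (card \<sigma>)})" if \<sigma>: "finite \<sigma>" for \<sigma>
  proof (rule ccontr)
    assume n: "\<not> mclosed m ?N (F \<sigma> ` {..<l (card \<sigma>)})"
    obtain \<psi> where \<psi>: "wf_fm (Lp L) \<psi>" "fv \<psi> \<subseteq> {..<l (card \<sigma>)}" "sat ?N (F \<sigma>) \<psi>"
      "\<And>M' H'. cmdl M' \<Longrightarrow> range H' \<subseteq> univ M' \<Longrightarrow> sat M' H' \<psi> \<Longrightarrow> \<not> mclosed m M' (H' ` {..<l (card \<sigma>)})"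
      by (rule not_mclosed_witness[OF rich_cmdl[OF rN] _ _ n]) (use F_in in auto)
    have "{n. sat M (F0 (s n ` \<sigma>)) \<psi>} \<in> U" using losM[of "\<lambda>n. F0 (s n ` \<sigma>)" \<psi>] F0Y \<psi>(1,3) by (simp add: F_def)
    then have "{n. sat M (F0 (s n ` \<sigma>)) \<psi>} \<noteq> {}" using up.U_not_empty by metis
    then obtain n where "sat M (F0 (s n ` \<sigma>)) \<psi>" by auto
    then have "\<not> mclosed m M (F0 (s n ` \<sigma>) ` {..<l (card \<sigma>)})" using \<psi>(4)[OF rich_cmdl[OF rM]] F0_in by auto
    then show False using uniq[OF \<sigma>] C[of "s n ` \<sigma>"] \<sigma> by simp
  qed
  have mono: "F \<sigma> ` {..<l (card \<sigma>)} \<subseteq> F \<tau> ` {..<l (card \<tau>)}" if \<tau>: "finite \<tau>" "\<sigma> \<subseteq> \<tau>" for \<sigma> \<tau>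
  proof (rule image_subsetI)
    fix k assume k: "k \<in> {..<l (card \<sigma>)}"
    have fin: "finite \<sigma>" using \<tau> finite_subset by blast
    \<comment> \<open>The position j depends on n, but only finitely many positions exist, so the
      ultrafilter decides for one of them.\<close>
    have "\<exists>j\<in>{..<l (card \<tau>)}. F0 (s n ` \<sigma>) k = F0 (s n ` \<tau>) j" for n
    proof -
      have "F0 (s n ` \<sigma>) k \<in> C (s n ` \<sigma>)" using uniq[OF fin, of n] k by blast
      also have "\<dots> \<subseteq> C (s n ` \<tau>)" using \<tau> by (intro Cmono) auto
      finally show ?thesis using uniq[OF \<tau>(1), of n] by (metis imageE)
    qed
    then have empty: "{n. \<forall>j\<in>{..<l (card \<tau>)}. F0 (s n ` \<sigma>) k \<noteq> F0 (s n ` \<tau>) j} = {}" by auto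
    have "{n. \<forall>j\<in>{..<l (card \<tau>)}. F0 (s n ` \<sigma>) k \<noteq> F0 (s n ` \<tau>) j} \<notin> U" unfolding empty by (rule up.U_not_empty)
    then obtain j where j: "j < l (card \<tau>)" "{n. F0 (s n ` \<sigma>) k \<noteq> F0 (s n ` \<tau>) j} \<notin> U"
      using up.U_finite_Inter[of "{..<l (card \<tau>)}" "\<lambda>j n. F0 (s n ` \<sigma>) k \<noteq> F0 (s n ` \<tau>) j"] by auto
    then have "{n. F0 (s n ` \<sigma>) k = F0 (s n ` \<tau>) j} \<in> U"
      using up.U_Collect_not[of "\<lambda>n. F0 (s n ` \<sigma>) k = F0 (s n ` \<tau>) j"] by simp
    then have "F \<sigma> k = F \<tau> j" unfolding F_def using F0Y by (subst up.code_eq) auto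
    then show "F \<sigma> k \<in> F \<tau> ` {..<l (card \<tau>)}" using j(1) by auto
  qed
  have indisc: "sat ?N (family_asg F \<sigma>) \<psi> \<longleftrightarrow> sat ?N (family_asg F \<tau>) \<psi>"
    if h: "finite \<sigma>" "finite \<tau>" "card \<sigma> = card \<tau>" "wf_fm (Lp L) \<psi>" for \<sigma> \<tau> \<psi>
  proof -
    have "(\<psi>, card \<sigma>) \<in> X" using h by (simp add: X_def)
    then obtain j where j: "en j = (\<psi>, card \<sigma>)" using en by (metis imageE)
    have "{n. sat M (family_asg F0 (s n ` \<sigma>)) \<psi> \<longleftrightarrow> sat M (family_asg F0 (s n ` \<tau>)) \<psi>} \<in> U"
    proof (rule up.U_cofinite, rule finite_subset)
      show "- {n. sat M (family_asg F0 (s n ` \<sigma>)) \<psi> \<longleftrightarrow> sat M (family_asg F0 (s n ` \<tau>)) \<psi>} \<subseteq> {..j}"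
      proof
        fix n assume n: "n \<in> - {n. sat M (family_asg F0 (s n ` \<sigma>)) \<psi> \<longleftrightarrow> sat M (family_asg F0 (s n ` \<tau>)) \<psi>}"
        have "\<not> j < n"
        proof
          assume "j < n"
          then have "sat M (family_asg F0 (s n ` \<sigma>)) (fst (en j)) \<longleftrightarrow> sat M (family_asg F0 (s n ` \<tau>)) (fst (en j))"
            by (rule s(2)[OF _ h(1,2)]) (simp_all add: j h(3))
          then show False using n unfolding j fst_conv by blast
        qed
        then show "n \<in> {..j}" by simp
      qed
    qed simp
    then have "{n. sat M (family_asg F0 (s n ` \<sigma>)) \<psi>} \<in> U \<longleftrightarrow> {n. sat M (family_asg F0 (s n ` \<tau>)) \<psi>} \<in> U"
      by (rule up.U_iff)
    then show ?thesis
      unfolding F_asg[OF h(1)] F_asg[OF h(2)] using losM[OF asg_in h(4)] by simp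
  qed
  define bs where "bs = map (\<lambda>k. code (\<lambda>n. b (J n) ! k)) [0..<p]"
  have bJ: "b (J n) ! k \<in> univ M0" if "k < p" for n k
  proof -
    have "b (J n) ! k \<in> set (b (J n))" using ab(2)[of "J n"] that by (simp add: tuples_def)
    then show ?thesis using M0(3) by (auto simp: Y_def)
  qed
  have bs: "bs \<in> tuples ?N p" using bJ by (auto simp: bs_def tuples_def intro!: up.code_in)
  have hold: "holds ?N \<phi> (bs @ map (F {i}) [0..<q]) \<longleftrightarrow> even i" for i
  proof -
    define E where "E = (\<lambda>n v. if v < p then b (J n) ! v else F0 {s n i} (v - p))"
    have E: "E n v \<in> univ M0" for n v using bJ F0Y by (auto simp: E_def)
    have wf: "wf_fm (Lp L) \<phi>" using \<phi> by (simp add: formula_in_def)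
    have "holds ?N \<phi> (bs @ map (F {i}) [0..<q]) \<longleftrightarrow> sat ?N (\<lambda>v. code (\<lambda>n. E n v)) \<phi>"
      by (rule holds_iff_sat[OF \<phi>]) (auto simp: E_def bs_def nth_append F_def)
    also have "\<dots> \<longleftrightarrow> {n. sat M (E n) \<phi>} \<in> U" by (rule losM[OF E wf])
    finally have eq: "holds ?N \<phi> (bs @ map (F {i}) [0..<q]) \<longleftrightarrow> {n. sat M (E n) \<phi>} \<in> U" .
    have "sat M (E n) \<phi> \<longleftrightarrow> even i" for n
    proof -
      have "holds M \<phi> (b (J n) @ a (s n i)) \<longleftrightarrow> sat M (E n) \<phi>"
        by (rule holds_iff_sat[OF \<phi>]) (use ab(2)[of "J n"] F0_single in \<open>auto simp: E_def nth_append tuples_def\<close>)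
      moreover have "s n i \<in> J n \<longleftrightarrow> even i" unfolding J_def using s_inj[of n UNIV] by (auto dest: injD)
      ultimately show ?thesis using ab(3) by simp
    qed
    then have "{n. sat M (E n) \<phi>} = (if even i then UNIV else {})" by auto
    then show ?thesis unfolding eq using up.U_UNIV up.U_not_empty by (cases "even i") auto
  qed
  have "indiscernible_family m ?N F l"
    unfolding indiscernible_family_def using F_in closed mono indisc by (intro conjI allI impI) assumption+
  moreover have "q \<le> l 1" by (simp add: l_def)
  ultimately show ?thesis using rN satN bs hold
    by (intro exI[of _ ?N] exI[of _ F] exI[of _ l] exI[of _ bs] conjI allI)
qed

end

section \<open>Positions in end extensions of an index set\<close>

lemma pick_all: "finite \<sigma> \<Longrightarrow> pick \<sigma> {..<card \<sigma>} = \<sigma>"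
  using nth_image[of "card \<sigma>" "sorted_list_of_set \<sigma>"] by (simp add: pick_def atLeast0LessThan)

lemma sorted_list_of_end_extension:
  assumes "finite I" "I \<subseteq> {..<u}" "sorted is" "distinct is" "set is \<subseteq> {u..}"
  shows "sorted_list_of_set (I \<union> set is) = sorted_list_of_set I @ is" "card (I \<union> set is) = card I + length is"
proof -
  show "sorted_list_of_set (I \<union> set is) = sorted_list_of_set I @ is"
    by (rule sorted_distinct_set_unique) (use assms in \<open>fastforce simp: sorted_append\<close>)+
  have "I \<inter> set is = {}" using assms by fastforce
  then show "card (I \<union> set is) = card I + length is"
    using assms by (simp add: card_Un_disjoint distinct_card)
qed

text \<open>New indices above \<open>I\<close> leave \<open>I\<close> at the first positions, so the
  t-th new one has position \<open>card I + t\<close> whatever its value.\<close>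

lemma pick_end_extension:
  assumes "finite I" "I \<subseteq> {..<u}" "sorted is" "distinct is" "set is \<subseteq> {u..}" "t < length is"
  shows "pick (I \<union> set is) {card I + t} = {is ! t}"
    "pick (I \<union> set is) (insert (card I + t) {..<card I}) = insert (is ! t) I"
proof -
  note s = sorted_list_of_end_extension[OF assms(1-5)]
  show "pick (I \<union> set is) {card I + t} = {is ! t}"
    using assms(6) unfolding pick_def s by (simp add: nth_append)
  have "insert (card I + t) {..<card I} \<inter> {..<card I + length is} = insert (card I + t) {..<card I}"
    using assms(6) by auto
  moreover have "(\<lambda>i. sorted_list_of_set I ! i) ` {..<card I} = I" using pick_all[OF assms(1)] by (simp add: pick_def)
  moreover have "{..<card I} \<inter> {x. x < card I} = {..<card I}" "{..<card I} \<inter> {x. \<not> x < card I} = {}" by auto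
  ultimately show "pick (I \<union> set is) (insert (card I + t) {..<card I}) = insert (is ! t) I"
    unfolding pick_def s by (simp add: nth_append)
qed

context colored_setting begin

text \<open>If both truth values occurred arbitrarily late, every finite pattern would occur along
  increasing indices. Indiscernibility moves it to consecutive indices at the price of new
  parameters, saturation makes the pattern infinite, and \<psi> would have the independence property
  in a model of \<open>T\<close>.\<close>

lemma eventually_constant:
  fixes N :: "('f, 'r option, 'u) fo_struct" and F :: "nat set \<Rightarrow> nat \<Rightarrow> 'u"
  assumes dep: "dependent_theory TYPE('u) L T" and N: "rich N" "saturated_struct N"
    and F: "\<And>\<sigma> k. F \<sigma> k \<in> univ N"
    and indisc: "\<And>\<sigma> \<tau> \<psi>. finite \<sigma> \<Longrightarrow> finite \<tau> \<Longrightarrow> card \<sigma> = card \<tau> \<Longrightarrow> wf_fm (Lp L) \<psi> \<Longrightarrow>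
       sat N (family_asg F \<sigma>) \<psi> \<longleftrightarrow> sat N (family_asg F \<tau>) \<psi>"
    and I: "finite I" "I \<subseteq> {..<u}" and ee: "range ee \<subseteq> univ N"
    and H: "\<And>i v. H i v = (if v \<in> VX then F (if single v then {i} else insert i I) (\<kappa> v) else ee v)"
    and \<psi>: "wf_fm L \<psi>" "qf \<psi>"
  shows "\<exists>b i0. \<forall>i\<ge>i0. sat (reduct N) (H i) \<psi> \<longleftrightarrow> b"
proof (rule ccontr)
  assume "\<not> ?thesis"
  then have frequently: "\<exists>i\<ge>i0. sat (reduct N) (H i) \<psi> \<longleftrightarrow> b" for b i0 by (metis (full_types))
  have M: "cmdl N" using N(1) by (rule rich_cmdl)
  have H_in: "H i v \<in> univ N" for i v using F ee by (auto simp: H)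
  have "\<exists>is. length is = n \<and> sorted is \<and> distinct is \<and> set is \<subseteq> {u..} \<and> (\<forall>t<n. sat (reduct N) (H (is ! t)) \<psi> \<longleftrightarrow> t \<in> J)" for n J
  proof (induction n)
    case (Suc n)
    then obtain "is" where "is": "length is = n" "sorted is" "distinct is" "set is \<subseteq> {u..}"
      "\<forall>t<n. sat (reduct N) (H (is ! t)) \<psi> \<longleftrightarrow> t \<in> J" by blast
    obtain i where i: "i \<ge> Suc (u + sum_list is)" "sat (reduct N) (H i) \<psi> \<longleftrightarrow> n \<in> J" using frequently by blast
    have less: "j < i" if "j \<in> set is" for j using member_le_sum_list[OF that] i(1) by simp
    have "sorted (is @ [i])" using "is"(2) less by (auto simp: sorted_append intro: less_imp_le)
    moreover have "distinct (is @ [i])" using "is"(3) less by auto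
    ultimately show ?case using "is" i by (intro exI[of _ "is @ [i]"]) (auto simp: nth_append less_Suc_eq)
  qed simp
  then have pattern: "\<exists>is. length is = n \<and> sorted is \<and> distinct is \<and> set is \<subseteq> {u..} \<and>
    (\<forall>t<n. sat (reduct N) (H (is ! t)) \<psi> \<longleftrightarrow> t \<in> J)" for n J .
  \<comment> \<open>The address for the t-th new index uses its position only, so the same formula
    describes every choice of indices.\<close>
  define addr where "addr = (\<lambda>t v. address (if single v then {card I + t} else insert (card I + t) {..<card I}) (\<kappa> v))"
  have addr: "family_asg F (I \<union> set is) (addr t v) = H (is ! t) v"
    if "sorted is" "distinct is" "set is \<subseteq> {u..}" "t < length is" "v \<in> VX" for "is" t v
    using pick_end_extension[OF I that(1-4)] that(5) by (simp add: addr_def H)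
  have even_addr: "even (addr t v)" for t v by (simp add: addr_def)
  define lit where "lit = (\<lambda>J (ren :: nat \<Rightarrow> nat \<Rightarrow> nat) (t :: nat). if t \<in> J then lift_fm (sub (ren t) \<psi>) else Neg (lift_fm (sub (ren t) \<psi>)) :: ('f, 'r option) fm)"
  have lit: "sat N e (lit J ren t) \<longleftrightarrow> (sat (reduct N) (e \<circ> ren t) \<psi> \<longleftrightarrow> t \<in> J)" for e J t and ren :: "nat \<Rightarrow> nat \<Rightarrow> nat"
    using sat_sub[OF \<psi>(2)] by (simp add: lit_def)
  have wf_lit: "wf_fm (Lp L) (lit J ren t)" for J ren t using \<psi>(1) by (simp add: lit_def)
  have fin: "\<exists>y. range y \<subseteq> univ N \<and> (\<forall>t<n. sat (reduct N) (\<lambda>w. if w \<in> VX then H (u + t) w else y w) \<psi> \<longleftrightarrow> t \<in> J)" for n J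
  proof -
    obtain "is" where "is": "length is = n" "sorted is" "distinct is" "set is \<subseteq> {u..}"
      "\<forall>t<n. sat (reduct N) (H (is ! t)) \<psi> \<longleftrightarrow> t \<in> J" using pattern by blast
    \<comment> \<open>The copies of \<psi> differ in their even addresses and share their
      parameters, which are moved to odd variables.\<close>
    define ren where "ren = (\<lambda>t w. if w \<in> VX then addr t w else 2 * w + 1)"
    obtain yl where yl: "set yl = (\<lambda>w. 2 * w + 1) ` (fv \<psi> - VX)" using finite_list[of "(\<lambda>w. 2 * w + 1) ` (fv \<psi> - VX)"] by auto
    define Q where "Q = foldr Ex yl (fconj (lit J ren ` {..<n}))"
    have odd_yl: "odd x" if "x \<in> set yl" for x using that yl by auto
    have wfQ: "wf_fm (Lp L) Q" using wf_lit by (auto simp: Q_def)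
    have conj: "sat N e' (fconj (lit J ren ` {..<n})) \<longleftrightarrow> (\<forall>t<n. sat (reduct N) (e' \<circ> ren t) \<psi> \<longleftrightarrow> t \<in> J)" for e'
      by (auto simp: lit)
    have satQ: "sat N e Q \<longleftrightarrow> (\<exists>e'. (\<forall>x. x \<notin> set yl \<longrightarrow> e' x = e x) \<and> (\<forall>x\<in>set yl. e' x \<in> univ N) \<and>
       (\<forall>t<n. sat (reduct N) (e' \<circ> ren t) \<psi> \<longleftrightarrow> t \<in> J))" for e
      unfolding Q_def sat_foldr_Ex conj by (rule refl)
    define e1 where "e1 = (\<lambda>x. if x \<in> set yl then ee ((x - 1) div 2) else family_asg F (I \<union> set is) x)"
    have "sat N (family_asg F (I \<union> set is)) Q"
      unfolding satQ
    proof (intro exI[of _ e1] conjI allI impI ballI)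
      fix t assume t: "t < n"
      have "sat (reduct N) (e1 \<circ> ren t) \<psi> \<longleftrightarrow> sat (reduct N) (H (is ! t)) \<psi>"
      proof (rule sat_cong)
        fix w assume w: "w \<in> fv \<psi>"
        show "(e1 \<circ> ren t) w = H (is ! t) w"
        proof (cases "w \<in> VX")
          case True
          have "addr t w \<notin> set yl" using odd_yl even_addr by blast
          then show ?thesis using True addr[OF "is"(2-4) _ True] t "is"(1) by (simp add: e1_def ren_def)
        next
          case False
          have "2 * w + 1 \<in> set yl" using False w yl by auto
          then show ?thesis using False by (simp add: e1_def ren_def H)
        qed
      qed
      then show "sat (reduct N) (e1 \<circ> ren t) \<psi> \<longleftrightarrow> t \<in> J" using "is"(5) t by simp
    qed (use ee in \<open>auto simp: e1_def\<close>)
    moreover have "set [u..<u + n] \<subseteq> {u..}" by auto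
    then have "card (I \<union> set is) = card (I \<union> set [u..<u + n])"
      using sorted_list_of_end_extension(2)[OF I "is"(2-4)] sorted_list_of_end_extension(2)[OF I, of "[u..<u + n]"] "is"(1) by simp
    ultimately have "sat N (family_asg F (I \<union> set [u..<u + n])) Q"
      using indisc[of "I \<union> set is" "I \<union> set [u..<u + n]" Q] I(1) wfQ by simp
    then obtain e2 where e2: "\<forall>x. x \<notin> set yl \<longrightarrow> e2 x = family_asg F (I \<union> set [u..<u + n]) x" "\<forall>x\<in>set yl. e2 x \<in> univ N"
       "\<forall>t<n. sat (reduct N) (e2 \<circ> ren t) \<psi> \<longleftrightarrow> t \<in> J" unfolding satQ by blast
    define y where "y = (\<lambda>w. if 2 * w + 1 \<in> set yl then e2 (2 * w + 1) else ee w)"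
    have "range y \<subseteq> univ N" using e2(2) ee by (auto simp: y_def)
    moreover have "sat (reduct N) (\<lambda>w. if w \<in> VX then H (u + t) w else y w) \<psi> \<longleftrightarrow> t \<in> J" if t: "t < n" for t
    proof -
      have "sat (reduct N) (\<lambda>w. if w \<in> VX then H (u + t) w else y w) \<psi> \<longleftrightarrow> sat (reduct N) (e2 \<circ> ren t) \<psi>"
      proof (rule sat_cong)
        fix w assume w: "w \<in> fv \<psi>"
        show "(if w \<in> VX then H (u + t) w else y w) = (e2 \<circ> ren t) w"
        proof (cases "w \<in> VX")
          case True
          have "addr t w \<notin> set yl" using odd_yl even_addr by blast
          then have "e2 (addr t w) = family_asg F (I \<union> set [u..<u + n]) (addr t w)" using e2(1) by blast
          also have "\<dots> = H ([u..<u + n] ! t) w" by (rule addr) (use t True in auto)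
          finally show ?thesis using True t by (simp add: ren_def)
        next
          case False
          have "2 * w + 1 \<in> set yl" using False w yl by auto
          then show ?thesis using False by (simp add: y_def ren_def)
        qed
      qed
      then show ?thesis using e2(3) t by simp
    qed
    ultimately show ?thesis by blast
  qed
  have inf: "\<exists>y. range y \<subseteq> univ N \<and> (\<forall>t. sat (reduct N) (\<lambda>w. if w \<in> VX then H (u + t) w else y w) \<psi> \<longleftrightarrow> t \<in> J)" for J
  proof -
    \<comment> \<open>Now the even variables hold the elements \<open>H (u + t) w\<close> as
      constants, and only the odd ones, the parameters, are to be realized.\<close>
    define ren where "ren = (\<lambda>t w. if w \<in> VX then 2 * prod_encode (t, w) else 2 * w + 1)"
    define e where "e = (\<lambda>x. case prod_decode (x div 2) of (t, w) \<Rightarrow> H (u + t) w)"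
    have e: "range e \<subseteq> univ N" using H_in by (auto simp: e_def split: prod.split)
    have split: "sat (reduct N) (e' \<circ> ren t) \<psi> \<longleftrightarrow> sat (reduct N) (\<lambda>w. if w \<in> VX then H (u + t) w else e' (2 * w + 1)) \<psi>"
      if "\<And>v. v \<notin> {x. odd x} \<Longrightarrow> e' v = e v" for e' t
    proof -
      have "e' \<circ> ren t = (\<lambda>w. if w \<in> VX then H (u + t) w else e' (2 * w + 1))"
        using that by (auto simp: ren_def e_def fun_eq_iff)
      then show ?thesis by simp
    qed
    obtain e' where e': "range e' \<subseteq> univ N" "\<And>v. v \<notin> {x. odd x} \<Longrightarrow> e' v = e v" "\<And>\<phi>. \<phi> \<in> range (lit J ren) \<Longrightarrow> sat N e' \<phi>"
    proof (rule saturated_struct_realize[OF N(2), of "range (lit J ren)" e "{x. odd x}"])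
      fix \<Sigma>0 assume "finite \<Sigma>0" "\<Sigma>0 \<subseteq> range (lit J ren)"
      then obtain A where A: "finite A" "\<Sigma>0 = lit J ren ` A" using finite_subset_image by (metis (no_types))
      obtain n where n: "A \<subseteq> {..<n}" using A(1) finite_nat_iff_bounded by blast
      obtain y where y: "range y \<subseteq> univ N" "\<forall>t<n. sat (reduct N) (\<lambda>w. if w \<in> VX then H (u + t) w else y w) \<psi> \<longleftrightarrow> t \<in> J"
        using fin by blast
      define e1 where "e1 = (\<lambda>x. if odd x then y ((x - 1) div 2) else e x)"
      have e1: "e1 v = e v" if "v \<notin> {x. odd x}" for v using that by (simp add: e1_def)
      have e1y: "e1 (2 * w + 1) = y w" for w by (simp add: e1_def)
      have "sat N e1 (lit J ren t)" if "t \<in> A" for t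
      proof -
        have "sat (reduct N) (e1 \<circ> ren t) \<psi> \<longleftrightarrow>
            sat (reduct N) (\<lambda>w. if w \<in> VX then H (u + t) w else e1 (2 * w + 1)) \<psi>"
          by (rule split, rule e1)
        then show ?thesis unfolding lit e1y using y(2) n that by auto
      qed
      moreover have "range e1 \<subseteq> univ N" using e y(1) by (auto simp: e1_def)
      ultimately show "\<exists>e'. range e' \<subseteq> univ N \<and> (\<forall>v. v \<notin> {x. odd x} \<longrightarrow> e' v = e v) \<and> (\<forall>\<phi>\<in>\<Sigma>0. sat N e' \<phi>)"
        using e1 A(2) by (intro exI[of _ e1]) auto
    qed (use e wf_lit in auto)
    have "sat (reduct N) (\<lambda>w. if w \<in> VX then H (u + t) w else e' (2 * w + 1)) \<psi> \<longleftrightarrow> t \<in> J" for t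
    proof -
      have "sat (reduct N) (e' \<circ> ren t) \<psi> \<longleftrightarrow>
          sat (reduct N) (\<lambda>w. if w \<in> VX then H (u + t) w else e' (2 * w + 1)) \<psi>"
        by (rule split, rule e'(2))
      then show ?thesis using e'(3)[of "lit J ren t"] unfolding lit by simp
    qed
    then show ?thesis using e'(1) by (intro exI[of _ "\<lambda>w. e' (2 * w + 1)"]) auto
  qed
  then obtain y where y: "\<And>J. range (y J) \<subseteq> univ N"
    "\<And>J t. sat (reduct N) (\<lambda>w. if w \<in> VX then H (u + t) w else y J w) \<psi> \<longleftrightarrow> t \<in> J" by metis
  obtain vE where vE: "set vE = fv \<psi> - VX" using finite_list[of "fv \<psi> - VX"] by auto
  obtain vX where vX: "set vX = fv \<psi> \<inter> VX" using finite_list[of "fv \<psi> \<inter> VX"] by auto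
  have "\<exists>i<length vE. vE ! i = w" if "w \<in> fv \<psi> - VX" for w using that vE by (metis in_set_conv_nth)
  then obtain iE where iE: "\<And>w. w \<in> fv \<psi> - VX \<Longrightarrow> iE w < length vE \<and> vE ! iE w = w" by metis
  have "\<exists>i<length vX. vX ! i = w" if "w \<in> fv \<psi> \<inter> VX" for w using that vX by (metis in_set_conv_nth)
  then obtain iX where iX: "\<And>w. w \<in> fv \<psi> \<inter> VX \<Longrightarrow> iX w < length vX \<and> vX ! iX w = w" by metis
  define ix where "ix = (\<lambda>w. if w \<in> VX then length vE + iX w else iE w)"
  have form: "formula_in L (length vE + length vX) (sub ix \<psi>)"
    by (rule formula_in_sub[OF \<psi>]) (use iE iX in \<open>force simp: ix_def\<close>)
  have "has_IP (reduct N) (length vE) (length vX) (sub ix \<psi>)"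
    unfolding has_IP_def
  proof (intro exI[of _ "\<lambda>t. map (H (u + t)) vX"] exI[of _ "\<lambda>J. map (y J) vE"] conjI allI)
    show "map (H (u + t)) vX \<in> tuples (reduct N) (length vX)" for t using H_in by (auto simp: tuples_def)
    show "map (y J) vE \<in> tuples (reduct N) (length vE)" for J using y(1) by (auto simp: tuples_def)
    fix t J
    have "holds (reduct N) (sub ix \<psi>) (map (y J) vE @ map (H (u + t)) vX) \<longleftrightarrow>
       sat (reduct N) (\<lambda>w. if w \<in> VX then H (u + t) w else y J w) \<psi>"
      unfolding holds_def sat_sub[OF \<psi>(2)] by (rule sat_cong) (use iE iX in \<open>auto simp: ix_def nth_append\<close>)
    then show "holds (reduct N) (sub ix \<psi>) (map (y J) vE @ map (H (u + t)) vX) \<longleftrightarrow> t \<in> J" using y(2) by simp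
  qed
  then show False using dep form M unfolding dependent_theory_def by blast
qed

theorem T_alpha_dependent:
  assumes dep: "dependent_theory TYPE('u) L T"
  shows "dependent_theory TYPE('u) (Lp L) (T_alpha TYPE('u) L T \<alpha>)"
  unfolding dependent_theory_def
proof (intro allI impI notI, elim exE conjE)
  fix p q \<phi> and M :: "('f, 'r option, 'u) fo_struct"
  assume \<phi>: "formula_in (Lp L) (p + q) \<phi>" and M: "is_model (Lp L) (T_alpha TYPE('u) L T \<alpha>) M" and ip: "has_IP M p q \<phi>"
  have wf\<phi>: "wf_fm (Lp L) \<phi>" using \<phi> by (simp add: formula_in_def)
  obtain m where m: "\<forall>N X f \<eta>. rich N \<longrightarrow> saturated_struct N \<longrightarrow> good m N X f \<longrightarrow> range \<eta> \<subseteq> X \<longrightarrow>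
     (sat N \<eta> \<phi> \<longleftrightarrow> sat N (f \<circ> \<eta>) \<phi>)" using good_preserves_formulas[OF wf\<phi>] by blast
  \<comment> \<open>Adding \<open>bs\<close> and one more point may use up
    \<open>closure_bound (p + 1) m\<close>, and closedness up to m points has to remain.\<close>
  define m1 where "m1 = closure_bound (p + 1) m + m"
  have "\<exists>(N :: ('f, 'r option, 'u) fo_struct) F l bs. rich N \<and> saturated_struct N \<and>
    indiscernible_family m1 N F l \<and> bs \<in> tuples N p \<and>
    (\<forall>i. holds N \<phi> (bs @ map (F {i}) [0..<q]) \<longleftrightarrow> even i) \<and> q \<le> l 1"
    by (rule indiscernible_family_exists[OF M \<phi> ip])
  then obtain N :: "('f, 'r option, 'u) fo_struct" and F l bs where
    N: "rich N" "saturated_struct N" and fam: "indiscernible_family m1 N F l"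
    and bs: "bs \<in> tuples N p" and holds: "\<And>i. holds N \<phi> (bs @ map (F {i}) [0..<q]) \<longleftrightarrow> even i" and q: "q \<le> l 1"
    by (elim exE conjE) (rule that, blast+)
  note F = indiscernible_familyD(1)[OF fam] and closed = indiscernible_familyD(2)[OF fam]
    and mono = indiscernible_familyD(3)[OF fam] and indisc = indiscernible_familyD(4)[OF fam]
  have cN: "cmdl N" using N(1) by (rule rich_cmdl)
  interpret pregeometry "univ N" "cacl N" by (rule cpregeometry[OF cN])
  define S where "S = (\<lambda>\<sigma>. F \<sigma> ` {..<l (card \<sigma>)})"
  define Y where "Y = (\<Union>\<sigma>\<in>{\<sigma>. finite \<sigma>}. S \<sigma>)"
  have Sclosed: "mclosed m1 N (S \<sigma>)" if "finite \<sigma>" for \<sigma> using closed[OF that] by (simp add: S_def)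
  have SU: "S \<sigma> \<subseteq> univ N" for \<sigma> using F by (auto simp: S_def)
  have YU: "Y \<subseteq> univ N" using SU by (auto simp: Y_def)
  have SY: "S \<sigma> \<subseteq> Y" if "finite \<sigma>" for \<sigma> using that by (auto simp: Y_def)
  have Smono: "S \<sigma> \<subseteq> S \<tau>" if "finite \<tau>" "\<sigma> \<subseteq> \<tau>" for \<sigma> \<tau> using mono[OF that] by (simp add: S_def)
  have directed: "\<exists>\<sigma>. finite \<sigma> \<and> B \<subseteq> S \<sigma>" if "finite B" "B \<subseteq> Y" for B
    using that
  proof (induction B rule: finite_induct)
    case (insert x B)
    then obtain \<sigma> \<tau> where "finite \<sigma>" "B \<subseteq> S \<sigma>" "finite \<tau>" "x \<in> S \<tau>" by (auto simp: Y_def)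
    then show ?case using Smono[of "\<sigma> \<union> \<tau>" \<sigma>] Smono[of "\<sigma> \<union> \<tau>" \<tau>] by (intro exI[of _ "\<sigma> \<union> \<tau>"]) auto
  qed auto
  \<comment> \<open>The dimension of a finite set over \<open>Y\<close> is attained over a finite
    part, hence over some member of the directed union.\<close>
  have closedY: "mclosed m1 N Y"
    unfolding mclosed_def
  proof (intro allI impI, elim conjE)
    fix Z assume Z: "finite Z" "Z \<subseteq> colored N" "Z \<inter> Y = {}" "card Z \<le> m1"
    have ZU: "Z \<subseteq> univ N" using Z(2) colored_subset by (rule subset_trans)
    obtain B where B: "finite B" "B \<subseteq> Y" "\<And>Y'. B \<subseteq> Y' \<Longrightarrow> Y' \<subseteq> Y \<Longrightarrow> cdim N Z Y' = cdim N Z Y"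
      by (rule dim_finite_base[OF Z(1) ZU YU], rule that)
    obtain \<sigma> where \<sigma>: "finite \<sigma>" "B \<subseteq> S \<sigma>" using directed[OF B(1,2)] by blast
    have "\<alpha> * card Z \<le> cdim N Z (S \<sigma>)"
      by (rule mclosedD[OF Sclosed[OF \<sigma>(1)]]) (use Z SY[OF \<sigma>(1)] in auto)
    then show "\<alpha> * card Z \<le> cdim N Z Y" using B(3)[OF \<sigma>(2) SY[OF \<sigma>(1)]] by simp
  qed
  \<comment> \<open>The extra point keeps \<open>E\<close> nonempty when p = 0, so that default
    values exist.\<close>
  define A where "A = insert (F {} 0) (set bs)"
  have bsU: "set bs \<subseteq> univ N" and lbs: "length bs = p" using bs by (auto simp: tuples_def)
  have A: "finite A" "A \<subseteq> univ N" "card A \<le> p + 1"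
    using F bsU card_length[of bs] lbs by (auto simp: A_def card_insert_if)
  obtain W where W: "finite W" "W \<subseteq> colored N" "mclosed m N (Y \<union> A \<union> W)"
    using mclosed_extension[OF cN YU closedY[unfolded m1_def] A] by metis
  define E where "E = A \<union> W"
  have E: "finite E" "E \<subseteq> univ N" using A W colored_subset[of N] by (auto simp: E_def)
  have YE: "mclosed m N (Y \<union> E)" using W(3) by (simp add: E_def Un_assoc)
  \<comment> \<open>\<open>E\<close> is free from \<open>Y\<close> over every set between
    \<open>C0\<close> and \<open>Y\<close>. Once the index set contains \<open>I\<close>, this
    applies to its closure, and \<open>mclosed_Un_free\<close> makes the closure with
    \<open>E\<close> closed.\<close>
  obtain C0 where C0: "finite C0" "C0 \<subseteq> Y" "\<And>Y'. C0 \<subseteq> Y' \<Longrightarrow> Y' \<subseteq> Y \<Longrightarrow> cdim N E Y' = cdim N E Y"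
    by (rule dim_finite_base[OF E YU], rule that)
  obtain I where I: "finite I" "C0 \<subseteq> S I" using directed[OF C0(1,2)] by blast
  obtain u where u: "I \<subseteq> {..<u}" using I(1) finite_nat_iff_bounded by blast
  obtain el where el: "set el = E" using finite_list[OF E(1)] by auto
  have el0: "0 < length el" using el by (cases el) (auto simp: E_def A_def)
  define ll where "ll = l (Suc (card I))"
  \<comment> \<open>The variables below p hold \<open>bs\<close>, the next q the tuple of index i,
    the next \<open>ll\<close> the closure for \<open>insert i I\<close>, and those from
    \<open>B0\<close> on the elements of \<open>E\<close>, the first of which also serves as
    default.\<close>
  define B0 where "B0 = p + q + ll"
  define VX where "VX = {p..<B0}"
  define ee where "ee = (\<lambda>v. if v < p then bs ! v else if B0 \<le> v \<and> v < B0 + length el then el ! (v - B0) else el ! 0)"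
  define H where "H = (\<lambda>i v. if v \<in> VX then F (if v < p + q then {i} else insert i I) (if v < p + q then v - p else v - (p + q)) else ee v)"
  define W0 where "W0 = {..<B0 + length el}"
  have elE: "el ! k \<in> E" if "k < length el" for k using that el nth_mem by blast
  have bsE: "bs ! v \<in> E" if "v < p" for v using that lbs nth_mem[of v bs] by (auto simp: E_def A_def)
  have ee_E: "ee v \<in> E" for v using elE bsE el0 by (auto simp: ee_def)
  have ee: "range ee \<subseteq> univ N" using ee_E E(2) by blast
  have H_in: "range (H i) \<subseteq> univ N" for i using F ee by (auto simp: H_def)
  have fresh: "i \<notin> I" if "i \<ge> u" for i using u that by auto
  have S_ins: "S (insert i I) = F (insert i I) ` {..<ll}" if "i \<ge> u" for i
    using fresh[OF that] I(1) by (simp add: S_def ll_def)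
  have H_img: "H i ` W0 = S (insert i I) \<union> E" if i: "i \<ge> u" for i
  proof (intro equalityI subsetI)
    fix x assume "x \<in> H i ` W0"
    then obtain v where v: "x = H i v" by auto
    consider "v \<notin> VX" | "p \<le> v" "v < p + q" | "p + q \<le> v" "v < B0" by (force simp: VX_def)
    then show "x \<in> S (insert i I) \<union> E"
    proof cases
      case 1
      then show ?thesis using v ee_E by (simp add: H_def)
    next
      case 2
      then have "x = F {i} (v - p)" using v by (simp add: H_def VX_def B0_def)
      moreover have "F {i} (v - p) \<in> S {i}" using 2 q by (auto simp: S_def)
      ultimately show ?thesis using Smono[of "insert i I" "{i}"] I(1) by auto
    next
      case 3
      then have "x = F (insert i I) (v - (p + q))" using v by (simp add: H_def VX_def)
      then show ?thesis unfolding S_ins[OF i] using 3 by (auto simp: B0_def)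
    qed
  next
    fix x assume "x \<in> S (insert i I) \<union> E"
    then consider k where "k < ll" "x = F (insert i I) k" | k where "k < length el" "x = el ! k"
      unfolding S_ins[OF i] using el by (auto simp: in_set_conv_nth)
    then show "x \<in> H i ` W0"
    proof cases
      case 1
      then have "x = H i (p + q + k)" "p + q + k \<in> W0" by (auto simp: H_def VX_def B0_def W0_def)
      then show ?thesis by blast
    next
      case 2
      then have "x = H i (B0 + k)" "B0 + k \<in> W0" by (auto simp: H_def VX_def ee_def W0_def B0_def)
      then show ?thesis by blast
    qed
  qed
  have H_closed: "mclosed m N (H i ` W0)" if i: "i \<ge> u" for i
    unfolding H_img[OF i]
  proof (rule mclosed_Un_free[OF cN YU _ _ E YE])
    have fin: "finite (insert i I)" using I(1) by simp
    show SYi: "S (insert i I) \<subseteq> Y" by (rule SY[OF fin])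
    show "mclosed m N (S (insert i I))"
      using mclosed_mono[OF Sclosed[OF fin], of m] by (simp add: m1_def)
    have "C0 \<subseteq> S (insert i I)" using I(2) Smono[OF fin, of I] by auto
    then show "cdim N E (S (insert i I)) = cdim N E Y" using C0(3) SYi by blast
  qed
  have ev: "\<exists>b i0. \<forall>i\<ge>i0. sat (reduct N) (H i) \<psi> \<longleftrightarrow> b" if "wf_fm L \<psi>" "qf \<psi>" for \<psi>
    by (rule eventually_constant[OF dep N F indisc I(1) u ee _ that, of H VX "\<lambda>v. v < p + q"
          "\<lambda>v. if v < p + q then v - p else v - (p + q)"]) (auto simp: H_def)
  have F_col: "F \<sigma> k \<in> colored N \<longleftrightarrow> F \<tau> k \<in> colored N" if "finite \<sigma>" "finite \<tau>" "card \<sigma> = card \<tau>" for \<sigma> \<tau> k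
  proof -
    have "sat N (family_asg F \<sigma>) (Rel None [Var (address {..<card \<sigma>} k)]) \<longleftrightarrow>
      sat N (family_asg F \<tau>) (Rel None [Var (address {..<card \<tau>} k)])"
      using indisc[OF that, of "Rel None [Var (address {..<card \<sigma>} k)]"] that(3) by simp
    moreover have "pick \<sigma> {..<card \<tau>} = \<sigma>" "pick \<tau> {..<card \<tau>} = \<tau>"
      using pick_all[OF that(1)] pick_all[OF that(2)] that(3) by simp_all
    ultimately show ?thesis using F that by (simp add: colored_def)
  qed
  have col: "\<exists>b. \<forall>i\<ge>u. H i v \<in> colored N \<longleftrightarrow> b" for v
  proof (cases "v \<in> VX")
    case True
    have "H i v \<in> colored N \<longleftrightarrow> H u v \<in> colored N" if "i \<ge> u" for i
      using F_col[of "{i}" "{u}"] F_col[of "insert i I" "insert u I"] I(1) fresh[OF that] fresh[of u] True by (simp add: H_def)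
    then show ?thesis by blast
  qed (auto simp: H_def)
  have H\<phi>: "sat N (H i) \<phi> \<longleftrightarrow> even i" for i
  proof -
    have "holds N \<phi> (bs @ map (F {i}) [0..<q]) \<longleftrightarrow> sat N (H i) \<phi>"
      by (rule holds_iff_sat[OF \<phi>]) (use lbs in \<open>auto simp: H_def VX_def B0_def ee_def nth_append\<close>)
    then show ?thesis using holds by simp
  qed
  \<comment> \<open>The type consists of all formulas that hold from some index on within one
    parity; any late index of that parity satisfies finitely many of them.\<close>
  have limit: "\<exists>G. range G \<subseteq> univ N \<and> (\<forall>v. v \<notin> VX \<longrightarrow> G v = ee v) \<and>
    (\<forall>\<psi> i0. wf_fm (Lp L) \<psi> \<longrightarrow> (\<forall>i\<ge>i0. even i = b \<longrightarrow> sat N (H i) \<psi>) \<longrightarrow> sat N G \<psi>)" for b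
  proof -
    define \<Sigma> where "\<Sigma> = {\<psi>. wf_fm (Lp L) \<psi> \<and> (\<exists>i0. \<forall>i\<ge>i0. even i = b \<longrightarrow> sat N (H i) \<psi>)}"
    obtain G where G: "range G \<subseteq> univ N" "\<And>v. v \<notin> VX \<Longrightarrow> G v = ee v" "\<And>\<psi>. \<psi> \<in> \<Sigma> \<Longrightarrow> sat N G \<psi>"
    proof (rule saturated_struct_realize[OF N(2), of \<Sigma> ee VX])
      fix \<Sigma>0 assume S0: "finite \<Sigma>0" "\<Sigma>0 \<subseteq> \<Sigma>"
      have "\<exists>i0. \<forall>i\<ge>i0. even i = b \<longrightarrow> (\<forall>\<psi>\<in>\<Sigma>0. sat N (H i) \<psi>)"
        using S0
      proof (induction \<Sigma>0 rule: finite_induct)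
        case (insert \<psi> \<Sigma>0)
        then obtain i0 i1 where "\<forall>i\<ge>i0. even i = b \<longrightarrow> (\<forall>\<psi>\<in>\<Sigma>0. sat N (H i) \<psi>)"
          "\<forall>i\<ge>i1. even i = b \<longrightarrow> sat N (H i) \<psi>" by (auto simp: \<Sigma>_def)
        then show ?case by (intro exI[of _ "max i0 i1"]) auto
      qed auto
      then obtain i0 where i0: "\<forall>i\<ge>i0. even i = b \<longrightarrow> (\<forall>\<psi>\<in>\<Sigma>0. sat N (H i) \<psi>)" by blast
      define i where "i = (if b then 2 * i0 else 2 * i0 + 1)"
      have "i \<ge> i0" "even i = b" by (auto simp: i_def)
      then show "\<exists>e'. range e' \<subseteq> univ N \<and> (\<forall>v. v \<notin> VX \<longrightarrow> e' v = ee v) \<and> (\<forall>\<phi>\<in>\<Sigma>0. sat N e' \<phi>)"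
        using i0 H_in[of i] by (intro exI[of _ "H i"]) (auto simp: H_def)
    qed (use ee in \<open>auto simp: \<Sigma>_def\<close>)
    then show ?thesis by (intro exI[of _ G]) (auto simp: \<Sigma>_def)
  qed
  then obtain G where G: "\<And>b. range (G b) \<subseteq> univ N" "\<And>b v. v \<notin> VX \<Longrightarrow> G b v = ee v"
    "\<And>b \<psi> i0. wf_fm (Lp L) \<psi> \<Longrightarrow> (\<And>i. i \<ge> i0 \<Longrightarrow> even i = b \<Longrightarrow> sat N (H i) \<psi>) \<Longrightarrow> sat N (G b) \<psi>" by metis
  have G\<phi>: "sat N (G b) \<phi> \<longleftrightarrow> b" for b
    using G(3)[of \<phi> 0 b] G(3)[of "Neg \<phi>" 0 b] wf\<phi> H\<phi> by (cases b) auto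
  \<comment> \<open>Here dependence of \<open>T\<close> enters: eventual constancy makes the two
    limits agree on \<open>L\<close>, whereas they disagree on \<phi>.\<close>
  have Gqf: "sat (reduct N) (G True) \<psi> \<longleftrightarrow> sat (reduct N) (G False) \<psi>" if \<psi>: "wf_fm L \<psi>" "qf \<psi>" for \<psi>
  proof -
    obtain b i0 where b: "\<forall>i\<ge>i0. sat (reduct N) (H i) \<psi> \<longleftrightarrow> b" using ev[OF \<psi>] by blast
    have "sat (reduct N) (G b') \<psi> \<longleftrightarrow> b" for b'
      using G(3)[of "lift_fm \<psi>" i0 b'] G(3)[of "Neg (lift_fm \<psi>)" i0 b'] \<psi>(1) b by (cases b) auto
    then show ?thesis by simp
  qed
  have Gcol: "G True v \<in> colored N \<longleftrightarrow> G False v \<in> colored N" for v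
  proof -
    obtain b where b: "\<forall>i\<ge>u. H i v \<in> colored N \<longleftrightarrow> b" using col by blast
    have inU: "H i v \<in> univ N" "G b' v \<in> univ N" for i b' using H_in[of i] G(1)[of b'] by auto
    have "G b' v \<in> colored N \<longleftrightarrow> b" for b'
      using G(3)[of "Rel None [Var v]" u b'] G(3)[of "Neg (Rel None [Var v])" u b'] b inU
      by (cases b) (auto simp: colored_def)
    then show ?thesis by simp
  qed
  have Gclosed: "mclosed m N (G b ` W0)" for b
  proof (rule ccontr)
    assume n: "\<not> mclosed m N (G b ` W0)"
    have "finite W0" by (simp add: W0_def)
    then obtain \<psi> where \<psi>: "wf_fm (Lp L) \<psi>" "fv \<psi> \<subseteq> W0" "sat N (G b) \<psi>"
      "\<And>M' H'. cmdl M' \<Longrightarrow> range H' \<subseteq> univ M' \<Longrightarrow> sat M' H' \<psi> \<Longrightarrow> \<not> mclosed m M' (H' ` W0)"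
      using not_mclosed_witness[OF cN G(1) _ n] by blast
    have "sat N (G b) (Neg \<psi>)"
      using \<psi>(1) \<psi>(4)[OF cN H_in] H_closed by (intro G(3)[of _ u]) auto
    then show False using \<psi>(3) by simp
  qed
  \<comment> \<open>Variables outside \<open>W0\<close> repeat the value at \<open>B0\<close>, so
    the whole range is the finite closed set already considered.\<close>
  have Grange: "range (G b) = G b ` W0" for b
  proof -
    have "G b v \<in> G b ` W0" for v
    proof (cases "v \<in> W0")
      case False
      then have "v \<notin> VX" "B0 \<notin> VX" "ee v = ee B0" "B0 \<in> W0" using el0 by (auto simp: VX_def W0_def ee_def B0_def)
      then show ?thesis using G(2) by (metis imageI)
    qed auto
    then show ?thesis by blast
  qed
  \<comment> \<open>Independent of the chosen variable, although \<open>G True\<close> may repeat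
    values: equalities between variables hold alike in both limits.\<close>
  define f where "f = (\<lambda>x. G False (SOME v. G True v = x))"
  have fG: "f (G True v) = G False v" for v
  proof -
    let ?w = "SOME w. G True w = G True v"
    have "G True ?w = G True v" by (rule someI[of _ v]) simp
    then have "G False ?w = G False v" using Gqf[of "Eq (Var ?w) (Var v)"] by simp
    then show ?thesis by (simp add: f_def)
  qed
  have fG': "f \<circ> G True = G False" using fG by auto
  have f_img: "f ` range (G True) = range (G False)" using fG' by (metis image_comp)
  have elem: "qf_elementary N (range (G True)) f"
    unfolding qf_elementary_def f_img
  proof (intro conjI allI impI G(1))
    fix \<psi> and \<eta> :: "nat \<Rightarrow> 'u" assume \<psi>: "wf_fm L \<psi>" "qf \<psi>" and \<eta>: "range \<eta> \<subseteq> range (G True)"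
    have "\<exists>v. G True v = \<eta> x" for x using range_subsetD[OF \<eta>, of x] by (metis imageE)
    then obtain h where "\<And>x. G True (h x) = \<eta> x" by metis
    then have h: "\<eta> = G True \<circ> h" by auto
    show "sat (reduct N) \<eta> \<psi> \<longleftrightarrow> sat (reduct N) (f \<circ> \<eta>) \<psi>"
      using Gqf[of "sub h \<psi>"] \<psi> unfolding h comp_assoc[symmetric] fG' by (simp add: sat_sub[OF \<psi>(2)])
  qed
  have finG: "finite (range (G True))" unfolding Grange by (simp add: W0_def)
  have colG: "\<forall>x\<in>range (G True). x \<in> colored N \<longleftrightarrow> f x \<in> colored N" using Gcol fG by auto
  have closedG: "mclosed m N (range (G b))" for b using Gclosed[of b] Grange[of b] by simp
  have "good m N (range (G True)) f"
    unfolding good_def f_img by (intro conjI finG G(1) elem colG closedG)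
  then have "sat N (G True) \<phi> \<longleftrightarrow> sat N (f \<circ> G True) \<phi>" using m N by blast
  then show False using G\<phi> fG' by simp
qed

end

theorem theorem4p0p20:
  fixes L :: "('f, 'r) lang" and T :: "('f, 'r) fm set" and \<alpha> :: real
    and c :: "nat set \<Rightarrow> 'u"
  assumes "inj c"
    and "countable_lang L"
    and "complete_theory TYPE('u) L T"
    and "no_finite_models TYPE('u) L T"
    and "quantifier_elimination TYPE('u) L T"
    and "geometric TYPE('u) L T"
    and "indecomposable TYPE('u) L T"
    and "free_amalgamation TYPE('u) L T"
    and "0 < \<alpha>" and "\<alpha> \<le> 1"
    and "dependent_theory TYPE('u) L T"
  shows "dependent_theory TYPE('u) (Lp L) (T_alpha TYPE('u) L T \<alpha>)"
proof -
  interpret colored_setting L T c \<alpha>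
    by unfold_locales (use assms in \<open>auto simp: complete_theory_def\<close>)
  show ?thesis using assms(11) by (rule T_alpha_dependent)
qed

end
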